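(* Let $0\leq \Omega<1$ be fixed. Then, as $a\to a_*$ with $0<a<a_*$, $$E^{\rm GP}_\Omega(a)=E^{\rm GP}_0(a)+o\big(E^{\rm GP}_0(a)\big)=\sqrt{a_*-a}\,\left(\frac{2\lambda_*^2}{a_*}+o(1)\right),\qquad \lambda_*=\left(\int_{\mathbb{R}^2}|x|^2|Q(x)|^2\,dx\right)^{1/4}.$$ In addition, for any sequence $a_N\to a_*$ with $0<a_N<a_*$, and any sequence $\{u_N\}\subset H^1(\mathbb{R}^2)$ such that $\|u_N\|_{L^2(\mathbb{R}^2)}=1$ and $$\mathcal{E}^{\rm GP}_{\Omega,a_N}(u_N)=E^{\rm GP}_\Omega(a_N)+o\big(\sqrt{a_*-a_N}\big)\quad\text{as } N\to\infty$$ (for instance $u_N$ a minimizer of $E^{\rm GP}_\Omega(a_N)$), there exist phases $\theta_N\in[0,2\pi)$ such that $$\lim_{N\to\infty}\left\|u_N-e^{i\theta_N}Q_N\right\|_{L^2(\mathbb{R}^2)}=0,$$ where $$Q_N(x)=(a_* )^{-1/2}\,\lambda_*\,(a_*-a_N)^{-1/4}\,Q\left(\lambda_*(a_*-a_N)^{-1/4}x\right).$$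
   Context: Functions are complex valued on $\mathbb{R}^2$. $Q\in H^1(\mathbb{R}^2)$ denotes the unique positive radial solution of $-\Delta Q+Q-Q^3=0$ in $\mathbb{R}^2$ (positive solutions are unique up to translations). $a_*$ is the optimal constant of the Gagliardo-Nirenberg inequality $$\left(\int_{\mathbb{R}^2}|\nabla u|^2\right)\left(\int_{\mathbb{R}^2}|u|^2\right)\geq\frac{a_*}{2}\int_{\mathbb{R}^2}|u|^4,\qquad\forall u\in H^1(\mathbb{R}^2),$$ equivalently $a_*=\|Q\|_{L^2(\mathbb{R}^2)}^2$. For $0\leq\Omega<1$ and $0<a<a_*$, the Gross-Pitaevskii functional is $$\mathcal{E}^{\rm GP}_{\Omega,a}(u)=\int_{\mathbb{R}^2}|\nabla u(x)|^2\,dx+\int_{\mathbb{R}^2}|x|^2|u(x)|^2\,dx-2\Omega\langle u,Lu\rangle-\frac a2\int_{\mathbb{R}^2}|u(x)|^4\,dx,$$ where $L=i(x_2\partial_1-x_1\partial_2)$ is the angular momentum operator, $\langle u,Lu\rangle=\int_{\mathbb{R}^2}\overline{u}\,Lu$, and the energy is understood as $+\infty$ when $|x|u\notin L^2(\mathbb{R}^2)$. The ground state energy is $$E^{\rm GP}_\Omega(a)=\min\left\{\mathcal{E}^{\rm GP}_{\Omega,a}(u)\ :\ u\in H^1(\mathbb{R}^2),\ \|u\|_{L^2(\mathbb{R}^2)}=1\right\}.$$ *)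

theory Defs
  imports "HOL-Analysis.Analysis" "HOL-Library.Landau_Symbols"
begin

definition partial :: "2 \<Rightarrow> (real^2 \<Rightarrow> real) \<Rightarrow> real^2 \<Rightarrow> real" where
  "partial i f x = frechet_derivative f (at x) (axis i 1)"

primrec C_k :: "nat \<Rightarrow> (real^2 \<Rightarrow> real) \<Rightarrow> bool" where
  "C_k 0 f \<longleftrightarrow> continuous_on UNIV f"
| "C_k (Suc k) f \<longleftrightarrow> (\<forall>x. f differentiable (at x)) \<and> (\<forall>i. C_k k (partial i f))"

definition test_functions :: "(real^2 \<Rightarrow> real) set" where
  "test_functions = {\<phi>. (\<forall>k. C_k k \<phi>) \<and> compact (closure {x. \<phi> x \<noteq> 0})}"

definition laplacian :: "(real^2 \<Rightarrow> real) \<Rightarrow> real^2 \<Rightarrow> real" where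
  "laplacian f x = (\<Sum>i\<in>UNIV. partial i (partial i f) x)"

text \<open>
  Elements of \<open>L\<^sup>2\<close> and \<open>H\<^sup>1\<close> are represented by Borel functions; the
  functionals below are invariant under changes on null sets.
\<close>

definition L2 :: "(real^2 \<Rightarrow> complex) set" where
  "L2 = {u \<in> borel_measurable lborel. integrable lborel (\<lambda>x. (cmod (u x))\<^sup>2)}"

definition L2_norm :: "(real^2 \<Rightarrow> complex) \<Rightarrow> real" where
  "L2_norm u = sqrt (\<integral>x. (cmod (u x))\<^sup>2 \<partial>lborel)"

definition has_weak_partial :: "2 \<Rightarrow> (real^2 \<Rightarrow> complex) \<Rightarrow> (real^2 \<Rightarrow> complex) \<Rightarrow> bool" where
  "has_weak_partial i u g \<longleftrightarrow>
     (\<forall>\<phi>\<in>test_functions.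
        (\<integral>x. partial i \<phi> x *\<^sub>R u x \<partial>lborel) = - (\<integral>x. \<phi> x *\<^sub>R g x \<partial>lborel))"

definition H1 :: "(real^2 \<Rightarrow> complex) set" where
  "H1 = {u \<in> L2. \<forall>i. \<exists>g\<in>L2. has_weak_partial i u g}"

text \<open>For \<open>u\<close> in \<open>H\<^sup>1\<close> the choice is determined up to a null set.\<close>

definition weak_partial :: "2 \<Rightarrow> (real^2 \<Rightarrow> complex) \<Rightarrow> real^2 \<Rightarrow> complex" where
  "weak_partial i u = (SOME g. g \<in> L2 \<and> has_weak_partial i u g)"

definition gradient_energy :: "(real^2 \<Rightarrow> complex) \<Rightarrow> real" where
  "gradient_energy u = (\<integral>x. (\<Sum>i\<in>UNIV. (cmod (weak_partial i u x))\<^sup>2) \<partial>lborel)"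

definition quartic :: "(real^2 \<Rightarrow> complex) \<Rightarrow> real" where
  "quartic u = (\<integral>x. (cmod (u x)) ^ 4 \<partial>lborel)"

text \<open>
  The optimal Gagliardo--Nirenberg constant.  The quartic integral is finite on \<open>H\<^sup>1\<close>
  by the Sobolev embedding into \<open>L\<^sup>4\<close>.
\<close>

definition a_star :: real where
  "a_star = Sup {c. \<forall>u\<in>H1.
     gradient_energy u * (\<integral>x. (cmod (u x))\<^sup>2 \<partial>lborel) \<ge> c / 2 * quartic u}"

text \<open>The equation \<open>- \<Delta> v + v - v\<^sup>3 = 0\<close> in the sense of distributions.\<close>

definition positive_solution :: "(real^2 \<Rightarrow> real) \<Rightarrow> bool" where
  "positive_solution v \<longleftrightarrow>
     (\<lambda>x. complex_of_real (v x)) \<in> H1 \<and>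
     (AE x in lborel. v x > 0) \<and>
     (\<forall>\<phi>\<in>test_functions.
        (\<integral>x. - (v x * laplacian \<phi> x) + v x * \<phi> x - (v x) ^ 3 * \<phi> x \<partial>lborel) = 0)"

text \<open>
  \<open>Q\<close> is the positive radial solution, where ``the'' refers to the (known) uniqueness of
  positive solutions up to translations.
\<close>

definition is_unique_positive_radial_solution :: "(real^2 \<Rightarrow> real) \<Rightarrow> bool" where
  "is_unique_positive_radial_solution Q \<longleftrightarrow>
     positive_solution Q \<and> (\<forall>x. Q x > 0) \<and>
     (\<forall>x y. norm x = norm y \<longrightarrow> Q x = Q y) \<and>
     (\<forall>v. positive_solution v \<longrightarrow> (\<exists>y. AE x in lborel. v x = Q (x - y)))"

definition ang_mom :: "(real^2 \<Rightarrow> complex) \<Rightarrow> real^2 \<Rightarrow> complex" where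
  "ang_mom u x =
     \<i> * (of_real (x $ 2) * weak_partial 1 u x - of_real (x $ 1) * weak_partial 2 u x)"

text \<open>
  The expectation of the angular momentum is real on \<open>H\<^sup>1\<close>-functions with finite trapping
  energy, so taking the real part only adjusts the type.
\<close>

definition gp_energy :: "real \<Rightarrow> real \<Rightarrow> (real^2 \<Rightarrow> complex) \<Rightarrow> ereal" where
  "gp_energy \<Omega> a u =
     (if (\<lambda>x. norm x *\<^sub>R u x) \<in> L2
      then ereal (gradient_energy u
             + (\<integral>x. (norm x)\<^sup>2 * (cmod (u x))\<^sup>2 \<partial>lborel)
             - 2 * \<Omega> * Re (\<integral>x. cnj (u x) * ang_mom u x \<partial>lborel)
             - a / 2 * quartic u)
      else \<infinity>)"

definition gp_ground_energy :: "real \<Rightarrow> real \<Rightarrow> ereal" where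
  "gp_ground_energy \<Omega> a = (INF u\<in>{u \<in> H1. L2_norm u = 1}. gp_energy \<Omega> a u)"

definition lambda_star :: "(real^2 \<Rightarrow> real) \<Rightarrow> real" where
  "lambda_star Q = root 4 (\<integral>x. (norm x)\<^sup>2 * (Q x)\<^sup>2 \<partial>lborel)"

definition blowup_profile :: "(real^2 \<Rightarrow> real) \<Rightarrow> real \<Rightarrow> real^2 \<Rightarrow> complex" where
  "blowup_profile Q a x =
     (let l = lambda_star Q * (a_star - a) powr (- 1 / 4)
      in complex_of_real (a_star powr (- 1 / 2) * l * Q (l *\<^sub>R x)))"

end

theory Submission imports Defs "HOL-Complex_Analysis.Great_Picard" "HOL-Probability.Distributions" begin

text \<open>
  Blowing up by \<open>e = (a\<^sub>* - a)\<^sup>1\<^sup>/\<^sup>4\<close>, the energy times \<open>e\<^sup>2\<close> becomes the Gagliardo--Nirenberg defect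
  \<open>D(v) = \<parallel>\<nabla>v\<parallel>\<^sup>2 - a\<^sub>*/2 \<parallel>v\<parallel>\<^sub>4\<^sup>4\<close> plus \<open>e\<^sup>4 (\<parallel>v\<parallel>\<^sub>4\<^sup>4 / 2 + \<parallel>x v\<parallel>\<^sup>2)\<close> plus a rotation term of
  order \<open>e\<^sup>2\<close>.  Scaling \<open>Q\<close> gives the upper bound, and a quasi-minimizing sequence has \<open>D \<rightarrow> 0\<close>, hence
  converges, up to phase and scale, to the optimizer \<open>q\<close> of the Gagliardo--Nirenberg inequality, which is \<open>Q\<close>
  up to scaling.  The rotation term is seemingly of larger order than the trap.  However, fixing the
  phase so that the imaginary part \<open>g\<close> of \<open>v\<close> is orthogonal to \<open>q\<close>, the defect controls \<open>\<parallel>g\<parallel>\<^sub>H\<^sub>1\<^sup>2\<close> by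
  coercivity of the linearized operator \<open>L\<^sub>-\<close>, whose kernel is spanned by \<open>q\<close>; and the rotation is
  linear in \<open>g\<close> with a coefficient that tends to zero, since \<open>q\<close> is radial.  So the rotation contributes \<open>o(e\<^sup>4)\<close>.
  The existence of \<open>q\<close> comes from concentration compactness, the simplicity of the kernel from the
  strong maximum principle, obtained from the heat kernel.
\<close>

text \<open>Two obstacles shape the details. The limit profile comes with a free centre z as well as
  a free scale s, and it is radial about z only. The rotation field is therefore split as
  \<open>rot90 x = rot90 (x - z) + rot90 z\<close>. Only the first part, cut off so as to be
  bounded, profits from the radial symmetry; the second is absorbed by completing a square against
  the phase part of the gradient and costs \<Omega>^2 |z|^2, less than the |z|^2 that the trap
  gains. The far part of the rotation is paid for by the far part of the trap. The leading energy is
  then s^2 / \<open>a_star\<close> + M / s^2 + (1 - \<Omega>^2) |z|^2, with M the second moment of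
  the normalized Q, and its only minimum is at s = \<open>lambda_star Q\<close>, z = 0. The other
  obstacle is that \<open>a_star\<close> is given as a supremum only: integrability of fourth
  powers, optimality of Q and the identity of \<open>a_star\<close> with the squared norm of Q all
  have to be derived. This is done for positive \<open>a_star\<close>, the last two by combining the
  existence of an optimizer with the uniqueness of Q; for \<open>a_star\<close> <= 0 the claims are
  vacuous.\<close>

notation (input) LIMSEQ (infix "---->" 60)
notation (input) scaleR (infixr "*R" 75)

section \<open>Square integrable functions\<close>

lemma fatou_integral:
 fixes f :: "nat => 'a => real"
 assumes int: "!!n. integrable M (f n)" and nn: "!!n x. 0 <= f n x"
  and bd: "!!n. (\<integral>x. f n x \<partial>M) <= C"
  and g[measurable]: "g \<in> borel_measurable M"
  and lim: "AE x in M. (%n. f n x) ----> g x"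
 shows "integrable M g" "(\<integral>x. g x \<partial>M) <= C" (is ?A)
proof -
 have [measurable]: "f n \<in> borel_measurable M" for n using int[of n] by simp
 have "0 <= (\<integral>x. f 0 x \<partial>M)" by (rule integral_nonneg_AE) (use nn in auto)
 hence C0: "0 <= C" using bd[of 0] by linarith
 have g0: "AE x in M. 0 <= g x"
  using lim by eventually_elim (rule LIMSEQ_le_const, auto simp: nn)
 have "(\<integral>\<^sup>+x. ennreal (g x) \<partial>M) = (\<integral>\<^sup>+x. liminf (%n. ennreal (f n x)) \<partial>M)"
 proof (rule nn_integral_cong_AE)
  show "AE x in M. ennreal (g x) = liminf (%n. ennreal (f n x))"
   using lim
  proof eventually_elim
   case (elim x)
   hence "(%n. ennreal (f n x)) ----> ennreal (g x)" by (rule tendsto_ennrealI)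
   thus ?case by (simp add: lim_imp_Liminf)
  qed
 qed
 also have "\<dots> <= liminf (%n. \<integral>\<^sup>+x. ennreal (f n x) \<partial>M)"
  by (rule nn_integral_liminf) measurable
 also have "\<dots> <= ennreal C"
  using Liminf_mono[of "%n. \<integral>\<^sup>+x. ennreal (f n x) \<partial>M" "%_. ennreal C" sequentially]
  by (simp add: nn_integral_eq_integral[OF int] nn ennreal_leI[OF bd] Liminf_const)
 finally have *: "(\<integral>\<^sup>+x. ennreal (g x) \<partial>M) <= ennreal C" .
 show "integrable M g"
  by (rule integrableI_nonneg[OF g g0]) (use * in \<open>auto simp: less_top[symmetric] top_unique\<close>)
 thus ?A
  using * g0 C0 by (simp add: nn_integral_eq_integral)
qed

text \<open>A dominated convergence theorem in which a small multiple of an \<open>L\<^sup>1\<close>-bounded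
 sequence is tolerated in the dominating function; this replaces Hoelder and interpolation
 arguments by pointwise Young inequalities.\<close>

lemma dominated_convergence_almost:
 fixes F :: "nat => 'a => 'b::{banach, second_countable_topology}"
 assumes F[measurable]: "!!n. F n \<in> borel_measurable M"
  and F0[measurable]: "F0 \<in> borel_measurable M"
  and lim: "AE x in M. (%n. F n x) ----> F0 x"
  and a: "!!n. integrable M (a n)" "!!n x. 0 <= a n x" "!!n. (\<integral>x. a n x \<partial>M) <= C"
  and dom: "!!\<delta>::real. \<delta> > 0 ==> EX G. integrable M G & (ALL n. AE x in M. norm (F n x) <= \<delta> * a n x + G x)"
 shows "!!n. integrable M (F n)" "integrable M F0"
  "(%n. \<integral>x. norm (F n x - F0 x) \<partial>M) ----> 0" (is ?A)
  "(%n. \<integral>x. F n x \<partial>M) ----> (\<integral>x. F0 x \<partial>M)" (is ?B)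
proof -
 have "0 <= (\<integral>x. a 0 x \<partial>M)" by (rule integral_nonneg_AE) (use a in auto)
 hence C0: "0 <= C" using a(3)[of 0] by linarith
 obtain G1 where G1: "integrable M G1" "!!n. AE x in M. norm (F n x) <= 1 * a n x + G1 x"
  using dom[of 1] by auto
 show int: "integrable M (F n)" for n
  proof (rule Bochner_Integration.integrable_bound[of M "%x. a n x + G1 x"])
  show "AE x in M. norm (F n x) <= norm (a n x + G1 x)"
   using G1(2)[of n] by eventually_elim simp
 qed (use G1 a in auto)
 have nb: "(\<integral>x. norm (F n x) \<partial>M) <= C + (\<integral>x. G1 x \<partial>M)" for n
 proof -
  have "(\<integral>x. norm (F n x) \<partial>M) <= (\<integral>x. a n x + G1 x \<partial>M)"
   by (rule integral_mono_AE) (use G1 a int in auto)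
  thus ?thesis using a(3)[of n] G1(1) a(1)[of n] by simp
 qed
 have "integrable M (%x. norm (F0 x))"
  by (rule fatou_integral(1)[of M "%n x. norm (F n x)", OF _ _ nb])
   (use int lim in \<open>auto intro: tendsto_norm elim!: eventually_mono\<close>)
 from this F0 show int0: "integrable M F0" by (rule integrable_norm_cancel)
 show L1: ?A
 proof (rule LIMSEQ_I)
  fix e :: real assume e: "e > 0"
  define d where "d = e / (2 * (C + 1))"
  have d: "d > 0" "d * C < e / 2 + 0"
   using e C0 by (auto simp: d_def field_simps)
  obtain G where G: "integrable M G" "!!n. AE x in M. norm (F n x) <= d * a n x + G x"
   using dom[OF d(1)] by auto
  have [measurable]: "a n \<in> borel_measurable M" for n using a(1)[of n] by simp
  \<comment> \<open>\<open>Z\<close> is the part of the error that \<open>d * a n\<close> does not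
    cover. It is almost everywhere at most \<open>norm (G x) + norm (F0 x)\<close>, so ordinary
    dominated convergence applies to it.\<close>
  define Z where "Z n x = max 0 (norm (F n x - F0 x) - d * a n x)" for n x
  have Z: "(%n. \<integral>x. Z n x \<partial>M) ----> (\<integral>x. 0 \<partial>M)"
  proof (rule integral_dominated_convergence[where w="%x. norm (G x) + norm (F0 x)"])
   show "AE x in M. (%n. Z n x) ----> 0"
    using lim
   proof eventually_elim
    case (elim x)
    hence "(%n. norm (F n x - F0 x)) ----> 0"
     by (simp add: LIM_zero tendsto_norm_zero)
    thus ?case
     by (rule Lim_null_comparison[rotated])
      (use d a(2) in \<open>auto simp: Z_def max_def mult_nonneg_nonneg\<close>)
   qed
   show "AE x in M. norm (Z n x) <= norm (G x) + norm (F0 x)" for n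
    using G(2)[of n]
   proof eventually_elim
    case (elim x)
    have "norm (F n x - F0 x) <= norm (F n x) + norm (F0 x)" by (rule norm_triangle_ineq4)
    moreover have "G x <= norm (G x)" by simp
    ultimately show ?case using elim by (auto simp: Z_def max_def)
   qed
   show "integrable M (%x. norm (G x) + norm (F0 x))" using G int0 by simp
  qed (auto simp: Z_def[abs_def])
  then obtain N where N: "!!n. n >= N ==> \<bar>\<integral>x. Z n x \<partial>M\<bar> < e / 2"
   using e LIMSEQ_D[of "%n. \<integral>x. Z n x \<partial>M" 0 "e/2"] by auto
  show "EX no. ALL n>=no. norm ((\<integral>x. norm (F n x - F0 x) \<partial>M) - 0) < e"
  proof (intro exI[of _ N] allI impI)
   fix n assume n: "N <= n"
   have iZ: "integrable M (Z n)"
    by (rule Bochner_Integration.integrable_bound[of M "%x. norm (F n x - F0 x)"])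
     (use int[of n] int0 d a(2) in \<open>auto simp: Z_def[abs_def] max_def mult_nonneg_nonneg\<close>)
   have "(\<integral>x. norm (F n x - F0 x) \<partial>M) <= (\<integral>x. Z n x + d * a n x \<partial>M)"
    by (rule integral_mono) (use int[of n] int0 iZ a(1)[of n] in \<open>auto simp: Z_def\<close>)
   also have "\<dots> = (\<integral>x. Z n x \<partial>M) + d * (\<integral>x. a n x \<partial>M)"
    using iZ a(1)[of n] by simp
   also have "\<dots> < e"
   proof -
    have "d * (\<integral>x. a n x \<partial>M) <= d * C" using a(3)[of n] d(1) by (intro mult_left_mono) auto
    thus ?thesis using N[OF n] d by linarith
   qed
   finally show "norm ((\<integral>x. norm (F n x - F0 x) \<partial>M) - 0) < e" by (simp add: integral_nonneg_AE)
  qed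
 qed
 have "(%n. (\<integral>x. F n x \<partial>M) - (\<integral>x. F0 x \<partial>M)) ----> 0"
 proof (rule Lim_null_comparison[OF _ L1], intro always_eventually allI)
  fix n
  have "(\<integral>x. F n x \<partial>M) - (\<integral>x. F0 x \<partial>M) = (\<integral>x. F n x - F0 x \<partial>M)" using int[of n] int0 by simp
  thus "norm ((\<integral>x. F n x \<partial>M) - (\<integral>x. F0 x \<partial>M)) <= (\<integral>x. norm (F n x - F0 x) \<partial>M)"
   by simp
 qed
 thus ?B by (simp add: LIM_zero_iff)
qed

section \<open>Square integrable functions with values in a Euclidean space\<close>

definition sq_int :: "('a::euclidean_space => 'b::euclidean_space) => bool" where
 "sq_int f \<longleftrightarrow> f \<in> borel_measurable lborel & integrable lborel (%x. (norm (f x))^2)"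

text \<open>Squared norms are primary because nearly all estimates are quadratic identities;
  \<open>l2\<close> serves the triangle and Cauchy-Schwarz inequalities. Values in any Euclidean
  space let scalars, gradients, complex values and pairs share one calculus.\<close>

definition sqn :: "('a::euclidean_space => 'b::euclidean_space) => real" where
 "sqn f = (LBINT x. (norm (f x))^2)"

definition l2 :: "('a::euclidean_space => 'b::euclidean_space) => real" where
 "l2 f = sqrt (sqn f)"

abbreviation (input) BM :: "('a::topological_space => 'b::topological_space) set" where
 "BM == borel_measurable borel"

abbreviation (input) sq :: "('a => 'b::power) => 'a => 'b" where
 "sq u == %x. (u x)^2"

abbreviation (input) l2_lim :: "(nat => 'a::euclidean_space => 'b::euclidean_space) => ('a => 'b) => bool" where
 "l2_lim f g == (%n. l2 (%x. f n x - g x)) ----> 0"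

lemma sq_int_measurable[measurable_dest]: "sq_int f ==> f \<in> BM"
 by (simp add: sq_int_def)

lemma sq_int_integrable: "sq_int f ==> integrable lborel (%x. (norm (f x))^2)"
 by (simp add: sq_int_def)

lemma sqn_nonneg[simp]: "0 <= sqn f"
 by (simp add: sqn_def)

lemma l2_nonneg[simp]: "0 <= l2 f"
 by (simp add: l2_def)

lemma l2_power2[simp]: "(l2 f)^2 = sqn f"
 by (simp add: l2_def)

lemma sq_int_bound:
 assumes "sq_int f" and [measurable]: "g \<in> BM"
  and le: "AE x in lborel. norm (g x) <= c * norm (f x)"
 shows "sq_int g" "sqn g <= c^2 * sqn f"
proof -
 have *: "AE x in lborel. (norm (g x))^2 <= c^2 * (norm (f x))^2"
  using le by eventually_elim (metis norm_ge_zero power_mono power_mult_distrib)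
 have i: "integrable lborel (%x. c^2 * (norm (f x))^2)"
  using assms(1) by (simp add: sq_int_def)
 have ig: "integrable lborel (%x. (norm (g x))^2)"
  by (rule Bochner_Integration.integrable_bound[OF i])
   (use * in \<open>auto elim!: eventually_mono\<close>)
 thus "sq_int g" by (simp add: sq_int_def)
 have "sqn g <= (LBINT x. c^2 * (norm (f x))^2)"
  unfolding sqn_def by (rule integral_mono_AE[OF ig i *])
 thus "sqn g <= c^2 * sqn f" by (simp add: sqn_def)
qed

lemma sq_int_zero[simp]: "sq_int (%x. 0)"
 by (simp add: sq_int_def)

lemma sqn_zero[simp]: "sqn (%x. 0) = 0"
 by (simp add: sqn_def)

lemma l2_zero[simp]: "l2 (%x. 0) = 0"
 by (simp add: l2_def)

lemma integrable_norm_mult: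
 assumes "sq_int f" "sq_int g"
 shows "integrable lborel (%x. norm (f x) * norm (g x))"
proof (rule Bochner_Integration.integrable_bound[of _ "%x. (norm (f x))^2 + (norm (g x))^2"])
 show "integrable lborel (%x. (norm (f x))^2 + (norm (g x))^2)"
  using assms by (simp add: sq_int_def)
 have "norm (f x) * norm (g x) <= (norm (f x))^2 + (norm (g x))^2" for x
  using sum_squares_bound[of "norm (f x)" "norm (g x)"]
   mult_nonneg_nonneg[OF norm_ge_zero[of "f x"] norm_ge_zero[of "g x"]] by linarith
 thus "AE x in lborel. norm (norm (f x) * norm (g x)) <= norm ((norm (f x))^2 + (norm (g x))^2)"
  by simp
qed (use assms in measurable)

lemma integrable_sq_int_bound:
 fixes h :: "'a::euclidean_space => 'c::euclidean_space"
 assumes "sq_int f" "sq_int g" and [measurable]: "h \<in> BM"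
  and "!!x. norm (h x) <= norm (f x) * norm (g x)"
 shows "integrable lborel h"
proof (rule Bochner_Integration.integrable_bound[OF integrable_norm_mult[OF assms(1,2)]])
 show "AE x in lborel. norm (h x) <= norm (norm (f x) * norm (g x))"
  using assms(4) by simp
qed (use assms in measurable)

lemma integrable_inner:
 assumes "sq_int f" "sq_int g"
 shows "integrable lborel (%x. f x \<bullet> g x)"
 by (rule integrable_sq_int_bound[OF assms])
  (use assms Cauchy_Schwarz_ineq2 in \<open>auto\<close>)

lemma integrable_mult_sq_int:
 fixes f g :: "'a::euclidean_space => real"
 assumes "sq_int f" "sq_int g"
 shows "integrable lborel (%x. f x * g x)"
 using integrable_inner[OF assms] by simp

lemma l2_cauchy_schwarz:
 assumes "sq_int f" "sq_int g"
 shows "(LBINT x. norm (f x) * norm (g x)) <= l2 f * l2 g"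
proof -
 note [measurable] = assms[THEN sq_int_measurable]
 let ?i = "LBINT x. norm (f x) * norm (g x)"
 have "(\<integral>\<^sup>+x. ennreal (norm (f x)) * ennreal (norm (g x)) \<partial>lborel) = ennreal ?i"
  by (subst nn_integral_eq_integral[symmetric])
   (use integrable_norm_mult[OF assms] in \<open>auto simp: ennreal_mult\<close>)
 moreover have "(\<integral>\<^sup>+x. (ennreal (norm (f x)))^2 \<partial>lborel) = ennreal (sqn f)"
  unfolding sqn_def by (subst nn_integral_eq_integral[symmetric])
   (use assms in \<open>auto simp: ennreal_power sq_int_def\<close>)
 moreover have "(\<integral>\<^sup>+x. (ennreal (norm (g x)))^2 \<partial>lborel) = ennreal (sqn g)"
  unfolding sqn_def by (subst nn_integral_eq_integral[symmetric])
   (use assms in \<open>auto simp: ennreal_power sq_int_def\<close>)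
 moreover have "(\<integral>\<^sup>+x. ennreal (norm (f x)) * ennreal (norm (g x)) \<partial>lborel)^2
  <= (\<integral>\<^sup>+x. (ennreal (norm (f x)))^2 \<partial>lborel) * (\<integral>\<^sup>+x. (ennreal (norm (g x)))^2 \<partial>lborel)"
  by (rule Cauchy_Schwarz_nn_integral) auto
 ultimately have "ennreal (?i^2) <= ennreal (sqn f * sqn g)"
  by (simp add: ennreal_power ennreal_mult)
 hence "?i^2 <= sqn f * sqn g" by (simp add: ennreal_le_iff)
 thus ?thesis unfolding l2_def real_sqrt_mult[symmetric]
  by (rule real_le_rsqrt)
qed

lemma inner_cauchy_schwarz:
 assumes "sq_int f" "sq_int g"
 shows "\<bar>LBINT x. f x \<bullet> g x\<bar> <= l2 f * l2 g"
proof -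
 have "\<bar>LBINT x. f x \<bullet> g x\<bar> <= (LBINT x. \<bar>f x \<bullet> g x\<bar>)"
  using integral_norm_bound[of lborel "%x. f x \<bullet> g x"] by simp
 also have "\<dots> <= (LBINT x. norm (f x) * norm (g x))"
  by (rule integral_mono) (use integrable_inner[OF assms] integrable_norm_mult[OF assms]
   Cauchy_Schwarz_ineq2 in auto)
 finally show ?thesis using l2_cauchy_schwarz[OF assms] by simp
qed

lemma sq_int_scaleR:
 assumes "sq_int f" shows "sq_int (%x. c *R f x)"
 by (rule sq_int_bound(1)[OF assms, where c="\<bar>c\<bar>"]) (use assms in \<open>auto dest: sq_int_measurable\<close>)

lemma sqn_scaleR: "sqn (%x. c *R f x) = c^2 * sqn f"
 by (simp add: sqn_def power_mult_distrib)

lemma l2_scaleR: "l2 (%x. c *R f x) = \<bar>c\<bar> * l2 f"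
 by (simp add: l2_def sqn_scaleR real_sqrt_mult)

lemma sq_int_cmult: "sq_int f ==> sq_int (%x. (c::real) * f x)"
 using sq_int_scaleR[of f c] by simp

lemma sqn_cmult: "sqn (%x. c * f x) = c^2 * sqn f" for f :: "'a::euclidean_space => real"
 using sqn_scaleR[of c f] by simp

lemma norm_add_sq: "(norm (a + b))^2 = (norm a)^2 + 2 * (a \<bullet> b) + (norm b)^2"
 by (simp add: power2_norm_eq_inner inner_add inner_commute)

lemma norm_diff_sq: "(norm (a - b))^2 = (norm a)^2 - 2 * (a \<bullet> b) + (norm b)^2"
 by (simp add: power2_norm_eq_inner inner_diff inner_commute)

lemma sq_int_add:
 assumes "sq_int f" "sq_int g" shows "sq_int (%x. f x + g x)"
 using assms integrable_inner[OF assms] by (auto simp: sq_int_def norm_add_sq)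

lemma sq_int_uminus: "sq_int f ==> sq_int (%x. - f x)"
 by (simp add: sq_int_def)

lemma sqn_uminus[simp]: "sqn (%x. - f x) = sqn f"
 by (simp add: sqn_def)

lemma sq_int_diff:
 assumes "sq_int f" "sq_int g" shows "sq_int (%x. f x - g x)"
 using sq_int_add[OF assms(1) sq_int_uminus[OF assms(2)]] by simp

lemma sqn_add:
 assumes "sq_int f" "sq_int g"
 shows "sqn (%x. f x + g x) = sqn f + 2 * (LBINT x. f x \<bullet> g x) + sqn g"
 using assms integrable_inner[OF assms] by (simp add: sqn_def norm_add_sq sq_int_def)

lemma sqn_diff:
 assumes "sq_int f" "sq_int g"
 shows "sqn (%x. f x - g x) = sqn f - 2 * (LBINT x. f x \<bullet> g x) + sqn g"
 using assms integrable_inner[OF assms] by (simp add: sqn_def norm_diff_sq sq_int_def)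

lemma sqn_add_le:
 assumes "sq_int f" "sq_int g"
 shows "sqn (%x. f x + g x) <= 2 * sqn f + 2 * sqn g"
 using sqn_add[OF assms] sqn_diff[OF assms] sqn_nonneg[of "%x. f x - g x"] by linarith

lemma l2_triangle:
 assumes "sq_int f" "sq_int g"
 shows "l2 (%x. f x + g x) <= l2 f + l2 g"
proof -
 have "sqn (%x. f x + g x) <= (l2 f + l2 g)^2"
  using sqn_add[OF assms] inner_cauchy_schwarz[OF assms] by (simp add: power2_sum)
 thus ?thesis unfolding l2_def[of "%x. f x + g x"]
  by (metis l2_nonneg add_nonneg_nonneg real_le_lsqrt)
qed

lemma l2_uminus[simp]: "l2 (%x. - f x) = l2 f"
 by (simp add: l2_def)

lemma l2_triangle_diff:
 assumes "sq_int f" "sq_int g"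
 shows "l2 (%x. f x - g x) <= l2 f + l2 g"
 using l2_triangle[OF assms(1) sq_int_uminus[OF assms(2)]] by simp

lemma l2_diff_commute: "l2 (%x. f x - g x) = l2 (%x. g x - f x)"
 by (simp add: l2_def sqn_def norm_minus_commute)

lemma l2_diff_trans:
 assumes "sq_int f" "sq_int g" "sq_int h"
 shows "l2 (%x. f x - h x) <= l2 (%x. f x - g x) + l2 (%x. g x - h x)"
 using l2_triangle[OF sq_int_diff[OF assms(1,2)] sq_int_diff[OF assms(2,3)]] by simp

lemma l2_reverse_triangle:
 assumes "sq_int f" "sq_int g"
 shows "\<bar>l2 f - l2 g\<bar> <= l2 (%x. f x - g x)"
 using l2_triangle[OF sq_int_diff[OF assms] assms(2)]
  l2_triangle[OF sq_int_diff[OF assms(2,1)] assms(1)] l2_diff_commute[of f g] by simp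

lemma sqn_cong_AE:
 assumes "AE x in lborel. norm (f x) = norm (g x)" "f \<in> BM" "g \<in> BM"
 shows "sqn f = sqn g"
 unfolding sqn_def by (rule integral_cong_AE) (use assms in \<open>auto elim!: eventually_mono\<close>)

lemma sqn_eq_0:
 assumes "sq_int f"
 shows "sqn f = 0 \<longleftrightarrow> (AE x in lborel. f x = 0)"
 unfolding sqn_def using integral_nonneg_eq_0_iff_AE[OF sq_int_integrable[OF assms]] by simp

lemma l2_tendsto_imp_sqn_tendsto:
 assumes f: "!!n. sq_int (f n)" "sq_int g" and lim: "l2_lim f g"
 shows "(%n. sqn (f n)) ----> sqn g"
proof -
 have "(%n. l2 (f n) - l2 g) ----> 0"
  by (rule Lim_null_comparison[OF _ lim]) (use l2_reverse_triangle[OF f(1) f(2)] in auto)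
 hence "(%n. l2 (f n)) ----> l2 g" by (simp add: LIM_zero_iff)
 hence "(%n. (l2 (f n))^2) ----> (l2 g)^2" by (rule tendsto_power)
 thus ?thesis by simp
qed

lemma inner_tendsto:
 assumes f: "!!n. sq_int (f n)" "sq_int f0" and g: "!!n. sq_int (g n)" "sq_int g0"
  and lim: "l2_lim f f0" "l2_lim g g0"
 shows "(%n. LBINT x. f n x \<bullet> g n x) ----> (LBINT x. f0 x \<bullet> g0 x)"
proof -
 have "(%n. (LBINT x. f n x \<bullet> g n x) - (LBINT x. f0 x \<bullet> g0 x)) ----> 0"
 proof (rule Lim_null_comparison)
  have "(%n. sqrt (sqn (g n))) ----> sqrt (sqn g0)"
   by (intro tendsto_real_sqrt l2_tendsto_imp_sqn_tendsto g lim)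
  hence "(%n. l2 (g n)) ----> l2 g0" by (simp add: l2_def)
  from tendsto_add[OF tendsto_mult[OF lim(1) this] tendsto_mult[OF tendsto_const lim(2), of "l2 f0"]]
  show "(%n. l2 (%x. f n x - f0 x) * l2 (g n) + l2 f0 * l2 (%x. g n x - g0 x)) ----> 0" by simp
  show "\<forall>\<^sub>F n in sequentially. norm ((LBINT x. f n x \<bullet> g n x) - (LBINT x. f0 x \<bullet> g0 x))
   <= l2 (%x. f n x - f0 x) * l2 (g n) + l2 f0 * l2 (%x. g n x - g0 x)"
  proof (intro always_eventually allI)
   fix n
   note i = integrable_inner
   have "(LBINT x. f n x \<bullet> g n x) - (LBINT x. f0 x \<bullet> g0 x)
    = (LBINT x. (f n x - f0 x) \<bullet> g n x) + (LBINT x. f0 x \<bullet> (g n x - g0 x))"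
    using i[OF f(1) g(1), of n n] i[OF f(2) g(1), of n] i[OF f(2) g(2)]
    by (simp add: inner_diff)
   thus "norm ((LBINT x. f n x \<bullet> g n x) - (LBINT x. f0 x \<bullet> g0 x))
   <= l2 (%x. f n x - f0 x) * l2 (g n) + l2 f0 * l2 (%x. g n x - g0 x)"
    using inner_cauchy_schwarz[OF sq_int_diff[OF f(1)[of n] f(2)] g(1)[of n]]
     inner_cauchy_schwarz[OF f(2) sq_int_diff[OF g(1)[of n] g(2)]] by simp
  qed
 qed
 thus ?thesis by (simp add: LIM_zero_iff)
qed

lemma sq_int_dominated:
 assumes f: "!!n. f n \<in> BM" "f0 \<in> BM"
  and w: "sq_int (w :: 'a::euclidean_space => real)"
  and le: "!!n. AE x in lborel. norm (f n x) <= w x"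
  and lim: "AE x in lborel. (%n. f n x) ----> f0 x"
 shows "!!n. sq_int (f n)" "sq_int f0" "l2_lim f f0"
proof -
 note [measurable] = f w[THEN sq_int_measurable]
 show s: "sq_int (f n)" for n
  by (rule sq_int_bound(1)[OF w, where c=1]) (use le[of n] f in \<open>auto elim!: eventually_mono\<close>)
 have "AE x in lborel. ALL n. norm (f n x) <= w x" using le by (simp add: AE_all_countable)
 hence w0: "AE x in lborel. norm (f0 x) <= w x"
  using lim
 proof eventually_elim
  case (elim x)
  show ?case by (rule tendsto_upperbound[OF tendsto_norm[OF elim(2)]]) (use elim in auto)
 qed
 show s0: "sq_int f0"
  by (rule sq_int_bound(1)[OF w, where c=1]) (use w0 f in \<open>auto elim!: eventually_mono\<close>)
 have "(%n. sqn (%x. f n x - f0 x)) ----> (\<integral>x. 0 \<partial>(lborel::'a measure))"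
  unfolding sqn_def
 proof (rule integral_dominated_convergence[where w="%x. (2 * w x)^2"])
  show "integrable lborel (%x. (2 * w x)^2)" using sq_int_integrable[OF sq_int_cmult[OF w, of 2]] by simp
  show "AE x in lborel. (%n. (norm (f n x - f0 x))^2) ----> 0"
   using lim
  proof eventually_elim
   case (elim x)
   hence "(%n. norm (f n x - f0 x)) ----> 0" by (simp add: LIM_zero tendsto_norm_zero)
   from tendsto_power[OF this, of 2] show ?case by simp
  qed
  show "AE x in lborel. norm ((norm (f n x - f0 x))^2) <= (2 * w x)^2" for n
   using le[of n] w0
  proof eventually_elim
   case (elim x)
   have "norm (f n x - f0 x) <= 2 * w x" using norm_triangle_ineq4[of "f n x" "f0 x"] elim by simp
   hence "(norm (f n x - f0 x))^2 <= (2 * w x)^2" by (rule power_mono) simp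
   thus ?case by simp
  qed
 qed auto
 hence "(%n. sqn (%x. f n x - f0 x)) ----> 0" by simp
 from tendsto_real_sqrt[OF this] show "l2_lim f f0" by (simp add: l2_def)
qed

lemma gaussian_integrable:
 assumes c: "c > 0"
 shows "integrable lborel (%x::'a::euclidean_space. exp (- c * (norm x)^2))"
proof -
 \<comment> \<open>With variance 1 / (2c) the normal density is a constant multiple of exp(-c
   t^2).\<close>
 define s where "s = sqrt (1 / (2 * c))"
 have s: "s > 0" "s^2 = 1 / (2 * c)" using c by (auto simp: s_def)
 have one: "integrable lborel (%t::real. exp (- c * t^2))"
 proof -
  have "integrable lborel (%t. sqrt (2 * pi * s^2) * normal_density 0 s t)"
   using s by simp
  also have "(%t. sqrt (2 * pi * s^2) * normal_density 0 s t) = (%t. exp (- c * t^2))"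
   using s c by (auto simp: normal_density_def field_simps)
  finally show ?thesis .
 qed
 have "exp (- c * (norm x)^2) = (\<Prod>b\<in>Basis. exp (- c * (x \<bullet> b)^2))" for x :: 'a
 proof -
  have "(norm x)^2 = (\<Sum>b\<in>Basis. (x \<bullet> b)^2)"
   unfolding power2_norm_eq_inner by (subst euclidean_inner) (simp add: power2_eq_square)
  thus ?thesis by (simp add: sum_distrib_left exp_sum)
 qed
 hence "(\<integral>\<^sup>+x. ennreal (exp (- c * (norm (x::'a))^2)) \<partial>lborel)
   = (\<integral>\<^sup>+x. (\<Prod>b\<in>Basis. ennreal (exp (- c * ((x::'a) \<bullet> b)^2))) \<partial>lborel)"
  by (simp add: prod_ennreal)
 also have "\<dots> = (\<Prod>b\<in>(Basis::'a set). \<integral>\<^sup>+x. ennreal (exp (- c * x^2)) \<partial>lborel)"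
  by (rule nn_integral_lborel_prod) auto
 also have "\<dots> < \<infinity>"
  by (subst nn_integral_eq_integral[OF one])
    (auto simp: ennreal_power)
 finally show ?thesis by (intro integrableI_nonneg) auto
qed

lemma sq_int_gaussian:
 assumes "c > 0"
 shows "sq_int (%x::'a::euclidean_space. exp (- c * (norm x)^2))"
proof -
 have "(exp (- c * (norm x)^2))^2 = exp (- (2 * c) * (norm x)^2)" for x :: 'a
  by (simp add: exp_double[symmetric] mult_ac)
 thus ?thesis using gaussian_integrable[of "2*c", where 'a='a] assms by (simp add: sq_int_def)
qed

lemma l2_lim_AE_subseq:
 assumes "!!n. sq_int (f n)" "sq_int g" and lim: "l2_lim f g"
 obtains r :: "nat => nat" where "strict_mono r" "AE x in lborel. (%n. f (r n) x) ----> g x"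
proof -
 have "(%n. (l2 (%x. f n x - g x))^2) ----> 0^2" by (rule tendsto_power[OF lim])
 hence "(%n. LBINT x. norm ((norm (f n x - g x))^2)) ----> 0"
  by (simp add: sqn_def)
 from tendsto_L1_AE_subseq[OF sq_int_integrable[OF sq_int_diff[OF assms(1,2)]] this]
 obtain r :: "nat => nat" where r: "strict_mono r"
  "AE x in lborel. (%n. (norm (f (r n) x - g x))^2) ----> 0" by auto
 have "AE x in lborel. (%n. f (r n) x) ----> g x"
  using r(2)
 proof eventually_elim
  case (elim x)
  from tendsto_real_sqrt[OF this] have "(%n. norm (f (r n) x - g x)) ----> 0" by simp
  thus ?case by (simp add: LIM_zero_iff tendsto_norm_zero_iff)
 qed
 with r(1) show thesis by (rule that)
qed

text \<open>Completeness of L1 applies to \<open>w x *R f n x\<close>; as w is positive, dividing by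
  it recovers almost everywhere convergence of f itself. The weight lets the lemma serve both the
  completeness of L2 and local compactness, where nothing is known uniformly at infinity.\<close>

lemma weighted_cauchy_AE_subseq:
 fixes f :: "nat => 'a::euclidean_space => 'b::euclidean_space"
 assumes f: "!!n. sq_int (f n)" and w: "sq_int (w :: 'a => real)" "!!x. w x > 0"
  and C: "!!e. e > 0 ==> EX N. ALL i>=N. ALL j>=N. (LBINT x. w x * norm (f i x - f j x)) < e"
 obtains r :: "nat => nat" and g where "strict_mono r" "g \<in> BM"
  "AE x in lborel. (%n. f (r n) x) ----> g x"
proof -
 note [measurable] = f[THEN sq_int_measurable] w(1)[THEN sq_int_measurable]
 have "integrable lborel (%x. w x *R f n x)" for n
  by (rule integrable_sq_int_bound[OF w(1) f[of n]]) auto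
 moreover have "norm (w x *R f i x - w x *R f j x) = w x * norm (f i x - f j x)" for x i j
  using w(2)[of x] by (simp add: scaleR_diff_right[symmetric])
 ultimately obtain r where r: "strict_mono r" "AE x in lborel. Cauchy (%i. w x *R f (r i) x)"
  using C cauchy_L1_AE_cauchy_subseq[of lborel "%n x. w x *R f n x"] by (simp del: norm_scaleR) blast
 show thesis
 proof (rule that[OF r(1)])
  show "AE x in lborel. (%n. f (r n) x) ----> lim (%n. f (r n) x)"
   using r(2)
  proof eventually_elim
   case (elim x)
   from elim have "convergent (%i. w x *R f (r i) x)" by (simp add: Cauchy_convergent_iff)
   then obtain l where "(%i. w x *R f (r i) x) ----> l" by (auto simp: convergent_def)
   from tendsto_scaleR[OF tendsto_const this, of "inverse (w x)"]
   have *: "(%i. f (r i) x) ----> inverse (w x) *R l" using w(2)[of x] by simp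
   thus ?case using limI[OF *] by simp
  qed
 qed measurable
qed

text \<open>A Gaussian weight and Cauchy-Schwarz turn the Cauchy property in L2 into a weighted one
  in L1, which yields an almost everywhere limit; Fatou along the subsequence then bounds the L2
  distance to that limit.\<close>

lemma l2_complete:
 fixes f :: "nat => 'a::euclidean_space => 'b::euclidean_space"
 assumes f: "!!n. sq_int (f n)"
  and C: "!!e. e > 0 ==> EX N. ALL i>=N. ALL j>=N. l2 (%x. f i x - f j x) < e"
 obtains g where "sq_int g" "l2_lim f g"
proof -
 define w :: "'a => real" where "w = (%x. exp (- 1 * (norm x)^2))"
 have w: "sq_int w" "!!x. w x > 0" using sq_int_gaussian[of 1] by (auto simp: w_def)
 have "EX N. ALL i>=N. ALL j>=N. (LBINT x. w x * norm (f i x - f j x)) < e" if e: "e > 0" for e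
 proof -
  have "e / (l2 w + 1) > 0" using e by (simp add: add_nonneg_pos)
  then obtain N where N: "!!i j. i >= N ==> j >= N ==> l2 (%x. f i x - f j x) < e / (l2 w + 1)"
   using C by blast
  have "(LBINT x. w x * norm (f i x - f j x)) < e" if "i >= N" "j >= N" for i j
  proof -
   have "(LBINT x. w x * norm (f i x - f j x)) <= l2 w * l2 (%x. f i x - f j x)"
    using l2_cauchy_schwarz[OF w(1) sq_int_diff[OF f[of i] f[of j]]] w(2) by (simp add: less_imp_le)
   also have "\<dots> <= (l2 w + 1) * l2 (%x. f i x - f j x)" by (intro mult_right_mono) auto
   also have "\<dots> < e" using N[OF that] by (subst (asm) pos_less_divide_eq) (simp_all add: mult.commute add_nonneg_pos)
   finally show ?thesis .
  qed
  thus ?thesis by blast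
 qed
 from weighted_cauchy_AE_subseq[OF f w this]
 obtain r :: "nat => nat" and g where r: "strict_mono r" and g[measurable]: "g \<in> BM"
  and lim: "AE x in lborel. (%n. f (r n) x) ----> g x" by metis
 have key: "sq_int (%x. f n x - g x) & sqn (%x. f n x - g x) <= e^2"
  if e: "e > 0" and N: "!!i j. i >= N ==> j >= N ==> l2 (%x. f i x - f j x) < e" and n: "n >= N" for n N e
 proof -
  note [measurable] = f[THEN sq_int_measurable]
  note F = fatou_integral[of lborel "%k x. (norm (f n x - f (r (k + N)) x))^2" "e^2" "%x. (norm (f n x - g x))^2"]
  have rk: "r (k + N) >= N" for k using seq_suble[OF r, of "k + N"] by linarith
  have 1: "integrable lborel (%x. (norm (f n x - f (r (k + N)) x))^2)" for k
   by (rule sq_int_integrable[OF sq_int_diff[OF f f]])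
  have 2: "(LBINT x. (norm (f n x - f (r (k + N)) x))^2) <= e^2" for k
   using power_mono[of "l2 (%x. f n x - f (r (k + N)) x)" e 2] N[OF n rk, of k]
   by (simp add: sqn_def[symmetric] less_imp_le)
  have 3: "AE x in lborel. (%k. (norm (f n x - f (r (k + N)) x))^2) ----> (norm (f n x - g x))^2"
   using lim by eventually_elim (intro tendsto_intros LIMSEQ_ignore_initial_segment, assumption)
  show ?thesis using F[OF 1 _ 2 _ 3] by (simp add: sq_int_def sqn_def)
 qed
 obtain N0 where N0: "!!i j. i >= N0 ==> j >= N0 ==> l2 (%x. f i x - f j x) < 1" using C[of 1] by auto
 have "sq_int (%x. f N0 x - g x)" using key[of 1 N0 N0] N0 by simp
 from sq_int_diff[OF f[of N0] this] have sg: "sq_int g" by simp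
 show thesis
 proof (rule that[OF sg], rule LIMSEQ_I)
  fix e :: real assume e: "e > 0"
  then obtain N where N: "!!i j. i >= N ==> j >= N ==> l2 (%x. f i x - f j x) < e/2" using C[of "e/2"] by auto
  show "EX no. ALL n>=no. norm (l2 (%x. f n x - g x) - 0) < e"
  proof (intro exI[of _ N] allI impI)
   fix n assume "n >= N"
   from key[OF _ N this] e have "sqn (%x. f n x - g x) <= (e/2)^2" by simp
   hence "l2 (%x. f n x - g x) <= e/2" unfolding l2_def using e by (intro real_le_lsqrt) auto
   thus "norm (l2 (%x. f n x - g x) - 0) < e" using e by simp
  qed
 qed
qed

text \<open>Convex combinations of the tail from n on, generated by midpoints alone: the
  parallelogram identity sees nothing else, and a property stable under midpoints passes to the
  whole hull by induction.\<close>

inductive_set midhull :: "(nat => 'a::euclidean_space => 'b::euclidean_space) => nat => ('a => 'b) set"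
 for G :: "nat => 'a => 'b" and n :: nat where
 base: "k >= n ==> G k \<in> midhull G n"
| mid: "f \<in> midhull G n ==> h \<in> midhull G n ==> (%x. (1/2) *R (f x + h x)) \<in> midhull G n"

lemma midhull_mono: "f \<in> midhull G m ==> n <= m ==> f \<in> midhull G n"
 by (induction rule: midhull.induct) (auto intro: midhull.intros)

lemma midhull_sq_int: "f \<in> midhull G m ==> (!!n. sq_int (G n)) ==> sq_int f"
 by (induction rule: midhull.induct) (auto intro: sq_int_scaleR sq_int_add simp del: scaleR_add_right scaleR_half_double)

lemma sqn_parallelogram:
 assumes "sq_int f" "sq_int g"
 shows "sqn (%x. f x - g x) = 2 * sqn f + 2 * sqn g - 4 * sqn (%x. (1/2) *R (f x + g x))"
 using sqn_add[OF assms] sqn_diff[OF assms] sqn_scaleR[of "1/2" "%x. f x + g x"]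
 by (simp add: power2_eq_square)

text \<open>The infima of \<open>sqn\<close> over the tail hulls increase to a finite limit. The
  midpoint of two near-minimizers lies in the larger of the two hulls, so the parallelogram identity
  makes the near-minimizers a Cauchy sequence. Strong limits of such combinations take the place of
  weak compactness of balls in L2.\<close>

lemma mazur:
 fixes G :: "nat => 'a::euclidean_space => 'b::euclidean_space"
 assumes G: "!!n. sq_int (G n)" and B: "!!n. sqn (G n) <= C"
 obtains h g where "!!m. h m \<in> midhull G m" "sq_int g" "l2_lim h g"
proof -
 define d where "d n = Inf (sqn ` midhull G n)" for n
 have bb: "bdd_below (sqn ` midhull G n)" for n by (intro bdd_belowI[of _ 0]) auto
 have ne: "sqn ` midhull G n ~= {}" for n using midhull.base[of n n G] by auto
 have dle: "d n <= sqn f" if "f \<in> midhull G n" for f n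
  unfolding d_def by (rule cInf_lower[OF _ bb]) (use that in auto)
 have dC: "d n <= C" for n using dle[OF midhull.base[of n n]] B[of n] by simp
 have "incseq d"
  unfolding d_def incseq_def by (intro allI impI cInf_superset_mono[OF ne bb]) (auto intro: midhull_mono)
 then obtain D where D: "d ----> D" using dC by (metis incseq_convergent)
 have "\<exists>f\<in>midhull G n. sqn f < d n + 1 / (real n + 1)" for n
 proof -
  have "Inf (sqn ` midhull G n) < d n + 1 / (real n + 1)" unfolding d_def by simp
  from cInf_lessD[OF ne this] show ?thesis by auto
 qed
 then obtain h where h: "!!n. h n \<in> midhull G n" "!!n. sqn (h n) < d n + 1 / (real n + 1)" by metis
 have hs: "sq_int (h n)" for n by (rule midhull_sq_int[OF h(1) G])
 have est: "sqn (%x. h m x - h n x) <= 2 * (d m - d n) + 2/(real n + 1) + 2/(real m + 1)" if "m >= n" for m n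
 proof -
  have "d n <= sqn (%x. (1/2) *R (h m x + h n x))"
   by (rule dle) (intro midhull.mid midhull_mono[OF h(1)] that order.refl)
  thus ?thesis using sqn_parallelogram[OF hs[of m] hs[of n]] h(2)[of m] h(2)[of n] by simp
 qed
 have lim0: "(%n. 2 * (D - d n) + 4/(real n + 1)) ----> 2 * (D - D) + 0"
  by (intro tendsto_intros D) real_asymp
 have dD: "d n <= D" for n using incseq_le[OF \<open>incseq d\<close> D] by simp
 have "EX N. ALL i>=N. ALL j>=N. l2 (%x. h i x - h j x) < e" if e: "e > 0" for e
 proof -
  obtain N where N: "!!n. n >= N ==> 2 * (D - d n) + 4/(real n + 1) < e^2"
   using order_tendstoD(2)[OF lim0, of "e^2"] e by (auto simp: eventually_sequentially)
  have *: "l2 (%x. h m x - h n x) < e" if "m >= n" "n >= N" for m n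
  proof -
   have "2/(real m + 1) <= 2/(real n + 1)" using that by (intro divide_left_mono) auto
   hence "sqn (%x. h m x - h n x) < e^2" using est[OF that(1)] N[OF that(2)] dD[of m] by simp
   thus ?thesis unfolding l2_def using e by (intro real_less_lsqrt) auto
  qed
  show ?thesis
  proof (intro exI[of _ N] allI impI)
   fix i j assume "N <= i" "N <= j"
   thus "l2 (%x. h i x - h j x) < e"
    using *[of i j] *[of j i] l2_diff_commute[of "h i" "h j"] by (cases "i >= j") auto
  qed
 qed
 from l2_complete[OF hs this] obtain g where "sq_int g" "l2_lim h g" by metis
 with h(1) show thesis by (rule that)
qed

section \<open>Affine substitutions and continuity of translations in L2\<close>

lemma lborel_integral_affine:
 fixes f :: "'a::euclidean_space => 'b::euclidean_space"
 assumes c: "c ~= 0" and [measurable]: "f \<in> BM"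
 shows "(LBINT x. f (t + c *R x)) = (1 / \<bar>c\<bar> ^ DIM('a)) *R (LBINT x. f x)"
  "integrable lborel (%x. f (t + c *R x)) \<longleftrightarrow> integrable lborel f"
proof -
 let ?T = "%x::'a. t + c *R x"
 have L: "lborel = density (distr lborel borel ?T) (%_. \<bar>c\<bar> ^ DIM('a))" by (rule lborel_affine[OF c])
 have "(LBINT x. f x) = (\<bar>c\<bar> ^ DIM('a)) *R (LBINT x. f (?T x))"
  by (subst L, subst integral_density) (auto simp: integral_distr)
 thus "(LBINT x. f (?T x)) = (1 / \<bar>c\<bar> ^ DIM('a)) *R (LBINT x. f x)"
  using c by simp
 have "integrable lborel f \<longleftrightarrow> integrable (density (distr lborel borel ?T) (%_. ennreal (\<bar>c\<bar> ^ DIM('a)))) f"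
  using L by simp
 also have "\<dots> \<longleftrightarrow> integrable lborel (%x. f (?T x))"
  using c integrable_scaleR_right[of "inverse (\<bar>c\<bar> ^ DIM('a))" lborel "%x. \<bar>c\<bar> ^ DIM('a) *R f (?T x)"]
  by (subst integrable_density) (auto simp: integrable_distr_eq)
 finally show "integrable lborel (%x. f (?T x)) \<longleftrightarrow> integrable lborel f" by simp
qed

lemma AE_lborel_affine:
 fixes t :: "'a::euclidean_space"
 assumes c: "c ~= 0" and P: "AE x in lborel. P x"
 shows "AE x in lborel. P (t + c *R x)"
proof -
 from P obtain N where N: "{x. \<not> P x} \<subseteq> N" "N \<in> null_sets lborel"
  unfolding eventually_ae_filter by auto
 have m: "{x::'a. t + c *R x \<in> N} \<in> sets borel"
  using measurable_sets[of "%x. t + c *R x" borel borel N] N(2) by (auto simp: vimage_def)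
 have "emeasure lborel N = (\<bar>c\<bar> ^ DIM('a)) * emeasure lborel {x. t + c *R x \<in> N}"
  using N(2) by (subst lborel_affine[OF c, of t], subst emeasure_density)
   (auto simp: emeasure_distr vimage_def nn_integral_cmult_indicator)
 hence "emeasure lborel {x. t + c *R x \<in> N} = 0" using c N(2) by (auto simp: null_sets_def)
 hence "{x. t + c *R x \<in> N} \<in> null_sets lborel" using m by (simp add: null_sets_def)
 thus ?thesis by (rule AE_I') (use N in auto)
qed

lemma sq_int_affine:
 fixes f :: "'a::euclidean_space => 'b::euclidean_space"
 assumes c: "c ~= 0" and f: "sq_int f"
 shows "sq_int (%x. f (t + c *R x))" (is ?A) "sqn (%x. f (t + c *R x)) = sqn f / \<bar>c\<bar> ^ DIM('a)" (is ?B)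
proof -
 note [measurable] = f[THEN sq_int_measurable]
 show ?A
  using f lborel_integral_affine(2)[OF c, of "%x. (norm (f x))^2" t] by (simp add: sq_int_def)
 show ?B
  using lborel_integral_affine(1)[OF c, of "%x. (norm (f x))^2" t] by (simp add: sqn_def)
qed

lemma sq_int_shift:
 fixes f :: "'a::euclidean_space => 'b::euclidean_space"
 assumes "sq_int f"
 shows "sq_int (%x. f (x + t))" "sqn (%x. f (x + t)) = sqn f" "l2 (%x. f (x + t)) = l2 f"
 using sq_int_affine[of 1 f t] assms by (auto simp: add.commute l2_def)

definition transl_cont :: "('a::euclidean_space => 'b::euclidean_space) => bool" where
 "transl_cont f \<longleftrightarrow> (ALL h. h ----> 0 --> l2_lim (%n x. f (x + h n)) f)"

lemma transl_cont_zero: "transl_cont (%x. 0)"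
 by (simp add: transl_cont_def)

lemma transl_cont_add:
 assumes "sq_int f" "sq_int g" "transl_cont f" "transl_cont g"
 shows "transl_cont (%x. f x + g x)"
 unfolding transl_cont_def
proof (intro allI impI)
 fix h :: "nat => 'a" assume h: "h ----> 0"
 have l: "(%n. l2 (%x. f (x + h n) - f x) + l2 (%x. g (x + h n) - g x)) ----> 0"
  using tendsto_add[of "%n. l2 (%x. f (x + h n) - f x)" 0 _ "%n. l2 (%x. g (x + h n) - g x)" 0]
   assms(3,4) h by (simp add: transl_cont_def)
 show "(%n. l2 (%x. f (x + h n) + g (x + h n) - (f x + g x))) ----> 0"
 proof (rule Lim_null_comparison[OF _ l], intro always_eventually allI)
  fix n
  have "l2 (%x. (f (x + h n) - f x) + (g (x + h n) - g x)) <= l2 (%x. f (x + h n) - f x) + l2 (%x. g (x + h n) - g x)"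
   by (intro l2_triangle sq_int_diff sq_int_shift assms)
  thus "norm (l2 (%x. f (x + h n) + g (x + h n) - (f x + g x))) <= l2 (%x. f (x + h n) - f x) + l2 (%x. g (x + h n) - g x)"
   by (simp add: algebra_simps)
 qed
qed

lemma transl_cont_closed:
 fixes f :: "'a::euclidean_space => 'b::euclidean_space"
 assumes f: "sq_int f"
  and a: "!!e. e > 0 ==> EX g. sq_int g & transl_cont g & l2 (%x. f x - g x) < e"
 shows "transl_cont f"
 unfolding transl_cont_def
proof (intro allI impI)
 fix h :: "nat => 'a" assume h: "h ----> 0"
 show "l2_lim (%n x. f (x + h n)) f"
 proof (rule LIMSEQ_I)
  fix e :: real assume e: "e > 0"
  then obtain g where g: "sq_int g" "transl_cont g" "l2 (%x. f x - g x) < e/3" using a[of "e/3"] by auto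
  hence "l2_lim (%n x. g (x + h n)) g" using h by (simp add: transl_cont_def)
  from LIMSEQ_D[OF this, of "e/3"] e obtain N where N: "!!n. n >= N ==> l2 (%x. g (x + h n) - g x) < e/3" by auto
  show "EX no. ALL n>=no. norm (l2 (%x. f (x + h n) - f x) - 0) < e"
  proof (intro exI[of _ N] allI impI)
   fix n assume n: "n >= N"
   have 1: "l2 (%x. f (x + h n) - g (x + h n)) = l2 (%x. f x - g x)"
    using sq_int_shift(3)[OF sq_int_diff[OF f g(1)]] by simp
   have "l2 (%x. f (x + h n) - f x) <= l2 (%x. f (x + h n) - g (x + h n)) + l2 (%x. g (x + h n) - f x)"
    by (intro l2_diff_trans sq_int_shift f g)
   also have "l2 (%x. g (x + h n) - f x) <= l2 (%x. g (x + h n) - g x) + l2 (%x. g x - f x)"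
    by (intro l2_diff_trans sq_int_shift f g)
   finally show "norm (l2 (%x. f (x + h n) - f x) - 0) < e"
    using N[OF n] g(3) 1 l2_diff_commute[of g f] by simp
  qed
 qed
qed

lemma sq_int_indicator:
 assumes "A \<in> sets borel" "emeasure lborel A < \<infinity>"
 shows "sq_int (%x. indicator A x *R v)" (is ?A) "sqn (%x. indicator A x *R v) = measure lborel A * (norm v)^2" (is ?B)
proof -
 have *: "(norm (indicator A x *R v))^2 = indicator A x * (norm v)^2" for x
  by (auto simp: indicator_def)
 have "integrable lborel (%x. indicator A x * (norm v)^2)"
  using assms by (intro integrable_mult_left) simp
 thus ?A using assms unfolding sq_int_def * by simp
 show ?B
  unfolding sqn_def * using assms by simp
qed

text \<open>Norms are translation invariant, so it suffices that the inner product of the translate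
  with the indicator converges. For open U the integrand converges pointwise: points of U stay in U
  under small shifts, and elsewhere the unshifted factor vanishes.\<close>

lemma transl_cont_open:
 fixes U :: "'a::euclidean_space set" and v :: "'b::euclidean_space"
 assumes U: "open U" "emeasure lborel U < \<infinity>"
 shows "transl_cont (%x. indicator U x *R v)"
 unfolding transl_cont_def
proof (intro allI impI)
 fix h :: "nat => 'a" assume h: "h ----> 0"
 have [measurable]: "U \<in> sets borel" using U by simp
 let ?f = "%x. indicator U x *R v"
 have s: "sq_int ?f" by (rule sq_int_indicator) (use U in auto)
 have "(%n. LBINT x. ?f (x + h n) \<bullet> ?f x) ----> (LBINT x. ?f x \<bullet> ?f x)"
 proof (rule integral_dominated_convergence[where w="%x. (norm (?f x))^2"])
  show "integrable lborel (%x. (norm (?f x))^2)" by (rule sq_int_integrable[OF s])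
  show "AE x in lborel. (%n. ?f (x + h n) \<bullet> ?f x) ----> ?f x \<bullet> ?f x"
  proof (rule AE_I2)
   fix x
   show "(%n. ?f (x + h n) \<bullet> ?f x) ----> ?f x \<bullet> ?f x"
   proof (cases "x \<in> U")
    case True
    have "(%n. x + h n) ----> x + 0" by (intro tendsto_intros h)
    hence "\<forall>\<^sub>F n in sequentially. x + h n \<in> U" using topological_tendstoD[OF _ U(1)] True by simp
    thus ?thesis by (intro tendsto_eventually) (auto elim!: eventually_mono simp: indicator_def True)
   qed (simp add: indicator_def)
  qed
  show "AE x in lborel. norm (?f (x + h n) \<bullet> ?f x) <= (norm (?f x))^2" for n
   by (rule AE_I2) (auto simp: indicator_def power2_norm_eq_inner)
 qed auto
 hence "(%n. sqn ?f - 2 * (LBINT x. ?f (x + h n) \<bullet> ?f x) + sqn ?f) ----> sqn ?f - 2 * (LBINT x. ?f x \<bullet> ?f x) + sqn ?f"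
  by (intro tendsto_intros)
 moreover have "sqn (%x. ?f (x + h n) - ?f x) = sqn ?f - 2 * (LBINT x. ?f (x + h n) \<bullet> ?f x) + sqn ?f" for n
  using sqn_diff[OF sq_int_shift(1)[OF s, of "h n"] s] sq_int_shift(2)[OF s, of "h n"] by simp
 moreover have "sqn ?f - 2 * (LBINT x. ?f x \<bullet> ?f x) + sqn ?f = 0"
  unfolding sqn_def power2_norm_eq_inner by simp
 ultimately have "(%n. sqn (%x. ?f (x + h n) - ?f x)) ----> 0" by simp
 from tendsto_real_sqrt[OF this] show "l2_lim (%n x. ?f (x + h n)) (?f)"
  by (simp add: l2_def)
qed

lemma transl_cont_indicator:
 fixes A :: "'a::euclidean_space set" and v :: "'b::euclidean_space"
 assumes A: "A \<in> sets borel" "emeasure lborel A < \<infinity>"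
 shows "transl_cont (%x. indicator A x *R v)"
proof (rule transl_cont_closed)
 show "sq_int (%x. indicator A x *R v)" by (rule sq_int_indicator[OF A])
 fix e :: real assume e: "e > 0"
 define d where "d = e^2 / (2 * ((norm v)^2 + 1))"
 have d: "d > 0" using e by (simp add: d_def add_nonneg_pos)
 obtain U where U: "open U" "A \<subseteq> U" "emeasure lborel (U - A) < d"
  using outer_regular_lborel[OF A(1) d] by blast
 have "emeasure lborel U <= emeasure lborel A + emeasure lborel (U - A)"
  using emeasure_subadditive[of A lborel "U - A"] A U by (simp add: Un_absorb1)
 also have "\<dots> < \<infinity>" using A(2) U(3) by (simp add: less_top[symmetric]) (metis ennreal_less_top order.strict_trans less_irrefl)
 finally have Uf: "emeasure lborel U < \<infinity>" .
 have D: "U - A \<in> sets borel" "emeasure lborel (U - A) < \<infinity>" using A U by (auto intro: order.strict_trans)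
 have eq: "indicator A x *R v - indicator U x *R v = indicator (U - A) x *R (- v)" for x
  using U(2) by (auto simp: indicator_def)
 have "measure lborel (U - A) < d" using U(3) D(2) by (simp add: emeasure_eq_ennreal_measure ennreal_less_iff)
 hence "measure lborel (U - A) * (norm v)^2 <= d * (norm v)^2" by (intro mult_right_mono) auto
 also have "\<dots> < e^2" using e by (simp add: d_def divide_simps add_nonneg_pos)
 finally have "sqn (%x. indicator A x *R v - indicator U x *R v) < e^2"
  unfolding eq sq_int_indicator(2)[OF D] by simp
 hence "l2 (%x. indicator A x *R v - indicator U x *R v) < e"
  unfolding l2_def using e by (intro real_less_lsqrt) auto
 thus "EX g. sq_int g & transl_cont g & l2 (%x. indicator A x *R v - g x) < e"
  using sq_int_indicator(1)[of U v] transl_cont_open[OF U(1) Uf, of v] U(1) Uf by (intro exI) auto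
qed

lemma transl_cont_simple:
 fixes S :: "'b::euclidean_space set"
 assumes "finite S" "!!y. y \<in> S ==> A y \<in> sets borel & emeasure lborel (A y :: 'a::euclidean_space set) < \<infinity>"
 shows "sq_int (%x. \<Sum>y\<in>S. indicator (A y) x *R y) & transl_cont (%x. \<Sum>y\<in>S. indicator (A y) x *R y)"
 using assms
proof (induction S rule: finite_induct)
 case empty
 thus ?case by (simp add: transl_cont_zero)
next
 case (insert z S)
 have IH: "sq_int (%x. \<Sum>y\<in>S. indicator (A y) x *R y)" "transl_cont (%x. \<Sum>y\<in>S. indicator (A y) x *R y)"
  using insert.IH insert.prems by blast+
 have z: "A z \<in> sets borel" "emeasure lborel (A z) < \<infinity>" using insert.prems by auto
 show ?case unfolding sum.insert[OF insert.hyps]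
  by (intro conjI sq_int_add transl_cont_add sq_int_indicator transl_cont_indicator z IH)
qed

text \<open>Translation continuity is closed under L2 limits and holds for simple functions whose
  nonzero level sets have finite measure. The approximants bounded by 2 |f| are of this kind, and
  this bound also makes them converge in L2.\<close>

lemma sq_int_transl_cont:
 fixes f :: "'a::euclidean_space => 'b::euclidean_space"
 assumes f: "sq_int f"
 shows "transl_cont f"
proof (rule transl_cont_closed[OF f])
 fix e :: real assume e: "e > 0"
 note [measurable] = f[THEN sq_int_measurable]
 have "f \<in> borel_measurable lborel" by simp
 from borel_measurable_implies_sequence_metric[OF this, of 0] obtain s where
  s: "!!i. simple_function lborel (s i)" "!!x. (%i. s i x) ----> f x" "!!i x. norm (s i x) <= 2 * norm (f x)"
  by auto
 have [measurable]: "s i \<in> BM" for i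
  using borel_measurable_simple_function[OF s(1)[of i]] by simp
 have w: "sq_int (%x. 2 * norm (f x))"
  by (rule sq_int_bound(1)[OF f, where c=2]) auto
 have lim: "l2_lim s f"
  by (rule sq_int_dominated(3)[OF _ _ w]) (use s in auto)
 have si: "sq_int (s i)" for i by (rule sq_int_bound(1)[OF f, where c=2]) (use s(3) in auto)
 from order_tendstoD(2)[OF lim e] obtain i where i: "l2 (%x. s i x - f x) < e"
  by (auto simp: eventually_sequentially)
 define S where "S = s i ` UNIV - {0}"
 have fin: "finite (range (s i))" using s(1)[of i] by (simp add: simple_function_def)
 have A: "s i -` {y} \<in> sets borel & emeasure lborel (s i -` {y}) < \<infinity>" if "y \<in> S" for y
 proof -
  have m: "s i -` {y} \<in> sets borel" using measurable_sets[of "s i" borel borel "{y}"] by simp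
  have y: "norm y > 0" using that by (auto simp: S_def)
  have "integrable lborel (%x. indicator (s i -` {y}) x :: real)"
  proof (rule Bochner_Integration.integrable_bound[OF integrable_mult_right[OF sq_int_integrable[OF si[of i]], of "inverse ((norm y)^2)"]])
   show "AE x in lborel. norm (indicator (s i -` {y}) x :: real) <= norm (inverse ((norm y)^2) * (norm (s i x))^2)"
    using y by (intro AE_I2) (auto simp: indicator_def)
  qed (use m in auto)
  thus ?thesis using m by (simp add: integrable_indicator_iff)
 qed
 have eq: "s i x = (\<Sum>y\<in>S. indicator (s i -` {y}) x *R y)" for x
 proof -
  have "s i x = (\<Sum>y\<in>range (s i). indicator (s i -` {y}) x *R y)"
   by (rule simple_function_indicator_representation_banach[OF s(1)[of i], unfolded space_lborel space_borel Int_UNIV_right, OF UNIV_I])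
  also have "\<dots> = (\<Sum>y\<in>S. indicator (s i -` {y}) x *R y)"
   unfolding S_def using fin by (intro sum.mono_neutral_right) auto
  finally show ?thesis .
 qed
 have "s i = (%x. \<Sum>y\<in>S. indicator (s i -` {y}) x *R y)" by (rule ext) (rule eq)
 moreover have "transl_cont (%x. \<Sum>y\<in>S. indicator (s i -` {y}) x *R y)"
  by (rule transl_cont_simple[THEN conjunct2]) (use A fin in \<open>auto simp: S_def\<close>)
 ultimately have "transl_cont (s i)" by metis
 thus "EX g. sq_int g & transl_cont g & l2 (%x. f x - g x) < e"
  using i si[of i] l2_diff_commute[of f "s i"] by auto
qed

text \<open>Pointwise Cauchy-Schwarz with the weight split into two factors sqrt K, followed by
  Tonelli. It is the common source of the bounds for mollifications, for their distance to the
  original function, and for translates, where K is the indicator of the unit interval.\<close>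

lemma averaging_jensen:
 fixes G :: "'a::euclidean_space => 'c::euclidean_space => 'b::euclidean_space" and K :: "'c => real"
 assumes K: "integrable lborel K" "!!z. 0 <= K z" "(LBINT z. K z) = 1"
  and G[measurable]: "(%(x, z). G x z) \<in> borel_measurable (lborel \<Otimes>\<^sub>M lborel)"
  and s: "!!z. sq_int (%x. G x z)" and B: "!!z. sqn (%x. G x z) <= B z"
  and KB: "integrable lborel (%z. K z * B z)"
 shows "sq_int (%x. LBINT z. K z *R G x z)"
  "sqn (%x. LBINT z. K z *R G x z) <= (LBINT z. K z * B z)"
proof -
 have [measurable]: "K \<in> borel_measurable lborel" using K(1) by simp
 have B0: "0 <= B z" for z using B[of z] sqn_nonneg order_trans by blast
 let ?C = "%x. LBINT z. K z *R G x z"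
 have Cm: "?C \<in> borel_measurable lborel" by measurable
 have pt: "ennreal ((norm (?C x))^2) <= (\<integral>\<^sup>+z. ennreal (K z * (norm (G x z))^2) \<partial>lborel)" for x
 proof (cases "integrable lborel (%z. K z *R G x z)")
  case True
  have "ennreal (norm (?C x)) <= (\<integral>\<^sup>+z. ennreal (sqrt (K z)) * ennreal (sqrt (K z) * norm (G x z)) \<partial>lborel)"
   using integral_norm_bound_ennreal[OF True] K(2)
   by (simp add: ennreal_mult[symmetric] mult.assoc[symmetric])
  hence "(ennreal (norm (?C x)))^2 <= (\<integral>\<^sup>+z. ennreal (sqrt (K z)) * ennreal (sqrt (K z) * norm (G x z)) \<partial>lborel)^2"
   by (rule power_mono) simp
  also have "\<dots> <= (\<integral>\<^sup>+z. (ennreal (sqrt (K z)))^2 \<partial>lborel) * (\<integral>\<^sup>+z. (ennreal (sqrt (K z) * norm (G x z)))^2 \<partial>lborel)"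
   by (rule Cauchy_Schwarz_nn_integral) auto
  also have "(\<integral>\<^sup>+z. (ennreal (sqrt (K z)))^2 \<partial>lborel) = 1"
   using K by (simp add: ennreal_power nn_integral_eq_integral)
  also have "(\<integral>\<^sup>+z. (ennreal (sqrt (K z) * norm (G x z)))^2 \<partial>lborel) = (\<integral>\<^sup>+z. ennreal (K z * (norm (G x z))^2) \<partial>lborel)"
   using K(2) by (simp add: ennreal_power power_mult_distrib)
  finally show ?thesis by (simp add: ennreal_power)
 \<comment> \<open>Where the average does not converge, the integral is 0 by convention and the
   bound is trivial.\<close>
 qed (simp add: not_integrable_integral_eq)
 have "(\<integral>\<^sup>+x. ennreal ((norm (?C x))^2) \<partial>lborel) <= (\<integral>\<^sup>+x. \<integral>\<^sup>+z. ennreal (K z * (norm (G x z))^2) \<partial>lborel \<partial>lborel)"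
  by (intro nn_integral_mono pt)
 also have "\<dots> = (\<integral>\<^sup>+z. \<integral>\<^sup>+x. ennreal (K z * (norm (G x z))^2) \<partial>lborel \<partial>lborel)"
  by (rule lborel_pair.Fubini'[symmetric]) measurable
 also have "\<dots> = (\<integral>\<^sup>+z. ennreal (K z * sqn (%x. G x z)) \<partial>lborel)"
 proof (rule nn_integral_cong)
  fix z
  have "(\<integral>\<^sup>+x. ennreal (K z * (norm (G x z))^2) \<partial>lborel) = ennreal (LBINT x. K z * (norm (G x z))^2)"
   by (rule nn_integral_eq_integral) (use sq_int_integrable[OF s[of z]] K(2) in auto)
  thus "(\<integral>\<^sup>+x. ennreal (K z * (norm (G x z))^2) \<partial>lborel) = ennreal (K z * sqn (%x. G x z))"
   by (simp add: sqn_def)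
 qed
 also have "\<dots> <= (\<integral>\<^sup>+z. ennreal (K z * B z) \<partial>lborel)"
  by (intro nn_integral_mono ennreal_leI mult_left_mono B K(2))
 also have "\<dots> = ennreal (LBINT z. K z * B z)"
  by (rule nn_integral_eq_integral[OF KB]) (use K(2) B0 in auto)
 finally have le: "(\<integral>\<^sup>+x. ennreal ((norm (?C x))^2) \<partial>lborel) <= ennreal (LBINT z. K z * B z)" .
 have "integrable lborel (%x. (norm (?C x))^2)"
  by (rule integrableI_nonneg) (use le Cm in \<open>auto simp: less_top[symmetric] top_unique\<close>)
 thus s: "sq_int ?C" using Cm by (simp add: sq_int_def)
 have "ennreal (sqn ?C) <= ennreal (LBINT z. K z * B z)"
  using le nn_integral_eq_integral[OF sq_int_integrable[OF s]] by (simp add: sqn_def)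
 thus "sqn ?C <= (LBINT z. K z * B z)"
  by (subst (asm) ennreal_le_iff) (use K(2) B0 in \<open>auto intro!: integral_nonneg_AE\<close>)
qed

text \<open>Convolution with e^(-d) K(x / e) in dimension d, written as an average of translates so
  that \<open>averaging_jensen\<close> applies directly; \<open>moll_kernel_translate\<close>
  recovers the usual form for e > 0.\<close>

definition moll :: "('a::euclidean_space => real) => real => ('a => 'b::euclidean_space) => 'a => 'b" where
 "moll K e f x = (LBINT z. K z *R f (x - e *R z))"

definition kernel :: "('a::euclidean_space => real) => bool" where
 "kernel K \<longleftrightarrow> sq_int K & integrable lborel K & (ALL z. 0 <= K z) & (LBINT z. K z) = 1"

lemma moll_sq_int:
 assumes K: "kernel K" and f: "sq_int f"
 shows "sq_int (moll K e f)" "sqn (moll K e f) <= sqn f" (is ?A)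
proof -
 have [measurable]: "f \<in> BM" "K \<in> BM"
  using f K by (auto simp: sq_int_measurable kernel_def)
 note J = averaging_jensen[of K "%x z. f (x - e *R z)" "%_. sqn f"]
 have s: "sq_int (%x. f (x - e *R z))" "sqn (%x. f (x - e *R z)) <= sqn f" for z
  using sq_int_shift[OF f, of "- e *R z"] by auto
 show "sq_int (moll K e f)" ?A
  using J s K unfolding kernel_def moll_def[abs_def] by auto
qed

lemma moll_kernel_translate:
 fixes f :: "'a::euclidean_space => 'b::euclidean_space"
 assumes e: "e > 0" and [measurable]: "K \<in> BM" "f \<in> BM"
 shows "moll K e f x = (LBINT y. ((1 / e ^ DIM('a)) * K ((1/e) *R (x - y))) *R f y)"
 using lborel_integral_affine(1)[of "- e" "%y. K ((1/e) *R (x - y)) *R f y" x] e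
 by (simp add: moll_def integral_scaleR_right[symmetric] del: integral_scaleR_right)

lemma moll_integrable:
 assumes K: "kernel K" and f: "sq_int f" and e: "e > 0"
 shows "integrable lborel (%z. K z *R f (x - e *R z))"
proof -
 have [measurable]: "f \<in> BM" "K \<in> BM"
  using f K by (auto simp: sq_int_measurable kernel_def)
 have "sq_int (%z. f (x - e *R z))"
  using sq_int_affine(1)[of "- e" f x] f e by simp
 thus ?thesis
  by (rule integrable_sq_int_bound[rotated]) (use K in \<open>auto simp: kernel_def\<close>)
qed

lemma moll_diff_le:
 fixes f :: "'a::euclidean_space => 'b::euclidean_space"
 assumes K: "kernel K" and f: "sq_int f" and e: "e > 0"
  and B: "!!z. sqn (%x. f (x - e *R z) - f x) <= B z" and KB: "integrable lborel (%z. K z * B z)"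
 shows "sqn (%x. moll K e f x - f x) <= (LBINT z. K z * B z)"
proof -
 have [measurable]: "f \<in> BM" "K \<in> BM"
  using f K by (auto simp: sq_int_measurable kernel_def)
 have "moll K e f x - f x = (LBINT z. K z *R (f (x - e *R z) - f x))" for x
  using moll_integrable[OF K f e, of x] K by (simp add: moll_def scaleR_diff_right kernel_def)
 moreover have "sq_int (%x. f (x - e *R z) - f x)" for z
  using sq_int_diff[OF sq_int_shift(1)[OF f, of "- e *R z"] f] by simp
 ultimately show ?thesis using averaging_jensen(2)[of K "%x z. f (x - e *R z) - f x" B] K B KB
  by (simp add: kernel_def)
qed

text \<open>The distance is bounded by a weighted average over z of translation moduli. Each modulus
  tends to 0 for fixed z and is at most \<open>4 * sqn f\<close>, so dominated convergence in z
  applies.\<close>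

lemma moll_tendsto:
 fixes f :: "'a::euclidean_space => 'b::euclidean_space"
 assumes K: "kernel K" and f: "sq_int f" and e: "!!n::nat. e n > 0" "e ----> 0"
 shows "l2_lim (%n. moll K (e n) f) f"
proof -
 have [measurable]: "f \<in> BM" "K \<in> BM"
  using f K by (auto simp: sq_int_measurable kernel_def)
 define B where "B n z = sqn (%x. f (x - e n *R z) - f x)" for n z
 have [measurable]: "B n \<in> BM" for n unfolding B_def sqn_def by measurable
 have B4: "B n z <= 4 * sqn f" for n z
  using sqn_add_le[OF sq_int_shift(1)[OF f, of "- e n *R z"] sq_int_uminus[OF f]]
   sq_int_shift(2)[OF f, of "- e n *R z"] by (simp add: B_def)
 have B0: "0 <= B n z" for n z by (simp add: B_def)
 have dom: "integrable lborel (%z. K z * (4 * sqn f))" using K by (simp add: kernel_def)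
 have "(%n. LBINT z. K z * B n z) ----> (\<integral>z. 0 \<partial>(lborel :: 'a measure))"
 proof (rule integral_dominated_convergence[OF _ _ dom])
  show "AE z in lborel. (%n. K z * B n z) ----> 0"
  proof (rule AE_I2, rule tendsto_mult_right_zero)
   fix z :: 'a
   have "(%n. - e n *R z) ----> - 0 *R z" by (intro tendsto_intros e)
   hence "l2_lim (%n x. f (x + (- e n *R z))) f"
    using sq_int_transl_cont[OF f, unfolded transl_cont_def, rule_format, of "%n. - e n *R z"] by simp
   from tendsto_power[OF this, of 2] show "(%n. B n z) ----> 0" by (simp add: B_def)
  qed
  show "AE z in lborel. norm (K z * B n z) <= K z * (4 * sqn f)" for n
   using K B4[of n] B0[of n] by (intro AE_I2) (auto simp: abs_mult kernel_def intro!: mult_left_mono)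
 qed auto
 hence lim: "(%n. sqrt (LBINT z. K z * B n z)) ----> 0"
  using tendsto_real_sqrt[of _ 0] by simp
 have KB: "integrable lborel (%z. K z * B n z)" for n
  by (rule Bochner_Integration.integrable_bound[OF dom])
   (use K B4[of n] B0[of n] in \<open>auto simp: abs_mult kernel_def intro!: mult_left_mono\<close>)
 show ?thesis
  by (rule Lim_null_comparison[OF _ lim])
   (auto simp: l2_def B_def[symmetric] intro!: always_eventually real_sqrt_le_mono moll_diff_le[OF K f e(1) _ KB])
qed

section \<open>Test functions and weak gradients\<close>

definition has_grad :: "(real^2 => real) => (real^2 => real^2) => bool" where
 "has_grad f g \<longleftrightarrow> (ALL x. (f has_derivative (%h. g x \<bullet> h)) (at x))"

definition grad :: "(real^2 => real) => real^2 => real^2" where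
 "grad f x = (\<chi> i. partial i f x)"

lemma grad_nth[simp]: "grad f x $ i = partial i f x"
 by (simp add: grad_def)

lemma inner_axis_one: "x \<bullet> axis i (1::real) = x $ i" for x :: "real^2"
 by (simp add: inner_axis)

lemma has_grad_partial:
 assumes "has_grad f g" shows "partial i f x = g x $ i" "partial i f = (%x. g x $ i)" (is ?A) "grad f = g"
proof -
 have *: "partial i f x = g x $ i" for i x
 proof -
  have "(%h. g x \<bullet> h) = frechet_derivative f (at x)"
   by (rule frechet_derivative_at) (use assms in \<open>simp add: has_grad_def\<close>)
  from fun_cong[OF this, of "axis i 1"] show ?thesis by (simp add: partial_def inner_axis_one)
 qed
 thus "partial i f x = g x $ i" ?A "grad f = g"
  by (auto simp: vec_eq_iff)
qed

lemma has_grad_differentiable: "has_grad f g ==> f differentiable (at x)"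
 by (auto simp: has_grad_def differentiable_def)

lemma differentiable_has_grad:
 assumes "!!x. f differentiable (at x)" shows "has_grad f (grad f)"
 unfolding has_grad_def
proof
 fix x
 have d: "(f has_derivative frechet_derivative f (at x)) (at x)"
  using assms by (simp add: frechet_derivative_works)
 then interpret D: bounded_linear "frechet_derivative f (at x)" by (rule has_derivative_bounded_linear)
 have "frechet_derivative f (at x) h = grad f x \<bullet> h" for h
 proof -
  have "h = (\<Sum>i\<in>UNIV. (h $ i) *R axis i (1::real))"
   by (simp add: vec_eq_iff axis_def if_distrib cong: if_cong)
  hence "frechet_derivative f (at x) h = frechet_derivative f (at x) (\<Sum>i\<in>UNIV. (h $ i) *R axis i (1::real))"
   by simp
  thus ?thesis by (simp add: D.sum D.scaleR partial_def inner_vec_def mult.commute)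
 qed
 hence "frechet_derivative f (at x) = (%h. grad f x \<bullet> h)" by auto
 with d show "(f has_derivative (%h. grad f x \<bullet> h)) (at x)" by simp
qed

lemma has_grad_add: "has_grad f a ==> has_grad g b ==> has_grad (%x. f x + g x) (%x. a x + b x)"
 unfolding has_grad_def inner_add_left by (auto intro: has_derivative_add)

lemma has_grad_mult: "has_grad f a ==> has_grad g b ==> has_grad (%x. f x * g x) (%x. f x *R b x + g x *R a x)"
 unfolding has_grad_def by (auto intro!: derivative_eq_intros simp: inner_add_left algebra_simps)

lemma has_grad_const: "has_grad (%x. c) (%x. 0)"
 by (simp add: has_grad_def)

lemma has_grad_inner: "has_grad (%x. x \<bullet> a) (%x. a)"
 unfolding has_grad_def by (auto intro!: derivative_eq_intros simp: inner_commute)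

lemma has_grad_coord: "has_grad (%x. x $ i) (%x. axis i 1)"
 using has_grad_inner[of "axis i 1"] by (simp add: inner_axis_one)

lemma has_grad_affine:
 assumes "has_grad f g" shows "has_grad (%x. f (t + c *R x)) (%x. c *R g (t + c *R x))"
 unfolding has_grad_def
proof
 fix x
 have "((%x. t + c *R x) has_derivative (%h. c *R h)) (at x)" by (auto intro!: derivative_eq_intros)
 from has_derivative_compose[OF this assms[unfolded has_grad_def, rule_format]]
 show "((%x. f (t + c *R x)) has_derivative (%h. c *R g (t + c *R x) \<bullet> h)) (at x)" by simp
qed

lemma has_grad_compose_real:
 assumes f: "has_grad f g" and F: "!!t. (F has_real_derivative F' t) (at t)"
 shows "has_grad (%x. F (f x)) (%x. F' (f x) *R g x)"
 unfolding has_grad_def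
proof
 fix x
 have "(F has_derivative (%h. F' (f x) * h)) (at (f x))"
  using F[of "f x"] by (simp add: has_field_derivative_def)
 from has_derivative_compose[OF f[unfolded has_grad_def, rule_format, of x] this]
 show "((%x. F (f x)) has_derivative (%h. F' (f x) *R g x \<bullet> h)) (at x)" by simp
qed

lemma has_grad_norm2: "has_grad (sq norm) (%x. 2 *R x)"
 unfolding has_grad_def power2_norm_eq_inner
 by (auto intro!: derivative_eq_intros simp: inner_commute)

lemma has_grad_continuous: "has_grad f g ==> continuous_on A f"
 by (meson has_grad_def has_derivative_continuous continuous_at_imp_continuous_on)

lemma C_k_has_grad:
 assumes "has_grad f g" shows "C_k (Suc k) f \<longleftrightarrow> (ALL i. C_k k (%x. g x $ i))"
 using has_grad_partial(2)[OF assms] has_grad_differentiable[OF assms] by simp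

lemma C_k_grad: "C_k (Suc k) f ==> has_grad f (grad f)"
 by (rule differentiable_has_grad) simp

lemma C_k_Suc_imp: "C_k (Suc k) f ==> C_k k f"
proof (induction k arbitrary: f)
 case 0
 thus ?case using has_grad_continuous[OF C_k_grad[OF 0]] by (simp only: C_k.simps(1))
next
 case (Suc k)
 thus ?case by (metis C_k.simps(2))
qed

lemma C_k_add: "C_k k f ==> C_k k g ==> C_k k (%x. f x + g x)"
proof (induction k arbitrary: f g)
 case 0
 thus ?case by (auto intro: continuous_on_add)
next
 case (Suc k)
 have "C_k k (%x. partial i f x + partial i g x)" for i
  using Suc.prems by (intro Suc.IH) auto
 thus ?case
  using C_k_has_grad[OF has_grad_add[OF C_k_grad[OF Suc.prems(1)] C_k_grad[OF Suc.prems(2)]]]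
  by (simp del: C_k.simps)
qed

lemma C_k_mult: "C_k k f ==> C_k k g ==> C_k k (%x. f x * g x)"
proof (induction k arbitrary: f g)
 case (Suc k)
 have "C_k k (%x. f x * partial i g x + g x * partial i f x)" for i
  using Suc.prems C_k_Suc_imp[OF Suc.prems(1)] C_k_Suc_imp[OF Suc.prems(2)]
  by (intro C_k_add Suc.IH) auto
 thus ?case
  using C_k_has_grad[OF has_grad_mult[OF C_k_grad[OF Suc.prems(1)] C_k_grad[OF Suc.prems(2)]]]
  by (simp del: C_k.simps)
qed (auto intro: continuous_on_mult)

lemma C_k_const: "C_k k (%x. c)"
proof (induction k arbitrary: c)
 case (Suc k)
 thus ?case using C_k_has_grad[OF has_grad_const[of c], of k] by (simp del: C_k.simps)
qed simp

lemma C_k_coord: "C_k k (%x. x $ i)"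
proof (cases k)
 case (Suc m)
 thus ?thesis using C_k_has_grad[OF has_grad_coord[of i], of m] C_k_const by (simp del: C_k.simps)
qed (auto intro: continuous_intros)

lemma C_k_affine: "C_k k f ==> C_k k (%x. f (t + c *R x))"
proof (induction k arbitrary: f)
 case 0
 thus ?case by (auto intro!: continuous_on_compose2[of UNIV f] continuous_intros)
next
 case (Suc k)
 have "C_k k (%x. c * partial i f (t + c *R x))" for i
  by (intro C_k_mult C_k_const Suc.IH) (use Suc.prems in auto)
 thus ?case using C_k_has_grad[OF has_grad_affine[OF C_k_grad[OF Suc.prems]]] by (simp del: C_k.simps)
qed

text \<open>The powers of 1/t make the family closed under differentiation: the derivative of
  \<open>hfun n\<close> combines \<open>hfun (n + 2)\<close> and \<open>hfun (n + 1)\<close>.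
  Smoothness of exp(-1/t), the case n = 0, thus follows by an induction that treats all n at
  once.\<close>

definition hfun :: "nat => real => real" where
 "hfun n t = (if t > 0 then (1/t)^n * exp (- (1/t)) else 0)"

lemma hfun_tendsto: "(hfun n \<longlongrightarrow> 0) (at 0)"
proof -
 have "((%x::real. x ^ n / exp x) \<longlongrightarrow> 0) at_top" by (rule tendsto_power_div_exp_0)
 from filterlim_compose[OF this filterlim_inverse_at_top_right]
 have "((%t::real. (1/t)^n * exp (- (1/t))) \<longlongrightarrow> 0) (at_right 0)"
  by (simp add: exp_minus field_simps)
 hence r: "(hfun n \<longlongrightarrow> 0) (at_right 0)"
  by (rule Lim_transform_eventually) (auto simp: hfun_def eventually_at_right_field intro!: exI[of _ 1])
 have l: "(hfun n \<longlongrightarrow> 0) (at_left 0)"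
  by (rule Lim_transform_eventually[OF tendsto_const])
   (auto simp: hfun_def eventually_at_left_field intro!: exI[of _ "-1"])
 from r l show ?thesis by (simp add: filterlim_split_at_real)
qed

lemma hfun_derivative: "(hfun n has_real_derivative (hfun (n + 2) t - real n * hfun (n + 1) t)) (at t)"
proof -
 consider "t > 0" | "t < 0" | "t = 0" by linarith
 thus ?thesis
 proof cases
  case 1
  have "((%t. (1/t)^n * exp (- (1/t))) has_real_derivative (hfun (n + 2) t - real n * hfun (n + 1) t)) (at t)"
   using 1
   by (auto intro!: derivative_eq_intros simp: hfun_def divide_simps power2_eq_square)
    (cases n; simp add: algebra_simps power_add divide_simps)
  thus ?thesis
   by (rule has_field_derivative_transform_within_open[of _ _ _ "{0<..}"]) (use 1 in \<open>auto simp: hfun_def\<close>)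
 next
  case 2
  have "((%t. 0) has_real_derivative (hfun (n + 2) t - real n * hfun (n + 1) t)) (at t)"
   using 2 by (simp add: hfun_def)
  thus ?thesis
   by (rule has_field_derivative_transform_within_open[of _ _ _ "{..<0}"]) (use 2 in \<open>auto simp: hfun_def\<close>)
 next
  case 3
  \<comment> \<open>At 0 the difference quotient of \<open>hfun n\<close> is
    \<open>hfun (n + 1)\<close>, which tends to 0.\<close>
  have "((%y. hfun n y / y) \<longlongrightarrow> 0) (at 0)"
   using hfun_tendsto[of "n + 1"]
   by (rule Lim_transform_eventually) (auto simp: hfun_def eventually_at_filter)
  thus ?thesis using 3 by (simp add: has_field_derivative_iff hfun_def)
 qed
qed

definition bump :: "real^2 => real" where
 "bump x = hfun 0 (1 - (norm x)^2)"

lemma has_grad_hfun_ball: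
 "has_grad (%x. hfun n (1 - (norm x)^2))
   (%x. (hfun (n + 2) (1 - (norm x)^2) - real n * hfun (n + 1) (1 - (norm x)^2)) *R ((- 2) *R x))"
proof -
 have "has_grad (%x. 1 + (-1) * (norm x)^2) (%x. 0 + ((-1) *R (2 *R x) + (norm x)^2 *R 0))"
  by (intro has_grad_add has_grad_mult has_grad_const has_grad_norm2)
 from has_grad_compose_real[OF this hfun_derivative[of n]] show ?thesis by simp
qed

lemma C_k_hfun_ball: "C_k k (%x. hfun n (1 - (norm x)^2))"
proof (induction k arbitrary: n)
 case 0
 thus ?case using has_grad_continuous[OF has_grad_hfun_ball] by simp
next
 case (Suc k)
 have "C_k k (%x. (hfun (n + 2) (1 - (norm x)^2) + (- real n) * hfun (n + 1) (1 - (norm x)^2)) * ((- 2) * x $ i))" for i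
  by (intro C_k_mult C_k_add C_k_const C_k_coord Suc.IH)
 thus ?case unfolding C_k_has_grad[OF has_grad_hfun_ball] by (simp add: algebra_simps)
qed

lemma test_functions_iff:
 "\<phi> \<in> test_functions \<longleftrightarrow> (ALL k. C_k k \<phi>) & (EX R. ALL x. norm x > R --> \<phi> x = 0)"
proof -
 have "compact (closure {x. \<phi> x ~= 0}) \<longleftrightarrow> (EX R. ALL x. norm x > R --> \<phi> x = 0)"
 proof -
  have "compact (closure {x. \<phi> x ~= 0}) \<longleftrightarrow> bounded {x. \<phi> x ~= 0}"
   by (metis compact_closure)
  also have "\<dots> \<longleftrightarrow> (EX R. ALL x. norm x > R --> \<phi> x = 0)"
   unfolding bounded_iff by (auto simp: not_less) (metis linorder_not_less)+
  finally show ?thesis .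
 qed
 thus ?thesis by (simp add: test_functions_def)
qed

lemma bump_test: "bump \<in> test_functions"
 unfolding test_functions_iff
proof (intro conjI allI)
 show "C_k k bump" for k using C_k_hfun_ball[of k 0] by (simp add: bump_def[abs_def])
 have "bump x = 0" if "norm x > 1" for x
  using one_le_power[of "norm x" 2] that by (simp add: bump_def hfun_def not_less)
 thus "EX R. ALL x. norm x > R --> bump x = 0" by blast
qed

lemma bump_nonneg: "0 <= bump x" "bump x <= exp (-1)"
 by (auto simp: bump_def hfun_def)

lemma bump_0: "bump 0 = exp (-1)"
 by (simp add: bump_def hfun_def)

lemma test_C_k: "\<phi> \<in> test_functions ==> C_k k \<phi>"
 by (simp add: test_functions_iff)

lemma test_has_grad: "\<phi> \<in> test_functions ==> has_grad \<phi> (grad \<phi>)"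
 using C_k_grad[OF test_C_k] .

lemma test_partial:
 assumes "\<phi> \<in> test_functions" shows "partial i \<phi> \<in> test_functions"
proof -
 obtain R where R: "!!x. norm x > R ==> \<phi> x = 0" using assms by (auto simp: test_functions_iff)
 have "partial i \<phi> x = 0" if "norm x > R" for x
 proof -
  have o: "open {x::real^2. norm x > R}" by (intro open_Collect_less continuous_intros)
  have "((%x. 0) has_derivative (%h. 0)) (at x)" by simp
  hence "(\<phi> has_derivative (%h. 0)) (at x)"
   by (rule has_derivative_transform_within_open[OF _ o]) (use that R in auto)
  from frechet_derivative_at[OF this, symmetric] show ?thesis by (simp add: partial_def)
 qed
 moreover have "C_k k (partial i \<phi>)" for k using test_C_k[OF assms, of "Suc k"] by simp
 ultimately show ?thesis by (auto simp: test_functions_iff)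
qed

lemma test_mult:
 assumes "\<phi> \<in> test_functions" "!!k. C_k k f" shows "(%x. \<phi> x * f x) \<in> test_functions"
 using assms by (auto simp: test_functions_iff intro!: C_k_mult)

lemma test_cmult: "\<phi> \<in> test_functions ==> (%x. c * \<phi> x) \<in> test_functions"
 using test_mult[of \<phi> "%x. c"] C_k_const by (simp add: mult.commute)

lemma test_affine:
 assumes "\<phi> \<in> test_functions" "c ~= 0" shows "(%x. \<phi> (t + c *R x)) \<in> test_functions"
proof -
 obtain R where R: "!!x. norm x > R ==> \<phi> x = 0" using assms by (auto simp: test_functions_iff)
 have "\<phi> (t + c *R x) = 0" if "norm x > (R + norm t) / \<bar>c\<bar>" for x
 proof (rule R)
  have "R + norm t < \<bar>c\<bar> * norm x" using that assms(2) by (simp add: field_simps)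
  also have "\<bar>c\<bar> * norm x = norm ((t + c *R x) - t)" by simp
  also have "\<dots> <= norm (t + c *R x) + norm t" by (rule norm_triangle_ineq4)
  finally show "R < norm (t + c *R x)" by simp
 qed
 thus ?thesis using C_k_affine[OF test_C_k[OF assms(1)]] by (auto simp: test_functions_iff)
qed

lemma test_partial_affine:
 assumes "\<phi> \<in> test_functions"
 shows "partial i (%x. \<phi> (t + c *R x)) x = c * partial i \<phi> (t + c *R x)"
 using has_grad_partial(1)[OF has_grad_affine[OF test_has_grad[OF assms]]] by simp

lemma test_continuous: "\<phi> \<in> test_functions ==> continuous_on A \<phi>"
 using test_has_grad has_grad_continuous by blast

lemma test_measurable[measurable_dest]: "\<phi> \<in> test_functions ==> \<phi> \<in> BM"
 by (rule borel_measurable_continuous_onI[OF test_continuous])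

lemma test_bounded:
 assumes "\<phi> \<in> test_functions"
 obtains B R where "B > 0" "R > 0" "!!x. \<bar>\<phi> x\<bar> <= B * indicator (cball 0 R) x"
proof -
 obtain R where R: "!!x. norm x > R ==> \<phi> x = 0" using assms by (auto simp: test_functions_iff)
 have "compact (\<phi> ` cball 0 (max R 1))" by (intro compact_continuous_image test_continuous assms) auto
 hence "bounded (\<phi> ` cball 0 (max R 1))" by (rule compact_imp_bounded)
 then obtain B where B: "!!x. x \<in> cball 0 (max R 1) ==> \<bar>\<phi> x\<bar> <= B"
  unfolding bounded_iff real_norm_def by blast
 show thesis
 proof (rule that[of "max B 1" "max R 1"])
  fix x show "\<bar>\<phi> x\<bar> <= max B 1 * indicator (cball 0 (max R 1)) x"
  proof (cases "norm x <= max R 1")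
   case True thus ?thesis using B[of x] by simp
  next
   case False thus ?thesis using R[of x] by simp
  qed
 qed auto
qed

lemma sq_int_cball: "sq_int (%x::real^2. B * indicator (cball 0 R) x :: real)"
 using sq_int_indicator(1)[of "cball (0::real^2) R" B] emeasure_compact_finite[of "cball (0::real^2) R"]
 by (simp add: mult.commute)

lemma integrable_cball: "integrable lborel (%x::real^2. B * indicator (cball 0 R) x :: real)"
 using emeasure_compact_finite[of "cball (0::real^2) R"] by (intro integrable_mult_right) simp

lemma test_sq_int: assumes "\<phi> \<in> test_functions" shows "sq_int \<phi>" "integrable lborel \<phi>"
proof -
 obtain B R where B: "B > 0" "!!x. \<bar>\<phi> x\<bar> <= B * indicator (cball 0 R) x" using test_bounded[OF assms] by metis
 have [measurable]: "\<phi> \<in> BM" by (rule test_measurable[OF assms])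
 show "sq_int \<phi>" by (rule sq_int_bound(1)[OF sq_int_cball[of B R], where c=1]) (use B in auto)
 show "integrable lborel \<phi>"
  by (rule Bochner_Integration.integrable_bound[OF integrable_cball[of B R]]) (use B in auto)
qed

lemma has_grad_mvt:
 assumes "has_grad f g" obtains s where "0 < s" "s < 1" "f (z + h) - f z = g (z + s *R h) \<bullet> h"
proof -
 have "EX s. 0 < s & s < 1 & (%s. f (z + s *R h)) 1 - (%s. f (z + s *R h)) 0 = (1 - 0) * (%s. g (z + s *R h) \<bullet> h) s"
 proof (rule MVT2)
  fix s :: real
  have "((%s. z + s *R h) has_derivative (%t. t *R h)) (at s)" by (auto intro!: derivative_eq_intros)
  from has_derivative_compose[OF this assms[unfolded has_grad_def, rule_format]]
  show "((%s. f (z + s *R h)) has_real_derivative g (z + s *R h) \<bullet> h) (at s)"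
   by (simp add: has_field_derivative_def mult.commute[of _ "_ \<bullet> _"])
 qed simp
 thus thesis using that by auto
qed

lemma norm_le_sum_2: "norm (v :: real^2) <= \<bar>v $ 1\<bar> + \<bar>v $ 2\<bar>"
 using norm_le_l1_cart[of v] by (simp add: sum_2)

lemma test_lipschitz:
 assumes "\<phi> \<in> test_functions" obtains L where "L > 0" "!!a b. \<bar>\<phi> a - \<phi> b\<bar> <= L * norm (a - b)"
proof -
 obtain B1 R1 where B1: "B1 > 0" "!!x. \<bar>partial 1 \<phi> x\<bar> <= B1 * indicator (cball 0 R1) x" using test_bounded[OF test_partial[OF assms]] by metis
 obtain B2 R2 where B2: "B2 > 0" "!!x. \<bar>partial 2 \<phi> x\<bar> <= B2 * indicator (cball 0 R2) x" using test_bounded[OF test_partial[OF assms]] by metis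
 have "norm (grad \<phi> x) <= B1 + B2" for x
 proof -
  have "\<bar>partial 1 \<phi> x\<bar> <= B1" "\<bar>partial 2 \<phi> x\<bar> <= B2"
   using B1(1) B1(2)[of x] B2(1) B2(2)[of x] by (cases "norm x <= R1"; cases "norm x <= R2"; simp)+
  thus ?thesis using norm_le_sum_2[of "grad \<phi> x"] by simp
 qed
 hence "\<bar>\<phi> a - \<phi> b\<bar> <= (B1 + B2) * norm (a - b)" for a b
 proof -
  obtain s where "\<phi> (b + (a - b)) - \<phi> b = grad \<phi> (b + s *R (a - b)) \<bullet> (a - b)"
   using has_grad_mvt[OF test_has_grad[OF assms], of b "a - b"] by metis
  hence "\<bar>\<phi> a - \<phi> b\<bar> <= norm (grad \<phi> (b + s *R (a - b))) * norm (a - b)"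
   using Cauchy_Schwarz_ineq2[of "grad \<phi> (b + s *R (a - b))" "a - b"] by simp
  also have "\<dots> <= (B1 + B2) * norm (a - b)" by (intro mult_right_mono) (use \<open>!!x. norm (grad \<phi> x) <= B1 + B2\<close> in auto)
  finally show ?thesis .
 qed
 thus thesis using B1(1) B2(1) that[of "B1 + B2"] by simp
qed

text \<open>The mean value theorem with a Lipschitz gradient. The bound has compact support in z
  uniformly over \<open>norm h <= 1\<close>, so that the remainder can be integrated against a
  merely square integrable function.\<close>

lemma test_taylor:
 assumes "\<phi> \<in> test_functions"
 obtains L R where "L > 0" "R > 0"
  "!!z h. norm h <= 1 ==> \<bar>\<phi> (z + h) - \<phi> z - grad \<phi> z \<bullet> h\<bar> <= (norm h)^2 * (L * indicator (cball 0 R) z)"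
proof -
 obtain L1 where L1: "L1 > 0" "!!a b. \<bar>partial 1 \<phi> a - partial 1 \<phi> b\<bar> <= L1 * norm (a - b)"
  using test_lipschitz[OF test_partial[OF assms]] by metis
 obtain L2 where L2: "L2 > 0" "!!a b. \<bar>partial 2 \<phi> a - partial 2 \<phi> b\<bar> <= L2 * norm (a - b)"
  using test_lipschitz[OF test_partial[OF assms]] by metis
 obtain B R where R: "R > 0" "!!x. \<bar>\<phi> x\<bar> <= B * indicator (cball 0 R) x" using test_bounded[OF assms] by metis
 have "EX R'. ALL i. ALL x. norm x > R' --> partial i \<phi> x = 0"
 proof -
  have "ALL i. EX R. ALL x. norm x > R --> partial i \<phi> x = 0" using test_partial[OF assms] by (auto simp: test_functions_iff)
  then obtain RR where "ALL i. ALL x. norm x > RR i --> partial i \<phi> x = 0" by metis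
  hence "ALL i. ALL x. norm x > max (RR 1) (RR 2) --> partial i \<phi> x = 0" by (metis exhaust_2 max_less_iff_conj)
  thus ?thesis by blast
 qed
 then obtain R' where R': "!!i x. norm x > R' ==> partial i \<phi> x = 0" by blast
 \<comment> \<open>The extra 1 ensures that for z outside the ball the point z + h lies off the
   support as well.\<close>
 define M where "M = max R R' + 1"
 show thesis
 proof (rule that[of "L1 + L2" M])
  show "L1 + L2 > 0" "M > 0" using L1 L2 R by (auto simp: M_def)
  fix z h :: "real^2" assume h: "norm h <= 1"
  show "\<bar>\<phi> (z + h) - \<phi> z - grad \<phi> z \<bullet> h\<bar> <= (norm h)^2 * ((L1 + L2) * indicator (cball 0 M) z)"
  proof (cases "norm z <= M")
   case True
   obtain s where s: "0 < s" "s < 1" "\<phi> (z + h) - \<phi> z = grad \<phi> (z + s *R h) \<bullet> h"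
    using has_grad_mvt[OF test_has_grad[OF assms], of z h] by metis
   have "norm (grad \<phi> (z + s *R h) - grad \<phi> z) <= (L1 + L2) * norm (s *R h)"
    using norm_le_sum_2[of "grad \<phi> (z + s *R h) - grad \<phi> z"] L1(2)[of "z + s *R h" z] L2(2)[of "z + s *R h" z]
    by (simp add: distrib_right)
   also have "\<dots> <= (L1 + L2) * norm h" using s L1 L2 by (intro mult_left_mono) (auto simp: mult_left_le_one_le)
   finally have "\<bar>(grad \<phi> (z + s *R h) - grad \<phi> z) \<bullet> h\<bar> <= ((L1 + L2) * norm h) * norm h"
    using Cauchy_Schwarz_ineq2[of "grad \<phi> (z + s *R h) - grad \<phi> z" h] mult_right_mono[of _ _ "norm h"]
    by (meson norm_ge_zero order_trans)
   thus ?thesis using True s by (simp add: inner_diff_left power2_eq_square mult_ac)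
  next
   case False
   have "norm (z + h) >= norm z - norm h" by (rule norm_diff_ineq)
   hence "norm (z + h) > R" "norm z > R" "norm z > R'" using False h by (auto simp: M_def)
   hence "\<phi> (z + h) = 0" "\<phi> z = 0" "grad \<phi> z = 0"
    using R(2)[of "z + h"] R(2)[of z] R'[of z] by (auto simp: vec_eq_iff)
   thus ?thesis using False by simp
  qed
 qed
qed

section \<open>Convolution with test functions\<close>

definition conv :: "(real^2 => real) => (real^2 => real) => real^2 => real" where
 "conv \<phi> f x = (LBINT y. \<phi> (x - y) * f y)"

lemma conv_integrable:
 fixes \<phi> f :: "real^2 => real"
 assumes "sq_int \<phi>" "sq_int f" shows "integrable lborel (%y. \<phi> (x - y) * f y)"
proof -
 have "sq_int (%y. \<phi> (x - y))" using sq_int_affine(1)[of "-1" \<phi> x] assms(1) by simp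
 thus ?thesis using assms(2) by (rule integrable_mult_sq_int)
qed

text \<open>By \<open>test_taylor\<close> the error of the linear approximation, integrated against
  f, is at most a constant times \<open>(norm h)^2\<close>; all regularity comes from the test
  function.\<close>

lemma conv_has_grad:
 assumes \<phi>: "\<phi> \<in> test_functions" and f: "sq_int f"
 shows "has_grad (conv \<phi> f) (%x. \<chi> i. conv (partial i \<phi>) f x)"
 unfolding has_grad_def has_derivative_at
proof (intro allI conjI)
 fix x
 let ?g = "\<chi> i. conv (partial i \<phi>) f x"
 show "bounded_linear (%h. ?g \<bullet> h)" by (rule bounded_linear_inner_right)
 obtain L R where L: "L > 0"
  "!!z h. norm h <= 1 ==> \<bar>\<phi> (z + h) - \<phi> z - grad \<phi> z \<bullet> h\<bar> <= (norm h)^2 * (L * indicator (cball 0 R) z)"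
  using test_taylor[OF \<phi>] by metis
 have ip: "integrable lborel (%y. \<phi> (x - y) * f y)" for x by (rule conv_integrable[OF test_sq_int(1)[OF \<phi>] f])
 have ig: "integrable lborel (%y. partial i \<phi> (x - y) * f y)" for x i by (rule conv_integrable[OF test_sq_int(1)[OF test_partial[OF \<phi>]] f])
 have sb: "sq_int (%z::real^2. L * indicator (cball 0 R) z)" by (rule sq_int_cball)
 define C where "C = (LBINT y. \<bar>(L * indicator (cball 0 R) (x - y)) * f y\<bar>)"
 have iC: "integrable lborel (%y. \<bar>(L * indicator (cball 0 R) (x - y)) * f y\<bar>)"
  using conv_integrable[OF sb f, of x] by (rule integrable_abs)
 have bound: "\<bar>conv \<phi> f (x + h) - conv \<phi> f x - ?g \<bullet> h\<bar> <= (norm h)^2 * C" if h: "norm h <= 1" for h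
 proof -
  have gh: "?g \<bullet> h = (LBINT y. (grad \<phi> (x - y) \<bullet> h) * f y)"
  proof -
   have "(LBINT y. (grad \<phi> (x - y) \<bullet> h) * f y) = (LBINT y. (partial 1 \<phi> (x - y) * f y) * h $ 1 + (partial 2 \<phi> (x - y) * f y) * h $ 2)"
    by (simp add: inner_vec_def sum_2 algebra_simps)
   also have "\<dots> = ?g \<bullet> h"
    using ig by (simp add: inner_vec_def sum_2 conv_def)
   finally show ?thesis ..
  qed
  have i1: "integrable lborel (%y. (grad \<phi> (x - y) \<bullet> h) * f y)"
  proof -
   have "integrable lborel (%y. (partial 1 \<phi> (x - y) * f y) * h $ 1 + (partial 2 \<phi> (x - y) * f y) * h $ 2)"
    using ig by simp
   thus ?thesis by (simp add: inner_vec_def sum_2 algebra_simps)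
  qed
  have i2: "integrable lborel (%y. (\<phi> (x + h - y) - \<phi> (x - y) - grad \<phi> (x - y) \<bullet> h) * f y)"
   using Bochner_Integration.integrable_diff[OF Bochner_Integration.integrable_diff[OF ip[of "x + h"] ip[of x]] i1]
   by (simp add: algebra_simps)
  have "conv \<phi> f (x + h) - conv \<phi> f x - ?g \<bullet> h = (LBINT y. (\<phi> (x + h - y) - \<phi> (x - y) - grad \<phi> (x - y) \<bullet> h) * f y)"
   unfolding gh unfolding conv_def using ip i1 by (simp add: left_diff_distrib)
  also have "\<bar>\<dots>\<bar> <= (LBINT y. \<bar>(\<phi> (x + h - y) - \<phi> (x - y) - grad \<phi> (x - y) \<bullet> h) * f y\<bar>)"
   using integral_norm_bound[of lborel "%y. (\<phi> (x + h - y) - \<phi> (x - y) - grad \<phi> (x - y) \<bullet> h) * f y"] by simp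
  also have "\<dots> <= (LBINT y. (norm h)^2 * \<bar>(L * indicator (cball 0 R) (x - y)) * f y\<bar>)"
  proof (rule integral_mono)
   show "integrable lborel (%y. \<bar>(\<phi> (x + h - y) - \<phi> (x - y) - grad \<phi> (x - y) \<bullet> h) * f y\<bar>)" using i2 by (rule integrable_abs)
   show "integrable lborel (%y. (norm h)^2 * \<bar>(L * indicator (cball 0 R) (x - y)) * f y\<bar>)" using iC by simp
   fix y
   have e: "x - y + h = x + h - y" by simp
   show "\<bar>(\<phi> (x + h - y) - \<phi> (x - y) - grad \<phi> (x - y) \<bullet> h) * f y\<bar> <= (norm h)^2 * \<bar>(L * indicator (cball 0 R) (x - y)) * f y\<bar>"
    using mult_right_mono[OF L(2)[OF h, of "x - y"], of "\<bar>f y\<bar>"] L(1) unfolding e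
    by (simp add: abs_mult mult_ac)
  qed
  finally show ?thesis by (simp add: C_def)
 qed
 have C0: "C >= 0" by (simp add: C_def)
 show "(%h. norm (conv \<phi> f (x + h) - conv \<phi> f x - ?g \<bullet> h) / norm h) \<midarrow>0\<rightarrow> 0"
 proof (rule Lim_null_comparison)
  show "((%h. norm h * C) \<longlongrightarrow> 0) (at (0::real^2))" by (auto intro!: tendsto_eq_intros)
  have "norm (norm (conv \<phi> f (x + h) - conv \<phi> f x - ?g \<bullet> h) / norm h) <= norm h * C" if "h ~= 0" "dist h 0 < 1" for h
  proof -
   have "\<bar>conv \<phi> f (x + h) - conv \<phi> f x - ?g \<bullet> h\<bar> <= (norm h * C) * norm h"
    using bound[of h] that by (simp add: power2_eq_square mult_ac)
   thus ?thesis using that by (simp add: divide_le_eq)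
  qed
  thus "\<forall>\<^sub>F h in at 0. norm (norm (conv \<phi> f (x + h) - conv \<phi> f x - ?g \<bullet> h) / norm h) <= norm h * C"
   unfolding eventually_at by (intro exI[of _ 1]) auto
 qed
qed

lemma conv_C_k:
 assumes "\<phi> \<in> test_functions" "sq_int f" shows "C_k k (conv \<phi> f)"
 using assms(1)
proof (induction k arbitrary: \<phi>)
 case 0
 thus ?case using has_grad_continuous[OF conv_has_grad[OF 0 assms(2)]] by simp
next
 case (Suc k)
 thus ?case unfolding C_k_has_grad[OF conv_has_grad[OF Suc.prems assms(2)]]
  using test_partial by simp
qed

lemma null_bound:
 fixes a b :: "nat => real"
 assumes "b ----> 0" "!!n. \<bar>a n\<bar> <= b n" shows "a ----> 0"
 by (rule Lim_null_comparison[OF _ assms(1)]) (use assms(2) in \<open>simp add: always_eventually\<close>)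

lemma borel_measurable_nth[measurable]: "(%x::real^2. x $ i) \<in> BM"
 by (intro borel_measurable_continuous_onI continuous_intros)

section \<open>Weak gradients of real functions\<close>

lemma sq_int_nth:
 assumes "sq_int (g :: real^2 => real^2)"
 shows "sq_int (%x. g x $ i)" (is ?A) "l2 (%x. g x $ i) <= l2 g" (is ?B) "sqn (%x. g x $ i) <= sqn g" (is ?C)
proof -
 note [measurable] = assms[THEN sq_int_measurable]
 have m: "(%x. g x $ i) \<in> BM" by measurable
 have "AE x in lborel. norm (g x $ i) <= 1 * norm (g x)" using component_le_norm_cart by auto
 from sq_int_bound[OF assms m this]
 show ?A ?C by auto
 thus ?B by (simp add: l2_def)
qed

lemma norm2_sum: "(norm (v::real^2))^2 = (\<Sum>i\<in>UNIV. (v $ i)^2)"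
 by (simp add: norm_vec_def L2_set_def sum_nonneg)

lemma sq_int_vec:
 fixes g :: "real^2 => real^2"
 assumes "!!i. sq_int (%x. g x $ i)"
 shows "sq_int g"
proof -
 have m: "(%x. g x $ i) \<in> BM" for i using assms by (rule sq_int_measurable)
 have "(%x. \<Sum>i\<in>UNIV. (g x $ i) *R axis i (1::real)) \<in> BM"
  by (intro borel_measurable_sum borel_measurable_scaleR m) auto
 moreover have "(%x. \<Sum>i\<in>UNIV. (g x $ i) *R axis i (1::real)) = g"
  by (auto simp: fun_eq_iff vec_eq_iff axis_def if_distrib cong: if_cong)
 ultimately have "g \<in> BM" by simp
 thus ?thesis
  using sq_int_integrable[OF assms] by (simp add: sq_int_def norm2_sum)
qed

text \<open>The gradient is one vector field, and square integrability is part of the predicate, so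
  that \<open>wgrad u g\<close> expresses membership of u in the real space H1 together with a named
  gradient. Naming it avoids reasoning about a choice of weak derivatives.\<close>

definition wgrad :: "(real^2 => real) => (real^2 => real^2) => bool" where
 "wgrad u g \<longleftrightarrow> sq_int u & sq_int g \<and>
   (\<forall>\<phi>\<in>test_functions. ALL i. (LBINT x. partial i \<phi> x * u x) = - (LBINT x. \<phi> x * g x $ i))"

lemma wgrad_sq_int: "wgrad u g ==> sq_int u" "wgrad u g ==> sq_int g"
 by (auto simp: wgrad_def)

lemma wgrad_eq:
 "wgrad u g ==> \<phi> \<in> test_functions ==> (LBINT x. partial i \<phi> x * u x) = - (LBINT x. \<phi> x * g x $ i)"
 by (auto simp: wgrad_def)

lemma wgrad_add:
 assumes "wgrad u a" "wgrad v b" shows "wgrad (%x. u x + v x) (%x. a x + b x)"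
 unfolding wgrad_def
proof (intro conjI ballI allI)
 note s = wgrad_sq_int[OF assms(1)] wgrad_sq_int[OF assms(2)]
 show "sq_int (%x. u x + v x)" "sq_int (%x. a x + b x)" by (intro sq_int_add s)+
 fix \<phi> i assume p: "\<phi> \<in> test_functions"
 note t = integrable_mult_sq_int[OF test_sq_int(1)[OF test_partial[OF p]]] integrable_mult_sq_int[OF test_sq_int(1)[OF p]]
 show "(LBINT x. partial i \<phi> x * (u x + v x)) = - (LBINT x. \<phi> x * (a x + b x) $ i)"
  using wgrad_eq[OF assms(1) p, of i] wgrad_eq[OF assms(2) p, of i] t(1)[OF s(1), of i] t(1)[OF s(3), of i]
   t(2)[OF sq_int_nth(1)[OF s(2)], of i] t(2)[OF sq_int_nth(1)[OF s(4)], of i]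
  by (simp add: distrib_left)
qed

lemma wgrad_cmult:
 assumes "wgrad u a" shows "wgrad (%x. c * u x) (%x. c *R a x)"
 unfolding wgrad_def
proof (intro conjI ballI allI)
 note s = wgrad_sq_int[OF assms(1)]
 show "sq_int (%x. c * u x)" "sq_int (%x. c *R a x)" by (intro sq_int_cmult sq_int_scaleR s)+
 fix \<phi> i assume p: "\<phi> \<in> test_functions"
 show "(LBINT x. partial i \<phi> x * (c * u x)) = - (LBINT x. \<phi> x * (c *R a x) $ i)"
  using wgrad_eq[OF assms(1) p, of i] by (simp add: mult.left_commute)
qed

lemma wgrad_zero: "wgrad (%x. 0) (%x. 0)"
 by (simp add: wgrad_def)

lemma wgrad_diff:
 assumes "wgrad u a" "wgrad v b" shows "wgrad (%x. u x - v x) (%x. a x - b x)"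
 using wgrad_add[OF assms(1) wgrad_cmult[OF assms(2), of "-1"]] by simp

lemma wgrad_affine:
 assumes u: "wgrad u g" and b: "\<beta> ~= 0"
 shows "wgrad (%x. u (t + \<beta> *R x)) (%x. \<beta> *R g (t + \<beta> *R x))"
 unfolding wgrad_def
proof (intro conjI ballI allI)
 note s = wgrad_sq_int[OF u]
 note [measurable] = s[THEN sq_int_measurable]
 show "sq_int (%x. u (t + \<beta> *R x))" "sq_int (%x. \<beta> *R g (t + \<beta> *R x))"
  by (intro sq_int_affine sq_int_scaleR s b)+
 fix \<phi> i assume p: "\<phi> \<in> test_functions"
 let ?\<psi> = "%y. \<phi> ((- (1/\<beta>) *R t) + (1/\<beta>) *R y)"
 have \<psi>: "?\<psi> \<in> test_functions" by (rule test_affine[OF p]) (use b in auto)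
 have [measurable]: "\<phi> \<in> BM" "partial i \<phi> \<in> BM"
  using p by (auto intro: test_measurable test_partial)
 have inv: "(- (1/\<beta>) *R t) + (1/\<beta>) *R (t + \<beta> *R x) = x" for x
  using b by (simp add: scaleR_add_right)
 have "(LBINT x. partial i \<phi> x * u (t + \<beta> *R x))
   = (LBINT x. (%y. partial i \<phi> ((- (1/\<beta>) *R t) + (1/\<beta>) *R y) * u y) (t + \<beta> *R x))"
  unfolding inv by simp
 also have "\<dots> = (1 / \<bar>\<beta>\<bar>^2) * (LBINT y. partial i \<phi> ((- (1/\<beta>) *R t) + (1/\<beta>) *R y) * u y)"
  by (subst lborel_integral_affine(1)[OF b]) simp_all
 also have "(LBINT y. partial i \<phi> ((- (1/\<beta>) *R t) + (1/\<beta>) *R y) * u y) = \<beta> * (LBINT y. partial i ?\<psi> y * u y)"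
  unfolding test_partial_affine[OF p] using b by (simp add: mult.assoc)
 also have "(LBINT y. partial i ?\<psi> y * u y) = - (LBINT y. ?\<psi> y * g y $ i)" by (rule wgrad_eq[OF u \<psi>])
 also have "(1 / \<bar>\<beta>\<bar>^2) * (\<beta> * - (LBINT y. ?\<psi> y * g y $ i)) = - (\<beta> * ((1 / \<bar>\<beta>\<bar>^2) * (LBINT y. ?\<psi> y * g y $ i)))"
  by simp
 also have "(1 / \<bar>\<beta>\<bar>^2) * (LBINT y. ?\<psi> y * g y $ i) = (LBINT x. (%y. ?\<psi> y * g y $ i) (t + \<beta> *R x))"
  by (subst lborel_integral_affine(1)[OF b]) simp_all
 also have "\<dots> = (LBINT x. \<phi> x * g (t + \<beta> *R x) $ i)" unfolding inv by simp
 finally show "(LBINT x. partial i \<phi> x * u (t + \<beta> *R x)) = - (LBINT x. \<phi> x * (\<beta> *R g (t + \<beta> *R x)) $ i)"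
  by (simp add: mult.left_commute)
qed

lemma wgrad_cong_AE:
 assumes "wgrad u g" "AE x in lborel. u x = u' x" "AE x in lborel. g x = g' x"
  and [measurable]: "u' \<in> BM" "g' \<in> BM"
 shows "wgrad u' g'"
 unfolding wgrad_def
proof (intro conjI ballI allI)
 note s = wgrad_sq_int[OF assms(1)]
 note [measurable] = s[THEN sq_int_measurable]
 show "sq_int u'" by (rule sq_int_bound(1)[OF s(1), where c=1]) (use assms(2) in auto)
 show "sq_int g'" by (rule sq_int_bound(1)[OF s(2), where c=1]) (use assms(3) in auto)
 fix \<phi> i assume p: "\<phi> \<in> test_functions"
 have [measurable]: "\<phi> \<in> BM" "partial i \<phi> \<in> BM"
  using p by (auto intro: test_measurable test_partial)
 have "(LBINT x. partial i \<phi> x * u' x) = (LBINT x. partial i \<phi> x * u x)"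
  by (rule integral_cong_AE) (use assms(2) in auto)
 moreover have "(LBINT x. \<phi> x * g' x $ i) = (LBINT x. \<phi> x * g x $ i)"
  by (rule integral_cong_AE) (use assms(3) in auto)
 ultimately show "(LBINT x. partial i \<phi> x * u' x) = - (LBINT x. \<phi> x * g' x $ i)"
  using wgrad_eq[OF assms(1) p, of i] by simp
qed

text \<open>Difference quotients in direction i have integral zero by translation invariance, and
  the mean value theorem dominates them by a constant on a slightly larger ball.\<close>

lemma integral_grad_zero:
 assumes f: "has_grad f g" and g: "continuous_on UNIV g" and R: "!!x. norm x > R ==> f x = 0"
 shows "(LBINT x. g x $ i) = 0"
proof -
 have c: "continuous_on UNIV f" by (rule has_grad_continuous[OF f])
 hence [measurable]: "f \<in> BM" "g \<in> BM"
  using g by (auto intro: borel_measurable_continuous_onI)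
 define e where "e = (axis i 1 :: real^2)"
 have ne: "norm e = 1" by (simp add: e_def)
 obtain B where B: "B > 0" "!!x. x \<in> cball 0 (R + 1) ==> norm (g x) <= B"
 proof -
  have "bounded (g ` cball 0 (R + 1))"
   by (intro compact_imp_bounded compact_continuous_image continuous_on_subset[OF g]) auto
  then obtain B where "\<forall>y\<in>g ` cball 0 (R + 1). norm y <= B" by (auto simp: bounded_iff)
  thus thesis by (intro that[of "max B 1"]) (auto intro: order_trans[OF _ max.cobounded1])
 qed
 have fint: "integrable lborel f"
 proof -
  have "bounded (f ` cball 0 R)"
   by (intro compact_imp_bounded compact_continuous_image continuous_on_subset[OF c]) auto
  then obtain A where A: "!!x. x \<in> cball 0 R ==> \<bar>f x\<bar> <= A" unfolding bounded_iff real_norm_def by blast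
  have le: "\<bar>f x\<bar> <= \<bar>A * indicator (cball 0 R) x\<bar>" for x
   using A[of x] R[of x] by (cases "norm x <= R") auto
  show ?thesis by (rule Bochner_Integration.integrable_bound[OF integrable_cball[of A R]]) (use le in auto)
 qed
 have sh: "(%x. f (x + v)) = (%x. f (v + 1 *R x))" for v by (simp add: add.commute)
 have si: "integrable lborel (%x. f (x + v))" "(LBINT x. f (x + v)) = (LBINT x. f x)" for v
  unfolding sh using lborel_integral_affine[of 1 f v] fint by simp_all
 define h where "h n = 1 / (real n + 1)" for n :: nat
 have h: "0 < h n" "h n <= 1" for n by (auto simp: h_def)
 have h0: "h ----> 0" unfolding h_def by real_asymp
 have "(%n. LBINT x. (f (x + h n *R e) - f x) / h n) ----> (LBINT x. g x $ i)"
 proof (rule integral_dominated_convergence)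
  show "integrable lborel (%x::real^2. B * indicator (cball 0 (R + 1)) x)" by (rule integrable_cball)
  show "AE x in lborel. (%n. (f (x + h n *R e) - f x) / h n) ----> g x $ i"
  proof (rule AE_I2)
   fix x
   have d1: "((%s::real. x + s *R e) has_derivative (%s. s *R e)) (at 0)" by (auto intro!: derivative_eq_intros)
   have "(f has_derivative (%h. g x \<bullet> h)) (at (x + 0 *R e))" using f by (simp add: has_grad_def)
   from has_derivative_compose[OF d1 this]
   have "((%s. f (x + s *R e)) has_real_derivative g x \<bullet> e) (at 0)"
    by (simp add: has_field_derivative_def mult.commute[of _ "_ \<bullet> _"])
   hence "((%s. (f (x + s *R e) - f x) / s) \<longlongrightarrow> g x \<bullet> e) (at 0)"
    by (simp add: has_field_derivative_iff)
   hence "(%n. (f (x + h n *R e) - f x) / h n) ----> g x \<bullet> e"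
    by (rule filterlim_compose) (use h h0 in \<open>auto simp: filterlim_at intro!: always_eventually less_imp_neq[symmetric]\<close>)
   thus "(%n. (f (x + h n *R e) - f x) / h n) ----> g x $ i" by (simp add: e_def inner_axis_one)
  qed
  show "AE x in lborel. norm ((f (x + h n *R e) - f x) / h n) <= B * indicator (cball 0 (R + 1)) x" for n
  proof (rule AE_I2)
   fix x
   show "norm ((f (x + h n *R e) - f x) / h n) <= B * indicator (cball 0 (R + 1)) x"
   proof (cases "norm x <= R + 1 & norm (x + h n *R e) <= R + 1")
    case True
    obtain s where s: "0 < s" "s < 1" "f (x + h n *R e) - f x = g (x + s *R (h n *R e)) \<bullet> (h n *R e)"
     using has_grad_mvt[OF f, of x "h n *R e"] by metis
    have "x + s *R (h n *R e) = (1 - s) *R x + s *R (x + h n *R e)" by (simp add: algebra_simps)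
    hence "x + s *R (h n *R e) \<in> cball 0 (R + 1)"
     using convexD_alt[OF convex_cball, of x 0 "R + 1" "x + h n *R e" s] True s by simp
    from B(2)[OF this] have "\<bar>g (x + s *R (h n *R e)) \<bullet> e\<bar> <= B"
     using Cauchy_Schwarz_ineq2[of "g (x + s *R (h n *R e))" e] ne by simp
    thus ?thesis using True s h[of n] by simp
   next
    case False
    have "norm (x + h n *R e) <= norm x + h n" "norm x <= norm (x + h n *R e) + h n"
     using norm_triangle_ineq[of x "h n *R e"] norm_triangle_ineq4[of "x + h n *R e" "h n *R e"] ne h[of n] by auto
    hence "f x = 0" "f (x + h n *R e) = 0"
     using False R[of x] R[of "x + h n *R e"] h[of n] by auto
    thus ?thesis using B(1) by simp
   qed
  qed
 qed measurable
 moreover have "(LBINT x. (f (x + h n *R e) - f x) / h n) = 0" for n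
  using si[of "h n *R e"] fint by simp
 ultimately have "(%n::nat. 0) ----> (LBINT x. g x $ i)" by (simp only:)
 thus ?thesis by (simp add: LIMSEQ_const_iff)
qed

lemma has_grad_wgrad:
 assumes w: "has_grad w g" "continuous_on UNIV g" "sq_int w" "sq_int g"
 shows "wgrad w g"
 unfolding wgrad_def
proof (intro conjI ballI allI w)
 fix \<phi> i assume p: "\<phi> \<in> test_functions"
 obtain R where R: "!!x. norm x > R ==> \<phi> x = 0" using p by (auto simp: test_functions_iff)
 have "continuous_on UNIV (grad \<phi>)"
  unfolding grad_def by (intro continuous_on_vec_lambda test_continuous test_partial p)
 hence c: "continuous_on UNIV (%x. \<phi> x *R g x + w x *R grad \<phi> x)"
  by (intro continuous_intros test_continuous p w has_grad_continuous[OF w(1)])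
 have "(LBINT x. (\<phi> x *R g x + w x *R grad \<phi> x) $ i) = 0"
  by (rule integral_grad_zero[OF has_grad_mult[OF test_has_grad[OF p] w(1)] c, of R]) (use R in auto)
 hence "(LBINT x. \<phi> x * g x $ i + partial i \<phi> x * w x) = 0" by (simp add: mult.commute)
 thus "(LBINT x. partial i \<phi> x * w x) = - (LBINT x. \<phi> x * g x $ i)"
  using integrable_mult_sq_int[OF test_sq_int(1)[OF test_partial[OF p]] w(3), of i]
   integrable_mult_sq_int[OF test_sq_int(1)[OF p] sq_int_nth(1)[OF w(4)], of i] by simp
qed

lemma wgrad_closed:
 assumes u: "!!n::nat. wgrad (u n) (g n)" and s: "sq_int u0" "sq_int g0"
  and lim: "l2_lim u u0" "l2_lim g g0"
 shows "wgrad u0 g0"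
 unfolding wgrad_def
proof (intro conjI ballI allI s)
 fix \<phi> i assume p: "\<phi> \<in> test_functions"
 note su = wgrad_sq_int[OF u]
 have z: "(%n::nat. l2 (%x::real^2. h x - h x)) ----> 0" for h :: "real^2 => real" by simp
 have 1: "(%n. LBINT x. partial i \<phi> x \<bullet> u n x) ----> (LBINT x. partial i \<phi> x \<bullet> u0 x)"
  by (rule inner_tendsto[OF _ _ _ _ z lim(1)]) (intro test_sq_int test_partial p su s)+
 have l: "l2_lim (%n x. g n x $ i) (%x. g0 x $ i)"
  by (rule Lim_null_comparison[OF _ lim(2)], intro always_eventually allI)
   (use sq_int_nth(2)[OF sq_int_diff[OF su(2) s(2)], of _ i] in simp)
 have 2: "(%n. LBINT x. \<phi> x \<bullet> g n x $ i) ----> (LBINT x. \<phi> x \<bullet> g0 x $ i)"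
  by (rule inner_tendsto[OF _ _ _ _ z l]) (intro test_sq_int test_partial p sq_int_nth su s)+
 have "(%n. LBINT x. partial i \<phi> x * u n x) ----> - (LBINT x. \<phi> x * g0 x $ i)"
  unfolding wgrad_eq[OF u p] using tendsto_minus[OF 2] by simp
 with 1 show "(LBINT x. partial i \<phi> x * u0 x) = - (LBINT x. \<phi> x * g0 x $ i)"
  by (simp add: LIMSEQ_unique)
qed

definition bkern :: "real^2 => real" where
 "bkern x = bump x / (LBINT y. bump y)"

lemma bump_integral_pos: "0 < (LBINT y. bump y)"
proof -
 have "(LBINT y. bump y) ~= 0"
 proof
  assume "(LBINT y. bump y) = 0"
  hence "AE x in lborel. bump x = 0"
   using integral_nonneg_eq_0_iff_AE[OF test_sq_int(2)[OF bump_test]] bump_nonneg by simp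
  moreover have "x \<in> ball 0 1 ==> bump x ~= 0" for x
   using power_strict_mono[of "norm x" 1 2] by (auto simp: bump_def hfun_def)
  ultimately have "AE x in lborel. x \<notin> ball (0::real^2) 1" by (auto elim!: eventually_mono)
  hence "emeasure lborel (ball (0::real^2) 1) = 0" by (subst (asm) AE_iff_measurable[of "ball 0 1"]) auto
  moreover have "emeasure lborel (ball (0::real^2) 1) > 0"
   using emeasure_lborel_ball_finite open_not_negligible[of "ball (0::real^2) 1"]
   by (auto simp: zero_less_iff_neq_zero negligible_iff_null_sets null_sets_def emeasure_completion)
  ultimately show False by simp
 qed
 moreover have "0 <= (LBINT y. bump y)" using bump_nonneg by (intro integral_nonneg_AE) auto
 ultimately show ?thesis by simp
qed

lemma bkern_test: "bkern \<in> test_functions"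
 using test_cmult[OF bump_test, of "1 / (LBINT y. bump y)"] by (simp add: bkern_def[abs_def])

lemma kernel_bkern: "kernel bkern"
 unfolding kernel_def using test_sq_int[OF bkern_test] bump_nonneg(1) bump_integral_pos
 by (auto simp: bkern_def[abs_def])

lemma scaled_bkern_test: "e > 0 ==> (%z. (1/e^2) * bkern ((1/e) *R z)) \<in> test_functions"
 using test_cmult[OF test_affine[OF bkern_test, of "1/e" 0], of "1/e^2"] by simp

lemma moll_conv:
 assumes e: "e > 0" and u: "sq_int u"
 shows "moll bkern e u = conv (%z. (1/e^2) * bkern ((1/e) *R z)) u"
 unfolding conv_def using moll_kernel_translate[OF e, of bkern u] sq_int_measurable[OF u] test_measurable[OF bkern_test]
 by (auto simp: fun_eq_iff)

lemma moll_nth: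
 assumes "sq_int g" "e > 0" shows "moll bkern e g x $ i = moll bkern e (%x. g x $ i) x"
proof -
 have "integrable lborel (%z. bkern z *R g (x - e *R z))" by (rule moll_integrable[OF kernel_bkern assms])
 from integral_bounded_linear[OF bounded_linear_vec_nth this, of i] show ?thesis by (simp add: moll_def)
qed

lemma moll_continuous:
 fixes u :: "real^2 => real"
 assumes "e > 0" "sq_int u" shows "continuous_on UNIV (moll bkern e u)"
 unfolding moll_conv[OF assms] using has_grad_continuous[OF conv_has_grad[OF scaled_bkern_test[OF assms(1)] assms(2)]] .

text \<open>The derivative falls on the kernel. A reflected translate of the kernel is a test
  function, so the defining identity of \<open>wgrad\<close> turns the result into a mollification
  of g.\<close>

lemma moll_wgrad:
 assumes u: "wgrad u g" and e: "e > 0"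
 shows "has_grad (moll bkern e u) (moll bkern e g)" (is ?A) "continuous_on UNIV (moll bkern e g)" (is ?B)
proof -
 note s = wgrad_sq_int[OF u]
 let ?\<phi> = "%z. (1/e^2) * bkern ((1/e) *R z)"
 have t: "?\<phi> \<in> test_functions" by (rule scaled_bkern_test[OF e])
 have "conv (partial i ?\<phi>) u x = conv ?\<phi> (%x. g x $ i) x" for x i
 proof -
  have 1: "(%y. ?\<phi> (x + (-1) *R y)) \<in> test_functions" by (rule test_affine[OF t]) simp
  have "conv (partial i ?\<phi>) u x = - (LBINT y. partial i (%y. ?\<phi> (x + (-1) *R y)) y * u y)"
   unfolding test_partial_affine[OF t] conv_def by simp
  thus ?thesis unfolding wgrad_eq[OF u 1] by (simp add: conv_def)
 qed
 hence "(\<chi> i. conv (partial i ?\<phi>) u x) = moll bkern e g x" for x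
  using moll_nth[OF s(2) e, of x] moll_conv[OF e sq_int_nth(1)[OF s(2)]] by (simp add: vec_eq_iff)
 thus ?A
  using conv_has_grad[OF t s(1)] moll_conv[OF e s(1)] by simp
 have "continuous_on UNIV (%x. \<chi> i. moll bkern e (%x. g x $ i) x)"
  by (intro continuous_on_vec_lambda moll_continuous e sq_int_nth(1) s)
 moreover have "(%x. \<chi> i. moll bkern e (%x. g x $ i) x) = moll bkern e g"
  using moll_nth[OF s(2) e] by (auto simp: vec_eq_iff)
 ultimately show ?B by (simp only:)
qed

text \<open>One fixed sequence of mollification scales; the shift by 1 keeps the scale positive at n
  = 0.\<close>

definition smth :: "nat => (real^2 => 'b::euclidean_space) => real^2 => 'b" where
 "smth n = moll bkern (1 / (real n + 1))"

lemma smth: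
 assumes u: "wgrad u g"
 shows "has_grad (smth n u) (smth n g)" (is ?A) "continuous_on UNIV (smth n g)" (is ?B) "sq_int (smth n u)" "sq_int (smth n g)"
  "l2_lim (%n. smth n u) u" (is ?C) "l2_lim (%n. smth n g) g" (is ?D) "C_k k (smth n u)"
proof -
 have e: "1 / (real n + 1) > 0" for n by simp
 have l: "(%n. 1 / (real n + 1)) ----> 0" by real_asymp
 note s = wgrad_sq_int[OF u]
 show ?A ?B
  unfolding smth_def by (rule moll_wgrad[OF u e])+
 show "sq_int (smth n u)" "sq_int (smth n g)" unfolding smth_def by (rule moll_sq_int[OF kernel_bkern] s)+
 show ?C ?D
  unfolding smth_def by (rule moll_tendsto[OF kernel_bkern _ e l] s)+
 show "C_k k (smth n u)" unfolding smth_def moll_conv[OF e s(1)] by (rule conv_C_k[OF scaled_bkern_test[OF e] s(1)])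
qed

lemma l2_eq_0_imp_AE_eq:
 assumes "sq_int f" "sq_int g" "l2 (%x. f x - g x) = 0" shows "AE x in lborel. f x = g x"
 using sqn_eq_0[OF sq_int_diff[OF assms(1,2)]] assms(3) by (simp add: l2_def)

text \<open>\<open>smth n g\<close> is the classical gradient of \<open>smth n u\<close>, hence
  determined by u. Two weak gradients thus have the same mollifications, and these converge to
  both.\<close>

lemma wgrad_unique:
 assumes "wgrad u g" "wgrad u g'" shows "AE x in lborel. g x = g' x"
proof (rule l2_eq_0_imp_AE_eq)
 note s = wgrad_sq_int[OF assms(1)] wgrad_sq_int[OF assms(2)]
 show "sq_int g" "sq_int g'" by (rule s)+
 have eq: "smth n g = smth n g'" for n
  using has_grad_partial(3)[OF smth(1)[OF assms(1), of n]] has_grad_partial(3)[OF smth(1)[OF assms(2), of n]] by simp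
 have "(%n. l2 (%x. smth n g x - g x) + l2 (%x. smth n g' x - g' x)) ----> 0 + 0"
  by (intro tendsto_add smth(6)[OF assms(1)] smth(6)[OF assms(2)])
 moreover have "l2 (%x. g x - g' x) <= l2 (%x. smth n g x - g x) + l2 (%x. smth n g' x - g' x)" for n
  using l2_diff_trans[OF s(2) smth(4)[OF assms(1), of n] s(4)] l2_diff_commute[of g "smth n g"] eq[of n] by simp
 ultimately have "l2 (%x. g x - g' x) <= 0"
  by (intro LIMSEQ_le_const[of "%n. l2 (%x. smth n g x - g x) + l2 (%x. smth n g' x - g' x)"]) auto
 thus "l2 (%x. g x - g' x) = 0" by (simp add: antisym)
qed

lemma l2_bound:
 assumes "sq_int f" "g \<in> BM" "!!x. norm (g x) <= c * norm (f x)" "c >= 0"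
 shows "sq_int g" "l2 g <= c * l2 f"
proof -
 have "AE x in lborel. norm (g x) <= c * norm (f x)" using assms(3) by simp
 note b = sq_int_bound[OF assms(1,2) this]
 show "sq_int g" by (rule b)
 have "sqrt (sqn g) <= sqrt (c^2 * sqn f)" by (intro real_sqrt_le_mono b)
 thus "l2 g <= c * l2 f" using assms(4) by (simp add: l2_def real_sqrt_mult)
qed

text \<open>The product rule is classical for the mollifications of u. Every term is a bounded
  function times something convergent in L2, so \<open>wgrad_closed\<close> carries the rule to the
  limit.\<close>

lemma wgrad_mult_C1:
 assumes u: "wgrad u g" and c: "has_grad \<zeta> k" "continuous_on UNIV k"
  and B: "!!x. \<bar>\<zeta> x\<bar> <= B" "!!x. norm (k x) <= B"
 shows "wgrad (%x. \<zeta> x * u x) (%x. \<zeta> x *R g x + u x *R k x)"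
proof -
 note s = wgrad_sq_int[OF u]
 have B0: "B >= 0" using B(1)[of 0] by linarith
 have [measurable]: "\<zeta> \<in> BM" "k \<in> BM"
  using has_grad_continuous[OF c(1)] c(2) by (auto intro: borel_measurable_continuous_onI)
 have 1: "sq_int (%x. \<zeta> x * v x) & l2 (%x. \<zeta> x * v x) <= B * l2 v" if "sq_int v" for v
  using sq_int_measurable[OF that] B(1) B0
  by (intro conjI l2_bound[OF that]) (auto simp: abs_mult mult_right_mono)
 have 2: "sq_int (%x. \<zeta> x *R v x) & l2 (%x. \<zeta> x *R v x) <= B * l2 v" if "sq_int v" for v :: "real^2 => real^2"
  using sq_int_measurable[OF that] B(1) B0
  by (intro conjI l2_bound[OF that]) (auto simp: abs_mult mult_right_mono)
 have 3: "sq_int (%x. v x *R k x) & l2 (%x. v x *R k x) <= B * l2 v" if "sq_int v" for v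
  using sq_int_measurable[OF that] B(2) B0
  by (intro conjI l2_bound[OF that]) (auto simp: abs_mult mult_right_mono mult.commute[of "\<bar>v _\<bar>"])
 show ?thesis
 proof (rule wgrad_closed[of "%n x. \<zeta> x * smth n u x" "%n x. \<zeta> x *R smth n g x + smth n u x *R k x"])
  note S = smth[OF u]
  show "wgrad (%x. \<zeta> x * smth n u x) (%x. \<zeta> x *R smth n g x + smth n u x *R k x)" for n
  proof (rule has_grad_wgrad)
   show "has_grad (%x. \<zeta> x * smth n u x) (%x. \<zeta> x *R smth n g x + smth n u x *R k x)"
    by (rule has_grad_mult[OF c(1) S(1)])
   show "continuous_on UNIV (%x. \<zeta> x *R smth n g x + smth n u x *R k x)"
    by (intro continuous_intros has_grad_continuous[OF c(1)] c(2) S(2) has_grad_continuous[OF S(1)])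
   show "sq_int (%x. \<zeta> x * smth n u x)" by (rule 1[THEN conjunct1, OF S(3)])
   show "sq_int (%x. \<zeta> x *R smth n g x + smth n u x *R k x)" by (intro sq_int_add 2[THEN conjunct1] 3[THEN conjunct1] S(3,4))
  qed
  show "sq_int (%x. \<zeta> x * u x)" by (rule 1[THEN conjunct1, OF s(1)])
  show "sq_int (%x. \<zeta> x *R g x + u x *R k x)" by (intro sq_int_add 2[THEN conjunct1] 3[THEN conjunct1] s)
  have "(%n. B * l2 (%x. smth n u x - u x)) ----> B * 0" by (intro tendsto_mult tendsto_const S)
  hence "(%n. B * l2 (%x. smth n u x - u x)) ----> 0" by simp
  thus "l2_lim (%n x. \<zeta> x * smth n u x) (%x. \<zeta> x * u x)"
  proof (rule null_bound)
   fix n show "\<bar>l2 (%x. \<zeta> x * smth n u x - \<zeta> x * u x)\<bar> <= B * l2 (%x. smth n u x - u x)"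
    using 1[OF sq_int_diff[OF S(3) s(1)], of n] by (simp add: right_diff_distrib)
  qed
  have "(%n. B * l2 (%x. smth n g x - g x) + B * l2 (%x. smth n u x - u x)) ----> B * 0 + B * 0"
   by (intro tendsto_add tendsto_mult tendsto_const S)
  hence "(%n. B * l2 (%x. smth n g x - g x) + B * l2 (%x. smth n u x - u x)) ----> 0" by simp
  thus "l2_lim (%n x. (\<zeta> x *R smth n g x + smth n u x *R k x)) (%x. (\<zeta> x *R g x + u x *R k x))"
  proof (rule null_bound)
   fix n
   have eq: "(\<zeta> x *R smth n g x + smth n u x *R k x) - (\<zeta> x *R g x + u x *R k x)
    = \<zeta> x *R (smth n g x - g x) + (smth n u x - u x) *R k x" for x by (simp add: algebra_simps)
   have a: "sq_int (%x. \<zeta> x *R (smth n g x - g x)) & l2 (%x. \<zeta> x *R (smth n g x - g x)) <= B * l2 (%x. smth n g x - g x)"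
    by (rule 2) (intro sq_int_diff S s)
   have b: "sq_int (%x. (smth n u x - u x) *R k x) & l2 (%x. (smth n u x - u x) *R k x) <= B * l2 (%x. smth n u x - u x)"
    by (rule 3) (intro sq_int_diff S s)
   show "\<bar>l2 (%x. (\<zeta> x *R smth n g x + smth n u x *R k x) - (\<zeta> x *R g x + u x *R k x))\<bar>
    <= B * l2 (%x. smth n g x - g x) + B * l2 (%x. smth n u x - u x)"
    unfolding eq using l2_triangle[of "%x. \<zeta> x *R (smth n g x - g x)" "%x. (smth n u x - u x) *R k x"] a b by simp
  qed
 qed
qed

lemma l2_tendsto_add:
 assumes s: "!!n::nat. sq_int (f n)" "sq_int f0" "!!n. sq_int (g n)" "sq_int g0"
  and l: "l2_lim f f0" "l2_lim g g0"
 shows "l2_lim (%n x. (f n x + g n x)) (%x. (f0 x + g0 x))"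
proof (rule null_bound[OF tendsto_add_zero[OF l]])
 fix n
 have "l2 (%x. (f n x - f0 x) + (g n x - g0 x)) <= l2 (%x. f n x - f0 x) + l2 (%x. g n x - g0 x)"
  by (intro l2_triangle sq_int_diff s)
 thus "\<bar>l2 (%x. (f n x + g n x) - (f0 x + g0 x))\<bar> <= l2 (%x. f n x - f0 x) + l2 (%x. g n x - g0 x)"
  by (simp add: algebra_simps)
qed

section \<open>Chain rule, truncation and modulus\<close>

definition vec2 :: "real => real => real^2" where
 "vec2 a b = a *R axis 1 1 + b *R axis 2 1"

lemma vec2_nth[simp]: "vec2 a b $ 1 = a" "vec2 a b $ 2 = b"
 by (auto simp: vec2_def axis_def)

lemma norm_vec2: "(norm (vec2 a b))^2 = a^2 + b^2"
 by (simp add: norm2_sum sum_2)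

lemma vec2_diff: "vec2 a b - vec2 c d = vec2 (a - c) (b - d)"
 by (simp add: vec2_def algebra_simps)

lemma has_grad_chain:
 assumes F: "has_grad F F'" and f: "has_grad f a" and g: "has_grad g b"
 shows "has_grad (%x. F (vec2 (f x) (g x))) (%x. (F' (vec2 (f x) (g x)) $ 1) *R a x + (F' (vec2 (f x) (g x)) $ 2) *R b x)"
 unfolding has_grad_def
proof
 fix x
 have d: "((%x. vec2 (f x) (g x)) has_derivative (%h. vec2 (a x \<bullet> h) (b x \<bullet> h))) (at x)"
  unfolding vec2_def using f g
  by (auto simp: has_grad_def intro!: has_derivative_add has_derivative_scaleR_left)
 from has_derivative_compose[OF d F[unfolded has_grad_def, rule_format]]
 show "((%x. F (vec2 (f x) (g x))) has_derivative
   (%h. ((F' (vec2 (f x) (g x)) $ 1) *R a x + (F' (vec2 (f x) (g x)) $ 2) *R b x) \<bullet> h)) (at x)"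
  by (simp add: inner_add_left inner_vec_def[of _ "vec2 _ _"] sum_2)
qed

lemma tendsto_vec2: "(f \<longlongrightarrow> a) F ==> (g \<longlongrightarrow> b) F ==> ((%x. vec2 (f x) (g x)) \<longlongrightarrow> vec2 a b) F"
 unfolding vec2_def by (intro tendsto_intros)

lemma continuous_on_vec2: "continuous_on A f ==> continuous_on A g ==> continuous_on A (%x. vec2 (f x) (g x))"
 unfolding vec2_def by (intro continuous_intros)

lemma measurable_vec2[measurable]:
 "f \<in> borel_measurable M ==> g \<in> borel_measurable M ==> (%x. vec2 (f x) (g x)) \<in> borel_measurable M"
 unfolding vec2_def by (intro borel_measurable_add borel_measurable_scaleR borel_measurable_const)

lemma abs_nth_le_norm: "\<bar>(v::real^2) $ i\<bar> <= norm v"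
 by (rule component_le_norm_cart)

lemma sq_int_vec2:
 fixes p q :: "real^2 => real"
 assumes p: "sq_int p" and q: "sq_int q"
 shows "sq_int (%x. vec2 (p x) (q x))" (is ?A) "l2 (%x. vec2 (p x) (q x)) <= l2 p + l2 q" (is ?B)
proof -
 have e: "sq_int (%x. h x *R (axis i 1 :: real^2))" "l2 (%x. h x *R (axis i 1 :: real^2)) = l2 h" if "sq_int h" for h :: "real^2 => real" and i :: 2
  using that by (auto simp: sq_int_def l2_def sqn_def)
 show ?A ?B
  using sq_int_add[OF e(1)[OF p] e(1)[OF q]] l2_triangle[OF e(1)[OF p, of 1] e(1)[OF q, of 2]] e(2)[OF p] e(2)[OF q] by (simp_all add: vec2_def)
qed

lemma sq_int_mult_bounded:
 fixes c :: "'a::euclidean_space => real"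
 assumes c: "c \<in> BM" "!!x. \<bar>c x\<bar> <= B" and w: "sq_int w"
 shows "sq_int (%x. c x *R w x)" (is ?A) "l2 (%x. c x *R w x) <= B * l2 w" (is ?B)
proof -
 note [measurable] = c(1) w[THEN sq_int_measurable]
 have "(%x. c x *R w x) \<in> BM" "norm (c x *R w x) <= B * norm (w x)" for x
  using c(2) by (simp_all add: mult_right_mono)
 from l2_bound[OF w this order_trans[OF abs_ge_zero c(2)]] show ?A ?B .
qed

text \<open>The difference splits into c n times v n - v0, which B controls, and varying
  coefficients on the fixed function v0, where B |v0| dominates. The coefficients therefore have to
  converge only almost everywhere.\<close>

lemma l2_tendsto_mult_bounded:
 fixes c0 :: "'a::euclidean_space => real"
 assumes c: "!!n::nat. c n \<in> BM" "c0 \<in> BM" "!!n x. \<bar>c n x\<bar> <= B" "AE x in lborel. (%n. c n x) ----> c0 x"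
  and v: "!!n. sq_int (v n)" "sq_int v0" "l2_lim v v0"
 shows "sq_int (%x. c n x *R v n x)" (is ?A) "sq_int (%x. c0 x *R v0 x)" (is ?B) "l2_lim (%n x. c n x *R v n x) (%x. c0 x *R v0 x)" (is ?C)
proof -
 note [measurable] = c(1,2) v(1,2)[THEN sq_int_measurable]
 note b = sq_int_mult_bounded[OF c(1,3)]
 have w: "sq_int (%x. B * norm (v0 x))" using v(2) by (intro sq_int_cmult) (simp add: sq_int_def)
 have le: "AE x in lborel. norm (c n x *R v0 x) <= B * norm (v0 x)" for n using c(3) by (intro AE_I2) (simp add: mult_right_mono)
 have lim: "AE x in lborel. (%n. c n x *R v0 x) ----> c0 x *R v0 x" using c(4) by eventually_elim (intro tendsto_intros)
 have D: ?B "l2_lim (%n x. c n x *R v0 x) (%x. c0 x *R v0 x)"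
  by (rule sq_int_dominated[OF _ _ w le lim]; measurable)+
 show ?A by (rule b(1)[OF v(1)])
 show ?B by (rule D(1))
 show ?C
 proof (rule null_bound[OF tendsto_add_zero[OF tendsto_mult_right_zero[OF v(3), of B] D(2)]])
  fix n
  show "\<bar>l2 (%x. c n x *R v n x - c0 x *R v0 x)\<bar> <= B * l2 (%x. v n x - v0 x) + l2 (%x. c n x *R v0 x - c0 x *R v0 x)"
   using l2_diff_trans[OF b(1)[OF v(1)] b(1)[OF v(2)] D(1), of n n n] b(2)[OF sq_int_diff[OF v(1) v(2)], of n n] by (simp add: scaleR_diff_right)
 qed
qed

lemma wgrad_chain_closed:
 fixes P0 :: "real^2 => real^2"
 assumes U: "!!n::nat. wgrad (U n) (%x. (P n x $ 1) *R a n x + (P n x $ 2) *R b n x)" "sq_int U0" "l2_lim U U0"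
  and P: "!!n. P n \<in> BM" "P0 \<in> BM" "!!n x. norm (P n x) <= B" "AE x in lborel. (%n. P n x) ----> P0 x"
  and a: "!!n. sq_int (a n)" "sq_int a0" "l2_lim a a0"
  and b: "!!n. sq_int (b n)" "sq_int b0" "l2_lim b b0"
 shows "wgrad U0 (%x. (P0 x $ 1) *R a0 x + (P0 x $ 2) *R b0 x)"
proof -
 note [measurable] = P(1,2)
 have m: "(%x. P n x $ i) \<in> BM" "(%x. P0 x $ i) \<in> BM" for n i by measurable
 have B: "\<bar>P n x $ i\<bar> <= B" for n x i using abs_nth_le_norm P(3) by (rule order_trans)
 have l: "AE x in lborel. (%n. P n x $ i) ----> P0 x $ i" for i using P(4) by eventually_elim (rule tendsto_vec_nth)
 note A = l2_tendsto_mult_bounded[OF m B l a] and A' = l2_tendsto_mult_bounded[OF m B l b]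
 show ?thesis
  by (rule wgrad_closed[OF U(1,2) sq_int_add[OF A(2) A'(2)] U(3) l2_tendsto_add[OF A(1,2) A'(1,2) A(3) A'(3)]])
qed

text \<open>The pair f, g is read as a point of \<open>real^2\<close>, so that F is an ordinary
  function with \<open>has_grad\<close>. A bounded F' and F 0 = 0 keep the composition square
  integrable. The classical rule for mollifications passes to the limit along a subsequence on which
  both mollifications converge almost everywhere, since F' enters only through bounded
  coefficients.\<close>

lemma wgrad_chain:
 assumes f: "wgrad f a" and g: "wgrad g b"
  and F: "has_grad F F'" "continuous_on UNIV F'" "!!p. norm (F' p) <= B" "F 0 = 0"
 shows "wgrad (%x. F (vec2 (f x) (g x))) (%x. (F' (vec2 (f x) (g x)) $ 1) *R a x + (F' (vec2 (f x) (g x)) $ 2) *R b x)"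
proof -
 note s = wgrad_sq_int[OF f] wgrad_sq_int[OF g] and Sf = smth[OF f] and Sg = smth[OF g]
 have B0: "B >= 0" using F(3)[of 0] norm_ge_zero order_trans by blast
 have [measurable]: "F \<in> BM" "F' \<in> BM"
  using has_grad_continuous[OF F(1)] F(2) by (auto intro: borel_measurable_continuous_onI)
 note [measurable] = s[THEN sq_int_measurable] Sf(3,4)[THEN sq_int_measurable] Sg(3,4)[THEN sq_int_measurable]
 have lip: "norm (F p - F q) <= B * norm (p - q)" for p q
 proof -
  obtain t where "F (q + (p - q)) - F q = F' (q + t *R (p - q)) \<bullet> (p - q)" using has_grad_mvt[OF F(1), of q "p - q"] by metis
  hence "\<bar>F p - F q\<bar> <= norm (F' (q + t *R (p - q))) * norm (p - q)"
   using Cauchy_Schwarz_ineq2[of "F' (q + t *R (p - q))" "p - q"] by simp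
  also have "\<dots> <= B * norm (p - q)" by (intro mult_right_mono F) auto
  finally show ?thesis by simp
 qed
 have bU: "sq_int (%x. F (vec2 (p x) (q x)))" if "sq_int p" "sq_int q" for p q :: "real^2 => real"
 proof (rule l2_bound(1)[OF sq_int_vec2(1)[OF that] _ _ B0])
  note [measurable] = that[THEN sq_int_measurable]
  show "(%x. F (vec2 (p x) (q x))) \<in> BM" by measurable
  show "norm (F (vec2 (p x) (q x))) <= B * norm (vec2 (p x) (q x))" for x using lip[of "vec2 (p x) (q x)" 0] F(4) by simp
 qed
 obtain r1 :: "nat => nat" where r1: "strict_mono r1" "AE x in lborel. (%n. smth (r1 n) f x) ----> f x"
  by (rule l2_lim_AE_subseq[OF Sf(3) s(1) Sf(5)])
 obtain r2 :: "nat => nat" where r2: "strict_mono r2" "AE x in lborel. (%n. smth (r1 (r2 n)) g x) ----> g x"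
  by (rule l2_lim_AE_subseq[OF Sg(3) s(3) LIMSEQ_subseq_LIMSEQ[OF Sg(5) r1(1), unfolded o_def]])
 define r where "r n = r1 (r2 n)" for n
 have r: "strict_mono r" using r1(1) r2(1) by (simp add: r_def strict_mono_def)
 note sub = LIMSEQ_subseq_LIMSEQ[OF _ r, unfolded o_def]
 have d: "(%x. F (vec2 (smth n f x) (smth n g x)) - F (vec2 (f x) (g x))) \<in> BM" for n by measurable
 let ?w = "%n x. vec2 (smth (r n) f x) (smth (r n) g x)"
 show ?thesis
 proof (rule wgrad_chain_closed[where U="%n x. F (?w n x)" and P="%n x. F' (?w n x)"
   and a="%n. smth (r n) a" and b="%n. smth (r n) b"])
  show "wgrad (%x. F (?w n x))
   (%x. (F' (?w n x) $ 1) *R smth (r n) a x + (F' (?w n x) $ 2) *R smth (r n) b x)" for n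
  proof (rule has_grad_wgrad[OF has_grad_chain[OF F(1) Sf(1) Sg(1)] _ bU[OF Sf(3) Sg(3)]])
   have c: "continuous_on UNIV (%x. F' (?w n x))"
    by (rule continuous_on_compose2[OF F(2)])
     (auto intro!: continuous_on_vec2 has_grad_continuous[OF Sf(1)] has_grad_continuous[OF Sg(1)])
   thus "continuous_on UNIV (%x. (F' (?w n x) $ 1) *R smth (r n) a x + (F' (?w n x) $ 2) *R smth (r n) b x)"
    by (intro continuous_intros Sf Sg)
   have V: "sq_int (%x. (F' (?w n x) $ i) *R v x)" if "sq_int v" for i and v :: "real^2 => real^2"
    by (rule sq_int_mult_bounded(1)[OF _ order_trans[OF abs_nth_le_norm F(3)] that]) measurable
   show "sq_int (%x. (F' (?w n x) $ 1) *R smth (r n) a x + (F' (?w n x) $ 2) *R smth (r n) b x)"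
    by (intro sq_int_add V Sf Sg)
  qed
  show "l2_lim (%n x. F (?w n x)) (%x. F (vec2 (f x) (g x)))"
  proof (rule null_bound[OF tendsto_mult_right_zero[OF tendsto_add_zero[OF sub[OF Sf(5)] sub[OF Sg(5)]], of B]])
   fix n
   note D = sq_int_vec2[OF sq_int_diff[OF Sf(3)[of "r n"] s(1)] sq_int_diff[OF Sg(3)[of "r n"] s(3)]]
   show "\<bar>l2 (%x. F (?w n x) - F (vec2 (f x) (g x)))\<bar> <= B * (l2 (%x. smth (r n) f x - f x) + l2 (%x. smth (r n) g x - g x))"
    using l2_bound(2)[OF D(1) d _ B0, of "r n"] lip[of "?w n x" "vec2 (f x) (g x)" for x] mult_left_mono[OF D(2) B0] by (simp add: vec2_diff)
  qed
  show "AE x in lborel. (%n. F' (?w n x)) ----> F' (vec2 (f x) (g x))"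
   using r1(2) r2(2)
  proof eventually_elim
   case (elim x)
   have "isCont F' (vec2 (f x) (g x))" using F(2) by (simp add: continuous_on_eq_continuous_at)
   thus ?case
    by (rule isCont_tendsto_compose) (use elim LIMSEQ_subseq_LIMSEQ[OF elim(1) r2(1)] in \<open>auto intro!: tendsto_vec2 simp: r_def o_def\<close>)
  qed
 qed (use sub[OF Sf(6)] sub[OF Sg(6)] Sf(4) Sg(4) s F(3) bU[OF s(1,3)] in \<open>auto\<close>)
qed

text \<open>A smooth truncation: bounded for fixed M, with a gradient pointwise no larger than that
  of f, and tending to f as M grows.\<close>

lemma wgrad_arctan:
 assumes f: "wgrad f a" and M: "M > 0"
 shows "wgrad (%x. M * arctan (f x / M)) (%x. (1 / (1 + (f x / M)^2)) *R a x)"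
proof -
 have d: "((%t. M * arctan (t / M)) has_real_derivative 1 / (1 + (t / M)^2)) (at t)" for t
  using M by (auto intro!: derivative_eq_intros simp: divide_simps)
 have h1: "has_grad (%p. M * arctan (p $ 1 / M)) (%p. (1 / (1 + (p $ 1 / M)^2)) *R axis 1 1)"
  by (rule has_grad_compose_real[OF has_grad_coord d])
 have "1 + (t / M)^2 ~= 0" for t by (metis add_pos_nonneg less_irrefl zero_le_power2 zero_less_one)
 hence h2: "continuous_on UNIV (%p::real^2. (1 / (1 + (p $ 1 / M)^2)) *R axis 1 1 :: real^2)"
  using M by (intro continuous_intros) auto
 have h3: "norm ((1 / (1 + (p $ 1 / M)^2)) *R axis 1 1 :: real^2) <= 1" for p :: "real^2"
 proof -
  have "0 < 1 + (p $ 1 / M)^2" by (simp add: add_pos_nonneg)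
  thus ?thesis by (simp add: divide_le_eq)
 qed
 have "M * arctan ((0::real^2) $ 1 / M) = 0" by simp
 from wgrad_chain[OF f wgrad_zero h1 h2 h3 this] show ?thesis by (simp add: axis_nth)
qed

text \<open>The function sqrt(d^2 + |p|^2) - d is smooth for d > 0, vanishes at 0 and has a gradient
  of length at most 1, so \<open>wgrad_chain\<close> applies; then d tends to 0. Where f and g both
  vanish, the regularized coefficients are 0, in agreement with the limit formula because 1 / 0 =
  0.\<close>

lemma wgrad_modulus:
 assumes f: "wgrad f a" and g: "wgrad g b"
 shows "wgrad (%x. sqrt ((f x)^2 + (g x)^2)) (%x. (1 / sqrt ((f x)^2 + (g x)^2)) *R (f x *R a x + g x *R b x))"
proof -
 note s = wgrad_sq_int[OF f] wgrad_sq_int[OF g]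
 note [measurable] = s[THEN sq_int_measurable]
 define d where "d n = 1 / (real n + 1)" for n
 have d: "d n > 0" for n by (simp add: d_def)
 have d0: "d ----> 0" unfolding d_def by real_asymp
 define F where "F n p = sqrt ((d n)^2 + (norm p)^2) - d n" for n and p :: "real^2"
 define F' where "F' n p = (1 / sqrt ((d n)^2 + (norm p)^2)) *R p" for n and p :: "real^2"
 have pos: "(d n)^2 + (norm p)^2 > 0" for n and p :: "real^2" using d[of n] by (simp add: add_pos_nonneg)
 have F'1: "norm (F' n p) <= 1" for n p
 proof -
  have "norm p <= sqrt ((d n)^2 + (norm p)^2)" by (rule real_le_rsqrt) simp
  thus ?thesis using pos[of n p] by (simp add: F'_def divide_le_eq)
 qed
 have F'm: "continuous_on UNIV (F' n)" for n unfolding F'_def using d[of n]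
  by (intro continuous_intros) (auto simp: less_imp_neq[symmetric])
 have W: "wgrad (%x. F n (vec2 (f x) (g x))) (%x. (F' n (vec2 (f x) (g x)) $ 1) *R a x + (F' n (vec2 (f x) (g x)) $ 2) *R b x)" for n
 proof (rule wgrad_chain[OF f g])
  show "has_grad (F n) (F' n)"
   unfolding has_grad_def
  proof
   fix p :: "real^2"
   have "((sq norm) has_derivative (%h. (2 *R p) \<bullet> h)) (at p)" using has_grad_norm2 by (simp add: has_grad_def)
   thus "(F n has_derivative (%h. F' n p \<bullet> h)) (at p)"
    unfolding F_def F'_def using pos[of n p] by (auto intro!: derivative_eq_intros simp: divide_simps)
  qed
  show "F n 0 = 0" using d[of n] by (simp add: F_def)
 qed (rule F'm F'1)+
 let ?\<rho> = "%x. sqrt ((f x)^2 + (g x)^2)"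
 have rv: "norm (vec2 (f x) (g x)) = ?\<rho> x" for x using norm_vec2[of "f x" "g x"] by (simp add: real_sqrt_unique)
 note V = sq_int_vec2(1)[OF s(1,3)]
 have Fl: "(%n. F n p) ----> norm p" for p
 proof -
  have "(%n. F n p) ----> sqrt (0^2 + (norm p)^2) - 0" unfolding F_def by (intro tendsto_intros d0)
  thus ?thesis by simp
 qed
 have F'l: "(%n. F' n p) ----> (1 / norm p) *R p" for p
 proof (cases "p = 0")
  case False
  have "(%n. F' n p) ----> (1 / sqrt (0^2 + (norm p)^2)) *R p" unfolding F'_def using False by (intro tendsto_intros d0) auto
  thus ?thesis by simp
 qed (simp add: F'_def)
 have Fle: "norm (F n p) <= norm p" for n p
  using sqrt_add_le_add_sqrt[of "(d n)^2" "(norm p)^2"] real_sqrt_le_mono[of "(d n)^2" "(d n)^2 + (norm p)^2"] d[of n] by (simp add: F_def)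
 have Fm: "continuous_on UNIV (F n)" for n unfolding F_def by (intro continuous_intros)
 note [measurable] = borel_measurable_continuous_onI[OF Fm] borel_measurable_continuous_onI[OF F'm]
 have w: "sq_int (%x. norm (vec2 (f x) (g x)))" using V by (simp add: sq_int_def)
 have A: "sq_int ?\<rho>" "l2_lim (%n x. F n (vec2 (f x) (g x))) (?\<rho>)"
  unfolding rv[symmetric] by (rule sq_int_dominated[OF _ _ w _ AE_I2[OF Fl]]; use Fle in \<open>simp\<close>)+
 have "wgrad ?\<rho> (%x. (((1 / ?\<rho> x) *R vec2 (f x) (g x)) $ 1) *R a x + (((1 / ?\<rho> x) *R vec2 (f x) (g x)) $ 2) *R b x)"
  by (rule wgrad_chain_closed[OF W A _ _ F'1 _ s(2,2) _ s(4,4)]) (use F'l in \<open>simp_all flip: rv\<close>)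
 thus ?thesis by (simp add: scaleR_add_right)
qed

text \<open>The diamagnetic decomposition of \<open>|\<nabla>(f + i g)|\<^sup>2\<close> into modulus and phase parts; on the zero set
 of \<open>f + i g\<close> the right-hand side vanishes because division by zero yields zero.\<close>

lemma modulus_phase_le:
 fixes a b :: "real^2" and f g :: real
 defines "\<rho> == sqrt (f^2 + g^2)"
 shows "(norm ((1 / \<rho>) *R (f *R a + g *R b)))^2 + (norm ((1 / \<rho>) *R (f *R b - g *R a)))^2 <= (norm a)^2 + (norm b)^2"
proof (cases "\<rho> = 0")
 case False
 have r: "\<rho>^2 = f^2 + g^2" by (simp add: \<rho>_def)
 have "(norm (f *R a + g *R b))^2 + (norm (f *R b - g *R a))^2 = (f^2 + g^2) * ((norm a)^2 + (norm b)^2)"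
  unfolding power2_norm_eq_inner by (simp add: inner_add inner_diff inner_commute algebra_simps power2_eq_square)
 thus ?thesis using False by (simp add: power_mult_distrib power_divide r[symmetric] add_divide_distrib[symmetric])
qed simp

text \<open>Dilates of the bump, normalized at the origin. The radial direction of the gradient is
  recorded for the sake of the rotation field, whose cutoff must not create divergence.\<close>

lemma cutoff:
 obtains c :: "nat => real^2 => real" and C where "C > 0" "!!n. c n \<in> test_functions"
  "!!n x. 0 <= c n x" "!!n x. c n x <= 1" "!!x. (%n. c n x) ----> 1"
  "!!n x i. \<bar>partial i (c n) x\<bar> <= C / (real n + 1)"
  "!!n x. EX s. grad (c n) x = s *R x"
proof -
 let ?e = "%n. 1 / (real n + 1)"
 have b0: "bump 0 > 0" by (simp add: bump_0)
 obtain B1 R1 where B1: "B1 > 0" "!!x. \<bar>partial 1 bump x\<bar> <= B1 * indicator (cball 0 R1) x"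
  using test_bounded[OF test_partial[OF bump_test, of 1]] by metis
 obtain B2 R2 where B2: "B2 > 0" "!!x. \<bar>partial 2 bump x\<bar> <= B2 * indicator (cball 0 R2) x"
  using test_bounded[OF test_partial[OF bump_test, of 2]] by metis
 have B: "\<bar>partial i bump x\<bar> <= B1 + B2" for i x
 proof -
  have "\<bar>partial 1 bump x\<bar> <= B1" "\<bar>partial 2 bump x\<bar> <= B2"
   using B1(1) B1(2)[of x] B2(1) B2(2)[of x] by (cases "norm x <= R1"; cases "norm x <= R2"; simp)+
  moreover have "i = 1 \<or> i = 2" by (rule exhaust_2)
  ultimately show ?thesis using B1(1) B2(1) by auto
 qed
 have t: "(%x. bump (?e n *R x)) \<in> test_functions" for n
  using test_affine[OF bump_test, of "?e n" 0] by simp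
 have eq: "(%x. bump (?e n *R x) / bump 0) = (%x. (1 / bump 0) * bump (0 + ?e n *R x))" for n by simp
 have p: "partial i (%x. bump (?e n *R x) / bump 0) x = (1 / bump 0) * ((?e n) * partial i bump (?e n *R x))" for i n x
  using has_grad_partial(1)[OF has_grad_mult[OF has_grad_const[of "1 / bump 0"] has_grad_affine[OF test_has_grad[OF bump_test], of 0 "?e n"]], of i x]
  unfolding eq by simp
 show thesis
 proof (rule that[of "(B1 + B2) / bump 0" "%n x. bump (?e n *R x) / bump 0"])
  show "(B1 + B2) / bump 0 > 0" using b0 B1 B2 by simp
  show "(%x. bump (?e n *R x) / bump 0) \<in> test_functions" for n
   using test_cmult[OF t[of n], of "1 / bump 0"] by simp
  show "0 <= bump (?e n *R x) / bump 0" "bump (?e n *R x) / bump 0 <= 1" for n x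
   using bump_nonneg b0 by (simp_all add: bump_0)
  show "(%n. bump (?e n *R x) / bump 0) ----> 1" for x
  proof -
   have "(%n. ?e n) ----> 0" by real_asymp
   hence "(%n. ?e n *R x) ----> 0 *R x" by (intro tendsto_intros)
   moreover have "isCont bump (0 *R x)" using test_continuous[OF bump_test, of UNIV] by (simp add: continuous_on_eq_continuous_at)
   ultimately have "(%n. bump (?e n *R x)) ----> bump (0 *R x)" by (rule isCont_tendsto_compose[rotated])
   hence "(%n. bump (?e n *R x) / bump 0) ----> bump 0 / bump 0" using b0 by (intro tendsto_divide tendsto_const) auto
   thus ?thesis using b0 by simp
  qed
  show "\<bar>partial i (%x. bump (?e n *R x) / bump 0) x\<bar> <= (B1 + B2) / bump 0 / (real n + 1)" for n x i
  proof -
   have "\<bar>(1 / bump 0) * ((?e n) * partial i bump (?e n *R x))\<bar>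
    = \<bar>partial i bump (?e n *R x)\<bar> / (bump 0 * (real n + 1))"
    using b0 by (simp add: abs_mult)
   also have "\<dots> <= (B1 + B2) / (bump 0 * (real n + 1))" using b0 by (intro divide_right_mono B) auto
   finally show ?thesis unfolding p by simp
  qed
  show "EX s. grad (%x. bump (?e n *R x) / bump 0) x = s *R x" for n x
  proof -
   define t where "t y = (hfun (0 + 2) (1 - (norm y)^2) - real 0 * hfun (0 + 1) (1 - (norm y)^2)) * (- 2)" for y :: "real^2"
   have t: "grad bump y = t y *R y" for y
    using has_grad_partial(3)[OF has_grad_hfun_ball[of 0]] unfolding bump_def[abs_def] t_def scaleR_scaleR by (rule fun_cong)
   have "grad (%x. bump (?e n *R x) / bump 0) x = (1 / bump 0 * (?e n)) *R grad bump (?e n *R x)"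
    by (simp add: vec_eq_iff p)
   thus ?thesis unfolding t scaleR_scaleR by blast
  qed
 qed
qed

text \<open>Neither function is a test function, so w is replaced by its cut mollification, which is
  one. The term in which the derivative hits the cutoff disappears because that derivative is
  uniformly small.\<close>

lemma wgrad_by_parts:
 assumes u: "wgrad u a" and w: "wgrad w b"
 shows "(LBINT x. a x $ i * w x) = - (LBINT x. u x * b x $ i)"
proof -
 note s = wgrad_sq_int[OF u] wgrad_sq_int[OF w] and S = smth[OF w]
 obtain c :: "nat => real^2 => real" and C where C: "C > 0" "!!n. c n \<in> test_functions" "!!n x. 0 <= c n x" "!!n x. c n x <= 1"
  "!!x. (%n. c n x) ----> 1" "!!n x i. \<bar>partial i (c n) x\<bar> <= C / (real n + 1)"
  by (rule cutoff, rule that, assumption+)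
 have c: "c n \<in> BM" "(%x. 1::real) \<in> BM" "\<bar>c n x\<bar> <= 1" "AE x in lborel. (%n. c n x) ----> 1" for n x
  using C(2-5) by (auto intro: test_measurable)
 have z: "(%n. C / (real n + 1)) ----> 0" by real_asymp
 have p: "partial i (c n) \<in> BM" "(%x. 0::real) \<in> BM" "\<bar>partial i (c n) x\<bar> <= C" "AE x in lborel. (%n. partial i (c n) x) ----> 0" for n x
 proof -
  show "partial i (c n) \<in> BM" by (intro test_measurable test_partial C)
  have "C / (real n + 1) <= C" using C(1) by (simp add: divide_le_eq algebra_simps)
  thus "\<bar>partial i (c n) x\<bar> <= C" using C(6) order_trans by blast
  show "AE x in lborel. (%n. partial i (c n) x) ----> 0" by (intro AE_I2 null_bound[OF z] C(6))
 qed simp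
 have nth: "smth n b x $ i = smth n (%x. b x $ i) x" for n x unfolding smth_def by (rule moll_nth[OF s(4)]) simp
 have Sb: "sq_int (smth n (%x. b x $ i))" for n
  using sq_int_nth(1)[OF S(4)[of n], of i] nth by simp
 have lb: "l2_lim (%n x. smth n (%x. b x $ i) x) (%x. b x $ i)"
  by (rule null_bound[OF S(6)])
   (use sq_int_nth(2)[OF sq_int_diff[OF S(4) s(4)], of _ i] nth in simp)
 note X1 = l2_tendsto_mult_bounded[OF c Sb sq_int_nth(1)[OF s(4)] lb, unfolded real_scaleR_def]
  and X2 = l2_tendsto_mult_bounded[OF c S(3) s(3) S(5), unfolded real_scaleR_def]
  and X3 = l2_tendsto_mult_bounded[OF p S(3) s(3) S(5), unfolded real_scaleR_def]
 have eq: "(LBINT x. (c n x * smth n (%x. b x $ i) x) \<bullet> u x) + (LBINT x. (partial i (c n) x * smth n w x) \<bullet> u x)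
   = - (LBINT x. (c n x * smth n w x) \<bullet> a x $ i)" for n
 proof -
  have t: "(%x. c n x * smth n w x) \<in> test_functions" by (rule test_mult[OF C(2) S(7)])
  have "partial i (%x. c n x * smth n w x) x = c n x * smth n (%x. b x $ i) x + partial i (c n) x * smth n w x" for x
   using has_grad_partial(1)[OF has_grad_mult[OF test_has_grad[OF C(2)] S(1)], of i n n x] nth by simp
  with wgrad_eq[OF u t, of i]
  have "(LBINT x. (c n x * smth n (%x. b x $ i) x + partial i (c n) x * smth n w x) * u x)
   = - (LBINT x. (c n x * smth n w x) * a x $ i)" by simp
  thus ?thesis
   using integrable_mult_sq_int[OF X1(1) s(1), of n] integrable_mult_sq_int[OF X3(1) s(1), of n]
   by (simp add: distrib_right)
 qed
 have z: "(%n::nat. l2 (%x::real^2. h x - h x)) ----> 0" for h :: "real^2 => real" by simp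
 note I = inner_tendsto[OF _ _ _ _ _ z]
 have "(%n. - (LBINT x. (c n x * smth n w x) \<bullet> a x $ i)) ----> (LBINT x. (1 * b x $ i) \<bullet> u x) + (LBINT x. (0 * w x) \<bullet> u x)"
  unfolding eq[symmetric] by (intro tendsto_add I X1 X3 s)
 moreover have "(%n. LBINT x. (c n x * smth n w x) \<bullet> a x $ i) ----> (LBINT x. (1 * w x) \<bullet> a x $ i)"
  by (intro I X2 sq_int_nth s)
 ultimately show ?thesis using LIMSEQ_unique[OF _ tendsto_minus] by (fastforce simp: mult.commute)
qed

text \<open>For a mollified function the increment is the average of the directional derivative over
  the segment from x to x + h; \<open>averaging_jensen\<close> with the indicator of the unit
  interval bounds it, and the bound survives the removal of the mollification.\<close>

lemma wgrad_translate_le: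
 assumes u: "wgrad u g"
 shows "sqn (%x. u (x + h) - u x) <= (norm h)^2 * sqn g"
proof -
 note s = wgrad_sq_int[OF u] and S = smth[OF u]
 note [measurable] = S(4)[THEN sq_int_measurable]
 have key: "sqn (%x. smth n u (x + h) - smth n u x) <= (norm h)^2 * sqn g" for n
 proof -
  define K :: "real => real" where "K = indicator {0..1}"
  let ?G = "%x t. smth n g (x + t *R h) \<bullet> h"
  have eq: "smth n u (x + h) - smth n u x = (LBINT t. K t *R ?G x t)" for x
  proof -
   have d: "((%t. smth n u (x + t *R h)) has_vector_derivative ?G x t) (at t within {0..1})" for t
   proof -
    have "((%t. x + t *R h) has_derivative (%t. t *R h)) (at t)" by (auto intro!: derivative_eq_intros)
    from has_derivative_compose[OF this S(1)[unfolded has_grad_def, rule_format]]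
    have "((%t. smth n u (x + t *R h)) has_vector_derivative ?G x t) (at t)" by (simp add: has_vector_derivative_def)
    thus ?thesis by (rule has_vector_derivative_at_within)
   qed
   have c: "continuous_on {0..1} (?G x)"
    by (intro continuous_intros continuous_on_compose2[OF S(2)]) auto
   have "(LBINT t. indicator {0..1} t *R ?G x t) = smth n u (x + 1 *R h) - smth n u (x + 0 *R h)"
    by (rule integral_FTC_Icc) (use d c in auto)
   thus ?thesis by (simp add: K_def)
  qed
  have B: "sq_int (%x. ?G x t)" "sqn (%x. ?G x t) <= (norm h)^2 * sqn g" for t
  proof -
   note sh = sq_int_shift[OF S(4)[of n], of "t *R h"]
   have [measurable]: "(%x. smth n g (x + t *R h)) \<in> BM" using sh(1) by (rule sq_int_measurable)
   have le: "AE x in lborel. norm (?G x t) <= norm h * norm (smth n g (x + t *R h))"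
    by (rule AE_I2) (metis Cauchy_Schwarz_ineq2 mult.commute real_norm_def)
   have m: "(%x. ?G x t) \<in> BM" by measurable
   note b = sq_int_bound[OF sh(1) m le]
   show "sq_int (%x. ?G x t)" by (rule b)
   have "sqn (smth n g) <= sqn g" unfolding smth_def by (rule moll_sq_int[OF kernel_bkern s(2)])
   hence "(norm h)^2 * sqn (smth n g) <= (norm h)^2 * sqn g" by (intro mult_left_mono) auto
   thus "sqn (%x. ?G x t) <= (norm h)^2 * sqn g" using b(2) sh(2) by simp
  qed
  have "sqn (%x. LBINT t. K t *R ?G x t) <= (LBINT t. K t * ((norm h)^2 * sqn g))"
  proof (rule averaging_jensen(2)[OF _ _ _ _ B])
   show "(%(x, t). ?G x t) \<in> borel_measurable (lborel \<Otimes>\<^sub>M lborel)" by measurable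
  qed (auto simp: K_def)
  also have "\<dots> = (norm h)^2 * sqn g" by (simp add: K_def)
  finally show ?thesis unfolding eq .
 qed
 have "(%n. sqn (%x. smth n u (x + h) - smth n u x)) ----> sqn (%x. u (x + h) - u x)"
 proof (rule l2_tendsto_imp_sqn_tendsto)
  show "sq_int (%x. smth n u (x + h) - smth n u x)" for n by (intro sq_int_diff sq_int_shift S)
  show "sq_int (%x. u (x + h) - u x)" by (intro sq_int_diff sq_int_shift s)
  show "(%n. l2 (%x. smth n u (x + h) - smth n u x - (u (x + h) - u x))) ----> 0"
  proof (rule null_bound[OF tendsto_add_zero[OF S(5) S(5)]])
   fix n
   have d: "sq_int (%x. smth n u x - u x)" by (intro sq_int_diff S s)
   have "l2 (%x. (smth n u (x + h) - u (x + h)) - (smth n u x - u x)) <= l2 (%x. smth n u (x + h) - u (x + h)) + l2 (%x. smth n u x - u x)"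
    by (intro l2_triangle_diff d sq_int_shift(1)[OF d])
   thus "\<bar>l2 (%x. smth n u (x + h) - smth n u x - (u (x + h) - u x))\<bar> <= l2 (%x. smth n u x - u x) + l2 (%x. smth n u x - u x)"
    using sq_int_shift(3)[OF d, of h] by (simp add: algebra_simps)
  qed
 qed
 thus ?thesis by (rule LIMSEQ_le_const2) (use key in auto)
qed

text \<open>The kernel lives in the unit ball, so the mollification averages translates by at most
  the scale; the translation estimate then gives a rate that is uniform over bounded sets of
  H1.\<close>

lemma smth_dist_le:
 assumes u: "wgrad u g"
 shows "l2 (%x. smth n u x - u x) <= (1 / (real n + 1)) * l2 g"
proof -
 define e where "e = 1 / (real n + 1)"
 have e: "e > 0" by (simp add: e_def)
 note s = wgrad_sq_int[OF u]
 have K: "0 <= bkern z" "integrable lborel bkern" "(LBINT z. bkern z) = 1" for z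
  using kernel_bkern by (auto simp: kernel_def)
 have [measurable]: "bkern \<in> BM" by (rule test_measurable[OF bkern_test])
 have K1: "bkern z * (norm z)^2 <= bkern z" for z
 proof (cases "norm z <= 1")
  case True
  hence "(norm z)^2 <= 1" by (simp add: power_le_one)
  thus ?thesis using K(1)[of z] by (simp add: mult_left_le)
 next
  case False
  hence "bump z = 0" using one_le_power[of "norm z" 2] by (simp add: bump_def hfun_def not_less)
  thus ?thesis by (simp add: bkern_def)
 qed
 have i: "integrable lborel (%z. bkern z * (norm z)^2)"
  by (rule Bochner_Integration.integrable_bound[OF K(2)]) (use K1 K(1) in \<open>auto simp: abs_mult\<close>)
 have "sqn (%x. moll bkern e u x - u x) <= (LBINT z. bkern z * ((e * norm z)^2 * sqn g))"
 proof (rule moll_diff_le[OF kernel_bkern s(1) e])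
  show "sqn (%x. u (x - e *R z) - u x) <= (e * norm z)^2 * sqn g" for z
   using wgrad_translate_le[OF u, of "- e *R z"] e by simp
  show "integrable lborel (%z. bkern z * ((e * norm z)^2 * sqn g))"
   using integrable_mult_right[OF i, of "e^2 * sqn g"] by (simp add: power_mult_distrib mult_ac)
 qed
 also have "\<dots> = (e^2 * sqn g) * (LBINT z. bkern z * (norm z)^2)"
  unfolding integral_mult_right_zero[symmetric] by (simp add: power_mult_distrib mult_ac)
 also have "\<dots> <= (e^2 * sqn g) * (LBINT z. bkern z)"
  by (intro mult_left_mono integral_mono i K K1) auto
 also have "\<dots> = e^2 * sqn g" using K by simp
 finally have "sqrt (sqn (%x. moll bkern e u x - u x)) <= sqrt (e^2 * sqn g)" by (rule real_sqrt_le_mono)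
 thus ?thesis using e by (simp add: smth_def e_def l2_def real_sqrt_mult)
qed

section \<open>Local compactness\<close>

lemma smth_bound:
 fixes u :: "real^2 => 'b::euclidean_space"
 assumes u: "sq_int u"
 shows "norm (smth n u x) <= l2 bkern * (real n + 1) * l2 u"
proof -
 define e where "e = 1 / (real n + 1)"
 have e: "e > 0" by (simp add: e_def)
 have sh: "sq_int (%z. u (x + (- e) *R z))" "sqn (%z. u (x + (- e) *R z)) = sqn u / e^2"
  using sq_int_affine[of "- e" u x] u e by auto
 have K: "sq_int bkern" "!!z. 0 <= bkern z" using kernel_bkern by (auto simp: kernel_def)
 have "norm (moll bkern e u x) <= (LBINT z. norm (bkern z *R u (x - e *R z)))"
  unfolding moll_def by (rule integral_norm_bound)
 also have "\<dots> = (LBINT z. norm (bkern z) * norm (u (x + (- e) *R z)))" by simp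
 also have "\<dots> <= l2 bkern * l2 (%z. u (x + (- e) *R z))" by (rule l2_cauchy_schwarz[OF K(1) sh(1)])
 also have "l2 (%z. u (x + (- e) *R z)) = (real n + 1) * l2 u"
  using e unfolding l2_def sh(2) by (simp add: real_sqrt_divide e_def)
 finally show ?thesis by (simp add: smth_def e_def mult_ac)
qed

text \<open>For fixed k the mollifications at scale 1 / (k + 1) are uniformly bounded and Lipschitz,
  so a diagonal subsequence that converges on a countable dense set converges everywhere. By
  \<open>smth_dist_le\<close> they approximate the sequence uniformly in n, and the Gaussian weight
  makes this a weighted Cauchy property in L1. Only almost everywhere convergence results: mass may
  still escape to infinity.\<close>

lemma rellich_AE:
 fixes u :: "nat => real^2 => real"
 assumes u: "!!n. wgrad (u n) (g n)" and B: "!!n. l2 (u n) <= B" "!!n. l2 (g n) <= B"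
 obtains r :: "nat => nat" and u0 where "strict_mono r" "u0 \<in> BM"
  "AE x in lborel. (%n. u (r n) x) ----> u0 x"
proof -
 note su = wgrad_sq_int[OF u]
 have B0: "B >= 0" using B(1)[of 0] l2_nonneg order_trans by blast
 define M where "M = l2 bkern * B"
 have M0: "M >= 0" using B0 by (simp add: M_def)
 have bd: "\<bar>smth k (u n) x\<bar> <= M * (real k + 1)" "norm (smth k (g n) x) <= M * (real k + 1)" for k n x
 proof -
  have "l2 bkern * (real k + 1) * l2 (u n) <= l2 bkern * (real k + 1) * B" "l2 bkern * (real k + 1) * l2 (g n) <= l2 bkern * (real k + 1) * B"
   by (intro mult_left_mono B; simp)+
  thus "\<bar>smth k (u n) x\<bar> <= M * (real k + 1)" "norm (smth k (g n) x) <= M * (real k + 1)"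
   using smth_bound[OF su(1), of k n x] smth_bound[OF su(2), of k n x] by (simp_all add: M_def mult_ac)
 qed
 obtain D :: "(real^2) set" where D: "countable D" "!!X. open X ==> X ~= {} ==> \<exists>d\<in>D. d \<in> X"
  using countable_dense_setE by blast
 \<comment> \<open>Division by k + 1 gives one bound M for all scales, as the diagonal selection
   over pairs of scale and point requires.\<close>
 define f where "f n p = smth (fst p) (u n) (snd p) / (real (fst p) + 1)" for n and p :: "nat \<times> (real^2)"
 have "countable (UNIV \<times> D :: (nat \<times> (real^2)) set)" using D(1) by simp
 moreover have "norm (f n p) <= M" for n p
  using bd(1)[of "fst p" n "snd p"] by (simp add: f_def divide_le_eq add_nonneg_pos)
 ultimately obtain r :: "nat => nat" where r: "strict_mono r" "!!p. p \<in> UNIV \<times> D ==> EX l. (%n. f (r n) p) ----> l"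
  by (metis function_convergent_subsequence)
 have cD: "convergent (%n. smth k (u (r n)) d)" if "d \<in> D" for k d
 proof -
  obtain l where "(%n. f (r n) (k, d)) ----> l" using r(2)[of "(k, d)"] \<open>d \<in> D\<close> by auto
  hence "(%n. (real k + 1) * f (r n) (k, d)) ----> (real k + 1) * l" by (intro tendsto_intros)
  thus ?thesis by (auto simp: f_def convergent_def)
 qed
 have lip: "\<bar>smth k (u n) x - smth k (u n) y\<bar> <= M * (real k + 1) * norm (x - y)" for k n x y
 proof -
  obtain t where "smth k (u n) (y + (x - y)) - smth k (u n) y = smth k (g n) (y + t *R (x - y)) \<bullet> (x - y)"
   using has_grad_mvt[OF smth(1)[OF u], of k n y "x - y"] by metis
  hence "\<bar>smth k (u n) x - smth k (u n) y\<bar> <= norm (smth k (g n) (y + t *R (x - y))) * norm (x - y)"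
   using Cauchy_Schwarz_ineq2[of "smth k (g n) (y + t *R (x - y))" "x - y"] by simp
  also have "\<dots> <= M * (real k + 1) * norm (x - y)" by (intro mult_right_mono bd) auto
  finally show ?thesis .
 qed
 have conv: "convergent (%n. smth k (u (r n)) x)" for k x
 proof -
  have "Cauchy (%n. smth k (u (r n)) x)"
  proof (rule metric_CauchyI)
   fix e :: real assume e: "e > 0"
   define L where "L = M * (real k + 1) + 1"
   have L: "L > 0" using M0 by (simp add: L_def add_nonneg_pos)
   have q: "e / (4 * L) > 0" by (rule divide_pos_pos) (use e L in auto)
   have "\<exists>d\<in>D. d \<in> ball x (e / (4 * L))"
   proof (rule D(2))
    show "ball x (e / (4 * L)) ~= {}" using q by (simp only: ball_eq_empty not_le)
   qed simp
   then obtain d where d: "d \<in> D" "d \<in> ball x (e / (4 * L))" by blast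
   have nd: "norm (x - d) < e / (4 * L)" using d(2) by (simp add: dist_norm)
   have c1: "\<bar>smth k (u n) x - smth k (u n) d\<bar> < e / 4" for n
   proof -
    have "\<bar>smth k (u n) x - smth k (u n) d\<bar> <= L * norm (x - d)"
     using lip[of k n x d] by (simp add: L_def distrib_right add_increasing2)
    also have "\<dots> < L * (e / (4 * L))" by (rule mult_strict_left_mono[OF nd L])
    finally show ?thesis using L by simp
   qed
   have "Cauchy (%n. smth k (u (r n)) d)" using cD[OF d(1)] by (simp add: Cauchy_convergent_iff)
   then obtain N where N: "!!m n. m >= N ==> n >= N ==> dist (smth k (u (r m)) d) (smth k (u (r n)) d) < e / 4"
    using metric_CauchyD[of _ "e/4"] e by (metis zero_less_divide_iff zero_less_numeral)
   show "EX N. ALL m>=N. ALL n>=N. dist (smth k (u (r m)) x) (smth k (u (r n)) x) < e"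
   proof (intro exI[of _ N] allI impI)
    fix m n assume "N <= m" "N <= n"
    thus "dist (smth k (u (r m)) x) (smth k (u (r n)) x) < e"
     using N[of m n] c1[of "r m"] c1[of "r n"] unfolding dist_real_def by linarith
   qed
  qed
  thus ?thesis by (simp add: Cauchy_convergent_iff)
 qed
 define w :: "real^2 => real" where "w = (%x. exp (- 1 * (norm x)^2))"
 have w: "sq_int w" "!!x. w x > 0" "integrable lborel w"
  using sq_int_gaussian[of 1, where 'a="real^2"] gaussian_integrable[of 1, where 'a="real^2"] by (auto simp: w_def)
 have [measurable]: "u n \<in> BM" "smth k (u n) \<in> BM" "w \<in> BM" for n k
  using su(1) smth(3)[OF u] w(1) by (auto dest: sq_int_measurable)
 have WC: "EX N. ALL i>=N. ALL j>=N. (LBINT x. w x * norm (u (r i) x - u (r j) x)) < e" if e: "e > 0" for e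
 proof -
  define A where "A = l2 w * B + 1"
  have A: "A > 0" using B0 by (simp add: A_def add_nonneg_pos)
  obtain k where k: "A / (real k + 1) < e / 4"
  proof -
   obtain k where "4 * A / e < real k" using reals_Archimedean2 by blast
   hence "4 * A / e < real k + 1" by simp
   thus thesis using that[of k] e A by (simp add: field_simps)
  qed
  define v where "v x = lim (%n. smth k (u (r n)) x)" for x
  have v: "(%n. smth k (u (r n)) x) ----> v x" for x using conv[of k x] by (simp add: convergent_LIMSEQ_iff v_def)
  have [measurable]: "v \<in> BM" unfolding v_def by measurable
  have vb: "\<bar>v x\<bar> <= M * (real k + 1)" for x
   by (rule tendsto_upperbound[OF tendsto_rabs[OF v]]) (use bd in auto)
  have le: "norm (w x * \<bar>smth k (u n) x - v x\<bar>) <= w x * (2 * (M * (real k + 1)))" for n x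
  proof -
   have "\<bar>smth k (u n) x - v x\<bar> <= 2 * (M * (real k + 1))" using bd(1)[of k n x] vb[of x] by linarith
   thus ?thesis using w(2)[of x] by (simp add: abs_mult mult_left_mono)
  qed
  have "(%n. LBINT x. w x * \<bar>smth k (u (r n)) x - v x\<bar>) ----> (\<integral>x. 0 \<partial>(lborel :: (real^2) measure))"
  proof (rule integral_dominated_convergence[where w="%x. w x * (2 * (M * (real k + 1)))"])
   show "AE x in lborel. (%n. w x * \<bar>smth k (u (r n)) x - v x\<bar>) ----> 0"
    using tendsto_rabs_zero[OF LIM_zero[OF v]] by (intro AE_I2 tendsto_mult_right_zero) simp
  qed (use w le in auto)
  hence "(%n. LBINT x. w x * \<bar>smth k (u (r n)) x - v x\<bar>) ----> 0" by simp
  from order_tendstoD(2)[OF this, of "e/4"] e obtain N where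
   N: "!!n. n >= N ==> (LBINT x. w x * \<bar>smth k (u (r n)) x - v x\<bar>) < e / 4" by (auto simp: eventually_sequentially)
  have iv: "integrable lborel (%x. w x * \<bar>smth k (u n) x - v x\<bar>)" for n
   by (rule Bochner_Integration.integrable_bound[of _ "%x. w x * (2 * (M * (real k + 1)))"]) (use w order_trans[OF le abs_ge_self] in auto)
  have iu: "integrable lborel (%x. w x * \<bar>smth k (u n) x - u n x\<bar>)" "(LBINT x. w x * \<bar>smth k (u n) x - u n x\<bar>) < e / 4" for n
  proof -
   have d: "sq_int (%x. smth k (u n) x - u n x)" by (intro sq_int_diff smth[OF u] su)
   show "integrable lborel (%x. w x * \<bar>smth k (u n) x - u n x\<bar>)"
    by (rule integrable_sq_int_bound[OF w(1) d]) (auto simp: abs_mult)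
   have "(LBINT x. w x * \<bar>smth k (u n) x - u n x\<bar>) <= l2 w * l2 (%x. smth k (u n) x - u n x)"
    using l2_cauchy_schwarz[OF w(1) d] w(2) by (simp add: less_imp_le)
   also have "\<dots> <= l2 w * ((1 / (real k + 1)) * l2 (g n))" by (intro mult_left_mono smth_dist_le[OF u]) auto
   also have "\<dots> <= l2 w * ((1 / (real k + 1)) * B)" by (intro mult_left_mono B) auto
   also have "\<dots> = (l2 w * B) / (real k + 1)" by simp
   also have "\<dots> <= A / (real k + 1)" by (intro divide_right_mono) (auto simp: A_def)
   finally show "(LBINT x. w x * \<bar>smth k (u n) x - u n x\<bar>) < e / 4" using k by (rule order.strict_trans1)
  qed
  show ?thesis
  proof (intro exI[of _ N] allI impI)
   fix i j assume ij: "N <= i" "N <= j"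
   let ?a = "%n x. w x * \<bar>smth k (u n) x - u n x\<bar>" and ?b = "%n x. w x * \<bar>smth k (u n) x - v x\<bar>"
   have "(LBINT x. w x * norm (u (r i) x - u (r j) x)) <= (LBINT x. (?a (r i) x + ?b (r i) x) + (?a (r j) x + ?b (r j) x))"
   proof (rule integral_mono)
    show "integrable lborel (%x. w x * norm (u (r i) x - u (r j) x))"
     by (rule integrable_sq_int_bound[OF w(1) sq_int_diff[OF su(1)[of "r i"] su(1)[of "r j"]]]) (auto simp: abs_mult)
    show "integrable lborel (%x. (?a (r i) x + ?b (r i) x) + (?a (r j) x + ?b (r j) x))"
     by (intro Bochner_Integration.integrable_add iu(1) iv)
    fix x
    have "norm (u (r i) x - u (r j) x) <= \<bar>smth k (u (r i)) x - u (r i) x\<bar> + \<bar>smth k (u (r i)) x - v x\<bar>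
      + (\<bar>smth k (u (r j)) x - u (r j) x\<bar> + \<bar>smth k (u (r j)) x - v x\<bar>)" unfolding real_norm_def by linarith
    thus "w x * norm (u (r i) x - u (r j) x) <= (?a (r i) x + ?b (r i) x) + (?a (r j) x + ?b (r j) x)"
     using mult_left_mono[OF _ less_imp_le[OF w(2)[of x]]] unfolding distrib_left[symmetric] by blast
   qed
   also have "\<dots> = ((LBINT x. ?a (r i) x) + (LBINT x. ?b (r i) x)) + ((LBINT x. ?a (r j) x) + (LBINT x. ?b (r j) x))"
    using iu(1) iv by (simp add: Bochner_Integration.integral_add)
   also have "\<dots> < e" using N[OF ij(1)] N[OF ij(2)] iu(2)[of "r i"] iu(2)[of "r j"] by linarith
   finally show "(LBINT x. w x * norm (u (r i) x - u (r j) x)) < e" .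
  qed
 qed
 obtain r' :: "nat => nat" and u0 where r': "strict_mono r'" "u0 \<in> BM" "AE x in lborel. (%n. u (r (r' n)) x) ----> u0 x"
  by (rule weighted_cauchy_AE_subseq[of "%n. u (r n)" w, OF su(1) w(1,2) WC])
 show thesis
  by (rule that[of "r \<circ> r'" u0]) (use r' strict_mono_o[OF r(1) r'(1)] in auto)
qed

section \<open>Weak limits by convex combinations\<close>

lemma subseq_away:
 fixes X :: "nat => 'a::metric_space"
 assumes "\<not> X ----> L"
 obtains e and s :: "nat => nat" where "e > 0" "strict_mono s" "!!n. dist (X (s n)) L >= e"
proof -
 from assms obtain e where e: "e > 0" "!!N. EX n>=N. dist (X n) L >= e"
  unfolding LIMSEQ_def by (meson not_less)
 hence "infinite {n. dist (X n) L >= e}"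
  unfolding infinite_nat_iff_unbounded_le by auto
 then obtain s :: "nat => nat" where "strict_mono s" "!!n. s n \<in> {n. dist (X n) L >= e}"
  using infinite_enumerate by blast
 thus thesis using that e(1) by auto
qed

lemma bounded_subseq_limit:
 fixes X :: "nat => real"
 assumes "!!n. \<bar>X n\<bar> <= B"
 obtains s :: "nat => nat" and L where "strict_mono s" "(%n. X (s n)) ----> L"
proof -
 have "bounded (range X)" using assms by (auto simp: bounded_iff)
 thus thesis using bounded_imp_convergent_subsequence[of X] that by (auto simp: o_def)
qed

lemma midhull_wgrad:
 assumes "h \<in> midhull (%k x. (u k x, g k x)) m" "!!k. wgrad (u k) (g k)"
 shows "wgrad (%x. fst (h x)) (%x. snd (h x))"
 using assms
proof (induction rule: midhull.induct)
 case (mid f h)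
 show ?case using wgrad_cmult[OF wgrad_add[OF mid(3)[OF mid(5)] mid(4)[OF mid(5)]], of "1/2"] by simp
qed auto

lemma midhull_sqn:
 assumes "h \<in> midhull (%k x. (u k x, g k x)) m" "!!k. wgrad (u k) (g k)" "!!k. sqn (g k) <= C"
 shows "sqn (%x. snd (h x)) <= C"
 using assms
proof (induction rule: midhull.induct)
 case (mid f h)
 note w = midhull_wgrad[OF mid(1) mid(5)] midhull_wgrad[OF mid(2) mid(5)]
 note s = wgrad_sq_int(2)[OF w(1)] wgrad_sq_int(2)[OF w(2)]
 show ?case using sqn_scaleR[of "1/2" "%x. snd (f x) + snd (h x)"] sqn_add_le[OF s] mid(3)[OF mid(5,6)] mid(4)[OF mid(5,6)]
  by (simp add: power2_eq_square)
qed auto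

lemma midhull_close:
 assumes "h \<in> midhull (%k x. (u k x, g k x)) m" "!!k. k >= m ==> \<bar>u k x - a\<bar> <= e"
 shows "\<bar>fst (h x) - a\<bar> <= (e::real)"
 using assms
proof (induction rule: midhull.induct)
 case (mid f h)
 have "\<bar>fst (f x) - a\<bar> <= e" "\<bar>fst (h x) - a\<bar> <= e" using mid.IH mid.prems by blast+
 thus ?case by (auto simp: abs_le_iff field_simps)
qed auto

lemma midhull_inner_close:
 assumes "h \<in> midhull (%k x. (u k x, g k x)) m" "!!k. wgrad (u k) (g k)" "sq_int \<psi>"
  "!!k. k >= m ==> \<bar>(LBINT x. \<psi> x \<bullet> g k x) - a\<bar> <= e"
 shows "\<bar>(LBINT x. \<psi> x \<bullet> snd (h x)) - a\<bar> <= e"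
 using assms
proof (induction rule: midhull.induct)
 case (mid f h)
 note w = midhull_wgrad[OF mid(1) mid(5)] midhull_wgrad[OF mid(2) mid(5)]
 note s = wgrad_sq_int(2)[OF w(1)] wgrad_sq_int(2)[OF w(2)]
 have "(LBINT x. \<psi> x \<bullet> snd ((1/2) *R (f x + h x))) = (1/2) * ((LBINT x. \<psi> x \<bullet> snd (f x)) + (LBINT x. \<psi> x \<bullet> snd (h x)))"
  using integrable_inner[OF mid(6) s(1)] integrable_inner[OF mid(6) s(2)] by (simp add: inner_add_right)
 thus ?case using mid(3)[OF mid(5-7)] mid(4)[OF mid(5-7)]
  by (auto simp: abs_le_iff field_simps)
qed auto

text \<open>\<open>mazur\<close> is applied to the pairs (u, g). Midpoints of a pointwise convergent
  sequence keep its limit, so the first component of the strong limit is u0, and closedness of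
  \<open>wgrad\<close> makes the second component its gradient. A convergent pairing with g keeps
  its limit under midpoints as well, which identifies L.\<close>

lemma weak_limit_subseq:
 assumes u: "!!n::nat. wgrad (u n) (g n)" and B: "!!n. sqn (u n) <= A" "!!n. sqn (g n) <= C"
  and lim: "AE x in lborel. (%n. u n x) ----> u0 x" and m[measurable]: "u0 \<in> BM"
 obtains g0 where "wgrad u0 g0" "sqn g0 <= C"
  "!!\<psi> L. sq_int \<psi> ==> (%n. LBINT x. \<psi> x \<bullet> g n x) ----> L ==> L = (LBINT x. \<psi> x \<bullet> g0 x)"
proof -
 define G where "G = (%k x. (u k x, g k x))"
 note su = wgrad_sq_int[OF u]
 have Gm: "G k \<in> BM" for k
  unfolding G_def by (intro borel_measurable_Pair) (use su in \<open>auto dest: sq_int_measurable\<close>)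
 have Gn: "(norm (G k x))^2 = (norm (u k x))^2 + (norm (g k x))^2" for k x
  by (simp add: G_def norm_Pair)
 have sG: "sq_int (G k)" for k
  unfolding sq_int_def Gn using Gm[of k] sq_int_integrable[OF su(1)[of k]] sq_int_integrable[OF su(2)[of k]] by simp
 have "sqn (G k) = sqn (u k) + sqn (g k)" for k
  unfolding sqn_def Gn using sq_int_integrable[OF su(1)[of k]] sq_int_integrable[OF su(2)[of k]] by simp
 hence GB: "sqn (G k) <= A + C" for k using B[of k] by simp
 obtain h q where h: "!!m. h m \<in> midhull G m" and q: "sq_int q" "l2_lim h q"
  by (rule mazur[of G "A + C", OF sG GB], rule that, assumption+)
 have hw: "wgrad (%x. fst (h m x)) (%x. snd (h m x))" for m
  using midhull_wgrad[OF h[unfolded G_def] u] .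
 note [measurable] = q(1)[THEN sq_int_measurable] midhull_sq_int[OF h sG, THEN sq_int_measurable]
 have mfst: "(%x. fst (q x)) \<in> BM" "(%x. snd (q x)) \<in> BM"
 proof -
  have f: "(fst :: real \<times> (real^2) => _) \<in> BM" "(snd :: real \<times> (real^2) => _) \<in> BM"
   by (intro borel_measurable_continuous_onI continuous_on_fst continuous_on_snd continuous_on_id)+
  show "(%x. fst (q x)) \<in> BM" "(%x. snd (q x)) \<in> BM"
   using measurable_compose[OF sq_int_measurable[OF q(1)] f(1)] measurable_compose[OF sq_int_measurable[OF q(1)] f(2)] by simp_all
 qed
 have fs: "norm (fst p) <= 1 * norm p" "norm (snd p) <= 1 * norm p" for p :: "real \<times> (real^2)"
  using norm_fst_le[of "fst p" "snd p"] norm_snd_le[of "snd p" "fst p"] by simp_all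
 have q12: "sq_int (%x. fst (q x))" "sq_int (%x. snd (q x))"
  by (rule l2_bound(1)[OF q(1), where c=1]; use mfst fs in simp)+
 have hd: "sq_int (%x. h m x - q x)" for m by (intro sq_int_diff midhull_sq_int[OF h sG] q)
 have l12: "l2_lim (%m x. fst (h m x)) (%x. fst (q x))" "l2_lim (%m x. snd (h m x)) (%x. snd (q x))"
 proof -
  have 1: "l2 (%x. fst (h m x) - fst (q x)) <= 1 * l2 (%x. h m x - q x)" for m
  proof (rule l2_bound(2)[OF hd])
   show "(%x. fst (h m x) - fst (q x)) \<in> BM"
    by (rule sq_int_measurable[OF sq_int_diff[OF wgrad_sq_int(1)[OF hw] q12(1)]])
   show "norm (fst (h m x) - fst (q x)) <= 1 * norm (h m x - q x)" for x using fs(1)[of "h m x - q x"] by simp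
  qed simp
  have 2: "l2 (%x. snd (h m x) - snd (q x)) <= 1 * l2 (%x. h m x - q x)" for m
  proof (rule l2_bound(2)[OF hd])
   show "(%x. snd (h m x) - snd (q x)) \<in> BM"
    by (rule sq_int_measurable[OF sq_int_diff[OF wgrad_sq_int(2)[OF hw] q12(2)]])
   show "norm (snd (h m x) - snd (q x)) <= 1 * norm (h m x - q x)" for x using fs(2)[of "h m x - q x"] by simp
  qed simp
  show "l2_lim (%m x. fst (h m x)) (%x. fst (q x))" "l2_lim (%m x. snd (h m x)) (%x. snd (q x))"
   by (rule null_bound[OF q(2)]; use 1 2 in simp)+
 qed
 have wq: "wgrad (%x. fst (q x)) (%x. snd (q x))" by (rule wgrad_closed[OF hw q12 l12])
 obtain r :: "nat => nat" where r: "strict_mono r" "AE x in lborel. (%n. fst (h (r n) x)) ----> fst (q x)"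
  by (rule l2_lim_AE_subseq[OF wgrad_sq_int(1)[OF hw] q12(1) l12(1)])
 have hu: "AE x in lborel. (%m. fst (h m x)) ----> u0 x"
  using lim
 proof eventually_elim
  case (elim x)
  show ?case
  proof (rule LIMSEQ_I)
   fix e :: real assume e: "e > 0"
   then obtain N where N: "!!n. n >= N ==> \<bar>u n x - u0 x\<bar> < e/2" using LIMSEQ_D[OF elim, of "e/2"] by auto
   show "EX no. ALL n>=no. norm (fst (h n x) - u0 x) < e"
   proof (intro exI[of _ N] allI impI)
    fix n assume n: "n >= N"
    have "\<bar>fst (h n x) - u0 x\<bar> <= e/2"
     by (rule midhull_close[OF h[unfolded G_def]]) (use N n in \<open>auto intro: less_imp_le\<close>)
    thus "norm (fst (h n x) - u0 x) < e" using e by simp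
   qed
  qed
 qed
 have eq: "AE x in lborel. fst (q x) = u0 x"
  using r(2) hu
 proof eventually_elim
  case (elim x)
  from LIMSEQ_unique[OF elim(1) LIMSEQ_subseq_LIMSEQ[OF elim(2) r(1), unfolded o_def]] show ?case .
 qed
 have w0: "wgrad u0 (%x. snd (q x))"
  by (rule wgrad_cong_AE[OF wq eq]) (use m mfst(2) in auto)
 show thesis
 proof (rule that[OF w0])
  have "(%m. sqn (%x. snd (h m x))) ----> sqn (%x. snd (q x))"
   by (rule l2_tendsto_imp_sqn_tendsto[OF wgrad_sq_int(2)[OF hw] q12(2) l12(2)])
  thus "sqn (%x. snd (q x)) <= C"
   by (rule LIMSEQ_le_const2) (use midhull_sqn[OF h[unfolded G_def] u B(2)] in auto)
  fix \<psi> :: "real^2 => real^2" and L assume psi: "sq_int \<psi>" and L: "(%n. LBINT x. \<psi> x \<bullet> g n x) ----> L"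
  have z: "(%n::nat. l2 (%x::real^2. \<psi> x - \<psi> x)) ----> 0" by simp
  have 1: "(%m. LBINT x. \<psi> x \<bullet> snd (h m x)) ----> (LBINT x. \<psi> x \<bullet> snd (q x))"
   by (rule inner_tendsto[OF psi psi wgrad_sq_int(2)[OF hw] q12(2) z l12(2)])
  have "(%m. LBINT x. \<psi> x \<bullet> snd (h m x)) ----> L"
  proof (rule LIMSEQ_I)
   fix e :: real assume e: "e > 0"
   then obtain N where N: "!!n. n >= N ==> \<bar>(LBINT x. \<psi> x \<bullet> g n x) - L\<bar> < e/2" using LIMSEQ_D[OF L, of "e/2"] by auto
   show "EX no. ALL n>=no. norm ((LBINT x. \<psi> x \<bullet> snd (h n x)) - L) < e"
   proof (intro exI[of _ N] allI impI)
    fix n assume n: "n >= N"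
    have "\<bar>(LBINT x. \<psi> x \<bullet> snd (h n x)) - L\<bar> <= e/2"
     by (rule midhull_inner_close[OF h[unfolded G_def] u psi]) (use N n in \<open>auto intro: less_imp_le\<close>)
    thus "norm ((LBINT x. \<psi> x \<bullet> snd (h n x)) - L) < e" using e by simp
   qed
  qed
  from LIMSEQ_unique[OF this 1] show "L = (LBINT x. \<psi> x \<bullet> snd (q x))" .
 qed
qed

text \<open>Along any subsequence on which the pairing converges, \<open>weak_limit_subseq\<close>
  represents the limit by a gradient of u0, and \<open>wgrad_unique\<close> makes this gradient the
  same each time. Hence the whole sequence of pairings converges.\<close>

lemma weak_limit:
 assumes u: "!!n::nat. wgrad (u n) (g n)" and B: "!!n. sqn (u n) <= A" "!!n. sqn (g n) <= C"
  and lim: "AE x in lborel. (%n. u n x) ----> u0 x" and m: "u0 \<in> BM"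
 obtains g0 where "wgrad u0 g0" "sqn u0 <= A" "sqn g0 <= C"
  "!!\<psi>. sq_int \<psi> ==> (%n. LBINT x. \<psi> x \<bullet> g n x) ----> (LBINT x. \<psi> x \<bullet> g0 x)"
proof -
 note su = wgrad_sq_int[OF u]
 obtain g0 where g0: "wgrad u0 g0" "sqn g0 <= C"
  by (rule weak_limit_subseq[OF u B lim m])
 show thesis
 proof (rule that[OF g0(1) _ g0(2)])
  note [measurable] = su(1)[THEN sq_int_measurable] m
  show "sqn u0 <= A" unfolding sqn_def
   by (rule fatou_integral(2)[OF sq_int_integrable[OF su(1)]])
    (use B(1) lim in \<open>auto simp: sqn_def intro: tendsto_intros elim!: eventually_mono\<close>)
  fix \<psi> :: "real^2 => real^2" assume psi: "sq_int \<psi>"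
  show "(%n. LBINT x. \<psi> x \<bullet> g n x) ----> (LBINT x. \<psi> x \<bullet> g0 x)" (is "?X ----> ?L")
  proof (rule ccontr)
   assume nl: "\<not> ?X ----> ?L"
   obtain e and s :: "nat => nat" where e: "e > 0" "strict_mono s" "!!n. dist (?X (s n)) ?L >= e"
    by (rule subseq_away[OF nl], rule that, assumption+)
   have "\<bar>?X n\<bar> <= l2 \<psi> * sqrt C" for n
   proof -
    have "l2 (g n) <= sqrt C" unfolding l2_def by (intro real_sqrt_le_mono B)
    hence "l2 \<psi> * l2 (g n) <= l2 \<psi> * sqrt C" by (intro mult_left_mono) auto
    thus ?thesis using inner_cauchy_schwarz[OF psi su(2)[of n]] by simp
   qed
   then obtain t :: "nat => nat" and L where t: "strict_mono t" "(%n. ?X (s (t n))) ----> L"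
    by (rule bounded_subseq_limit[of "%n. ?X (s n)"])
   have st: "strict_mono (%n. s (t n))" using strict_mono_o[OF e(2) t(1)] by (simp add: o_def)
   have lim': "AE x in lborel. (%n. u (s (t n)) x) ----> u0 x"
    using lim by eventually_elim (use LIMSEQ_subseq_LIMSEQ[OF _ st] in \<open>auto simp: o_def\<close>)
   obtain g1 where g1: "wgrad u0 g1"
    "!!\<psi> L. sq_int \<psi> ==> (%n. LBINT x. \<psi> x \<bullet> g (s (t n)) x) ----> L ==> L = (LBINT x. \<psi> x \<bullet> g1 x)"
    by (rule weak_limit_subseq[of "%n. u (s (t n))" "%n. g (s (t n))" A C u0, OF u B lim' m], rule that, assumption+)
   have [measurable]: "g0 \<in> BM" "g1 \<in> BM" "\<psi> \<in> BM"
    using wgrad_sq_int(2)[OF g0(1)] wgrad_sq_int(2)[OF g1(1)] psi by (auto dest: sq_int_measurable)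
   have Leq: "L = ?L" unfolding g1(2)[OF psi t(2)]
    by (rule integral_cong_AE) (use wgrad_unique[OF g0(1) g1(1)] in auto)
   have "(%n. dist (?X (s (t n))) ?L) ----> dist L ?L" by (intro tendsto_dist t(2) tendsto_const)
   hence "(%n. dist (?X (s (t n))) ?L) ----> 0" unfolding Leq by simp
   from order_tendstoD(2)[OF this e(1)] obtain n where "dist (?X (s (t n))) ?L < e"
    by (auto simp: eventually_sequentially)
   with e(3)[of "t n"] show False by simp
  qed
 qed
qed

section \<open>Complex functions as pairs of real functions\<close>

lemma measurable_complex_of:
 assumes [measurable]: "f \<in> borel_measurable M" "g \<in> borel_measurable M"
 shows "(%x. Complex (f x) (g x)) \<in> borel_measurable M"
 unfolding Complex_eq by measurable

lemma L2_iff: "u \<in> L2 \<longleftrightarrow> sq_int u"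
 by (simp add: L2_def sq_int_def)

lemma complex_sq_int:
 assumes "sq_int (u :: real^2 => complex)"
 shows "sq_int (%x. Re (u x))" (is ?A) "sq_int (%x. Im (u x))" (is ?B)
proof -
 note [measurable] = assms[THEN sq_int_measurable]
 show ?A by (rule l2_bound(1)[OF assms, where c=1]) (auto simp: abs_Re_le_cmod)
 show ?B by (rule l2_bound(1)[OF assms, where c=1]) (auto simp: abs_Im_le_cmod)
qed

lemma sq_int_complex:
 assumes "sq_int f" "sq_int g" shows "sq_int (%x. Complex (f x) (g x))"
proof -
 have m: "f \<in> BM" "g \<in> BM" using assms by (auto dest: sq_int_measurable)
 show ?thesis unfolding sq_int_def cmod_power2
  using measurable_complex_of[of f lborel g] m sq_int_integrable[OF assms(1)] sq_int_integrable[OF assms(2)] by simp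
qed

lemma has_weak_partial_iff:
 assumes u: "sq_int u" and g: "sq_int g"
 shows "has_weak_partial i u g \<longleftrightarrow>
  (\<forall>\<phi>\<in>test_functions. (LBINT x. partial i \<phi> x * Re (u x)) = - (LBINT x. \<phi> x * Re (g x))) \<and>
  (\<forall>\<phi>\<in>test_functions. (LBINT x. partial i \<phi> x * Im (u x)) = - (LBINT x. \<phi> x * Im (g x)))"
proof -
 have *: "Re (LBINT x. \<psi> x *R v x) = (LBINT x. \<psi> x * Re (v x))" "Im (LBINT x. \<psi> x *R v x) = (LBINT x. \<psi> x * Im (v x))"
  if "\<psi> \<in> test_functions" "sq_int v" for \<psi> v
 proof -
  have [measurable]: "\<psi> \<in> BM" "v \<in> BM" using that by (auto dest: sq_int_measurable test_measurable)
  have "integrable lborel (%x. \<psi> x *R v x)"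
   by (rule integrable_sq_int_bound[OF test_sq_int(1)[OF that(1)] that(2)]) auto
  from integral_bounded_linear[OF bounded_linear_Re this] integral_bounded_linear[OF bounded_linear_Im this]
  show "Re (LBINT x. \<psi> x *R v x) = (LBINT x. \<psi> x * Re (v x))" "Im (LBINT x. \<psi> x *R v x) = (LBINT x. \<psi> x * Im (v x))"
   by simp_all
 qed
 show ?thesis unfolding has_weak_partial_def complex_eq_iff
  using *[OF test_partial u] *[OF _ g] by auto
qed

lemma weak_partials_wgrad:
 assumes u: "sq_int u" and g: "!!i. sq_int (g i)" "!!i. has_weak_partial i u (g i)"
 shows "wgrad (%x. Re (u x)) (%x. \<chi> i. Re (g i x))" (is ?A) "wgrad (%x. Im (u x)) (%x. \<chi> i. Im (g i x))" (is ?B)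
proof -
 have s: "sq_int (%x. \<chi> i. Re (g i x))" "sq_int (%x. \<chi> i. Im (g i x))"
  by (intro sq_int_vec; simp add: complex_sq_int[OF g(1)])+
 show ?A ?B
  unfolding wgrad_def using s complex_sq_int[OF u] g(2)[unfolded has_weak_partial_iff[OF u g(1)]] by auto
qed

lemma wgrad_weak_partial:
 assumes "wgrad f a" "wgrad g b"
 shows "has_weak_partial i (%x. Complex (f x) (g x)) (%x. Complex (a x $ i) (b x $ i))" (is ?A)
  "sq_int (%x. Complex (a x $ i) (b x $ i))" (is ?B)
proof -
 show s: ?B by (intro sq_int_complex sq_int_nth wgrad_sq_int[OF assms(1)] wgrad_sq_int[OF assms(2)])
 show ?A
  by (subst has_weak_partial_iff[OF sq_int_complex[OF wgrad_sq_int(1)[OF assms(1)] wgrad_sq_int(1)[OF assms(2)]] s])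
   (use wgrad_eq[OF assms(1)] wgrad_eq[OF assms(2)] in auto)
qed

lemma H1_I: "wgrad f a ==> wgrad g b ==> (%x. Complex (f x) (g x)) \<in> H1"
 unfolding H1_def L2_iff using wgrad_weak_partial[of f a g b] sq_int_complex[OF wgrad_sq_int(1) wgrad_sq_int(1)]
 by (simp add: Bex_def L2_iff) blast

lemma H1_E:
 assumes "u \<in> H1"
 obtains a b where "wgrad (%x. Re (u x)) a" "wgrad (%x. Im (u x)) b"
  "!!i. weak_partial i u = (%x. Complex (a x $ i) (b x $ i))"
proof -
 have s: "sq_int u" using assms by (simp add: H1_def L2_iff)
 have "EX g. g \<in> L2 & has_weak_partial i u g" for i using assms by (auto simp: H1_def)
 from someI_ex[OF this] have w: "sq_int (weak_partial i u)" "has_weak_partial i u (weak_partial i u)" for i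
  by (auto simp: weak_partial_def L2_iff)
 show thesis
  by (rule that[OF weak_partials_wgrad[OF s w]]) simp
qed

text \<open>The chosen \<open>weak_partial\<close> agrees almost everywhere with any other weak
  derivative, so energies may be computed from whatever gradients are at hand.\<close>

lemma gradient_energy_eq:
 assumes u: "u \<in> H1" and a: "wgrad (%x. Re (u x)) a" and b: "wgrad (%x. Im (u x)) b"
 shows "gradient_energy u = sqn a + sqn b" (is ?A) "AE x in lborel. ALL i. weak_partial i u x = Complex (a x $ i) (b x $ i)" (is ?B)
proof -
 obtain a' b' where w: "wgrad (%x. Re (u x)) a'" "wgrad (%x. Im (u x)) b'"
  "!!i. weak_partial i u = (%x. Complex (a' x $ i) (b' x $ i))" by (rule H1_E[OF u], rule that, assumption+)
 note e = wgrad_unique[OF w(1) a] wgrad_unique[OF w(2) b]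
 show ?B
  using e by eventually_elim (simp add: w(3))
 note s = wgrad_sq_int(2)[OF w(1)] wgrad_sq_int(2)[OF w(2)] wgrad_sq_int(2)[OF a] wgrad_sq_int(2)[OF b]
 have m: "a' \<in> BM" "b' \<in> BM" "a \<in> BM" "b \<in> BM"
  using s by (auto dest: sq_int_measurable)
 have "gradient_energy u = (LBINT x. (norm (a' x))^2 + (norm (b' x))^2)"
  unfolding gradient_energy_def w(3) by (simp add: norm2_sum sum.distrib cmod_power2)
 also have "\<dots> = sqn a' + sqn b'" using s by (simp add: sqn_def sq_int_def)
 also have "sqn a' = sqn a" by (rule sqn_cong_AE) (use e m in auto)
 also have "sqn b' = sqn b" by (rule sqn_cong_AE) (use e m in auto)
 finally show ?A .
qed

definition rot90 :: "real^2 => real^2" where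
 "rot90 x = vec2 (- x $ 2) (x $ 1)"

lemma norm_rot90: "norm (rot90 x) = norm x"
proof -
 have "(norm (rot90 x))^2 = (norm x)^2" by (simp add: rot90_def norm_vec2 norm2_sum sum_2)
 thus ?thesis by simp
qed

lemma rot90_diff: "rot90 (x - y) = rot90 x - rot90 y"
 by (simp add: rot90_def vec2_diff)

lemma rot90_inner: "rot90 x \<bullet> x = 0"
 by (simp add: rot90_def inner_vec_def sum_2)

lemma rot90_measurable[measurable]: "rot90 \<in> BM"
 unfolding rot90_def by measurable

text \<open>With \<open>u = f + i g\<close>, \<open>a = \<nabla>f\<close>, \<open>b = \<nabla>g\<close>, the vector field \<open>f b - g a\<close> is the
 probability current of \<open>u\<close>.\<close>

lemma ang_mom_eq:
 assumes u: "u \<in> H1" and a: "wgrad (%x. Re (u x)) a" and b: "wgrad (%x. Im (u x)) b"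
  and x: "sq_int (%x. norm x *R u x)"
 shows "integrable lborel (%x. rot90 x \<bullet> (Re (u x) *R b x - Im (u x) *R a x))" (is ?A)
  "Re (LBINT x. cnj (u x) * ang_mom u x) = (LBINT x. rot90 x \<bullet> (Re (u x) *R b x - Im (u x) *R a x))" (is ?B)
proof -
 obtain a' b' where w: "wgrad (%x. Re (u x)) a'" "wgrad (%x. Im (u x)) b'"
  "!!i. weak_partial i u = (%x. Complex (a' x $ i) (b' x $ i))" by (rule H1_E[OF u], rule that, assumption+)
 note e = wgrad_unique[OF w(1) a] wgrad_unique[OF w(2) b]
 note s = wgrad_sq_int(2)[OF w(1)] wgrad_sq_int(2)[OF w(2)] wgrad_sq_int(2)[OF a] wgrad_sq_int(2)[OF b]
 have su: "sq_int u" using u by (simp add: H1_def L2_iff)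
 note [measurable] = s[THEN sq_int_measurable] su[THEN sq_int_measurable]
 have wm: "sq_int (weak_partial i u)" for i
  unfolding w(3) by (rule wgrad_weak_partial(2)[OF w(1,2)])
 have i1: "integrable lborel (%x. cnj (u x) * (of_real (x $ k) * weak_partial i u x))" for i k
 proof (rule integrable_sq_int_bound[OF x wm[of i]])
  have c: "cnj \<in> BM" by (intro borel_measurable_continuous_onI continuous_intros)
  have "(%x. cnj (u x)) \<in> BM" by (rule measurable_compose[OF sq_int_measurable[OF su] c])
  moreover have "(%x::real^2. complex_of_real (x $ k)) \<in> BM"
   by (intro borel_measurable_continuous_onI continuous_intros)
  ultimately show "(%x. cnj (u x) * (of_real (x $ k) * weak_partial i u x)) \<in> BM"
   using sq_int_measurable[OF wm[of i]] by (intro borel_measurable_times)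
  show "norm (cnj (u x) * (of_real (x $ k) * weak_partial i u x)) <= norm (norm x *R u x) * norm (weak_partial i u x)" for x
   using mult_right_mono[OF mult_left_mono[OF abs_nth_le_norm[of x k], of "cmod (u x)"], of "cmod (weak_partial i u x)"]
   by (simp add: norm_mult mult_ac)
 qed
 have int: "integrable lborel (%x. cnj (u x) * ang_mom u x)"
 proof -
  have "integrable lborel (%x. \<i> * (cnj (u x) * (of_real (x $ 2) * weak_partial 1 u x)) - \<i> * (cnj (u x) * (of_real (x $ 1) * weak_partial 2 u x)))"
   by (intro Bochner_Integration.integrable_diff integrable_mult_right i1)
  thus ?thesis by (simp add: ang_mom_def algebra_simps)
 qed
 have pt: "Re (cnj (u x) * ang_mom u x) = rot90 x \<bullet> (Re (u x) *R b' x - Im (u x) *R a' x)" for x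
  unfolding ang_mom_def w(3) by (simp add: rot90_def inner_vec_def sum_2 algebra_simps)
 have ae: "AE x in lborel. Re (cnj (u x) * ang_mom u x) = rot90 x \<bullet> (Re (u x) *R b x - Im (u x) *R a x)"
  using e by eventually_elim (simp only: pt)
 have m: "(%x. rot90 x \<bullet> (Re (u x) *R b x - Im (u x) *R a x)) \<in> BM"
  "(%x. rot90 x \<bullet> (Re (u x) *R b' x - Im (u x) *R a' x)) \<in> BM" by measurable
 have iR: "integrable lborel (%x. Re (cnj (u x) * ang_mom u x))" using int by (rule integrable_Re)
 show ?A
  by (rule integrable_cong_AE_imp[OF iR]) (use m ae in \<open>auto elim!: eventually_mono\<close>)
 have "Re (LBINT x. cnj (u x) * ang_mom u x) = (LBINT x. Re (cnj (u x) * ang_mom u x))"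
  using integral_bounded_linear[OF bounded_linear_Re int] by simp
 also have "\<dots> = (LBINT x. rot90 x \<bullet> (Re (u x) *R b x - Im (u x) *R a x))"
  by (rule integral_cong_AE) (use m ae iR in auto)
 finally show ?B .
qed

lemma wgrad_scale:
 assumes u: "wgrad u g" and b: "\<beta> > 0"
 shows "wgrad (%x. \<alpha> * u (t + \<beta> *R x)) (%x. (\<alpha> * \<beta>) *R g (t + \<beta> *R x))" (is ?A)
  "sqn (%x. \<alpha> * u (t + \<beta> *R x)) = \<alpha>^2 / \<beta>^2 * sqn u" (is ?B)
  "sqn (%x. (\<alpha> * \<beta>) *R g (t + \<beta> *R x)) = \<alpha>^2 * sqn g" (is ?C)
proof -
 show ?A
  using wgrad_cmult[OF wgrad_affine[OF u, of \<beta> t], of \<alpha>] b by simp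
 show ?B
  using sqn_cmult[of \<alpha> "%x. u (t + \<beta> *R x)"] sq_int_affine(2)[of \<beta> u t] wgrad_sq_int(1)[OF u] b by simp
 show ?C
  using sqn_scaleR[of "\<alpha> * \<beta>" "%x. g (t + \<beta> *R x)"] sq_int_affine(2)[of \<beta> g t] wgrad_sq_int(2)[OF u] b
  by (simp add: power_mult_distrib)
qed

lemma sqn_square_scale:
 assumes [measurable]: "u \<in> BM" and b: "\<beta> > 0"
 shows "sqn (%x::real^2. (\<alpha> * u (t + \<beta> *R x))^2) = \<alpha>^4 / \<beta>^2 * sqn (sq u)"
proof -
 have "sqn (%x::real^2. (\<alpha> * u (t + \<beta> *R x))^2) = (LBINT x. \<alpha>^4 * (%y. ((u y)^2)^2) (t + \<beta> *R x))"
  by (simp add: sqn_def power_mult_distrib)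
 also have "\<dots> = \<alpha>^4 * (LBINT x. (%y. ((u y)^2)^2) (t + \<beta> *R x))" by simp
 also have "(LBINT x. (%y. ((u y)^2)^2) (t + \<beta> *R x)) = 1 / \<beta>^2 * sqn (sq u)"
  using b by (subst lborel_integral_affine(1)) (auto simp: sqn_def)
 finally show ?thesis by simp
qed

section \<open>The Gagliardo-Nirenberg inequality\<close>

definition gn_set :: "real set" where
 "gn_set = {c. \<forall>u\<in>H1. gradient_energy u * (LBINT x. (cmod (u x))^2) >= c / 2 * quartic u}"

lemma a_star_Sup: "a_star = Sup gn_set"
 by (simp add: a_star_def gn_set_def)

lemma gradient_energy_nonneg: "0 <= gradient_energy u"
 unfolding gradient_energy_def by (intro integral_nonneg_AE) (auto intro!: sum_nonneg)

lemma quartic_nonneg: "0 <= quartic u"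
 unfolding quartic_def by (intro integral_nonneg_AE) auto

lemma gn_set_0: "0 \<in> gn_set"
 by (auto simp: gn_set_def intro!: mult_nonneg_nonneg gradient_energy_nonneg integral_nonneg_AE)

text \<open>Every admissible constant is bounded by the quotient belonging to u, hence so is their
  supremum. If the fourth power of u is not integrable, \<open>quartic u\<close> is 0 by convention;
  the inequality alone thus says nothing about integrability.\<close>

lemma gn_complex:
 assumes "u \<in> H1"
 shows "a_star / 2 * quartic u <= gradient_energy u * (LBINT x. (cmod (u x))^2)"
proof (cases "quartic u = 0")
 case True
 thus ?thesis by (auto intro!: mult_nonneg_nonneg gradient_energy_nonneg integral_nonneg_AE)
next
 case False
 hence q: "quartic u > 0" using quartic_nonneg[of u] by simp
 have "a_star <= 2 * (gradient_energy u * (LBINT x. (cmod (u x))^2)) / quartic u"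
  unfolding a_star_Sup
 proof (rule cSup_least)
  show "gn_set ~= {}" using gn_set_0 by blast
  fix c assume "c \<in> gn_set"
  hence "c / 2 * quartic u <= gradient_energy u * (LBINT x. (cmod (u x))^2)" using assms by (simp add: gn_set_def)
  thus "c <= 2 * (gradient_energy u * (LBINT x. (cmod (u x))^2)) / quartic u"
   using q by (simp add: pos_le_divide_eq)
 qed
 thus ?thesis using q by (simp add: pos_le_divide_eq algebra_simps)
qed

lemma cmod4: "cmod (Complex a b) ^ 4 = (a^2 + b^2)^2"
proof -
 have "cmod (Complex a b) ^ 4 = ((cmod (Complex a b))^2)^2" by simp
 thus ?thesis unfolding cmod_power2 by simp
qed

lemma quartic_eq: "quartic (%x. Complex (f x) (g x)) = (LBINT x. ((f x)^2 + (g x)^2)^2)"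
 unfolding quartic_def cmod4 ..

lemma mass_eq:
 assumes "sq_int f" "sq_int g"
 shows "(LBINT x. (cmod (Complex (f x) (g x)))^2) = sqn f + sqn g"
 unfolding cmod_power2 using sq_int_integrable[OF assms(1)] sq_int_integrable[OF assms(2)] by (simp add: sqn_def)

lemma gn_pair:
 assumes f: "wgrad f a" and g: "wgrad g b"
 shows "a_star / 2 * (LBINT x. ((f x)^2 + (g x)^2)^2) <= (sqn a + sqn b) * (sqn f + sqn g)"
 using gn_complex[OF H1_I[OF f g]] gradient_energy_eq(1)[OF H1_I[OF f g], of a b] f g
  mass_eq[OF wgrad_sq_int(1)[OF f] wgrad_sq_int(1)[OF g]]
 by (simp add: quartic_eq)

text \<open>Boundedness makes the supremum a genuine upper bound, so that every constant above
  \<open>a_star\<close> is violated by some function. The bump provides the bound.\<close>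

lemma gn_set_bdd: "bdd_above gn_set"
proof -
 have w: "wgrad bump (grad bump)"
 proof (rule has_grad_wgrad[OF test_has_grad[OF bump_test]])
  show "continuous_on UNIV (grad bump)"
   unfolding grad_def by (intro continuous_on_vec_lambda test_continuous test_partial bump_test)
  show "sq_int (grad bump)" by (rule sq_int_vec) (simp add: test_sq_int[OF test_partial[OF bump_test]])
 qed (rule test_sq_int[OF bump_test])
 let ?u = "%x. Complex (bump x) 0"
 have u: "?u \<in> H1" by (rule H1_I[OF w wgrad_zero])
 have b4: "(%x. (bump x)^4) \<in> test_functions"
  using test_mult[OF bump_test C_k_mult[OF test_C_k[OF bump_test] C_k_mult[OF test_C_k[OF bump_test] test_C_k[OF bump_test]]]]
  by (simp add: power4_eq_xxxx mult.assoc)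
 have q: "quartic ?u > 0"
 proof -
  have eq: "quartic ?u = (LBINT x. (bump x)^4)" by (simp add: quartic_eq)
  have "(LBINT x. (bump x)^4) ~= 0"
  proof
   assume "(LBINT x. (bump x)^4) = 0"
   hence ae: "AE x in lborel. bump x = 0"
    using integral_nonneg_eq_0_iff_AE[OF test_sq_int(2)[OF b4]] by simp
   have "(LBINT x. bump x) = (\<integral>x. 0 \<partial>(lborel :: (real^2) measure))"
    by (rule integral_cong_AE) (use ae test_measurable[OF bump_test] in auto)
   thus False using bump_integral_pos by simp
  qed
  with quartic_nonneg[of ?u] eq show ?thesis by linarith
 qed
 show ?thesis
 proof (rule bdd_aboveI)
  fix c assume "c \<in> gn_set"
  hence "c / 2 * quartic ?u <= gradient_energy ?u * (LBINT x. (cmod (?u x))^2)" using u by (auto simp: gn_set_def)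
  thus "c <= 2 * (gradient_energy ?u * (LBINT x. (cmod (?u x))^2)) / quartic ?u"
   using q by (simp add: pos_le_divide_eq algebra_simps)
 qed
qed

lemma quad_zero:
 assumes "!!\<sigma>::real. \<bar>\<sigma>\<bar> <= 1 ==> 0 <= 2 * \<sigma> * b + \<sigma>^2 * c" "0 <= c"
 shows "b = 0"
proof (rule ccontr)
 assume b: "b ~= 0"
 \<comment> \<open>m > |b| makes the step -b/m admissible, and 2m > c keeps the negative first order
   term dominant.\<close>
 define m where "m = \<bar>b\<bar> + c + 1"
 have m: "m > 0" using assms(2) by (simp add: m_def add_nonneg_pos)
 have "0 <= 2 * (- b / m) * b + (- b / m)^2 * c"
  by (rule assms(1)) (use m assms(2) in \<open>auto simp: m_def abs_divide\<close>)
 hence "0 <= (2 * (- b / m) * b + (- b / m)^2 * c) * m^2" by (intro mult_nonneg_nonneg) auto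
 also have "\<dots> = - (b^2) * (2 * m - c)" using m by (simp add: power2_eq_square field_simps)
 finally have "b^2 * (2 * m - c) <= 0" by simp
 moreover have "2 * m - c > 0" using assms(2) by (simp add: m_def)
 ultimately have "b^2 <= 0" by (simp add: mult_le_0_iff)
 thus False using b by simp
qed

lemma young_tail:
 fixes s t d :: real assumes "d > 0"
 shows "\<bar>s * t\<bar> <= d * s^2 + t^2 / d"
proof -
 have "0 <= (\<bar>s\<bar> * d - \<bar>t\<bar>)^2" by simp
 hence "2 * (\<bar>s\<bar> * \<bar>t\<bar>) * d <= s^2 * d^2 + t^2" by (simp add: power2_diff power_mult_distrib algebra_simps)
 moreover have "0 <= \<bar>s\<bar> * \<bar>t\<bar> * d" using assms by simp
 ultimately have "\<bar>s\<bar> * \<bar>t\<bar> * d <= s^2 * d^2 + t^2" by linarith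
 thus ?thesis using assms by (simp add: abs_mult field_simps power2_eq_square)
qed

lemma arctan_lim: "(%n. real (Suc n) * arctan (c / real (Suc n))) ----> c"
proof -
 have "((%t. arctan (c * t)) has_real_derivative c) (at 0)" by (auto intro!: derivative_eq_intros)
 hence l: "((%t. arctan (c * t) / t) \<longlongrightarrow> c) (at 0)" by (simp add: has_field_derivative_iff)
 have "filterlim (%n. 1 / real (Suc n)) (at 0) sequentially"
  unfolding filterlim_at using LIMSEQ_inverse_real_of_nat by (simp add: inverse_eq_divide)
 from filterlim_compose[OF l this] show ?thesis by (simp add: mult.commute)
qed

text \<open>Positivity of the optimal constant is the qualitative content of the Gagliardo-Nirenberg
  inequality. It is taken as a hypothesis here, because for \<open>a_star\<close> <= 0 no coupling
  lies between 0 and \<open>a_star\<close>.\<close>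

locale gn = assumes a_pos: "0 < a_star"
begin

text \<open>Since the integral of a non-integrable function is 0, the inequality must not be applied
  to f directly. The arctan truncations are bounded and so have integrable fourth powers; the
  inequality bounds these uniformly, and Fatou concludes. This is the embedding of H1 into
  L4.\<close>

lemma quartic_integrable:
 assumes f: "wgrad f a"
 shows "sq_int (sq f)" "a_star / 2 * sqn (sq f) <= sqn a * sqn f" (is ?A)
proof -
 note s = wgrad_sq_int[OF f]
 note [measurable] = s[THEN sq_int_measurable]
 define w where "w n x = real (Suc n) * arctan (f x / real (Suc n))" for n x
 define v where "v n x = (1 / (1 + (f x / real (Suc n))^2)) *R a x" for n x
 have w: "wgrad (w n) (v n)" for n unfolding w_def v_def by (rule wgrad_arctan[OF f]) simp
 have at: "\<bar>arctan t\<bar> <= \<bar>t\<bar>" for t :: real by (rule abs_arctan_le)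
 have wf: "\<bar>w n x\<bar> <= \<bar>f x\<bar>" for n x
  using at[of "f x / real (Suc n)"] by (simp add: w_def abs_mult divide_simps mult.commute)
 have wM: "\<bar>w n x\<bar> <= real (Suc n) * 2" for n x
 proof -
  have "\<bar>arctan (f x / real (Suc n))\<bar> <= 2"
   using arctan_bounded[of "f x / real (Suc n)"] pi_less_4 by (auto simp: abs_le_iff)
  thus ?thesis unfolding w_def abs_mult abs_of_nat by (rule mult_left_mono) simp
 qed
 have va: "norm (v n x) <= norm (a x)" for n x
 proof -
  have "1 + (f x / real (Suc n))^2 > 0" by (simp add: add_pos_nonneg)
  hence "\<bar>1 / (1 + (f x / real (Suc n))^2)\<bar> <= 1" by (simp only: abs_divide abs_one abs_of_pos) (simp add: divide_le_eq)
  thus ?thesis unfolding v_def norm_scaleR by (rule mult_left_le_one_le[rotated 2]) auto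
 qed
 note [measurable] = wgrad_sq_int[OF w, THEN sq_int_measurable]
 have sw: "sqn (w n) <= sqn f" "sqn (v n) <= sqn a" for n
  using sq_int_bound(2)[OF s(1), of "w n" 1] sq_int_bound(2)[OF s(2), of "v n" 1] wf va by auto
 have iw: "integrable lborel (%x. (w n x)^4)" for n
 proof (rule Bochner_Integration.integrable_bound[OF integrable_mult_right[OF sq_int_integrable[OF wgrad_sq_int(1)[OF w[of n]]], of "(real (Suc n) * 2)^2"]])
  show "AE x in lborel. norm ((w n x)^4) <= norm ((real (Suc n) * 2)^2 * (norm (w n x))^2)"
  proof (rule AE_I2)
   fix x
   have "(w n x)^2 <= (real (Suc n) * 2)^2" using power_mono[OF wM[of n x], of 2] by simp
   hence "(w n x)^2 * (w n x)^2 <= (real (Suc n) * 2)^2 * (w n x)^2" by (rule mult_right_mono) simp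
   moreover have "(w n x)^4 = (w n x)^2 * (w n x)^2" by (simp add: power_add[symmetric])
   ultimately have "(w n x)^4 <= (real (Suc n) * 2)^2 * (norm (w n x))^2" by (simp only: real_norm_def power2_abs)
   thus "norm ((w n x)^4) <= norm ((real (Suc n) * 2)^2 * (norm (w n x))^2)"
    by (metis abs_ge_self norm_power order_trans power_even_abs_numeral even_numeral real_norm_def)
  qed
 qed measurable
 have bd: "(LBINT x. (w n x)^4) <= 2 / a_star * (sqn a * sqn f)" for n
 proof -
  have "a_star / 2 * (LBINT x. ((w n x)^2 + 0^2)^2) <= (sqn (v n) + sqn (%x::real^2. 0 :: real^2)) * (sqn (w n) + sqn (%x::real^2. 0 :: real))"
   by (rule gn_pair[OF w wgrad_zero])
  hence "a_star / 2 * (LBINT x. (w n x)^4) <= sqn (v n) * sqn (w n)" by simp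
  also have "\<dots> <= sqn a * sqn f" by (intro mult_mono sw) auto
  finally show ?thesis using a_pos by (simp add: field_simps)
 qed
 have lim: "(%n. (w n x)^4) ----> (f x)^4" for x
 proof -
  have "(%n. real (Suc n) * arctan (f x / real (Suc n))) ----> f x" by (rule arctan_lim)
  thus ?thesis unfolding w_def by (rule tendsto_power)
 qed
 have F: "integrable lborel (%x. (f x)^4)" "(LBINT x. (f x)^4) <= 2 / a_star * (sqn a * sqn f)"
 proof -
  have nn: "0 <= (w n x)^4" for n x by simp
  have m: "(%x. (f x)^4) \<in> borel_measurable lborel" by measurable
  have l: "AE x in lborel. (%n. (w n x)^4) ----> (f x)^4" using lim by simp
  show "integrable lborel (%x. (f x)^4)" "(LBINT x. (f x)^4) <= 2 / a_star * (sqn a * sqn f)"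
   using fatou_integral[OF iw nn bd m l] by auto
 qed
 show "sq_int (sq f)" using F(1) by (simp add: sq_int_def)
 show ?A using F(2) a_pos by (simp add: sqn_def field_simps)
qed

lemma gn_quad:
 assumes f: "wgrad f a" and g: "wgrad g b"
 shows "a_star / 2 * (sqn (sq f) + 2 * (LBINT x. (f x)^2 * (g x)^2) + sqn (sq g)) <= (sqn a + sqn b) * (sqn f + sqn g)"
proof -
 note q = quartic_integrable(1)[OF f] quartic_integrable(1)[OF g]
 have "(LBINT x. ((f x)^2 + (g x)^2)^2) = sqn (%x. (f x)^2 + (g x)^2)" by (simp add: sqn_def)
 thus ?thesis using gn_pair[OF f g] sqn_add[OF q] by simp
qed

lemma cubic_integrable:
 assumes f: "wgrad f a" and g: "wgrad g b" and h: "wgrad h c"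
 shows "integrable lborel (%x. (f x)^2 * (g x * h x))"
proof -
 note q = quartic_integrable(1)[OF f] quartic_integrable(1)[OF g] quartic_integrable(1)[OF h]
 note [measurable] = wgrad_sq_int(1)[OF f, THEN sq_int_measurable] wgrad_sq_int(1)[OF g, THEN sq_int_measurable] wgrad_sq_int(1)[OF h, THEN sq_int_measurable]
 show ?thesis
 proof (rule Bochner_Integration.integrable_bound[OF integrable_mult_sq_int[OF q(1) sq_int_add[OF q(2,3)]]])
  have "\<bar>g x * h x\<bar> <= (g x)^2 + (h x)^2" for x using young_tail[of 1 "g x" "h x"] by simp
  thus "AE x in lborel. norm ((f x)^2 * (g x * h x)) <= norm ((f x)^2 * ((g x)^2 + (h x)^2))"
   by (intro AE_I2) (simp add: abs_mult mult_left_mono)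
 qed measurable
qed

text \<open>A constant slightly above \<open>a_star\<close> is violated by some u. The modulus has
  the same mass and quartic integral and no larger gradient norm; amplitude and dilation then
  normalize mass and gradient at once without changing the quotient.\<close>

lemma near_optimal:
 assumes e: "e > 0"
 obtains w v where "wgrad w v" "!!x. w x >= 0" "sqn w = 1" "sqn v = 1" "sqn (sq w) >= 2 / (a_star * (1 + e))"
proof -
 define c where "c = a_star * (1 + e)"
 have c: "c > a_star" "c > 0" using e a_pos by (auto simp: c_def add_pos_pos)
 have "c \<notin> gn_set" using cSup_upper[OF _ gn_set_bdd, of c] c a_star_Sup by auto
 then obtain u where u: "u \<in> H1" "gradient_energy u * (LBINT x. (cmod (u x))^2) < c / 2 * quartic u"
  by (auto simp: gn_set_def not_le)
 obtain a b where ab: "wgrad (%x. Re (u x)) a" "wgrad (%x. Im (u x)) b" by (rule H1_E[OF u(1)])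
 define \<rho> where "\<rho> x = sqrt ((Re (u x))^2 + (Im (u x))^2)" for x
 define r where "r x = (1 / \<rho> x) *R (Re (u x) *R a x + Im (u x) *R b x)" for x
 have w: "wgrad \<rho> r" unfolding \<rho>_def[abs_def] r_def[abs_def] by (rule wgrad_modulus[OF ab])
 note sa = wgrad_sq_int[OF ab(1)] wgrad_sq_int[OF ab(2)] wgrad_sq_int[OF w]
 have "sqn r <= (LBINT x. (norm (a x))^2 + (norm (b x))^2)"
  unfolding sqn_def
 proof (rule integral_mono)
  show "integrable lborel (%x. (norm (r x))^2)" by (rule sq_int_integrable[OF sa(6)])
  show "integrable lborel (%x. (norm (a x))^2 + (norm (b x))^2)" using sa by (simp add: sq_int_def)
  fix x
  have "0 <= (norm ((1 / \<rho> x) *R (Re (u x) *R b x - Im (u x) *R a x)))^2" by simp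
  thus "(norm (r x))^2 <= (norm (a x))^2 + (norm (b x))^2"
   using modulus_phase_le[of "Re (u x)" "Im (u x)" "a x" "b x"] unfolding r_def \<rho>_def by linarith
 qed
 also have "\<dots> = sqn a + sqn b" using sa by (simp add: sqn_def sq_int_def)
 also have "\<dots> = gradient_energy u" using gradient_energy_eq(1)[OF u(1) ab] by simp
 finally have g1: "sqn r <= gradient_energy u" .
 have m1: "(LBINT x. (cmod (u x))^2) = sqn \<rho>" unfolding cmod_power2 by (simp add: sqn_def \<rho>_def)
 have "cmod (u x) ^ 4 = ((\<rho> x)^2)^2" for x using cmod4[of "Re (u x)" "Im (u x)"] by (simp add: \<rho>_def)
 hence q1: "quartic u = sqn (sq \<rho>)" by (simp add: quartic_def sqn_def)
 have "sqn r * sqn \<rho> <= gradient_energy u * sqn \<rho>" by (intro mult_right_mono g1) simp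
 hence lt: "sqn r * sqn \<rho> < c / 2 * sqn (sq \<rho>)" using u(2) m1 q1 by simp
 hence "0 < c / 2 * sqn (sq \<rho>)" using mult_nonneg_nonneg[OF sqn_nonneg sqn_nonneg] order.strict_trans1 by blast
 hence qpos: "0 < sqn (sq \<rho>)" using c by (simp add: zero_less_mult_iff)
 have "0 < a_star / 2 * sqn (sq \<rho>)" using a_pos qpos by simp
 also have "\<dots> <= sqn r * sqn \<rho>" by (rule quartic_integrable(2)[OF w])
 finally have "0 < sqn r * sqn \<rho>" .
 hence pos: "0 < sqn r" "0 < sqn \<rho>" using sqn_nonneg[of r] sqn_nonneg[of \<rho>] by (auto simp: zero_less_mult_iff)
 define \<alpha> where "\<alpha> = 1 / sqrt (sqn r)"
 define \<beta> where "\<beta> = sqrt (sqn \<rho> / sqn r)"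
 have ab2: "\<alpha>^2 = 1 / sqn r" "\<beta>^2 = sqn \<rho> / sqn r" "\<alpha> > 0" "\<beta> > 0" using pos by (auto simp: \<alpha>_def \<beta>_def power_divide)
 note S = wgrad_scale[OF w ab2(4), of \<alpha> 0]
 have [measurable]: "\<rho> \<in> BM" using sa(5) by (rule sq_int_measurable)
 have a4: "\<alpha>^4 = (1 / sqn r)^2" using ab2(1) by (metis power_mult numeral_Bit0 mult_2 power_add power2_eq_square)
 show thesis
 proof (rule that[OF S(1)])
  show "\<alpha> * \<rho> (0 + \<beta> *R x) >= 0" for x using ab2(3) by (simp add: \<rho>_def)
  show "sqn (%x. \<alpha> * \<rho> (0 + \<beta> *R x)) = 1" unfolding S(2) ab2 using pos by simp
  show "sqn (%x. (\<alpha> * \<beta>) *R r (0 + \<beta> *R x)) = 1" unfolding S(3) ab2 using pos by simp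
  have "sqn (%x. (\<alpha> * \<rho> (0 + \<beta> *R x))^2) = sqn (sq \<rho>) / (sqn r * sqn \<rho>)"
   by (subst sqn_square_scale) (use ab2 a4 pos in \<open>auto simp: power2_eq_square\<close>)
  moreover have "2 / c <= sqn (sq \<rho>) / (sqn r * sqn \<rho>)"
   using lt c pos by (simp add: divide_le_eq pos_le_divide_eq field_simps)
  ultimately show "2 / (a_star * (1 + e)) <= sqn (%x. (\<alpha> * \<rho> (0 + \<beta> *R x))^2)" by (simp add: c_def)
 qed
qed

end

section \<open>Existence of an optimizer\<close>

lemma integral_convolution:
 fixes p q :: "'a::euclidean_space => real"
 assumes p: "integrable lborel p" "!!x. 0 <= p x" and q: "integrable lborel q" "!!x. 0 <= q x"
  and pq: "!!y. integrable lborel (%x. p (x - y) * q x)"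
 shows "(\<integral>\<^sup>+y. ennreal (LBINT x. p (x - y) * q x) \<partial>lborel) = ennreal ((LBINT x. p x) * (LBINT x. q x))"
proof -
 have [measurable]: "p \<in> BM" "q \<in> BM" using p q by auto
 have "(\<integral>\<^sup>+y. ennreal (LBINT x. p (x - y) * q x) \<partial>lborel) = (\<integral>\<^sup>+y. \<integral>\<^sup>+x. ennreal (p (x - y) * q x) \<partial>lborel \<partial>lborel)"
  by (intro nn_integral_cong nn_integral_eq_integral[symmetric] pq) (use p q in auto)
 also have "\<dots> = (\<integral>\<^sup>+x. \<integral>\<^sup>+y. ennreal (p (x - y) * q x) \<partial>lborel \<partial>lborel)"
  by (rule lborel_pair.Fubini'[symmetric]) measurable
 also have "\<dots> = (\<integral>\<^sup>+x. ennreal ((LBINT x. p x) * q x) \<partial>lborel)"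
 proof (rule nn_integral_cong)
  fix x
  have i: "integrable lborel (%y. p (x + (- 1) *R y))" "(LBINT y. p (x + (- 1) *R y)) = (LBINT x. p x)"
   using lborel_integral_affine[of "- 1" p x] p by auto
  have "(\<integral>\<^sup>+y. ennreal (p (x - y) * q x) \<partial>lborel) = ennreal (LBINT y. p (x - y) * q x)"
   by (rule nn_integral_eq_integral) (use i(1) p q in auto)
  thus "(\<integral>\<^sup>+y. ennreal (p (x - y) * q x) \<partial>lborel) = ennreal ((LBINT x. p x) * q x)" using i by simp
 qed
 also have "\<dots> = ennreal (LBINT x. (LBINT x. p x) * q x)"
  by (rule nn_integral_eq_integral) (use p q in \<open>auto intro!: mult_nonneg_nonneg integral_nonneg_AE\<close>)
 finally show ?thesis by simp
qed

lemma test_bounded_const: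
 assumes "\<phi> \<in> test_functions" obtains B where "B > 0" "!!x. \<bar>\<phi> x\<bar> <= B"
proof -
 obtain B R where B: "B > 0" "R > 0" "!!x. \<bar>\<phi> x\<bar> <= B * indicator (cball 0 R) x"
  by (rule test_bounded[OF assms], rule that, assumption+)
 have "\<bar>\<phi> x\<bar> <= B" for x using B(1) B(3)[of x] by (cases "norm x <= R"; simp)
 with B(1) show thesis by (rule that)
qed

lemma test_grad:
 assumes p: "\<phi> \<in> test_functions"
 shows "continuous_on UNIV (grad \<phi>)" (is ?A) "sq_int (grad \<phi>)" "EX B. ALL x. \<bar>\<phi> x\<bar> <= B & norm (grad \<phi> x) <= B" (is ?B) "wgrad \<phi> (grad \<phi>)" (is ?C)
proof -
 show c: ?A
  unfolding grad_def by (intro continuous_on_vec_lambda test_continuous test_partial p)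
 show s: "sq_int (grad \<phi>)" by (rule sq_int_vec) (simp add: test_sq_int[OF test_partial[OF p]])
 show ?C by (rule has_grad_wgrad[OF test_has_grad[OF p] c test_sq_int(1)[OF p] s])
 obtain B where B: "B > 0" "!!x. \<bar>\<phi> x\<bar> <= B" by (rule test_bounded_const[OF p], rule that, assumption+)
 obtain B1 where B1: "B1 > 0" "!!x. \<bar>partial 1 \<phi> x\<bar> <= B1" by (rule test_bounded_const[OF test_partial[OF p]], rule that, assumption+)
 obtain B2 where B2: "B2 > 0" "!!x. \<bar>partial 2 \<phi> x\<bar> <= B2" by (rule test_bounded_const[OF test_partial[OF p]], rule that, assumption+)
 have "\<bar>\<phi> x\<bar> <= B + B1 + B2 & norm (grad \<phi> x) <= B + B1 + B2" for x
  using B(1) B(2)[of x] B1(1) B1(2)[of x] B2(1) B2(2)[of x] norm_le_sum_2[of "grad \<phi> x"] by simp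
 thus ?B by blast
qed

context gn
begin

text \<open>Integrating the Gagliardo--Nirenberg inequality for the localized functions \<open>bump(\<cdot> - y) w\<close>
 over all \<open>y\<close> shows that their \<open>L\<^sup>2\<close> norms cannot all be small.\<close>

lemma nonvanishing:
 obtains c0 where "c0 > 0"
  "!!w v. wgrad w v ==> sqn w = 1 ==> sqn v = 1 ==> 1 / a_star <= sqn (sq w) ==> EX y. c0 <= sqn (%x. bump (x - y) * w x)"
proof -
 have bsq: "(sq bump) \<in> test_functions"
  using test_mult[OF bump_test test_C_k[OF bump_test]] by (simp add: power2_eq_square)
 have b4: "(%x. (bump x)^2 * (bump x)^2) \<in> test_functions"
  by (rule test_mult[OF bsq test_C_k[OF bsq]])
 define I4 where "I4 = (LBINT x. (bump x)^2 * (bump x)^2)"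
 define I2 where "I2 = (LBINT x. (bump x)^2)"
 define J2 where "J2 = (LBINT x. (norm (grad bump x))^2)"
 have J20: "J2 >= 0" by (simp add: J2_def)
 have pos: "0 < (LBINT x. p (bump x))" if "(%x. p (bump x)) \<in> test_functions" "!!t. p t = 0 \<longleftrightarrow> t = 0" "!!t. 0 <= p t" for p :: "real => real"
 proof -
  have "(LBINT x. p (bump x)) ~= 0"
  proof
   assume "(LBINT x. p (bump x)) = 0"
   hence ae: "AE x in lborel. bump x = 0"
    using integral_nonneg_eq_0_iff_AE[OF test_sq_int(2)[OF that(1)]] that(2,3) by simp
   have "(LBINT x. bump x) = (\<integral>x. 0 \<partial>(lborel :: (real^2) measure))"
    by (rule integral_cong_AE) (use ae test_measurable[OF bump_test] in auto)
   thus False using bump_integral_pos by simp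
  qed
  moreover have "0 <= (LBINT x. p (bump x))" by (intro integral_nonneg_AE) (simp add: that(3))
  ultimately show ?thesis by linarith
 qed
 have I4: "I4 > 0" unfolding I4_def by (rule pos[of "%t. t^2 * t^2"]) (use b4 in auto)
 have I2: "I2 > 0" unfolding I2_def by (rule pos[of "%t. t^2"]) (use bsq in auto)
 \<comment> \<open>If every localized mass were at most \<open>c0\<close>, integration over y would
   give I4 / 2 <= 2 c0 (I2 + J2) = I4 / 4.\<close>
 define c0 where "c0 = I4 / (8 * (I2 + J2))"
 have IJ: "I2 + J2 > 0" using I2 J20 by simp
 have c0: "c0 > 0" using I4 IJ by (simp add: c0_def)
 obtain B where B: "!!x. \<bar>bump x\<bar> <= B" "!!x. norm (grad bump x) <= B" using test_grad(3)[OF bump_test] by metis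
 have [measurable]: "bump \<in> BM" "grad bump \<in> BM"
  using test_measurable[OF bump_test] test_grad(2)[OF bump_test] by (auto dest: sq_int_measurable)
 show thesis
 proof (rule that[OF c0], rule ccontr)
  fix w v assume w: "wgrad w v" "sqn w = 1" "sqn v = 1" "1 / a_star <= sqn (sq w)"
   and "\<nexists>y. c0 <= sqn (%x. bump (x - y) * w x)"
  hence lt: "sqn (%x. bump (x - y) * w x) <= c0" for y by (meson le_cases)
  note s = wgrad_sq_int[OF w(1)] quartic_integrable(1)[OF w(1)]
  note [measurable] = s[THEN sq_int_measurable]
  have hg: "has_grad (%x. bump (x - y)) (%x. grad bump (x - y))" for y
   using has_grad_affine[OF test_has_grad[OF bump_test], of "- y" 1] by simp
  have W: "wgrad (%x. bump (x - y) * w x) (%x. bump (x - y) *R v x + w x *R grad bump (x - y))" for y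
   by (rule wgrad_mult_C1[OF w(1) hg _ B]) (intro continuous_on_compose2[OF test_grad(1)[OF bump_test]] continuous_intros; simp)
  have s1: "sq_int (%x. bump (x - y) *R v x)" for y
   by (rule sq_int_bound(1)[OF s(2), where c=B]) (use B in \<open>auto simp: mult_right_mono\<close>)
  have s2: "sq_int (%x. w x *R grad bump (x - y))" for y
   by (rule sq_int_bound(1)[OF s(1), where c=B]) (use B in \<open>auto simp: mult_left_mono mult.commute[of B]\<close>)
  define P where "P y = (LBINT x. ((bump (x - y))^2 * (bump (x - y))^2) * (w x)^4)" for y
  define R where "R y = (LBINT x. (bump (x - y))^2 * (norm (v x))^2)" for y
  define T where "T y = (LBINT x. (norm (grad bump (x - y)))^2 * (w x)^2)" for y
  have Peq: "P y = sqn (%x. (bump (x - y) * w x)^2)" for y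
   by (simp add: P_def sqn_def power_mult_distrib power2_eq_square power4_eq_xxxx mult_ac)
  have Req: "R y = sqn (%x. bump (x - y) *R v x)" for y by (simp add: R_def sqn_def power_mult_distrib)
  have Teq: "T y = sqn (%x. w x *R grad bump (x - y))" for y by (simp add: T_def sqn_def power_mult_distrib mult.commute)
  have ineq: "a_star / 2 * P y <= c0 * (2 * R y + 2 * T y)" for y
  proof -
   have "a_star / 2 * P y <= sqn (%x. bump (x - y) *R v x + w x *R grad bump (x - y)) * sqn (%x. bump (x - y) * w x)"
    unfolding Peq by (rule quartic_integrable(2)[OF W])
   also have "\<dots> <= (2 * R y + 2 * T y) * c0"
    unfolding Req Teq using sqn_add_le[OF s1 s2, of y y] lt[of y] by (intro mult_mono) auto
   finally show ?thesis by (simp add: mult.commute)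
  qed
  have PI: "(\<integral>\<^sup>+y. ennreal (P y) \<partial>lborel) = ennreal (I4 * sqn (sq w))"
  proof -
   have "integrable lborel (%x. ((bump (x - y))^2 * (bump (x - y))^2) * (w x)^4)" for y
    using sq_int_integrable[OF quartic_integrable(1)[OF W[of y]]]
    by (simp add: power_mult_distrib power2_eq_square power4_eq_xxxx mult_ac)
   moreover have "integrable lborel (%x. (w x)^4)" using sq_int_integrable[OF s(3)] by simp
   ultimately show ?thesis unfolding P_def I4_def
    using integral_convolution[of "%x. (bump x)^2 * (bump x)^2" "%x. (w x)^4"] test_sq_int(2)[OF b4] by (simp add: sqn_def)
  qed
  have RI: "(\<integral>\<^sup>+y. ennreal (R y) \<partial>lborel) = ennreal (I2 * sqn v)"
  proof -
   have "integrable lborel (%x. (bump (x - y))^2 * (norm (v x))^2)" for y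
    using sq_int_integrable[OF s1[of y]] by (simp add: power_mult_distrib)
   thus ?thesis unfolding R_def I2_def
    using integral_convolution[of "%x. (bump x)^2" "%x. (norm (v x))^2"] test_sq_int(2)[OF bsq] sq_int_integrable[OF s(2)] by (simp add: sqn_def)
  qed
  have TI: "(\<integral>\<^sup>+y. ennreal (T y) \<partial>lborel) = ennreal (J2 * sqn w)"
  proof -
   have "integrable lborel (%x. (norm (grad bump (x - y)))^2 * (w x)^2)" for y
    using sq_int_integrable[OF s2[of y]] by (simp add: power_mult_distrib mult.commute)
   thus ?thesis unfolding T_def J2_def
    using integral_convolution[of "%x. (norm (grad bump x))^2" "%x. (w x)^2"] sq_int_integrable[OF test_grad(2)[OF bump_test]] sq_int_integrable[OF s(1)] by (simp add: sqn_def)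
  qed
  have nn: "0 <= P y" "0 <= R y" "0 <= T y" for y unfolding Peq Req Teq by auto
  have [measurable]: "P \<in> BM" "R \<in> BM" "T \<in> BM"
   unfolding P_def R_def T_def by measurable
  have "(\<integral>\<^sup>+y. ennreal (a_star / 2 * P y) \<partial>lborel) = (\<integral>\<^sup>+y. ennreal (a_star / 2) * ennreal (P y) \<partial>lborel)"
   by (intro nn_integral_cong ennreal_mult) (use a_pos nn in auto)
  also have "\<dots> = ennreal (a_star / 2) * ennreal (I4 * sqn (sq w))"
   unfolding PI[symmetric] by (rule nn_integral_cmult) measurable
  also have "\<dots> = ennreal (a_star / 2 * (I4 * sqn (sq w)))"
   by (rule ennreal_mult[symmetric]) (use a_pos I4 in auto)
  finally have "ennreal (a_star / 2 * (I4 * sqn (sq w))) = (\<integral>\<^sup>+y. ennreal (a_star / 2 * P y) \<partial>lborel)" ..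
  also have "\<dots> <= (\<integral>\<^sup>+y. ennreal (c0 * (2 * R y + 2 * T y)) \<partial>lborel)" by (intro nn_integral_mono ennreal_leI ineq)
  also have "\<dots> = ennreal (c0 * 2) * ((\<integral>\<^sup>+y. ennreal (R y) \<partial>lborel) + (\<integral>\<^sup>+y. ennreal (T y) \<partial>lborel))"
   using c0 nn by (simp add: ennreal_mult'[symmetric] nn_integral_add[symmetric] nn_integral_cmult[symmetric] ennreal_plus[symmetric] algebra_simps del: ennreal_plus)
  also have "\<dots> = ennreal (c0 * 2 * (I2 + J2))"
   unfolding RI TI w(2,3) using I2 J20 c0 by (simp add: ennreal_mult ennreal_plus[symmetric] del: ennreal_plus)
  finally have "a_star / 2 * (I4 * sqn (sq w)) <= c0 * 2 * (I2 + J2)"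
   using I2 J20 c0 by (subst (asm) ennreal_le_iff) auto
  also have "\<dots> = I4 / 4"
  proof -
   have "I4 / (8 * M) * 2 * M = I4 / 4" if "M > 0" for M :: real using that by simp
   from this[OF IJ] show ?thesis by (simp only: c0_def)
  qed
  finally have 1: "a_star / 2 * (I4 * sqn (sq w)) <= I4 / 4" .
  have "I4 / 2 = a_star / 2 * (I4 * (1 / a_star))" using a_pos by simp
  also have "\<dots> <= a_star / 2 * (I4 * sqn (sq w))" using w(4) a_pos I4 by (intro mult_left_mono) auto
  finally show False using 1 I4 by simp
 qed
qed

lemma quartic_bound:
 assumes w: "wgrad w v" and B: "sqn w <= A" "sqn v <= A"
 shows "sqn (sq w) <= 2 / a_star * A^2"
proof -
 have "a_star / 2 * sqn (sq w) <= sqn v * sqn w" by (rule quartic_integrable(2)[OF w])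
 also have "\<dots> <= A * A" using order_trans[OF sqn_nonneg B(1)] by (intro mult_mono B) auto
 finally show ?thesis using a_pos by (simp add: field_simps power2_eq_square)
qed

text \<open>Boundedness in L2 and almost everywhere convergence yield weak convergence: Young's
  inequality splits p w into a small multiple of w^2 and a fixed integrable function, the form that
  \<open>dominated_convergence_almost\<close> accepts. \<open>limit_quadratic\<close> and
  \<open>limit_cubic\<close> do the same with the L4 bound.\<close>

lemma limit_linear:
 assumes w: "!!n::nat. wgrad (w n) (v n)" and B: "!!n. sqn (w n) <= A"
  and lim: "AE x in lborel. (%n. w n x) ----> u x" and u: "u \<in> BM" and p: "sq_int p"
 shows "(%n. LBINT x. p x * w n x) ----> (LBINT x. p x * u x)"
proof -
 note s = wgrad_sq_int(1)[OF w]
 note [measurable] = s[THEN sq_int_measurable] u p[THEN sq_int_measurable]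
 show ?thesis
 proof (rule dominated_convergence_almost(4)[where a="%n x. (w n x)^2" and C=A])
  show "AE x in lborel. (%n. p x * w n x) ----> p x * u x" using lim by eventually_elim (intro tendsto_intros)
  show "integrable lborel (sq (w n))" for n using sq_int_integrable[OF s[of n]] by simp
  show "(LBINT x. (w n x)^2) <= A" for n using B[of n] by (simp add: sqn_def)
  fix d :: real assume d: "d > 0"
  have "integrable lborel (%x. (p x)^2 / d)" using sq_int_integrable[OF p] by simp
  moreover have "norm (p x * w n x) <= d * (w n x)^2 + (p x)^2 / d" for n x
   using young_tail[OF d, of "w n x" "p x"] by (simp add: mult.commute)
  ultimately show "EX G. integrable lborel G & (ALL n. AE x in lborel. norm (p x * w n x) <= d * (w n x)^2 + G x)" by auto
 qed auto
qed

lemma limit_quadratic: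
 assumes w: "!!n::nat. wgrad (w n) (v n)" and B: "!!n. sqn (w n) <= A" "!!n. sqn (v n) <= A"
  and lim: "AE x in lborel. (%n. w n x) ----> u x" and u: "u \<in> BM" and p: "sq_int p"
 shows "(%n. LBINT x. p x * (w n x)^2) ----> (LBINT x. p x * (u x)^2)"
proof -
 note s = wgrad_sq_int(1)[OF w]
 note [measurable] = s[THEN sq_int_measurable] u p[THEN sq_int_measurable]
 show ?thesis
 proof (rule dominated_convergence_almost(4)[where a="%n x. ((w n x)^2)^2" and C="2 / a_star * A^2"])
  show "AE x in lborel. (%n. p x * (w n x)^2) ----> p x * (u x)^2" using lim by eventually_elim (intro tendsto_intros)
  show "integrable lborel (%x. ((w n x)^2)^2)" for n using sq_int_integrable[OF quartic_integrable(1)[OF w[of n]]] by simp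
  show "(LBINT x. ((w n x)^2)^2) <= 2 / a_star * A^2" for n using quartic_bound[OF w B, of n] by (simp add: sqn_def)
  fix d :: real assume d: "d > 0"
  have "integrable lborel (%x. (p x)^2 / d)" using sq_int_integrable[OF p] by simp
  moreover have "norm (p x * (w n x)^2) <= d * ((w n x)^2)^2 + (p x)^2 / d" for n x
   using young_tail[OF d, of "(w n x)^2" "p x"] by (simp add: mult.commute)
  ultimately show "EX G. integrable lborel G & (ALL n. AE x in lborel. norm (p x * (w n x)^2) <= d * ((w n x)^2)^2 + G x)" by auto
 qed auto
qed

lemma young_cubic:
 fixes s t d :: real assumes d: "d > 0"
 shows "\<bar>s^2 * (s * t)\<bar> <= d * (s^2)^2 + (8 / d ^ 3) * (t^2)^2"
proof -
 have d2: "d / 2 > 0" "(d / 2)^2 > 0" using d by auto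
 have "\<bar>s^2 * (s * t)\<bar> <= (d/2) * (s^2)^2 + (s * t)^2 / (d/2)" by (rule young_tail[OF d2(1)])
 also have "(s * t)^2 / (d/2) <= ((d/2)^2 * (s^2)^2 + (t^2)^2 / (d/2)^2) / (d/2)"
  using young_tail[OF d2(2), of "s^2" "t^2"] d by (intro divide_right_mono) (auto simp: power_mult_distrib)
 also have "\<dots> = (d/2) * (s^2)^2 + (8 / d ^ 3) * (t^2)^2"
  using d by (simp add: field_simps power2_eq_square power3_eq_cube)
 finally show ?thesis by simp
qed

lemma limit_cubic:
 assumes w: "!!n::nat. wgrad (w n) (v n)" and B: "!!n. sqn (w n) <= A" "!!n. sqn (v n) <= A"
  and lim: "AE x in lborel. (%n. w n x) ----> u x" and u: "wgrad u g"
 shows "(%n. LBINT x. (w n x)^2 * (w n x * u x)) ----> sqn (sq u)"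
proof -
 note s = wgrad_sq_int(1)[OF w]
 note [measurable] = s[THEN sq_int_measurable] wgrad_sq_int(1)[OF u, THEN sq_int_measurable]
 have eq: "sqn (sq u) = (LBINT x. (u x)^2 * (u x * u x))" by (simp add: sqn_def power2_eq_square)
 show ?thesis unfolding eq
 proof (rule dominated_convergence_almost(4)[where a="%n x. ((w n x)^2)^2" and C="2 / a_star * A^2"])
  show "AE x in lborel. (%n. (w n x)^2 * (w n x * u x)) ----> (u x)^2 * (u x * u x)" using lim by eventually_elim (intro tendsto_intros)
  show "integrable lborel (%x. ((w n x)^2)^2)" for n using sq_int_integrable[OF quartic_integrable(1)[OF w[of n]]] by simp
  show "(LBINT x. ((w n x)^2)^2) <= 2 / a_star * A^2" for n using quartic_bound[OF w B, of n] by (simp add: sqn_def)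
  fix d :: real assume d: "d > 0"
  have "integrable lborel (%x. (8 / d^3) * ((u x)^2)^2)" using sq_int_integrable[OF quartic_integrable(1)[OF u]] by simp
  thus "EX G. integrable lborel G & (ALL n. AE x in lborel. norm ((w n x)^2 * (w n x * u x)) <= d * ((w n x)^2)^2 + G x)"
   using young_cubic[OF d] unfolding real_norm_def by (intro exI[of _ "%x. (8 / d^3) * ((u x)^2)^2"]) auto
 qed auto
qed

text \<open>The maximizing sequence only yields a weak limit \<open>u \<noteq> 0\<close>.  Varying \<open>W\<close> in the imaginary
 direction \<open>W + i t h\<close> gives an approximate second order condition, whose null direction \<open>h = W\<close>
 produces \<open>\<parallel>\<nabla>u\<parallel>\<^sup>2 + \<parallel>u\<parallel>\<^sup>2 = a\<^sub>* \<parallel>u\<parallel>\<^sub>4\<^sup>4\<close>; together with Gagliardo--Nirenberg and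
 \<open>\<parallel>u\<parallel>, \<parallel>\<nabla>u\<parallel> \<le> 1\<close> this forces \<open>u\<close> to be optimal, so no mass is lost.\<close>

lemma optimizer_exists:
 obtains q k where "wgrad q k" "!!x. q x >= 0" "sqn q = 1" "sqn k = 1" "a_star / 2 * sqn (sq q) = 1"
proof -
 define \<delta> where "\<delta> n = 1 / (real n + 1)" for n
 have d: "\<delta> n > 0" "\<delta> n <= 1" for n by (auto simp: \<delta>_def)
 have d0: "\<delta> ----> 0" unfolding \<delta>_def by real_asymp
 obtain c0 where c0: "c0 > 0"
  "!!w v. wgrad w v ==> sqn w = 1 ==> sqn v = 1 ==> 1 / a_star <= sqn (sq w) ==> EX y. c0 <= sqn (%x. bump (x - y) * w x)"
  by (rule nonvanishing, rule that, assumption+)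
 define good where "good n w v \<longleftrightarrow> wgrad w v & (ALL x. 0 <= w x) & sqn w = 1 & sqn v = 1 \<and>
   2 / (a_star * (1 + \<delta> n)) <= sqn (sq w) & c0 <= sqn (%x. bump x * w x)" for n w v
 have "EX w v. good n w v" for n
 proof -
  obtain w v where w: "wgrad w v" "!!x. 0 <= w x" "sqn w = 1" "sqn v = 1" "2 / (a_star * (1 + \<delta> n)) <= sqn (sq w)"
   by (rule near_optimal[OF d(1)[of n]], rule that, assumption+)
  have "2 / (a_star * 2) <= 2 / (a_star * (1 + \<delta> n))"
   using d[of n] a_pos by (intro divide_left_mono mult_left_mono mult_pos_pos add_pos_pos) auto
  hence "1 / a_star <= 2 / (a_star * (1 + \<delta> n))" by simp
  hence "1 / a_star <= sqn (sq w)" using w(5) by (rule order_trans)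
  from c0(2)[OF w(1,3,4) this] obtain y where y: "c0 <= sqn (%x. bump (x - y) * w x)" by blast
  note S = wgrad_scale[OF w(1) zero_less_one, of 1 y]
  note [measurable] = wgrad_sq_int(1)[OF w(1), THEN sq_int_measurable]
  have bw: "sq_int (%x. bump (x - y) * w x)"
  proof (rule sq_int_bound(1)[OF wgrad_sq_int(1)[OF w(1)], where c=1])
   have [measurable]: "bump \<in> BM" by (rule test_measurable[OF bump_test])
   show "(%x. bump (x - y) * w x) \<in> BM" by measurable
   have "\<bar>bump t\<bar> <= 1" for t using bump_nonneg[of t] by (simp add: order_trans[OF bump_nonneg(2)])
   thus "AE x in lborel. norm (bump (x - y) * w x) <= 1 * norm (w x)"
    by (intro AE_I2) (simp add: abs_mult mult_left_le_one_le)
  qed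
  show ?thesis unfolding good_def
  proof (intro exI conjI allI)
   show "wgrad (%x. 1 * w (y + 1 *R x)) (%x. (1 * 1) *R v (y + 1 *R x))" by (rule S(1))
   show "sqn (%x. 1 * w (y + 1 *R x)) = 1" "sqn (%x. (1 * 1) *R v (y + 1 *R x)) = 1"
    unfolding S(2,3) using w by simp_all
   show "0 <= 1 * w (y + 1 *R x)" for x using w(2) by simp
   show "2 / (a_star * (1 + \<delta> n)) <= sqn (%x. (1 * w (y + 1 *R x))^2)"
    by (subst sqn_square_scale) (use w(5) in auto)
   show "c0 <= sqn (%x. bump x * (1 * w (y + 1 *R x)))"
    using sq_int_shift(2)[OF bw, of y] y by (simp add: add.commute)
  qed
 qed
 then obtain W V where "!!n. good n (W n) (V n)" by metis
 hence WV: "!!n. wgrad (W n) (V n)" "!!n x. 0 <= W n x" "!!n. sqn (W n) = 1" "!!n. sqn (V n) = 1"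
  "!!n. 2 / (a_star * (1 + \<delta> n)) <= sqn (sq (W n))" "!!n. c0 <= sqn (%x. bump x * W n x)"
  by (simp_all add: good_def)
 have l2W: "l2 (W n) <= 1" "l2 (V n) <= 1" for n using WV(3,4) by (simp_all add: l2_def)
 obtain r :: "nat => nat" and u where r: "strict_mono r" "u \<in> BM" "AE x in lborel. (%n. W (r n) x) ----> u x"
  by (rule rellich_AE[of W V, OF WV(1) l2W])
 define w v where "w n = W (r n)" and "v n = V (r n)" for n
 have w: "wgrad (w n) (v n)" "0 <= w n x" "sqn (w n) = 1" "sqn (v n) = 1" "c0 <= sqn (%x. bump x * w n x)" for n x
  using WV by (auto simp: w_def v_def)
 have lim: "AE x in lborel. (%n. w n x) ----> u x" using r(3) by (simp add: w_def)
 have rn: "\<delta> (r n) <= \<delta> n" for n using seq_suble[OF r(1), of n] by (simp add: \<delta>_def frac_le)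
 have w5: "2 / (a_star * (1 + \<delta> n)) <= sqn (sq (w n))" for n
 proof -
  have "a_star * (1 + \<delta> (r n)) <= a_star * (1 + \<delta> n)" using rn[of n] a_pos by (intro mult_left_mono) auto
  moreover have "0 < a_star * (1 + \<delta> (r n))" using a_pos d(1)[of "r n"] by (simp add: add_pos_pos)
  ultimately have "2 / (a_star * (1 + \<delta> n)) <= 2 / (a_star * (1 + \<delta> (r n)))" by (intro divide_left_mono) (auto intro: mult_pos_pos)
  thus ?thesis using WV(5)[of "r n"] by (simp add: w_def)
 qed
 have le1: "sqn (w n) <= 1" "sqn (v n) <= 1" for n using w(3,4) by simp_all
 obtain g where g: "wgrad u g" "sqn u <= 1" "sqn g <= 1"
  "!!\<psi>. sq_int \<psi> ==> (%n. LBINT x. \<psi> x \<bullet> v n x) ----> (LBINT x. \<psi> x \<bullet> g x)"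
  by (rule weak_limit[OF w(1) le1 lim r(2)], rule that, assumption+)
 note su = wgrad_sq_int[OF g(1)] and sw = wgrad_sq_int[OF w(1)]
 note qu = quartic_integrable[OF g(1)] and qw = quartic_integrable[OF w(1)]
 have u0: "AE x in lborel. 0 <= u x" using lim
  by eventually_elim (rule LIMSEQ_le_const, assumption, use w(2) in auto)
 have bsq: "(sq bump) \<in> test_functions"
  using test_mult[OF bump_test test_C_k[OF bump_test]] by (simp add: power2_eq_square)
 have "(%n. LBINT x. (bump x)^2 * (w n x)^2) ----> (LBINT x. (bump x)^2 * (u x)^2)"
  by (rule limit_quadratic[OF w(1) le1 lim r(2) test_sq_int(1)[OF bsq]])
 hence "c0 <= (LBINT x. (bump x)^2 * (u x)^2)"
  by (rule LIMSEQ_le_const) (use w(5) in \<open>auto simp: sqn_def power_mult_distrib\<close>)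
 hence un0: "sqn u ~= 0"
 proof (rule contrapos_pn)
  assume "sqn u = 0"
  hence ae: "AE x in lborel. u x = 0" using sqn_eq_0[OF su(1)] by simp
  have "(LBINT x. (bump x)^2 * (u x)^2) = (\<integral>x. 0 \<partial>(lborel :: (real^2) measure))"
   by (rule integral_cong_AE) (use ae r(2) test_measurable[OF bump_test] in auto)
  thus "\<not> c0 <= (LBINT x. (bump x)^2 * (u x)^2)" using c0 by simp
 qed
 hence upos: "sqn u > 0" using sqn_nonneg[of u] by linarith
 define F where "F n = sqn (sq (w n))" for n
 define A B U where "A = sqn g" and "B = sqn u" and "U = sqn (sq u)"
 have F1: "a_star / 2 * F n <= 1" for n using qw(2)[of n] w(3,4) by (simp add: F_def)
 have F2: "1 - \<delta> n <= a_star / 2 * F n" for n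
 proof -
  have "1 - \<delta> n <= 1 / (1 + \<delta> n)" using d[of n] by (subst pos_le_divide_eq) (auto simp: algebra_simps add_pos_pos)
  also have "\<dots> = a_star / 2 * (2 / (a_star * (1 + \<delta> n)))" using a_pos by simp
  also have "\<dots> <= a_star / 2 * F n" using w5[of n] a_pos unfolding F_def by (intro mult_left_mono) auto
  finally show ?thesis .
 qed
 have Flim: "(%n. a_star * F n) ----> 2"
 proof (rule tendsto_sandwich[of "%n. 2 - 2 * \<delta> n" _ _ "%_. 2"])
  show "\<forall>\<^sub>F n in sequentially. 2 - 2 * \<delta> n <= a_star * F n" using F2 by (intro always_eventually allI) (auto simp: field_simps)
  show "\<forall>\<^sub>F n in sequentially. a_star * F n <= 2" using F1 by (intro always_eventually allI) (auto simp: field_simps)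
  show "(%n. 2 - 2 * \<delta> n) ----> 2" using tendsto_diff[OF tendsto_const tendsto_mult_right_zero[OF d0], of 2 2] by simp
 qed auto
 define P1 where "P1 n = (LBINT x. g x \<bullet> v n x)" for n
 define P2 where "P2 n = (LBINT x. u x * w n x)" for n
 define P3 where "P3 n = (LBINT x. (w n x)^2 * (w n x * u x))" for n
 have l1: "P1 ----> A" using g(4)[OF su(2)] by (simp add: P1_def[abs_def] A_def sqn_def power2_norm_eq_inner)
 have l2': "P2 ----> B" using limit_linear[OF w(1) le1(1) lim r(2) su(1)] by (simp add: P2_def[abs_def] B_def sqn_def power2_eq_square)
 have l3: "P3 ----> U" unfolding P3_def[abs_def] U_def by (rule limit_cubic[OF w(1) le1 lim g(1)])
 have key: "- 17 * sqrt (\<delta> n) <= (1 + 2 * \<sigma> * P1 n + \<sigma>^2 * A) + (1 + 2 * \<sigma> * P2 n + \<sigma>^2 * B) - a_star * F n - 2 * \<sigma> * a_star * P3 n"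
  if sig: "\<bar>\<sigma>\<bar> <= 1" for \<sigma> n
 proof -
  \<comment> \<open>The direction w itself is asymptotically null; adding \<sigma> u measures the
    first variation of the form in the direction of the weak limit.\<close>
  define h where "h x = w n x + \<sigma> * u x" for x
  define k where "k x = v n x + \<sigma> *R g x" for x
  have h: "wgrad h k" unfolding h_def[abs_def] k_def[abs_def] by (intro wgrad_add w wgrad_cmult g)
  \<comment> \<open>With t = \<delta>^(1/4) the defect of w is at most t^4, the size of the fourth
    order terms, which are at most 4 * 4 * t^4. Dividing by t^2 leaves the error 17 t^2 = 17 sqrt
    \<delta>.\<close>
  define t where "t = sqrt (sqrt (\<delta> n))"
  have t: "t^2 = sqrt (\<delta> n)" "t^2 * t^2 = \<delta> n" "t > 0" using d(1)[of n] by (auto simp: t_def)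
  have A: "sqn k = 1 + 2 * \<sigma> * P1 n + \<sigma>^2 * A"
   unfolding k_def using sqn_add[OF sw(2)[of n] sq_int_scaleR[OF su(2), of \<sigma>]] w(4)[of n]
   by (simp add: sqn_scaleR P1_def A_def inner_commute)
  have B: "sqn h = 1 + 2 * \<sigma> * P2 n + \<sigma>^2 * B"
   unfolding h_def using sqn_add[OF sw(1)[of n] sq_int_cmult[OF su(1), of \<sigma>]] w(3)[of n]
   by (simp add: sqn_cmult P2_def B_def mult_ac)
  have s4: "sqn k <= 4" "sqn h <= 4"
  proof -
   have s1: "\<sigma>^2 <= 1" using sig by (simp add: abs_square_le_1)
   have "\<sigma>^2 * sqn g <= 1 * 1" "\<sigma>^2 * sqn u <= 1 * 1" by (intro mult_mono s1 g; simp)+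
   thus "sqn k <= 4" "sqn h <= 4"
    unfolding k_def h_def
    using sqn_add_le[OF sw(2)[of n] sq_int_scaleR[OF su(2), of \<sigma>]] sqn_add_le[OF sw(1)[of n] sq_int_cmult[OF su(1), of \<sigma>]] w(3,4)[of n]
    by (simp_all add: sqn_scaleR sqn_cmult)
  qed
  have C: "(LBINT x. (w n x)^2 * (h x)^2) >= F n + 2 * \<sigma> * P3 n"
  proof -
   have "(w n x)^2 * (h x)^2 = ((w n x)^2)^2 + 2 * \<sigma> * ((w n x)^2 * (w n x * u x)) + \<sigma>^2 * ((w n x)^2 * (u x * u x))" for x
    by (simp add: h_def power2_eq_square algebra_simps)
   hence "(LBINT x. (w n x)^2 * (h x)^2) = F n + 2 * \<sigma> * P3 n + \<sigma>^2 * (LBINT x. (w n x)^2 * (u x * u x))"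
    using sq_int_integrable[OF qw(1)[of n]] cubic_integrable[OF w(1) w(1) g(1), of n n] cubic_integrable[OF w(1) g(1) g(1), of n]
    by (simp add: F_def P3_def sqn_def)
   moreover have "0 <= (LBINT x. (w n x)^2 * (u x * u x))" by (intro integral_nonneg_AE) auto
   ultimately show ?thesis by simp
  qed
  have "a_star / 2 * (F n + 2 * (t^2 * (LBINT x. (w n x)^2 * (h x)^2)) + sqn (%x. (t * h x)^2)) <= (1 + t^2 * sqn k) * (1 + t^2 * sqn h)"
   using gn_quad[OF w(1)[of n] wgrad_cmult[OF h, of t]] w(3,4)[of n]
   by (simp add: F_def sqn_scaleR sqn_cmult power_mult_distrib mult.left_commute[of _ "t^2"])
  moreover have "0 <= a_star / 2 * sqn (%x. (t * h x)^2)" using a_pos by simp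
  moreover have "a_star * (t^2 * (F n + 2 * \<sigma> * P3 n)) <= a_star * (t^2 * (LBINT x. (w n x)^2 * (h x)^2))"
   using C a_pos by (intro mult_left_mono) auto
  moreover have "t^2 * sqn k * (t^2 * sqn h) <= 16 * \<delta> n"
  proof -
   have "sqn k * sqn h <= 4 * 4" by (intro mult_mono s4) auto
   hence "\<delta> n * (sqn k * sqn h) <= \<delta> n * 16" using d(1)[of n] by (intro mult_left_mono) auto
   thus ?thesis unfolding t(2)[symmetric] by (simp add: mult_ac)
  qed
  ultimately have "0 <= 1 - a_star / 2 * F n + t^2 * (sqn k + sqn h - a_star * (F n + 2 * \<sigma> * P3 n)) + 16 * \<delta> n"
   by (simp add: algebra_simps)
  hence "0 <= t^2 * (sqn k + sqn h - a_star * (F n + 2 * \<sigma> * P3 n)) + 17 * (t^2 * t^2)" using F2[of n] t(2) by simp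
  hence "0 <= t^2 * ((sqn k + sqn h - a_star * (F n + 2 * \<sigma> * P3 n)) + 17 * t^2)" by (simp add: algebra_simps)
  hence "0 <= (sqn k + sqn h - a_star * (F n + 2 * \<sigma> * P3 n)) + 17 * t^2" using t(3) by (simp add: zero_le_mult_iff)
  thus ?thesis unfolding A B t(1) by (simp add: algebra_simps)
 qed
 \<comment> \<open>At \<sigma> = 0 the limiting inequality reads 0 <= 0, so the coefficient linear
   in \<sigma> must vanish.\<close>
 have EL: "A + B = a_star * U"
 proof -
  have "A + B - a_star * U = 0"
  proof (rule quad_zero[where c="A + B"])
   show "0 <= A + B" by (simp add: A_def B_def)
   fix \<sigma> :: real assume sig: "\<bar>\<sigma>\<bar> <= 1"
   have L1: "(%n. (1 + 2 * \<sigma> * P1 n + \<sigma>^2 * A) + (1 + 2 * \<sigma> * P2 n + \<sigma>^2 * B) - a_star * F n - 2 * \<sigma> * a_star * P3 n)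
    ----> (1 + 2 * \<sigma> * A + \<sigma>^2 * A) + (1 + 2 * \<sigma> * B + \<sigma>^2 * B) - 2 - 2 * \<sigma> * a_star * U"
    by (intro tendsto_intros l1 l2' l3 Flim)
   have L2: "(%n. - 17 * sqrt (\<delta> n)) ----> - 17 * sqrt 0" by (intro tendsto_intros d0)
   have "- 17 * sqrt 0 <= (1 + 2 * \<sigma> * A + \<sigma>^2 * A) + (1 + 2 * \<sigma> * B + \<sigma>^2 * B) - 2 - 2 * \<sigma> * a_star * U"
    by (rule LIMSEQ_le[OF L2 L1]) (use key[OF sig] in auto)
   thus "0 <= 2 * \<sigma> * (A + B - a_star * U) + \<sigma>^2 * (A + B)" by (simp add: algebra_simps)
  qed
  thus ?thesis by simp
 qed
 have "A + B <= 2 * (A * B)" using qu(2) EL by (simp add: A_def B_def U_def)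
 hence "A * (1 - B) + B * (1 - A) <= 0" by (simp add: algebra_simps)
 moreover have "0 <= A * (1 - B)" "0 <= B * (1 - A)" using g(2,3) by (auto simp: A_def B_def)
 ultimately have "A * (1 - B) = 0" "B * (1 - A) = 0" by linarith+
 hence AB: "A = 1" "B = 1" using upos by (auto simp: B_def)
 have ae: "AE x in lborel. u x = \<bar>u x\<bar>" using u0 by eventually_elim simp
 have m: "g \<in> BM" "(%x. \<bar>u x\<bar>) \<in> BM" using su r(2) by (auto dest: sq_int_measurable)
 show thesis
 proof (rule that[of "%x. \<bar>u x\<bar>" g])
  show "wgrad (%x. \<bar>u x\<bar>) g" by (rule wgrad_cong_AE[OF g(1) ae _ m(2,1)]) simp
  show "sqn (%x. \<bar>u x\<bar>) = 1" using AB by (simp add: B_def sqn_def)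
  show "sqn g = 1" using AB by (simp add: A_def)
  show "a_star / 2 * sqn (%x. \<bar>u x\<bar>^2) = 1" using EL AB by (simp add: U_def)
 qed simp
qed

end

section \<open>The ground state is simple and decays\<close>

definition heat :: "real => real^2 => real" where
 "heat s x = (1 / s) * exp (- ((norm x)^2 / (4 * s)))"

lemma lborel_not_AE_False: "\<not> (AE x in (lborel :: 'a::euclidean_space measure). False)"
 using ae_filter_eq_bot_iff[of "lborel :: 'a measure"] by (simp add: trivial_limit_def[symmetric] eventually_False)

lemma mult_exp_le: "t * exp (- t) <= (1::real)"
proof -
 have "t <= exp t" using exp_ge_add_one_self[of t] by linarith
 hence "t * exp (- t) <= exp t * exp (- t)" by (intro mult_right_mono) auto
 thus ?thesis by (simp add: exp_minus)
qed

lemma sq_int_poly_gaussian: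
 assumes s: "s > 0"
 shows "sq_int (%x::real^2. (A + B * (norm x)^2) * exp (- ((norm x)^2 / s)))"
proof -
 have s2: "1 / (2 * s) > 0" using s by simp
 have i: "sq_int (%x::real^2. exp (- (1 / (2 * s)) * (norm x)^2))" by (rule sq_int_gaussian[OF s2])
 show ?thesis
 proof (rule l2_bound(1)[OF i])
  show "norm ((A + B * (norm x)^2) * exp (- ((norm x)^2 / s))) <= (\<bar>A\<bar> + \<bar>B\<bar> * (2 * s)) * norm (exp (- (1 / (2 * s)) * (norm x)^2))" for x :: "real^2"
  proof -
   define t where "t = (norm x)^2 / (2 * s)"
   have t: "t >= 0" "(norm x)^2 / s = t + t" "(norm x)^2 = 2 * s * t" "- (1 / (2 * s)) * (norm x)^2 = - t"
    using s by (auto simp: t_def field_simps)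
   have "\<bar>A + B * (norm x)^2\<bar> * exp (- t) <= (\<bar>A\<bar> + \<bar>B\<bar> * (2 * s * t)) * exp (- t)"
    unfolding t(3) using s t(1) abs_triangle_ineq[of A "B * (2 * s * t)"] by (intro mult_right_mono) (auto simp: abs_mult)
   also have "\<dots> = \<bar>A\<bar> * exp (- t) + \<bar>B\<bar> * (2 * s) * (t * exp (- t))" by (simp add: algebra_simps)
   also have "\<dots> <= \<bar>A\<bar> * 1 + \<bar>B\<bar> * (2 * s) * 1"
    using s t(1) by (intro add_mono mult_left_mono mult_exp_le) auto
   finally have "\<bar>A + B * (norm x)^2\<bar> * exp (- t) * exp (- t) <= (\<bar>A\<bar> * 1 + \<bar>B\<bar> * (2 * s) * 1) * exp (- t)"
    by (rule mult_right_mono) simp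
   thus ?thesis unfolding t(2,4) by (simp add: abs_mult mult_exp_exp mult.assoc)
  qed
 qed (use s in \<open>auto intro!: mult_nonneg_nonneg add_nonneg_nonneg\<close>)
qed

lemma heat_has_grad:
 assumes s: "s > 0"
 shows "has_grad (heat s) (%x. (- (heat s x / (2 * s))) *R x)"
proof -
 have d: "((%t. (1 / s) * exp (- (t / (4 * s)))) has_real_derivative (1 / s) * (exp (- (t / (4 * s))) * (- (1 / (4 * s))))) (at t)" for t
  using s by (auto intro!: derivative_eq_intros)
 have "has_grad (%x. (1 / s) * exp (- ((norm x)^2 / (4 * s)))) (%x. ((1 / s) * (exp (- ((norm x)^2 / (4 * s))) * (- (1 / (4 * s))))) *R (2 *R x))"
  by (rule has_grad_compose_real[OF has_grad_norm2 d])
 moreover have "((1 / s) * (exp (- ((norm x)^2 / (4 * s))) * (- (1 / (4 * s))))) *R (2 *R x) = (- (heat s x / (2 * s))) *R x" for x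
  unfolding scaleR_scaleR by (simp add: heat_def)
 moreover have "(%x. (1 / s) * exp (- ((norm x)^2 / (4 * s)))) = heat s" by (simp add: heat_def fun_eq_iff)
 ultimately show ?thesis by (simp only:)
qed

lemma heat_partial_has_grad:
 assumes s: "s > 0"
 shows "has_grad (%x. (- (heat s x / (2 * s))) * x $ i)
   (%x. (- (heat s x / (2 * s))) *R axis i 1 + (x $ i) *R ((heat s x / (4 * s^2)) *R x))"
proof -
 have "has_grad (%x. ((- (1 / (2 * s))) * heat s x) * x $ i)
   (%x. ((- (1 / (2 * s))) * heat s x) *R axis i 1 + (x $ i) *R ((- (1 / (2 * s))) *R ((- (heat s x / (2 * s))) *R x) + heat s x *R 0))"
  by (intro has_grad_mult has_grad_const heat_has_grad s has_grad_coord)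
 thus ?thesis using s by (simp add: power2_eq_square)
qed

lemma heat_continuous: "s > 0 ==> continuous_on A (heat s)"
 by (rule has_grad_continuous[OF heat_has_grad])

lemma heat_measurable[measurable]: "heat s \<in> BM"
 unfolding heat_def[abs_def] by measurable

lemma heat_pos: "s > 0 ==> heat s x > 0"
 by (simp add: heat_def)

lemma norm_le_1_sq: "norm x <= 1 + (norm x)^2"
proof -
 have "0 <= (norm x - 1)^2" by simp
 hence "2 * norm x <= 1 + (norm x)^2" by (simp add: power2_diff algebra_simps)
 thus ?thesis using zero_le_power2[of "norm x"] norm_ge_zero[of x] by linarith
qed

text \<open>The second claim puts the first derivatives of the kernel into H1. Thus
  \<open>wgrad_by_parts\<close> can move a derivative from h onto them, with h itself merely in
  H1.\<close>

lemma heat_wgrad: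
 assumes s: "s > 0"
 shows "wgrad (%x. heat s (x - y)) (%x. (- (heat s (x - y) / (2 * s))) *R (x - y))" (is ?A)
  "wgrad (%x. (- (heat s (x - y) / (2 * s))) * (x - y) $ i)
    (%x. (- (heat s (x - y) / (2 * s))) *R axis i 1 + ((x - y) $ i) *R ((heat s (x - y) / (4 * s^2)) *R (x - y)))" (is ?B)
proof -
 have s4: "4 * s > 0" using s by simp
 have heq: "heat s x = (1 / s) * exp (- ((norm x)^2 / (4 * s)))" for x by (simp add: heat_def)
 note P = sq_int_poly_gaussian[OF s4]
 have [measurable]: "(%x::real^2. heat s x) \<in> BM" by measurable
 have s1: "sq_int (heat s)"
  by (rule l2_bound(1)[OF P[of "1/s" 0], where c=1]) (auto simp: heq)
 have s2: "sq_int (%x. (- (heat s x / (2 * s))) *R x)"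
 proof (rule l2_bound(1)[OF P[of "1 / (2 * s^2)" "1 / (2 * s^2)"], where c=1])
  fix x :: "real^2"
  have "norm ((- (heat s x / (2 * s))) *R x) = (1 / (2 * s^2)) * norm x * exp (- ((norm x)^2 / (4 * s)))"
   using s by (simp add: heq power2_eq_square mult_ac)
  also have "\<dots> <= (1 / (2 * s^2)) * (1 + (norm x)^2) * exp (- ((norm x)^2 / (4 * s)))"
   by (intro mult_right_mono mult_left_mono norm_le_1_sq) auto
  also have "\<dots> = (1 / (2 * s^2) + 1 / (2 * s^2) * (norm x)^2) * exp (- ((norm x)^2 / (4 * s)))" by (simp add: distrib_left)
  also have "\<dots> <= norm ((1 / (2 * s^2) + 1 / (2 * s^2) * (norm x)^2) * exp (- ((norm x)^2 / (4 * s))))" by simp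
  finally show "norm ((- (heat s x / (2 * s))) *R x) <= 1 * norm ((1 / (2 * s^2) + 1 / (2 * s^2) * (norm x)^2) * exp (- ((norm x)^2 / (4 * s))))" by simp
 qed auto
 have s3: "sq_int (%x. (- (heat s x / (2 * s))) * x $ i)"
  using sq_int_nth(1)[OF s2, of i] by simp
 have s4: "sq_int (%x. (- (heat s x / (2 * s))) *R axis i 1 + (x $ i) *R ((heat s x / (4 * s^2)) *R x))"
 proof (rule sq_int_add)
  show "sq_int (%x. (- (heat s x / (2 * s))) *R axis i (1::real))"
   by (rule l2_bound(1)[OF s1, where c="1 / (2 * s)"]) (use s in auto)
  show "sq_int (%x. (x $ i) *R ((heat s x / (4 * s^2)) *R x))"
  proof (rule l2_bound(1)[OF P[of 0 "1 / (4 * s^3)"], where c=1])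
   fix x :: "real^2"
   have "norm ((x $ i) *R ((heat s x / (4 * s^2)) *R x)) = (\<bar>x $ i\<bar> * norm x) * (1 / (4 * s^3)) * exp (- ((norm x)^2 / (4 * s)))"
    using s by (simp add: heq power2_eq_square power3_eq_cube abs_mult mult_ac)
   also have "\<dots> <= (norm x * norm x) * (1 / (4 * s^3)) * exp (- ((norm x)^2 / (4 * s)))"
    using s by (intro mult_right_mono abs_nth_le_norm) auto
   also have "\<dots> = 1 * norm ((0 + 1 / (4 * s^3) * (norm x)^2) * exp (- ((norm x)^2 / (4 * s))))"
    using s by (simp add: power2_eq_square)
   finally show "norm ((x $ i) *R ((heat s x / (4 * s^2)) *R x)) <= 1 * norm ((0 + 1 / (4 * s^3) * (norm x)^2) * exp (- ((norm x)^2 / (4 * s))))" .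
  qed auto
 qed
 have w1: "wgrad (heat s) (%x. (- (heat s x / (2 * s))) *R x)"
  by (rule has_grad_wgrad[OF heat_has_grad[OF s] _ s1 s2]) (use s in \<open>auto intro!: continuous_intros heat_continuous\<close>)
 have w2: "wgrad (%x. (- (heat s x / (2 * s))) * x $ i) (%x. (- (heat s x / (2 * s))) *R axis i 1 + (x $ i) *R ((heat s x / (4 * s^2)) *R x))"
  by (rule has_grad_wgrad[OF heat_partial_has_grad[OF s] _ s3 s4]) (use s in \<open>auto intro!: continuous_intros heat_continuous\<close>)
 show ?A
  using wgrad_affine[OF w1, of 1 "- y"] by simp
 show ?B
  using wgrad_affine[OF w2, of 1 "- y"] by simp
qed

text \<open>The time derivative of the kernel in closed form. It is also its Laplacian, and this
  double role (\<open>heat_deriv\<close>, \<open>heat_equation\<close>) is how the equation for the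
  kernel is used.\<close>

definition heat_dt :: "real => real^2 => real" where
 "heat_dt s x = (- (1 / s^2) + (1 / (4 * s^3)) * (norm x)^2) * exp (- ((norm x)^2 / (4 * s)))"

lemma heat_deriv: "s > 0 ==> ((%s. heat s x) has_real_derivative heat_dt s x) (at s)"
 unfolding heat_def heat_dt_def
 by (auto intro!: derivative_eq_intros simp: field_simps power2_eq_square power3_eq_cube)

lemma heat_equation:
 assumes h: "wgrad h c" and s: "s > 0"
 shows "(LBINT x. c x \<bullet> ((- (heat s (x - y) / (2 * s))) *R (x - y))) = - (LBINT x. h x * heat_dt s (x - y))"
proof -
 note sh = wgrad_sq_int[OF h]
 let ?w = "%i x. (- (heat s (x - y) / (2 * s))) * (x - y) $ i"
 let ?D = "%i x. (- (heat s (x - y) / (2 * s))) *R axis i 1 + ((x - y) $ i) *R ((heat s (x - y) / (4 * s^2)) *R (x - y))"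
 have W: "wgrad (?w i) (?D i)" for i by (rule heat_wgrad(2)[OF s])
 have i1: "integrable lborel (%x. c x $ i * ?w i x)" for i
  by (rule integrable_mult_sq_int[OF sq_int_nth(1)[OF sh(2)] wgrad_sq_int(1)[OF W]])
 have i2: "integrable lborel (%x. h x * ?D i x $ i)" for i
  by (rule integrable_mult_sq_int[OF sh(1) sq_int_nth(1)[OF wgrad_sq_int(2)[OF W]]])
 have "c x \<bullet> ((- (heat s (x - y) / (2 * s))) *R (x - y)) = c x $ 1 * ?w 1 x + c x $ 2 * ?w 2 x" for x
  unfolding inner_vec_def sum_2 by simp
 hence "(LBINT x. c x \<bullet> ((- (heat s (x - y) / (2 * s))) *R (x - y))) = (LBINT x. c x $ 1 * ?w 1 x) + (LBINT x. c x $ 2 * ?w 2 x)"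
  using i1[of 1] i1[of 2] by (simp only: Bochner_Integration.integral_add)
 also have "\<dots> = - ((LBINT x. h x * ?D 1 x $ 1) + (LBINT x. h x * ?D 2 x $ 2))"
  using wgrad_by_parts[OF h W, of 1 1] wgrad_by_parts[OF h W, of 2 2] by (simp only: minus_add_distrib)
 also have "(LBINT x. h x * ?D 1 x $ 1) + (LBINT x. h x * ?D 2 x $ 2) = (LBINT x. h x * ?D 1 x $ 1 + h x * ?D 2 x $ 2)"
  by (rule Bochner_Integration.integral_add[symmetric, OF i2 i2])
 also have "\<dots> = (LBINT x. h x * heat_dt s (x - y))"
 proof (rule Bochner_Integration.integral_cong[OF refl])
  fix x
  have n: "(norm (x - y))^2 = ((x - y) $ 1)^2 + ((x - y) $ 2)^2" by (simp only: norm2_sum sum_2)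
  have a: "axis i (1::real) $ i = 1" for i :: 2 by (simp add: axis_def)
  show "h x * ?D 1 x $ 1 + h x * ?D 2 x $ 2 = h x * heat_dt s (x - y)"
   using s unfolding heat_dt_def n vector_add_component vector_scaleR_component a
   unfolding heat_def n by (simp add: field_simps power2_eq_square power3_eq_cube)
 qed
 finally show ?thesis .
qed

lemma heat_dt_bound:
 assumes s: "s > 0" and t: "s / 2 <= t" "t <= 2 * s"
 shows "\<bar>heat_dt t x\<bar> <= (4 / s^2 + (2 / s^3) * (norm x)^2) * exp (- ((norm x)^2 / (8 * s)))"
proof -
 have t0: "t > 0" using s t by linarith
 have e: "exp (- ((norm x)^2 / (4 * t))) <= exp (- ((norm x)^2 / (8 * s)))"
  using t t0 s by (simp add: frac_le)
 have a: "1 / t^2 <= 4 / s^2"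
 proof -
  have "(s / 2)^2 <= t^2" using s t by (intro power_mono) auto
  hence "1 / t^2 <= 1 / (s / 2)^2" using s t0 by (intro divide_left_mono) auto
  thus ?thesis by (simp add: power_divide)
 qed
 have b: "1 / (4 * t^3) <= 2 / s^3"
 proof -
  have "(s / 2)^3 <= t^3" using s t by (intro power_mono) auto
  hence "1 / (4 * t^3) <= 1 / (4 * (s / 2)^3)" using s t0 by (intro divide_left_mono mult_left_mono) auto
  thus ?thesis by (simp add: power_divide)
 qed
 have "\<bar>- (1 / t^2) + (1 / (4 * t^3)) * (norm x)^2\<bar> <= 1 / t^2 + (1 / (4 * t^3)) * (norm x)^2"
  using t0 by (simp add: abs_le_iff)
 also have "\<dots> <= 4 / s^2 + (2 / s^3) * (norm x)^2" by (intro add_mono mult_right_mono a b) auto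
 finally show ?thesis unfolding heat_dt_def abs_mult by (intro mult_mono) (use e s in auto)
qed

lemma heat_integral_deriv:
 assumes h: "sq_int h" and s: "s > 0"
 shows "((%s. LBINT x. h x * heat s (x - y)) has_real_derivative (LBINT x. h x * heat_dt s (x - y))) (at s)"
proof -
 note [measurable] = h[THEN sq_int_measurable]
 have [measurable]: "heat_dt s \<in> BM" for s unfolding heat_dt_def[abs_def] by measurable
 \<comment> \<open>Increments in this window keep the time between s / 2 and 2 s, the range of
   \<open>heat_dt_bound\<close>.\<close>
 let ?S = "{- (s / 2)<..<s}"
 define D where "D x = (4 / s^2 + (2 / s^3) * (norm x)^2) * exp (- ((norm x)^2 / (8 * s)))" for x :: "real^2"
 have "sq_int D" unfolding D_def[abs_def] by (rule sq_int_poly_gaussian) (use s in simp)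
 hence D: "sq_int (%x. D (x - y))" using sq_int_shift(1)[of D "- y"] by simp
 have [measurable]: "(%x. D (x - y)) \<in> BM" using D by (rule sq_int_measurable)
 have ih: "integrable lborel (%x. h x * heat t (x - y))" if "t > 0" for t
  by (rule integrable_mult_sq_int[OF h wgrad_sq_int(1)[OF heat_wgrad(1)[OF that]]])
 have bound: "\<bar>heat (s + t) z - heat s z\<bar> <= \<bar>t\<bar> * D z" if t: "t \<in> ?S" "t ~= 0" for t z
 proof -
  have mvt: "EX u. min s (s + t) < u & u < max s (s + t) & heat (max s (s + t)) z - heat (min s (s + t)) z = (max s (s + t) - min s (s + t)) * heat_dt u z"
  proof (rule MVT2)
   show "min s (s + t) < max s (s + t)" using t(2) by auto
   fix u assume "min s (s + t) <= u" "u <= max s (s + t)"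
   hence "u > 0" using t s by auto
   thus "((%s. heat s z) has_real_derivative heat_dt u z) (at u)" by (rule heat_deriv)
  qed
  then obtain u where u: "min s (s + t) < u" "u < max s (s + t)" "heat (max s (s + t)) z - heat (min s (s + t)) z = (max s (s + t) - min s (s + t)) * heat_dt u z" by blast
  have "\<bar>heat (s + t) z - heat s z\<bar> = \<bar>heat (max s (s + t)) z - heat (min s (s + t)) z\<bar>" by (auto simp: max_def min_def)
  also have "\<dots> = \<bar>t\<bar> * \<bar>heat_dt u z\<bar>" unfolding u(3) abs_mult by (auto simp: max_def min_def)
  also have "\<dots> <= \<bar>t\<bar> * D z" unfolding D_def using u t s by (intro mult_left_mono heat_dt_bound) auto
  finally show ?thesis .
 qed
 have "((%t. ((LBINT x. h x * heat (s + t) (x - y)) - (LBINT x. h x * heat s (x - y))) / t) \<longlongrightarrow> (LBINT x. h x * heat_dt s (x - y))) (at 0 within ?S)"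
  unfolding tendsto_at_iff_sequentially
 proof (intro allI impI)
  fix X :: "nat => real" assume X: "ALL i. X i \<in> ?S - {0}" "X ----> 0"
  have Xp: "s + X n > 0" "X n ~= 0" "X n \<in> ?S" for n using X(1) s by (auto dest: spec[of _ n])
  have eq: "((LBINT x. h x * heat (s + X n) (x - y)) - (LBINT x. h x * heat s (x - y))) / X n
   = (LBINT x. h x * ((heat (s + X n) (x - y) - heat s (x - y)) / X n))" for n
   using ih[OF Xp(1)[of n]] ih[OF s] by (simp add: right_diff_distrib diff_divide_distrib)
  have "(%n. LBINT x. h x * ((heat (s + X n) (x - y) - heat s (x - y)) / X n)) ----> (LBINT x. h x * heat_dt s (x - y))"
  proof (rule integral_dominated_convergence)
   show "integrable lborel (%x. \<bar>h x * D (x - y)\<bar>)" using integrable_mult_sq_int[OF h D] by (rule integrable_abs)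
   show "AE x in lborel. (%n. h x * ((heat (s + X n) (x - y) - heat s (x - y)) / X n)) ----> h x * heat_dt s (x - y)"
   proof (rule AE_I2, rule tendsto_mult[OF tendsto_const])
    fix x
    have "((%t. (heat (s + t) (x - y) - heat s (x - y)) / t) \<longlongrightarrow> heat_dt s (x - y)) (at 0)"
     using heat_deriv[OF s, of "x - y"] by (simp add: DERIV_def)
    thus "(%n. (heat (s + X n) (x - y) - heat s (x - y)) / X n) ----> heat_dt s (x - y)"
     by (rule filterlim_compose) (use X(2) Xp in \<open>auto simp: filterlim_at intro!: always_eventually\<close>)
   qed
   show "AE x in lborel. norm (h x * ((heat (s + X n) (x - y) - heat s (x - y)) / X n)) <= \<bar>h x * D (x - y)\<bar>" for n
   proof (rule AE_I2)
    fix x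
    have "\<bar>heat (s + X n) (x - y) - heat s (x - y)\<bar> / \<bar>X n\<bar> <= D (x - y)"
     using bound[OF Xp(3,2), of n "x - y"] Xp(2)[of n] by (simp add: divide_le_eq mult.commute)
    hence "\<bar>h x\<bar> * (\<bar>heat (s + X n) (x - y) - heat s (x - y)\<bar> / \<bar>X n\<bar>) <= \<bar>h x\<bar> * \<bar>D (x - y)\<bar>"
     by (intro mult_left_mono) auto
    thus "norm (h x * ((heat (s + X n) (x - y) - heat s (x - y)) / X n)) <= \<bar>h x * D (x - y)\<bar>" by (simp add: abs_mult abs_divide)
   qed
  qed measurable
  thus "((%t. ((LBINT x. h x * heat (s + t) (x - y)) - (LBINT x. h x * heat s (x - y))) / t) \<circ> X) ----> (LBINT x. h x * heat_dt s (x - y))"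
   unfolding o_def eq .
 qed
 moreover have "at 0 within ?S = at 0" by (rule at_within_open) (use s in auto)
 ultimately show ?thesis by (simp add: DERIV_def)
qed

text \<open>Strong maximum principle.  For a supersolution \<open>h\<close> the function \<open>s \<mapsto> e\<^sup>-\<^sup>\<mu>\<^sup>s (heat s * h)(y)\<close>
 decreases, so \<open>h\<close> is bounded below by a positive multiple of \<open>heat 1 * h > 0\<close>.\<close>

lemma strong_maximum_principle:
 assumes h: "wgrad h c" and nn: "AE x in lborel. 0 <= h x" and mu: "\<mu> >= 0"
  and sup: "!!\<phi> d. wgrad \<phi> d ==> (!!x. 0 <= \<phi> x) ==> 0 <= (LBINT x. c x \<bullet> d x) + \<mu> * (LBINT x. h x * \<phi> x)"
  and n0: "\<not> (AE x in lborel. h x = 0)"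
 shows "AE x in lborel. 0 < h x"
proof -
 note sh = wgrad_sq_int[OF h]
 note [measurable] = sh(1)[THEN sq_int_measurable]
 define F where "F y s = (LBINT x. h x * heat s (x - y))" for y s
 define C where "C = (LBINT z. exp (- (1/4) * (norm (z::real^2))^2))"
 have gi: "integrable lborel (%z::real^2. exp (- (1/4) * (norm z)^2))" by (rule gaussian_integrable) simp
 have ih: "integrable lborel (%x. h x * heat t (x - y))" if "t > 0" for t y
  by (rule integrable_mult_sq_int[OF sh(1) wgrad_sq_int(1)[OF heat_wgrad(1)[OF that]]])
 have Cpos: "C > 0"
 proof -
  have "C ~= 0"
  proof
   assume "C = 0"
   hence "AE z in (lborel :: (real^2) measure). exp (- (1/4) * (norm z)^2) = 0"
    using integral_nonneg_eq_0_iff_AE[OF gi] by (simp add: C_def)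
   hence "AE z in (lborel :: (real^2) measure). False" by simp
   thus False using lborel_not_AE_False by blast
  qed
  moreover have "0 <= C" unfolding C_def by (intro integral_nonneg_AE) auto
  ultimately show ?thesis by simp
 qed
 have Fpos: "F y 1 > 0" for y
 proof -
  have ae: "AE x in lborel. 0 <= h x * heat 1 (x - y)"
   using nn by eventually_elim (simp add: less_imp_le[OF heat_pos])
  have "F y 1 ~= 0"
  proof
   assume "F y 1 = 0"
   hence "AE x in lborel. h x * heat 1 (x - y) = 0"
    unfolding F_def using integral_nonneg_eq_0_iff_AE[OF ih[OF zero_less_one] ae] by simp
   hence "AE x in lborel. h x = 0" by eventually_elim (use heat_pos[of 1] in \<open>auto simp: less_imp_neq[symmetric]\<close>)
   thus False using n0 by simp
  qed
  moreover have "0 <= F y 1" unfolding F_def by (rule integral_nonneg_AE[OF ae])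
  ultimately show ?thesis by simp
 qed
 have mono: "exp (- \<mu>) * F y 1 <= F y s" if s: "0 < s" "s <= 1" for s y
 proof -
  have "exp (- \<mu> * 1) * F y 1 <= exp (- \<mu> * s) * F y s"
  proof (rule DERIV_nonpos_imp_nonincreasing[OF s(2)])
   fix t assume t: "s <= t" "t <= 1"
   hence t0: "t > 0" using s by linarith
   have d: "(F y has_real_derivative (LBINT x. h x * heat_dt t (x - y))) (at t)"
    unfolding F_def by (rule heat_integral_deriv[OF sh(1) t0])
   have "((%t. exp (- \<mu> * t) * F y t) has_real_derivative (exp (- \<mu> * t) * (LBINT x. h x * heat_dt t (x - y)) + (exp (- \<mu> * t) * (- \<mu>)) * F y t)) (at t)"
    by (rule derivative_eq_intros d refl | simp)+
   moreover have "exp (- \<mu> * t) * (LBINT x. h x * heat_dt t (x - y)) + (exp (- \<mu> * t) * (- \<mu>)) * F y t <= 0"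
   proof -
    have "0 <= - (LBINT x. h x * heat_dt t (x - y)) + \<mu> * F y t"
     using sup[OF heat_wgrad(1)[OF t0, of y]] heat_pos[OF t0] heat_equation[OF h t0, of y] by (simp add: F_def less_imp_le)
    hence "0 <= exp (- \<mu> * t) * (- (LBINT x. h x * heat_dt t (x - y)) + \<mu> * F y t)" by (intro mult_nonneg_nonneg) auto
    thus ?thesis by (simp add: algebra_simps)
   qed
   ultimately show "EX d. ((%t. exp (- \<mu> * t) * F y t) has_real_derivative d) (at t) & d <= 0" by blast
  qed
  moreover have "exp (- \<mu> * s) * F y s <= 1 * F y s"
  proof (rule mult_right_mono)
   show "exp (- \<mu> * s) <= 1" using mu s by simp
   show "0 <= F y s" unfolding F_def
    by (rule integral_nonneg_AE) (use nn s in \<open>auto elim!: eventually_mono simp: less_imp_le[OF heat_pos]\<close>)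
  qed
  ultimately show ?thesis by simp
 qed
 define K where "K z = exp (- (1/4) * (norm (z::real^2))^2) / C" for z
 have K: "kernel K"
  unfolding kernel_def
 proof (intro conjI allI)
  show "sq_int K" using sq_int_cmult[OF sq_int_gaussian[of "1/4", where 'a="real^2"], of "1/C"] by (simp add: K_def[abs_def])
  show "integrable lborel K" using gi by (simp add: K_def[abs_def])
  show "0 <= K z" for z using Cpos by (simp add: K_def)
  show "(LBINT z. K z) = 1" using Cpos by (simp add: K_def C_def)
 qed
 have Km: "K \<in> BM" using K by (auto simp: kernel_def sq_int_measurable)
 define e where "e n = 1 / (real n + 1)" for n
 have e: "e n > 0" "(e n)^2 <= 1" for n by (auto simp: e_def power_le_one)
 have e0: "e ----> 0" unfolding e_def by real_asymp
 \<comment> \<open>Heat flow for time e^2 is mollification by a Gaussian at scale e, with C as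
   normalization. As e tends to 0 the lower bound on the flow therefore becomes one on h.\<close>
 have MF: "moll K (e n) h y = F y ((e n)^2) / C" for n y
 proof -
  have "((1 / (e n)^2) * K ((1 / e n) *R (y - x))) *R h x = (h x * heat ((e n)^2) (x - y)) / C" for x
   by (simp add: K_def heat_def power_divide norm_minus_commute)
  thus ?thesis unfolding F_def moll_kernel_translate[OF e(1) Km sq_int_measurable[OF sh(1)]] by simp
 qed
 have lb: "exp (- \<mu>) * F y 1 / C <= moll K (e n) h y" for n y
  unfolding MF using mono[of "(e n)^2" y] e[of n] Cpos by (intro divide_right_mono) auto
 obtain r :: "nat => nat" where r: "strict_mono r" "AE x in lborel. (%n. moll K (e (r n)) h x) ----> h x"
  by (rule l2_lim_AE_subseq[OF moll_sq_int(1)[OF K sh(1)] sh(1) moll_tendsto[OF K sh(1) e(1) e0]])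
 show ?thesis
  using r(2)
 proof eventually_elim
  case (elim x)
  have "exp (- \<mu>) * F x 1 / C <= h x" by (rule LIMSEQ_le_const[OF elim]) (use lb in auto)
  moreover have "0 < exp (- \<mu>) * F x 1 / C" using Fpos Cpos by simp
  ultimately show ?case by linarith
 qed
qed

section \<open>Optimizers and the kernel of the linearized operator\<close>

lemma wgrad_abs:
 assumes h: "wgrad h c"
 obtains r where "wgrad (%x. \<bar>h x\<bar>) r" "sqn r <= sqn c"
proof -
 define r where "r x = (1 / \<bar>h x\<bar>) *R (h x *R c x)" for x
 have w: "wgrad (%x. \<bar>h x\<bar>) r"
  using wgrad_modulus[OF h wgrad_zero] by (simp add: r_def[abs_def])
 have "norm (r x) <= norm (c x)" for x by (simp add: r_def abs_mult)
 hence "sqn r <= 1^2 * sqn c"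
  using wgrad_sq_int(2)[OF w] by (intro sq_int_bound(2)[OF wgrad_sq_int(2)[OF h]]) (auto dest: sq_int_measurable)
 thus thesis using that[OF w] by simp
qed

lemma wgrad_modulus_sqn:
 assumes f: "wgrad f a" and g: "wgrad g b"
 defines "\<rho> == %x. sqrt ((f x)^2 + (g x)^2)"
 defines "r == %x. (1 / \<rho> x) *R (f x *R a x + g x *R b x)"
 shows "wgrad \<rho> r" "sqn r <= sqn a + sqn b" (is ?A) "sqn \<rho> = sqn f + sqn g" (is ?B)
proof -
 show w: "wgrad \<rho> r" unfolding \<rho>_def r_def by (rule wgrad_modulus[OF f g])
 note sa = wgrad_sq_int[OF f] wgrad_sq_int[OF g] wgrad_sq_int[OF w]
 have "sqn r <= (LBINT x. (norm (a x))^2 + (norm (b x))^2)"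
  unfolding sqn_def
 proof (rule integral_mono)
  show "integrable lborel (%x. (norm (r x))^2)" by (rule sq_int_integrable[OF sa(6)])
  show "integrable lborel (%x. (norm (a x))^2 + (norm (b x))^2)" using sa by (simp add: sq_int_def)
  fix x
  have "0 <= (norm ((1 / \<rho> x) *R (f x *R b x - g x *R a x)))^2" by simp
  thus "(norm (r x))^2 <= (norm (a x))^2 + (norm (b x))^2"
   using modulus_phase_le[of "f x" "g x" "a x" "b x"] unfolding r_def \<rho>_def by linarith
 qed
 also have "\<dots> = sqn a + sqn b" using sa by (simp add: sqn_def sq_int_def)
 finally show ?A .
 show ?B using sa by (simp add: sqn_def \<rho>_def sq_int_def)
qed

context gn
begin

text \<open>Only the mass is normalized. The gradient norm stays free because limits of almost
  optimal sequences arrive with an unknown scale.\<close>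

definition optimizer :: "(real^2 => real) => (real^2 => real^2) => bool" where
 "optimizer q k \<longleftrightarrow> wgrad q k & sqn q = 1 & a_star / 2 * sqn (sq q) = sqn k"

lemma optimizerD:
 assumes "optimizer q k"
 shows "wgrad q k" "sqn q = 1" "a_star / 2 * sqn (sq q) = sqn k" "a_star * sqn (sq q) = 2 * sqn k"
 using assms by (auto simp: optimizer_def)

text \<open>The form of the linearized operator \<open>L\<^sub>- = -\<Delta> + \<parallel>\<nabla>q\<parallel>\<^sup>2 - a\<^sub>* q\<^sup>2\<close>.\<close>

definition lform :: "(real^2 => real) => (real^2 => real^2) => (real^2 => real) => (real^2 => real^2) => (real^2 => real) => (real^2 => real^2) => real" where
 "lform q k h c \<phi> d = (LBINT x. c x \<bullet> d x) + sqn k * (LBINT x. h x * \<phi> x) - a_star * (LBINT x. (q x)^2 * (h x * \<phi> x))"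

lemma lform_diag:
 "lform q k h c h c = sqn c + sqn k * sqn h - a_star * (LBINT x. (q x)^2 * (h x)^2)"
proof -
 have "(LBINT x. c x \<bullet> c x) = sqn c" by (simp add: sqn_def power2_norm_eq_inner)
 moreover have "(LBINT x. h x * h x) = sqn h" by (simp add: sqn_def power2_eq_square)
 ultimately show ?thesis by (simp add: lform_def power2_eq_square)
qed

lemma lform_sym: "lform q k h c \<phi> d = lform q k \<phi> d h c"
 by (simp add: lform_def inner_commute mult.commute)

lemma lform_add:
 assumes q: "wgrad q k" and h: "wgrad h c" and h': "wgrad h' c'" and p: "wgrad \<phi> d"
 shows "lform q k (%x. h x + \<sigma> * h' x) (%x. c x + \<sigma> *R c' x) \<phi> d = lform q k h c \<phi> d + \<sigma> * lform q k h' c' \<phi> d"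
proof -
 note s = wgrad_sq_int[OF h] wgrad_sq_int[OF h'] wgrad_sq_int[OF p]
 have "(LBINT x. (c x + \<sigma> *R c' x) \<bullet> d x) = (LBINT x. c x \<bullet> d x) + \<sigma> * (LBINT x. c' x \<bullet> d x)"
  using integrable_inner[OF s(2,6)] integrable_inner[OF s(4,6)] by (simp add: inner_add_left)
 moreover have "(LBINT x. (h x + \<sigma> * h' x) * \<phi> x) = (LBINT x. h x * \<phi> x) + \<sigma> * (LBINT x. h' x * \<phi> x)"
  using integrable_mult_sq_int[OF s(1,5)] integrable_mult_sq_int[OF s(3,5)] by (simp add: distrib_right mult.assoc)
 moreover have "(LBINT x. (q x)^2 * ((h x + \<sigma> * h' x) * \<phi> x)) = (LBINT x. (q x)^2 * (h x * \<phi> x)) + \<sigma> * (LBINT x. (q x)^2 * (h' x * \<phi> x))"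
 proof -
  have "(q x)^2 * ((h x + \<sigma> * h' x) * \<phi> x) = (q x)^2 * (h x * \<phi> x) + \<sigma> * ((q x)^2 * (h' x * \<phi> x))" for x by (simp add: algebra_simps)
  thus ?thesis using cubic_integrable[OF q h p] cubic_integrable[OF q h' p] by simp
 qed
 ultimately show ?thesis by (simp add: lform_def algebra_simps)
qed

text \<open>The inequality for the complex function q + i t h is an equality at t = 0. Its next
  order is t^2 with the form as coefficient, up to an error of order t^4; dividing by t^2 = \<tau>
  and letting \<tau> tend to 0 leaves the form.\<close>

lemma lform_nonneg:
 assumes q: "optimizer q k" and h: "wgrad h c"
 shows "0 <= lform q k h c h c"
proof -
 note Q = optimizerD[OF q]
 define I where "I = (LBINT x. (q x)^2 * (h x)^2)"
 have key: "0 <= lform q k h c h c + \<tau> * (sqn c * sqn h)" if t: "\<tau> > 0" for \<tau>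
 proof -
  define t where "t = sqrt \<tau>"
  have t2: "t^2 = \<tau>" using t by (simp add: t_def)
  have "a_star / 2 * (sqn (sq q) + 2 * (LBINT x. (q x)^2 * (t * h x)^2) + sqn (%x. (t * h x)^2)) <= (sqn k + sqn (%x. t *R c x)) * (sqn q + sqn (%x. t * h x))"
   by (rule gn_quad[OF Q(1) wgrad_cmult[OF h]])
  moreover have "(LBINT x. (q x)^2 * (t * h x)^2) = \<tau> * I"
   unfolding I_def power_mult_distrib t2 by (simp add: mult.left_commute[of _ \<tau>])
  moreover have "0 <= a_star / 2 * sqn (%x. (t * h x)^2)" using a_pos by simp
  ultimately have "sqn k + a_star * (\<tau> * I) <= (sqn k + \<tau> * sqn c) * (1 + \<tau> * sqn h)"
   using Q(2,3) unfolding sqn_scaleR sqn_cmult t2 by (simp add: algebra_simps)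
  hence "0 <= \<tau> * (sqn c + sqn k * sqn h - a_star * I + \<tau> * (sqn c * sqn h))" by (simp add: algebra_simps)
  thus ?thesis using t unfolding lform_diag I_def by (simp add: zero_le_mult_iff)
 qed
 have "((%\<tau>. lform q k h c h c + \<tau> * (sqn c * sqn h)) \<longlongrightarrow> lform q k h c h c + 0 * (sqn c * sqn h)) (at_right 0)"
  by (intro tendsto_intros)
 hence "0 <= lform q k h c h c + 0 * (sqn c * sqn h)"
  by (rule tendsto_lowerbound) (use key in \<open>auto simp: eventually_at_right_field intro!: exI[of _ 1]\<close>)
 thus ?thesis by simp
qed

text \<open>A nonnegative quadratic form vanishes at h only if h lies in its kernel: along h +
  \<sigma> \<phi> the linear term has to disappear. For h = q this is the Euler-Lagrange
  equation.\<close>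

lemma lform_null:
 assumes q: "optimizer q k" and h: "wgrad h c" and z: "lform q k h c h c = 0" and p: "wgrad \<phi> d"
 shows "lform q k h c \<phi> d = 0"
proof (rule quad_zero[where c="lform q k \<phi> d \<phi> d"])
 note Q = optimizerD(1)[OF q]
 show "0 <= lform q k \<phi> d \<phi> d" by (rule lform_nonneg[OF q p])
 fix \<sigma> :: real
 have w: "wgrad (%x. h x + \<sigma> * \<phi> x) (%x. c x + \<sigma> *R d x)" by (intro wgrad_add wgrad_cmult h p)
 have "0 <= lform q k (%x. h x + \<sigma> * \<phi> x) (%x. c x + \<sigma> *R d x) (%x. h x + \<sigma> * \<phi> x) (%x. c x + \<sigma> *R d x)"
  by (rule lform_nonneg[OF q w])
 also have "\<dots> = lform q k h c h c + \<sigma> * lform q k \<phi> d h c + \<sigma> * (lform q k h c \<phi> d + \<sigma> * lform q k \<phi> d \<phi> d)"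
  unfolding lform_add[OF Q h p w] lform_sym[of q k h c "%x. h x + \<sigma> * \<phi> x"] lform_sym[of q k \<phi> d "%x. h x + \<sigma> * \<phi> x"]
   lform_add[OF Q h p h] lform_add[OF Q h p p] lform_sym[of q k h c \<phi> d] by simp
 finally show "0 <= 2 * \<sigma> * lform q k h c \<phi> d + \<sigma>^2 * lform q k \<phi> d \<phi> d"
  unfolding z lform_sym[of q k \<phi> d h c] by (simp add: power2_eq_square algebra_simps)
qed

lemma optimizer_null: "optimizer q k ==> lform q k q k q k = 0"
 using optimizerD(2,4)[of q k] by (simp add: lform_diag sqn_def power2_eq_square algebra_simps)

text \<open>Weakly, a null vector satisfies -\<Delta>h + \<mu> h = \<open>a_star\<close> q^2 h with
  \<mu> = \<open>sqn k\<close>. If h is nonnegative, so is the right-hand side, and h is a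
  supersolution in the sense of \<open>strong_maximum_principle\<close>.\<close>

lemma null_positive:
 assumes q: "optimizer q k" and h: "wgrad h c" and z: "lform q k h c h c = 0" and nn: "AE x in lborel. 0 <= h x"
  and n0: "\<not> (AE x in lborel. h x = 0)"
 shows "AE x in lborel. 0 < h x"
proof (rule strong_maximum_principle[OF h nn _ _ n0])
 show "0 <= sqn k" by simp
 fix \<phi> d assume p: "wgrad \<phi> d" "!!x. 0 <= \<phi> x"
 have "0 <= (LBINT x. (q x)^2 * (h x * \<phi> x))"
  by (rule integral_nonneg_AE) (use nn p(2) in \<open>auto elim!: eventually_mono\<close>)
 hence "0 <= a_star * (LBINT x. (q x)^2 * (h x * \<phi> x))" using a_pos by simp
 thus "0 <= (LBINT x. c x \<bullet> d x) + sqn k * (LBINT x. h x * \<phi> x)"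
  using lform_null[OF q h z p(1)] by (simp add: lform_def)
qed

lemma optimizer_positive:
 assumes q: "optimizer q k" and nn: "AE x in lborel. 0 <= q x"
 shows "AE x in lborel. 0 < q x"
proof (rule null_positive[OF q optimizerD(1)[OF q] optimizer_null[OF q] nn])
 show "\<not> (AE x in lborel. q x = 0)"
  using sqn_eq_0[OF wgrad_sq_int(1)[OF optimizerD(1)[OF q]]] optimizerD(2)[OF q] by simp
qed

text \<open>Ground states are simple: \<open>|h|\<close> is again a null vector, hence so is \<open>|h| + h \<ge> 0\<close>, which by
 the maximum principle vanishes or is positive; orthogonality to \<open>q > 0\<close> excludes the latter.\<close>

lemma null_orthogonal_nonpos:
 assumes q: "optimizer q k" and nn: "AE x in lborel. 0 <= q x"
  and h: "wgrad h c" and z: "lform q k h c h c = 0" and o: "(LBINT x. h x * q x) = 0"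
 shows "AE x in lborel. h x <= 0"
proof -
 note Q = optimizerD(1)[OF q]
 obtain r where r: "wgrad (%x. \<bar>h x\<bar>) r" "sqn r <= sqn c" by (rule wgrad_abs[OF h])
 have "lform q k (%x. \<bar>h x\<bar>) r (%x. \<bar>h x\<bar>) r <= lform q k h c h c"
  using r(2) by (simp add: lform_diag sqn_def)
 hence z': "lform q k (%x. \<bar>h x\<bar>) r (%x. \<bar>h x\<bar>) r = 0" using lform_nonneg[OF q r(1)] z by simp
 have w: "wgrad (%x. \<bar>h x\<bar> + 1 * h x) (%x. r x + 1 *R c x)" by (intro wgrad_add wgrad_cmult r h)
 have zz: "lform q k (%x. \<bar>h x\<bar> + 1 * h x) (%x. r x + 1 *R c x) (%x. \<bar>h x\<bar> + 1 * h x) (%x. r x + 1 *R c x) = 0"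
  unfolding lform_add[OF Q r(1) h w] using lform_null[OF q r(1) z' w] lform_null[OF q h z w] by simp
 show ?thesis
 proof (cases "AE x in lborel. \<bar>h x\<bar> + 1 * h x = 0")
  case True
  thus ?thesis by eventually_elim simp
 next
  case False
  have "AE x in lborel. 0 < \<bar>h x\<bar> + 1 * h x"
   by (rule null_positive[OF q w zz _ False]) (simp add: abs_if)
  hence hp: "AE x in lborel. 0 < h x" by eventually_elim (simp add: abs_if split: if_splits)
  have "AE x in lborel. h x * q x = 0"
  proof -
   have "AE x in lborel. 0 <= h x * q x" using hp nn by eventually_elim simp
   thus ?thesis using integral_nonneg_eq_0_iff_AE[OF integrable_mult_sq_int[OF wgrad_sq_int(1)[OF h] wgrad_sq_int(1)[OF Q]]] o by simp
  qed
  hence "AE x in (lborel :: (real^2) measure). False"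
   using hp optimizer_positive[OF q nn] by eventually_elim simp
  thus ?thesis using lborel_not_AE_False by blast
 qed
qed

text \<open>The component of h orthogonal to q is again a null vector.
  \<open>null_orthogonal_nonpos\<close>, applied to it and to its negative, makes it vanish.\<close>

lemma null_simple:
 assumes q: "optimizer q k" and nn: "AE x in lborel. 0 <= q x"
  and h: "wgrad h c" and z: "lform q k h c h c = 0"
 shows "AE x in lborel. h x = (LBINT x. h x * q x) * q x"
proof -
 note Q = optimizerD[OF q]
 define m where "m = (LBINT x. h x * q x)"
 have w: "wgrad (%x. h x + (- m) * q x) (%x. c x + (- m) *R k x)" by (intro wgrad_add wgrad_cmult Q h)
 have zz: "lform q k (%x. h x + (- m) * q x) (%x. c x + (- m) *R k x) (%x. h x + (- m) * q x) (%x. c x + (- m) *R k x) = 0"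
  unfolding lform_add[OF Q(1) h Q(1) w] using lform_null[OF q h z w] lform_null[OF q Q(1) optimizer_null[OF q] w] by simp
 have "(h x + (- m) * q x) * q x = h x * q x - m * (q x * q x)" for x by (simp add: algebra_simps)
 hence o: "(LBINT x. (h x + (- m) * q x) * q x) = 0"
  using integrable_mult_sq_int[OF wgrad_sq_int(1)[OF h] wgrad_sq_int(1)[OF Q(1)]] sq_int_integrable[OF wgrad_sq_int(1)[OF Q(1)]] Q(2)
  by (simp add: m_def sqn_def power2_eq_square)
 have w': "wgrad (%x. (-1) * (h x + (- m) * q x)) (%x. (-1) *R (c x + (- m) *R k x))" by (rule wgrad_cmult[OF w])
 have zz': "lform q k (%x. (-1) * (h x + (- m) * q x)) (%x. (-1) *R (c x + (- m) *R k x)) (%x. (-1) * (h x + (- m) * q x)) (%x. (-1) *R (c x + (- m) *R k x)) = 0"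
  using zz unfolding lform_def by (simp only: inner_scaleR_left inner_scaleR_right mult_minus1 minus_mult_minus mult_minus1_right minus_minus mult_1)
 have o': "(LBINT x. (-1) * (h x + (- m) * q x) * q x) = 0" using o by (simp only: mult.assoc integral_mult_right_zero mult_zero_right)
 have "AE x in lborel. h x + (- m) * q x <= 0" by (rule null_orthogonal_nonpos[OF q nn w zz o])
 moreover have "AE x in lborel. (-1) * (h x + (- m) * q x) <= 0" by (rule null_orthogonal_nonpos[OF q nn w' zz' o'])
 ultimately show ?thesis unfolding m_def[symmetric] by eventually_elim simp
qed

text \<open>The modulus is an optimizer with the same gradient norm. Relative to it the forms of f
  and g are nonnegative and add up to zero, so both are null vectors and hence multiples of the
  modulus: an optimizer has constant phase.\<close>

lemma complex_optimizer:
 assumes f: "wgrad f a" and g: "wgrad g b" and m: "sqn f + sqn g = 1"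
  and opt: "sqn a + sqn b <= a_star / 2 * (LBINT x. ((f x)^2 + (g x)^2)^2)"
 obtains \<rho> r c1 c2 where "optimizer \<rho> r" "!!x. 0 <= \<rho> x" "AE x in lborel. f x = c1 * \<rho> x" "AE x in lborel. g x = c2 * \<rho> x"
  "c1^2 + c2^2 = 1"
proof -
 define \<rho> where "\<rho> = (%x. sqrt ((f x)^2 + (g x)^2))"
 define r where "r = (%x. (1 / sqrt ((f x)^2 + (g x)^2)) *R (f x *R a x + g x *R b x))"
 note W = wgrad_modulus_sqn[OF f g, folded \<rho>_def, folded r_def]
 have q: "sqn (sq \<rho>) = (LBINT x. ((f x)^2 + (g x)^2)^2)" by (simp add: sqn_def \<rho>_def)
 have m1: "sqn \<rho> = 1" using W(3) m by simp
 have "a_star / 2 * sqn (sq \<rho>) <= sqn r" using quartic_integrable(2)[OF W(1)] m1 by simp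
 hence eq: "a_star / 2 * sqn (sq \<rho>) = sqn r" "sqn a + sqn b = sqn r" using W(2) opt q by auto
 have O: "optimizer \<rho> r" using W(1) m1 eq by (simp add: optimizer_def)
 have nn: "0 <= \<rho> x" for x by (simp add: \<rho>_def)
 hence nn': "AE x in lborel. 0 <= \<rho> x" by simp
 have "lform \<rho> r f a f a + lform \<rho> r g b g b = 0"
 proof -
  have "(LBINT x. (\<rho> x)^2 * (f x)^2) + (LBINT x. (\<rho> x)^2 * (g x)^2) = (LBINT x. (\<rho> x)^2 * (f x)^2 + (\<rho> x)^2 * (g x)^2)"
   using integrable_mult_sq_int[OF quartic_integrable(1)[OF W(1)] quartic_integrable(1)[OF f]] integrable_mult_sq_int[OF quartic_integrable(1)[OF W(1)] quartic_integrable(1)[OF g]] by simp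
  also have "\<dots> = sqn (sq \<rho>)" by (simp add: sqn_def \<rho>_def distrib_left[symmetric] power2_eq_square)
  finally have "(LBINT x. (\<rho> x)^2 * (f x)^2) + (LBINT x. (\<rho> x)^2 * (g x)^2) = sqn (sq \<rho>)" .
  hence "a_star * (LBINT x. (\<rho> x)^2 * (f x)^2) + a_star * (LBINT x. (\<rho> x)^2 * (g x)^2) = 2 * sqn r"
   using eq(1) by (simp add: distrib_left[symmetric])
  moreover have "sqn r * sqn f + sqn r * sqn g = sqn r" using m by (simp add: distrib_left[symmetric])
  ultimately show ?thesis unfolding lform_diag using eq(2) by linarith
 qed
 hence z: "lform \<rho> r f a f a = 0" "lform \<rho> r g b g b = 0" using lform_nonneg[OF O f] lform_nonneg[OF O g] by linarith+
 define c1 where "c1 = (LBINT x. f x * \<rho> x)"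
 define c2 where "c2 = (LBINT x. g x * \<rho> x)"
 have ae: "AE x in lborel. f x = c1 * \<rho> x" "AE x in lborel. g x = c2 * \<rho> x"
  unfolding c1_def c2_def by (rule null_simple[OF O nn' f z(1)] null_simple[OF O nn' g z(2)])+
 have [measurable]: "f \<in> BM" "g \<in> BM" "\<rho> \<in> BM"
  using wgrad_sq_int(1)[OF f] wgrad_sq_int(1)[OF g] wgrad_sq_int(1)[OF W(1)] by (auto dest: sq_int_measurable)
 have aen: "AE x in lborel. norm (f x) = norm (c1 * \<rho> x)" "AE x in lborel. norm (g x) = norm (c2 * \<rho> x)"
  using ae(1) apply eventually_elim apply simp
  using ae(2) apply eventually_elim apply simp
  done
 have "sqn f = sqn (%x. c1 * \<rho> x)" by (rule sqn_cong_AE[OF aen(1)]) measurable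
 moreover have "sqn g = sqn (%x. c2 * \<rho> x)" by (rule sqn_cong_AE[OF aen(2)]) measurable
 ultimately have "c1^2 + c2^2 = 1" using m m1 by (simp add: sqn_cmult)
 with O nn ae show thesis by (rule that)
qed

end

section \<open>Rotations and radial functions\<close>

lemma lborel_orthogonal:
 fixes T :: "real^2 => real^2"
 assumes T: "orthogonal_transformation T"
 shows "distr lborel borel T = lborel"
proof (rule lborel_eqI[symmetric])
 have lin: "linear T" using T by (rule orthogonal_transformation_linear)
 hence [measurable]: "T \<in> BM"
  by (intro borel_measurable_continuous_onI linear_continuous_on) (simp add: linear_conv_bounded_linear)
 have bij: "bij T" by (rule orthogonal_transformation_bij[OF T])
 have Ti: "orthogonal_transformation (inv T)" by (rule orthogonal_transformation_inv[OF T])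
 fix l u :: "real^2" assume lu: "!!b. b \<in> Basis ==> l \<bullet> b <= u \<bullet> b"
 have vi: "T -` box l u = inv T ` box l u" using bij by (simp add: bij_vimage_eq_inv_image)
 have s: "T -` box l u \<in> sets borel" using measurable_sets[of T borel borel "box l u"] by simp
 have m: "inv T ` box l u \<in> lmeasurable" "measure lebesgue (inv T ` box l u) = measure lebesgue (box l u)"
  using measurable_orthogonal_image[OF Ti] measure_orthogonal_image[OF Ti] by auto
 have "emeasure (distr lborel borel T) (box l u) = emeasure lborel (T -` box l u)" by (simp add: emeasure_distr)
 also have "\<dots> = emeasure lebesgue (T -` box l u)" using s by simp
 also have "\<dots> = ennreal (measure lebesgue (inv T ` box l u))" unfolding vi by (rule emeasure_eq_measure2[OF m(1)])
 also have "\<dots> = ennreal (measure lborel (box l u))" unfolding m(2) by simp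
 also have "\<dots> = (\<Prod>b\<in>Basis. (u - l) \<bullet> b)"
  using lu by (subst measure_lborel_box) (auto simp: )
 finally show "emeasure (distr lborel borel T) (box l u) = (\<Prod>b\<in>Basis. (u - l) \<bullet> b)" .
qed simp

definition rotate_by :: "real => real^2 => real^2" where
 "rotate_by t x = cos t *R x + sin t *R rot90 x"

lemma rot90_linear: "rot90 (x + y) = rot90 x + rot90 y" "rot90 (c *R x) = c *R rot90 x"
 by (simp_all add: rot90_def vec2_def algebra_simps)

lemma norm_rotate_by: "norm (rotate_by t x) = norm x"
proof -
 have "(norm (rotate_by t x))^2 = (cos t)^2 * (norm x)^2 + (sin t)^2 * (norm x)^2"
  using rot90_inner[of x] norm_rot90[of x] unfolding rotate_by_def norm_add_sq by (simp add: power_mult_distrib inner_commute)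
 also have "\<dots> = ((cos t)^2 + (sin t)^2) * (norm x)^2" by (simp only: distrib_right)
 finally show ?thesis by simp
qed

lemma orthogonal_rotate_by: "orthogonal_transformation (rotate_by t)"
 unfolding orthogonal_transformation
proof (intro conjI allI norm_rotate_by)
 show "linear (rotate_by t)"
  by (rule linearI) (simp_all add: rotate_by_def rot90_linear algebra_simps)
qed

text \<open>Radial mollifications are constant along circles, so their gradients have no angular part.\<close>

lemma radial_gradient:
 assumes q: "wgrad q k" and rad: "!!x y. norm x = norm y ==> q x = q y"
 shows "AE x in lborel. rot90 x \<bullet> k x = 0"
proof -
 note s = wgrad_sq_int[OF q]
 have [measurable]: "q \<in> BM" "bkern \<in> BM"
  using sq_int_measurable[OF s(1)] test_measurable[OF bkern_test] by auto
 have bk: "bkern x = bkern y" if "norm x = norm y" for x y using that by (simp add: bkern_def bump_def)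
 have inv: "smth n q (rotate_by t x) = smth n q x" for n t x
 proof -
  define e where "e = 1 / (real n + 1)"
  have lin: "linear (rotate_by t)" using orthogonal_rotate_by by (rule orthogonal_transformation_linear)
  hence [measurable]: "rotate_by t \<in> BM"
   by (intro borel_measurable_continuous_onI linear_continuous_on) (simp add: linear_conv_bounded_linear)
  have "moll bkern e q (rotate_by t x) = (\<integral>z. bkern z *R q (rotate_by t x - e *R z) \<partial>distr lborel borel (rotate_by t))"
   by (simp add: moll_def lborel_orthogonal[OF orthogonal_rotate_by])
  also have "\<dots> = (LBINT z. bkern (rotate_by t z) *R q (rotate_by t x - e *R rotate_by t z))"
   by (rule integral_distr) measurable
  also have "\<dots> = (LBINT z. bkern z *R q (x - e *R z))"
  proof (rule Bochner_Integration.integral_cong[OF refl])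
   fix z
   have "rotate_by t x - e *R rotate_by t z = rotate_by t (x - e *R z)"
    by (simp add: linear_diff[OF lin] linear_scale[OF lin])
   thus "bkern (rotate_by t z) *R q (rotate_by t x - e *R rotate_by t z) = bkern z *R q (x - e *R z)"
    using bk[OF norm_rotate_by] rad[OF norm_rotate_by] by simp
  qed
  finally show ?thesis by (simp add: smth_def e_def moll_def)
 qed
 have z: "rot90 x \<bullet> smth n k x = 0" for n x
 proof -
  have d1: "((%t. rotate_by t x) has_derivative (%t. t *R rot90 x)) (at 0)"
   unfolding rotate_by_def by (auto intro!: derivative_eq_intros)
  have "(smth n q has_derivative (%h. smth n k (rotate_by 0 x) \<bullet> h)) (at (rotate_by 0 x))"
   using smth(1)[OF q] by (simp add: has_grad_def)
  from has_derivative_compose[OF d1 this]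
  have "((%t. smth n q x) has_derivative (%t. t * (smth n k x \<bullet> rot90 x))) (at 0)"
   unfolding inv by (simp add: rotate_by_def)
  moreover have "((%t::real. smth n q x) has_derivative (%t. 0)) (at 0)" by simp
  ultimately have "(%t. t * (smth n k x \<bullet> rot90 x)) = (%t. 0)" by (rule has_derivative_unique)
  from fun_cong[OF this, of 1] show ?thesis by (simp add: inner_commute)
 qed
 obtain r :: "nat => nat" where r: "strict_mono r" "AE x in lborel. (%n. smth (r n) k x) ----> k x"
  by (rule l2_lim_AE_subseq[OF smth(4)[OF q] s(2) smth(6)[OF q]])
 show ?thesis using r(2)
 proof eventually_elim
  case (elim x)
  from tendsto_inner[OF tendsto_const this, of "rot90 x"] show ?case unfolding z by (simp add: LIMSEQ_const_iff)
 qed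
qed

section \<open>Identification of the optimizer with the rescaled Q\<close>

locale gn_Q = gn +
 fixes Q :: "real^2 => real"
 assumes Q: "is_unique_positive_radial_solution Q"
begin

lemma Q_facts:
 shows "positive_solution Q" "!!x. Q x > 0" "!!x y. norm x = norm y ==> Q x = Q y"
  "!!v. positive_solution v ==> EX y. AE x in lborel. v x = Q (x - y)"
 using Q unfolding is_unique_positive_radial_solution_def by blast+

lemma Q_measurable[measurable]: "Q \<in> BM"
proof -
 have "(%x. complex_of_real (Q x)) \<in> L2" using Q_facts(1) by (simp add: positive_solution_def H1_def)
 hence "sq_int (%x. Re (complex_of_real (Q x)))" by (intro complex_sq_int) (simp add: L2_iff)
 thus ?thesis by (simp add: sq_int_measurable)
qed

lemma optimizer_rescale:
 assumes q: "optimizer q k" and b: "\<beta> > 0"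
 shows "optimizer (%x. \<beta> * q (t + \<beta> *R x)) (%x. (\<beta> * \<beta>) *R k (t + \<beta> *R x))" (is ?A)
  "sqn (%x. (\<beta> * \<beta>) *R k (t + \<beta> *R x)) = \<beta>^2 * sqn k" (is ?B)
proof -
 note D = optimizerD[OF q] and S = wgrad_scale[OF optimizerD(1)[OF q] b, of \<beta> t]
 have "sqn (%x. (\<beta> * q (t + \<beta> *R x))^2) = \<beta>^2 * sqn (sq q)"
  using b by (subst sqn_square_scale[OF sq_int_measurable[OF wgrad_sq_int(1)[OF D(1)]] b]) (simp add: power4_eq_xxxx power2_eq_square)
 moreover have "a_star / 2 * (\<beta>^2 * sqn (sq q)) = \<beta>^2 * sqn k" unfolding D(3)[symmetric] by simp
 ultimately show ?A
  unfolding optimizer_def using S D(2) b by simp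
 show ?B by (rule S(3))
qed

lemma optimizer_grad_pos:
 assumes "optimizer q k" shows "sqn k > 0"
proof -
 note D = optimizerD[OF assms]
 have "sqn (sq q) ~= 0"
 proof
  assume "sqn (sq q) = 0"
  hence "AE x in lborel. (q x)^2 = 0" using sqn_eq_0[OF quartic_integrable(1)[OF D(1)]] by simp
  hence "AE x in lborel. q x = 0" by simp
  hence "sqn q = 0" using sqn_eq_0[OF wgrad_sq_int(1)[OF D(1)]] by simp
  thus False using D(2) by simp
 qed
 hence "sqn (sq q) > 0" using sqn_nonneg[of "%x. (q x)^2"] by linarith
 hence "a_star / 2 * sqn (sq q) > 0" using a_pos by simp
 thus ?thesis using D(3) by simp
qed

text \<open>With unit gradient norm the null equation of q reads -\<Delta>q + q =
  \<open>a_star\<close> q^3, and the factor \<open>sqrt a_star\<close> turns the cubic coefficient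
  into 1.\<close>

lemma optimizer_solution:
 assumes q: "optimizer q k" and k: "sqn k = 1" and nn: "!!x. 0 <= q x"
 shows "positive_solution (%x. sqrt a_star * q x)"
 unfolding positive_solution_def
proof (intro conjI ballI)
 note D = optimizerD[OF q] and s = wgrad_sq_int[OF optimizerD(1)[OF q]]
 have w: "wgrad (%x. sqrt a_star * q x) (%x. sqrt a_star *R k x)" by (rule wgrad_cmult[OF D(1)])
 show "(%x. complex_of_real (sqrt a_star * q x)) \<in> H1"
  using H1_I[OF w wgrad_zero] by (simp add: complex_of_real_def)
 have "AE x in lborel. 0 < q x" by (rule optimizer_positive[OF q]) (simp add: nn)
 thus "AE x in lborel. 0 < sqrt a_star * q x" by eventually_elim (simp add: a_pos)
 fix \<phi> assume p: "\<phi> \<in> test_functions"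
 have pp: "partial i (partial i \<phi>) \<in> test_functions" for i by (intro test_partial p)
 have lap: "sq_int (laplacian \<phi>)"
  unfolding laplacian_def[abs_def] sum_2 by (intro sq_int_add test_sq_int pp)
 have "(LBINT x. k x \<bullet> grad \<phi> x) = (LBINT x. partial 1 \<phi> x * k x $ 1 + partial 2 \<phi> x * k x $ 2)"
  by (simp add: inner_vec_def sum_2 mult.commute)
 also have "\<dots> = (LBINT x. partial 1 \<phi> x * k x $ 1) + (LBINT x. partial 2 \<phi> x * k x $ 2)"
  by (intro Bochner_Integration.integral_add integrable_mult_sq_int test_sq_int test_partial p sq_int_nth s)
 also have "\<dots> = - ((LBINT x. partial 1 (partial 1 \<phi>) x * q x) + (LBINT x. partial 2 (partial 2 \<phi>) x * q x))"
  using wgrad_eq[OF D(1) test_partial[OF p, of 1], of 1] wgrad_eq[OF D(1) test_partial[OF p, of 2], of 2] by simp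
 also have "(LBINT x. partial 1 (partial 1 \<phi>) x * q x) + (LBINT x. partial 2 (partial 2 \<phi>) x * q x)
   = (LBINT x. partial 1 (partial 1 \<phi>) x * q x + partial 2 (partial 2 \<phi>) x * q x)"
  by (intro Bochner_Integration.integral_add[symmetric] integrable_mult_sq_int test_sq_int pp s)
 also have "\<dots> = (LBINT x. q x * laplacian \<phi> x)" by (simp add: laplacian_def sum_2 algebra_simps)
 finally have kl: "(LBINT x. k x \<bullet> grad \<phi> x) = - (LBINT x. q x * laplacian \<phi> x)" .
 have EL: "- (LBINT x. q x * laplacian \<phi> x) + (LBINT x. q x * \<phi> x) - a_star * (LBINT x. (q x)^2 * (q x * \<phi> x)) = 0"
  using lform_null[OF q D(1) optimizer_null[OF q] test_grad(4)[OF p]] k kl by (simp add: lform_def)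
 have sa: "sqrt a_star ^ 3 = sqrt a_star * a_star" using a_pos by (simp add: power3_eq_cube)
 have "- (sqrt a_star * q x * laplacian \<phi> x) + sqrt a_star * q x * \<phi> x - (sqrt a_star * q x) ^ 3 * \<phi> x
   = sqrt a_star * (- (q x * laplacian \<phi> x) + q x * \<phi> x - a_star * ((q x)^2 * (q x * \<phi> x)))" for x
  unfolding power_mult_distrib sa by (simp add: algebra_simps power2_eq_square power3_eq_cube)
 hence "(LBINT x. - (sqrt a_star * q x * laplacian \<phi> x) + sqrt a_star * q x * \<phi> x - (sqrt a_star * q x) ^ 3 * \<phi> x)
   = sqrt a_star * (LBINT x. - (q x * laplacian \<phi> x) + q x * \<phi> x - a_star * ((q x)^2 * (q x * \<phi> x)))"
  by simp
 also have "(LBINT x. - (q x * laplacian \<phi> x) + q x * \<phi> x - a_star * ((q x)^2 * (q x * \<phi> x))) = 0"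
  using EL integrable_mult_sq_int[OF s(1) lap] integrable_mult_sq_int[OF s(1) test_sq_int(1)[OF p]] cubic_integrable[OF D(1) D(1) test_grad(4)[OF p]]
  by simp
 finally show "(LBINT x. - (sqrt a_star * q x * laplacian \<phi> x) + sqrt a_star * q x * \<phi> x - (sqrt a_star * q x) ^ 3 * \<phi> x) = 0"
  by simp
qed

text \<open>The normalizing factor is \<open>sqrt a_star\<close> and not the norm of Q: that the two
  agree, that is, that \<open>q0\<close> has unit mass, is part of
  \<open>q0_optimizer\<close>.\<close>

definition q0 :: "real^2 => real" where
 "q0 x = Q x / sqrt a_star"

lemma q0_pos: "q0 x > 0"
 using Q_facts(2) a_pos by (simp add: q0_def)

lemma q0_radial: "norm x = norm y ==> q0 x = q0 y"
 using Q_facts(3)[of x y] by (simp add: q0_def)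

lemma q0_measurable[measurable]: "q0 \<in> BM"
 unfolding q0_def[abs_def] by measurable

text \<open>A dilation to unit gradient norm makes the optimizer a multiple of a positive solution,
  hence a translate of Q up to that factor; the dilation is then undone.\<close>

lemma optimizer_shape:
 assumes q: "optimizer q k" and nn: "!!x. 0 <= q x"
 obtains y where "AE x in lborel. q x = sqrt (sqn k) * q0 (sqrt (sqn k) *R x - y)"
proof -
 define s where "s = sqrt (sqn k)"
 have s: "s > 0" "s^2 = sqn k" using optimizer_grad_pos[OF q] by (auto simp: s_def)
 note R = optimizer_rescale[OF q, of "1/s" 0]
 have s1: "1 / s > 0" using s by simp
 have "sqn (%x. ((1/s) * (1/s)) *R k (0 + (1/s) *R x)) = 1" unfolding R(2)[OF s1] using s optimizer_grad_pos[OF q] by (simp add: power_divide)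
 from optimizer_solution[OF R(1)[OF s1] this] have "positive_solution (%x. sqrt a_star * ((1/s) * q (0 + (1/s) *R x)))"
  using nn s by simp
 then obtain y where y: "AE x in lborel. sqrt a_star * ((1/s) * q (0 + (1/s) *R x)) = Q (x - y)" using Q_facts(4) by blast
 have "AE x in lborel. sqrt a_star * ((1/s) * q (0 + (1/s) *R (0 + s *R x))) = Q (0 + s *R x - y)"
  using s by (intro AE_lborel_affine[OF _ y]) simp
 hence "AE x in lborel. q x = s * q0 (s *R x - y)"
  by eventually_elim (use s a_pos in \<open>simp add: q0_def field_simps\<close>)
 thus thesis using that by (simp add: s_def)
qed

text \<open>Q is known only as a solution. Some optimizer exists, and uniqueness of positive
  solutions makes it a translate of \<open>q0\<close>; optimality is invariant under
  translations.\<close>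

lemma q0_optimizer:
 obtains k0 where "optimizer q0 k0" "sqn k0 = 1"
proof -
 obtain q k where q: "wgrad q k" "!!x. q x >= 0" "sqn q = 1" "sqn k = 1" "a_star / 2 * sqn (sq q) = 1"
  by (rule optimizer_exists, rule that, assumption+)
 have O: "optimizer q k" using q by (simp add: optimizer_def)
 obtain y where y: "AE x in lborel. q x = sqrt (sqn k) * q0 (sqrt (sqn k) *R x - y)"
  by (rule optimizer_shape[OF O q(2)])
 have "AE x in lborel. q (y + 1 *R x) = sqrt (sqn k) * q0 (sqrt (sqn k) *R (y + 1 *R x) - y)"
  by (rule AE_lborel_affine[OF _ y]) simp
 hence ae: "AE x in lborel. 1 * q (y + 1 *R x) = q0 x" by eventually_elim (simp add: q(4))
 note R = optimizer_rescale[OF O zero_less_one, of y]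
 define k0 where "k0 = (%x. (1 * 1) *R k (y + 1 *R x))"
 note D = optimizerD[OF R(1), folded k0_def]
 note sm = sq_int_measurable[OF wgrad_sq_int(1)[OF D(1)]] sq_int_measurable[OF wgrad_sq_int(2)[OF D(1)]]
 have w: "wgrad q0 k0" by (rule wgrad_cong_AE[OF D(1) ae _ q0_measurable sm(2)]) simp
 have n1: "AE x in lborel. norm (1 * q (y + 1 *R x)) = norm (q0 x)" using ae by eventually_elim simp
 have n2: "AE x in lborel. norm ((1 * q (y + 1 *R x))^2) = norm ((q0 x)^2)" using ae by eventually_elim simp
 have "sqn q0 = 1" using D(2) sqn_cong_AE[OF n1 sm(1) q0_measurable] by simp
 moreover have "sqn (%x. (1 * q (y + 1 *R x))^2) = sqn (sq q0)"
 proof (rule sqn_cong_AE[OF n2])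
  show "(%x. (1 * q (y + 1 *R x))^2) \<in> BM" using sm(1) by (rule borel_measurable_power)
 qed measurable
 ultimately have "optimizer q0 k0" using w D(3) by (simp add: optimizer_def)
 moreover have "sqn k0 = 1" unfolding k0_def R(2) using q(4) by simp
 ultimately show thesis by (rule that)
qed

definition k0 :: "real^2 => real^2" where
 "k0 = (SOME k. optimizer q0 k & sqn k = 1)"

lemma k0: "optimizer q0 k0" "sqn k0 = 1"
proof -
 have "EX k. optimizer q0 k & sqn k = 1" using q0_optimizer by metis
 from someI_ex[OF this] show "optimizer q0 k0" "sqn k0 = 1" by (auto simp: k0_def)
qed

lemma q0_wgrad: "wgrad q0 k0" "sqn q0 = 1" "a_star * sqn (sq q0) = 2"
 using optimizerD[OF k0(1)] k0(2) by auto

lemma k0_tangential: "AE x in lborel. rot90 x \<bullet> k0 x = 0"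
 by (rule radial_gradient[OF q0_wgrad(1) q0_radial])

end

text \<open>The bound B serves only to make multiplication by \<eta> admissible and may depend on
  \<eta>. The bounds 3 and \<open>norm x\<close> are uniform over the family, and the constant of
  \<open>weighted_bound\<close> is built from them alone.\<close>

definition damped :: "(real^2 => real) => (real^2 => real^2) => bool" where
 "damped \<eta> \<kappa> \<longleftrightarrow> has_grad \<eta> \<kappa> & continuous_on UNIV \<kappa> & (EX B. ALL x. \<bar>\<eta> x\<bar> <= B) & (ALL x. norm (\<kappa> x) <= 3 & \<bar>\<eta> x\<bar> <= norm x)"

context gn
begin

text \<open>Testing the Euler-Lagrange equation with \<open>\<eta>\<^sup>2q\<close> bounds \<open>\<eta>q\<close>, since the potential \<open>q\<^sup>2\<close> is small at infinity.\<close>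

lemma weighted_bound:
 assumes q: "optimizer q k" and k: "sqn k = 1"
 shows "EX C. ALL \<eta> \<kappa>. damped \<eta> \<kappa> --> sqn (%x. \<eta> x * q x) <= C"
proof -
 note w = optimizerD(1)[OF q] and s = wgrad_sq_int[OF optimizerD(1)[OF q]]
 note qq = quartic_integrable(1)[OF w]
 note [measurable] = s(1)[THEN sq_int_measurable]
 define T where "T R x = (if norm x <= R then 0 else (q x)^2)" for R and x :: "real^2"
 have Tm[measurable]: "T R \<in> BM" for R unfolding T_def[abs_def] by measurable
 have "l2_lim (%n. T (real n)) (%x. 0)"
 proof (rule sq_int_dominated(3)[OF Tm _ qq])
  show "AE x in lborel. norm (T (real n) x) <= (q x)^2" for n by (simp add: T_def)
  show "AE x in lborel. (%n. T (real n) x) ----> 0"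
  proof (rule AE_I2, rule tendsto_eventually)
   fix x :: "real^2"
   obtain n where "norm x <= real n" using real_arch_simple by blast
   thus "\<forall>\<^sub>F n in sequentially. T (real n) x = 0"
    unfolding eventually_sequentially T_def by (intro exI[of _ n]) auto
  qed
 qed simp
 \<comment> \<open>Chosen so that the potential beyond the radius R contributes at most half of the
   H1 norm of the weighted function, which is then absorbed on the left.\<close>
 moreover define \<delta> where "\<delta> = 1 / (2 * a_star * sqrt (2 / a_star))"
 have d: "\<delta> > 0" "a_star * (\<delta> * sqrt (2 / a_star)) = 1 / 2" using a_pos by (auto simp: \<delta>_def)
 ultimately obtain n where n: "l2 (T (real n)) < \<delta>"
  using order_tendstoD(2)[of "%n. l2 (%x. T (real n) x - 0)" 0 sequentially \<delta>] by (auto simp: eventually_sequentially)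
 define R where "R = real n"
 have Ts: "sq_int (T R)" "l2 (T R) <= \<delta>" using n sq_int_bound(1)[OF qq Tm, of R 1] by (auto simp: R_def T_def)
 have "sqn (%x. \<eta> x * q x) <= 18 + 4 * R^2"
  if dm: "damped \<eta> \<kappa>" for \<eta> \<kappa>
 proof -
  obtain B where c: "has_grad \<eta> \<kappa>" "continuous_on UNIV \<kappa>" "!!x. \<bar>\<eta> x\<bar> <= B" "!!x. norm (\<kappa> x) <= 3" "!!x. \<bar>\<eta> x\<bar> <= norm x"
   using dm by (auto simp: damped_def)
  define h where "h x = \<eta> x * q x" for x
  define c where "c x = \<eta> x *R k x + q x *R \<kappa> x" for x
  have B': "\<bar>\<eta> x\<bar> <= max B 3" "norm (\<kappa> x) <= max B 3" for x using c(3)[of x] c(4)[of x] by auto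
  have h: "wgrad h c" unfolding h_def[abs_def] c_def[abs_def] by (rule wgrad_mult_C1[OF w c(1,2) B'])
  have h': "wgrad (%x. \<eta> x * h x) (%x. \<eta> x *R c x + h x *R \<kappa> x)" by (rule wgrad_mult_C1[OF h c(1,2) B'])
  note sh = wgrad_sq_int[OF h]
  have [measurable]: "\<eta> \<in> BM" "\<kappa> \<in> BM"
   using has_grad_continuous[OF c(1)] c(2) by (auto intro: borel_measurable_continuous_onI)
  have qk: "sq_int (%x. q x *R \<kappa> x)" "sqn (%x. q x *R \<kappa> x) <= 3^2 * sqn q"
  proof -
   have "AE x in lborel. norm (q x *R \<kappa> x) <= 3 * norm (q x)" using c(4) by (intro AE_I2) (simp add: mult.commute mult_left_mono)
   from sq_int_bound[OF s(1) _ this] show "sq_int (%x. q x *R \<kappa> x)" "sqn (%x. q x *R \<kappa> x) <= 3^2 * sqn q" by simp_all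
  qed
  \<comment> \<open>The localization identity: testing with \<eta>^2 q gives the full gradient of
    \<eta> q up to the error |q \<nabla>\<eta>|^2, which is bounded uniformly in \<eta>.\<close>
  have "k x \<bullet> (\<eta> x *R c x + h x *R \<kappa> x) = (norm (c x))^2 - (norm (q x *R \<kappa> x))^2" for x
   unfolding c_def h_def power2_norm_eq_inner inner_add_left inner_add_right inner_scaleR_left inner_scaleR_right
   by (simp add: inner_commute[of "\<kappa> x" "k x"] algebra_simps)
  hence "(LBINT x. k x \<bullet> (\<eta> x *R c x + h x *R \<kappa> x)) = sqn c - sqn (%x. q x *R \<kappa> x)"
   using sq_int_integrable[OF sh(2)] sq_int_integrable[OF qk(1)] by (simp add: sqn_def)
  moreover have "(LBINT x. q x * (\<eta> x * h x)) = sqn h" by (simp add: sqn_def h_def power2_eq_square ac_simps)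
  moreover have "(LBINT x. (q x)^2 * (q x * (\<eta> x * h x))) = (LBINT x. (q x)^2 * (h x)^2)"
   by (simp add: h_def power2_eq_square ac_simps)
  ultimately have EL: "sqn c + sqn h = sqn (%x. q x *R \<kappa> x) + a_star * (LBINT x. (q x)^2 * (h x)^2)"
   using lform_null[OF q w optimizer_null[OF q] h'] k by (simp add: lform_def)
  define A where "A = sqn c + sqn h"
  have A: "sqn h <= A" "sqn c <= A" "0 <= A" by (simp_all add: A_def)
  note hh = quartic_integrable(1)[OF h]
  have "l2 (sq h) <= sqrt (2 / a_star * A^2)" unfolding l2_def using quartic_bound[OF h A(1,2)] by simp
  also have "\<dots> = sqrt (2 / a_star) * A" using A(3) unfolding real_sqrt_mult by simp
  finally have l4: "l2 (sq h) <= sqrt (2 / a_star) * A" .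
  have hb: "integrable lborel (%x. (q x)^2 * (h x)^2)" by (rule integrable_mult_sq_int[OF qq hh])
  have i1: "integrable lborel (%x. R^2 * ((q x)^2)^2)" using sq_int_integrable[OF qq] by simp
  have i2: "integrable lborel (%x. T R x * (h x)^2)" by (rule integrable_mult_sq_int[OF Ts(1) hh])
  have "(LBINT x. (q x)^2 * (h x)^2) <= (LBINT x. R^2 * ((q x)^2)^2 + T R x * (h x)^2)"
  proof (rule integral_mono[OF hb Bochner_Integration.integrable_add[OF i1 i2]])
   fix x
   show "(q x)^2 * (h x)^2 <= R^2 * ((q x)^2)^2 + T R x * (h x)^2"
   proof (cases "norm x <= R")
    case True
    have "(\<eta> x)^2 <= R^2" using power_mono[of "\<bar>\<eta> x\<bar>" R 2] c(5)[of x] True by simp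
    hence "(\<eta> x)^2 * ((q x)^2)^2 <= R^2 * ((q x)^2)^2" by (rule mult_right_mono) simp
    thus ?thesis using True by (simp add: T_def h_def power_mult_distrib power2_eq_square ac_simps)
   qed (simp add: T_def)
  qed
  also have "\<dots> = R^2 * sqn (sq q) + (LBINT x. T R x * (h x)^2)" using i1 i2 by (simp add: sqn_def)
  also have "(LBINT x. T R x * (h x)^2) <= l2 (T R) * l2 (sq h)"
   using inner_cauchy_schwarz[OF Ts(1) hh] by simp
  also have "\<dots> <= \<delta> * (sqrt (2 / a_star) * A)" by (intro mult_mono Ts l4) (use d in auto)
  finally have "a_star * (LBINT x. (q x)^2 * (h x)^2) <= a_star * (R^2 * sqn (sq q) + \<delta> * (sqrt (2 / a_star) * A))"
   using a_pos by simp
  also have "\<dots> = R^2 * (a_star * sqn (sq q)) + (a_star * (\<delta> * sqrt (2 / a_star))) * A" by (simp add: algebra_simps)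
  also have "\<dots> = 2 * R^2 + A / 2" unfolding d(2) optimizerD(4)[OF q] k by simp
  finally have "A <= 9 + 2 * R^2 + A / 2" using EL qk(2) optimizerD(2)[OF q] by (simp add: A_def)
  thus ?thesis using A(1) by (simp add: h_def[abs_def])
 qed
 thus ?thesis by blast
qed

text \<open>For each e the weight is bounded, yet the bounds on its gradient and by
  \<open>norm x\<close> do not depend on e, because t exp(-t) <= 1. In
  \<open>optimizer_moment\<close> e tends to 0 and Fatou turns the weighted bound into a second
  moment.\<close>

lemma damped_coordinate:
 fixes e :: real and i :: 2 assumes e: "e > 0"
 defines "\<eta> == %x::real^2. x $ i * exp (- e * (norm x)^2)"
 defines "\<kappa> == %x. exp (- e * (norm x)^2) *R axis i 1 - (2 * e * x $ i * exp (- e * (norm x)^2)) *R x"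
 shows "has_grad \<eta> \<kappa>" "continuous_on UNIV \<kappa>" (is ?A) "!!x. \<bar>\<eta> x\<bar> <= 1 + 1 / e" "damped \<eta> \<kappa>"
proof -
 have main: "has_grad \<eta> \<kappa>" ?A "\<bar>\<eta> x\<bar> <= 1 + 1 / e" "norm (\<kappa> x) <= 3" "\<bar>\<eta> x\<bar> <= norm x" for x
 proof -
  define E where "E = exp (- e * (norm x)^2)"
  have E: "0 < E" "E <= 1" using e by (auto simp: E_def)
  have eE: "e * (norm x)^2 * E <= 1" using mult_exp_le[of "e * (norm x)^2"] by (simp add: E_def)
  have "has_grad (%x. exp (- e * (norm x)^2)) (%x. (- e * exp (- e * (norm x)^2)) *R (2 *R x))"
   by (rule has_grad_compose_real[OF has_grad_norm2]) (auto intro!: derivative_eq_intros)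
  from has_grad_mult[OF has_grad_coord this, of i] show "has_grad \<eta> \<kappa>"
   unfolding \<eta>_def \<kappa>_def by (simp add: algebra_simps)
  show ?A unfolding \<kappa>_def by (intro continuous_intros)
  have cx: "\<bar>\<eta> x\<bar> <= norm x * E"
   unfolding \<eta>_def E_def abs_mult using abs_nth_le_norm[of x i] by (simp add: mult_right_mono)
  have "norm x * E <= norm x * 1" using E by (intro mult_left_mono) auto
  thus "\<bar>\<eta> x\<bar> <= norm x" using cx by simp
  have "norm x * E <= (1 + (norm x)^2) * E" using E norm_le_1_sq[of x] by (intro mult_right_mono) auto
  also have "\<dots> = E + (e * (norm x)^2 * E) * (1 / e)" using e by (simp add: field_simps)
  also have "\<dots> <= 1 + 1 * (1 / e)" using e by (intro add_mono E mult_right_mono eE) auto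
  finally have "norm x * E <= 1 + 1 / e" by simp
  thus "\<bar>\<eta> x\<bar> <= 1 + 1 / e" using cx by simp
  have "norm (\<kappa> x) <= norm (E *R axis i (1::real) :: real^2) + norm ((2 * e * x $ i * E) *R x)"
   unfolding \<kappa>_def E_def by (rule norm_triangle_ineq4)
  also have "\<dots> = E + 2 * (e * (\<bar>x $ i\<bar> * norm x) * E)" using E e by (simp add: abs_mult norm_axis_1)
  also have "\<dots> <= E + 2 * (e * (norm x * norm x) * E)"
   using E e abs_nth_le_norm[of x i] by (intro add_left_mono mult_left_mono mult_right_mono) auto
  also have "\<dots> <= 3" using eE E by (simp add: power2_eq_square)
  finally show "norm (\<kappa> x) <= 3" .
 qed
 show "has_grad \<eta> \<kappa>" ?A "!!x. \<bar>\<eta> x\<bar> <= 1 + 1 / e" by (rule main)+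
 show "damped \<eta> \<kappa>" unfolding damped_def using main by blast
qed

lemma optimizer_moment:
 assumes q: "optimizer q k" and k: "sqn k = 1"
 shows "sq_int (%x. norm x * q x)"
proof -
 obtain C where C: "!!\<eta> \<kappa>. damped \<eta> \<kappa> ==> sqn (%x. \<eta> x * q x) <= C" using weighted_bound[OF q k] by blast
 note s = wgrad_sq_int(1)[OF optimizerD(1)[OF q]]
 note [measurable] = s[THEN sq_int_measurable]
 have "integrable lborel (%x. (x $ i * q x)^2)" for i
 proof -
  define f where "f n x = x $ i * exp (- (1 / (real n + 1)) * (norm x)^2) * q x" for n and x :: "real^2"
  have e: "1 / (real n + 1) > 0" for n by simp
  note D = damped_coordinate[OF e]
  have b: "sqn (f n) <= C" for n unfolding f_def by (rule C[OF D(4)])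
  have si: "sq_int (f n)" for n
  proof (rule sq_int_bound(1)[OF s, of _ "1 + 1 / (1 / (real n + 1))"])
   show "AE x in lborel. norm (f n x) <= (1 + 1 / (1 / (real n + 1))) * norm (q x)"
    unfolding f_def norm_mult using D(3)[of _ i n] by (intro AE_I2 mult_right_mono) (auto simp: abs_mult)
  qed (unfold f_def, measurable)
  have "(%n. (f n x)^2) ----> (x $ i * q x)^2" for x
  proof -
   have "(%n. (x $ i * exp (- (1 / (real n + 1)) * (norm x)^2) * q x)^2) ----> (x $ i * exp (- 0 * (norm x)^2) * q x)^2"
    using LIMSEQ_inverse_real_of_nat by (intro tendsto_intros) (simp add: inverse_eq_divide add.commute)
   thus ?thesis by (simp add: f_def)
  qed
  thus ?thesis
   using fatou_integral(1)[of lborel "%n x. (f n x)^2" C "%x. (x $ i * q x)^2"] sq_int_integrable[OF si] b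
   by (simp add: sqn_def)
 qed
 hence "integrable lborel (%x. (x $ 1 * q x)^2 + (x $ 2 * q x)^2)" by simp
 moreover have "(x $ 1 * q x)^2 + (x $ 2 * q x)^2 = (norm (norm x * q x))^2" for x :: "real^2"
  using norm2_sum[of x] by (simp add: sum_2 power_mult_distrib distrib_right)
 ultimately show ?thesis unfolding sq_int_def by simp
qed

end

context gn_Q
begin

lemma q0_moment: "sq_int (%x. norm x * q0 x)"
 by (rule optimizer_moment[OF k0])

definition M where "M = sqn (%x. norm x * q0 x)"

lemma M_pos: "M > 0"
proof -
 have "sqn (%x. norm x * q0 x) ~= 0"
 proof
  assume "sqn (%x. norm x * q0 x) = 0"
  hence "AE x in lborel. norm x * q0 x = 0" using sqn_eq_0[OF q0_moment] by simp
  moreover have "AE x in lborel. x ~= (0::real^2)" by (rule AE_lborel_singleton)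
  ultimately have "AE x in (lborel :: (real^2) measure). False"
   by eventually_elim (use q0_pos in \<open>auto simp: less_le\<close>)
  thus False using lborel_not_AE_False by blast
 qed
 thus ?thesis using sqn_nonneg[of "%x. norm x * q0 x"] by (simp add: M_def less_le)
qed

lemma lambda_star_eq: "lambda_star Q > 0" "lambda_star Q ^ 4 = a_star * M" (is ?A) "(lambda_star Q)^2 = sqrt (a_star * M)" (is ?B)
proof -
 have "(norm (norm x * q0 x))^2 = (norm x)^2 * (Q x)^2 / a_star" for x
  using a_pos by (simp add: q0_def power_divide power_mult_distrib)
 hence I: "(LBINT x. (norm x)^2 * (Q x)^2) = a_star * M" unfolding M_def sqn_def using a_pos by simp
 have p: "a_star * M > 0" using a_pos M_pos by simp
 show "lambda_star Q > 0" ?A unfolding lambda_star_def I using p by auto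
 hence "((lambda_star Q)^2)^2 = a_star * M" by simp
 thus ?B by (metis real_sqrt_unique zero_le_power2)
qed

abbreviation (input) E0 where
 "E0 == 2 * (lambda_star Q)^2 / a_star"

text \<open>After centring, the mixed term of the moment is odd while \<open>q0\<close> is even, so
  the displacement contributes exactly the square of its length.\<close>

lemma q0_scaled_moment:
 assumes s: "s > 0" and p: "!!x. p x = s * q0 (s *R (x - z))"
 shows "sq_int (%x. norm x * p x)" (is ?A) "sqn (%x. norm x * p x) = M / s^2 + (norm z)^2" (is ?B)
proof -
 note q = wgrad_sq_int(1)[OF q0_wgrad(1)]
 define F where "F y = norm (z + (1/s) *R y) * q0 y" for y
 have Fm[measurable]: "F \<in> BM" unfolding F_def[abs_def] by measurable
 have odd: "(LBINT y. (z \<bullet> y) * (q0 y)^2) = 0"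
 proof -
  have "(LBINT y. (%y. (z \<bullet> y) * (q0 y)^2) (0 + (-1) *R y)) = (1 / \<bar>- 1\<bar> ^ DIM(real^2)) *R (LBINT y. (z \<bullet> y) * (q0 y)^2)"
   by (rule lborel_integral_affine(1)) (simp, measurable)
  thus ?thesis using q0_radial[of "- y" y for y] by simp
 qed
 have ic: "integrable lborel (%y. (z \<bullet> y) * (q0 y)^2)"
 proof (rule Bochner_Integration.integrable_bound[OF integrable_mult_right[OF integrable_mult_sq_int[OF q0_moment q]]])
  show "AE y in lborel. norm ((z \<bullet> y) * (q0 y)^2) <= norm (norm z * (norm y * q0 y * q0 y))"
  proof (rule AE_I2)
   fix y
   have "\<bar>z \<bullet> y\<bar> * (q0 y)^2 <= (norm z * norm y) * (q0 y)^2" by (intro mult_right_mono Cauchy_Schwarz_ineq2) auto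
   thus "norm ((z \<bullet> y) * (q0 y)^2) <= norm (norm z * (norm y * q0 y * q0 y))"
    by (simp add: abs_mult power2_eq_square ac_simps)
  qed
 qed measurable
 have F2: "(norm (F y))^2 = (norm z)^2 * (norm (q0 y))^2 + (2 / s) * ((z \<bullet> y) * (q0 y)^2) + (1 / s^2) * (norm (norm y * q0 y))^2" for y
  unfolding F_def by (simp add: power_mult_distrib norm_add_sq power_divide algebra_simps)
 note I = sq_int_integrable[OF q] ic sq_int_integrable[OF q0_moment]
 have F: "sq_int F" unfolding sq_int_def F2 using I Fm by simp
 have "sqn F = (norm z)^2 * sqn q0 + (1 / s^2) * M"
  unfolding sqn_def F2 M_def using I odd by (simp del: integral_mult_right_zero add: integral_mult_right_zero)
 hence sF: "sqn F = M / s^2 + (norm z)^2" using q0_wgrad(2) by simp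
 have e: "norm x * p x = s * F (- s *R z + s *R x)" for x
  using s by (simp add: F_def p algebra_simps)
 show ?A unfolding e using s by (intro sq_int_cmult sq_int_affine(1) F) simp
 show ?B
  unfolding e sqn_cmult using s by (subst sq_int_affine(2)[OF _ F]) (simp_all add: sF)
qed

end

section \<open>Blow-up of the energy\<close>

text \<open>From here on a function u = f + i g is carried as a real pair f, g with gradients a, b.
  \<open>quart\<close>, \<open>mom\<close> and \<open>rotation\<close> are the interaction, trap and
  angular momentum terms of the functional in these terms.\<close>

definition quart :: "(real^2 => real) => (real^2 => real) => real" where
 "quart f g = sqn (%x. (f x)^2 + (g x)^2)"

definition mom :: "(real^2 => real) => (real^2 => real) => real" where
 "mom f g = sqn (%x. norm x * f x) + sqn (%x. norm x * g x)"

definition rotation :: "(real^2 => real) => (real^2 => real^2) => (real^2 => real) => (real^2 => real^2) => real" where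
 "rotation f a g b = (LBINT x. rot90 x \<bullet> (f x *R b x - g x *R a x))"

definition state :: "(real^2 => real) => (real^2 => real^2) => (real^2 => real) => (real^2 => real^2) => bool" where
 "state f a g b \<longleftrightarrow> wgrad f a & wgrad g b & sqn f + sqn g = 1 & sq_int (%x. norm x * f x) & sq_int (%x. norm x * g x)"

definition defect :: "(real^2 => real) => (real^2 => real^2) => (real^2 => real) => (real^2 => real^2) => real" where
 "defect f a g b = sqn a + sqn b - a_star / 2 * quart f g"

text \<open>The energy after blow-up by \<open>e = (a\<^sub>* - a)\<^sup>1\<^sup>/\<^sup>4\<close>, multiplied by \<open>e\<^sup>2\<close>.\<close>

definition energy :: "real => real => (real^2 => real) => (real^2 => real^2) => (real^2 => real) => (real^2 => real^2) => real" where
 "energy \<Omega> e f a g b = defect f a g b + e^4 * (quart f g / 2 + mom f g) - 2 * \<Omega> * e^2 * rotation f a g b"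

lemma gp_energy_eq:
 assumes u: "u \<in> H1" and ab: "wgrad (%x. Re (u x)) a" "wgrad (%x. Im (u x)) b" and x: "(%x. norm x *R u x) \<in> L2"
 shows "gp_energy \<Omega> \<alpha> u = ereal (sqn a + sqn b + mom (%x. Re (u x)) (%x. Im (u x))
  - 2 * \<Omega> * rotation (%x. Re (u x)) a (%x. Im (u x)) b - \<alpha> / 2 * quart (%x. Re (u x)) (%x. Im (u x)))"
proof -
 have xs: "sq_int (%x. norm x *R u x)" using x by (simp add: L2_iff)
 have "(LBINT x. (norm x)^2 * (cmod (u x))^2) = (LBINT x. (norm x * Re (u x))^2 + (norm x * Im (u x))^2)"
  by (simp add: cmod_power2 power_mult_distrib distrib_left)
 also have "\<dots> = mom (%x. Re (u x)) (%x. Im (u x))"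
  using sq_int_integrable[OF complex_sq_int(1)[OF xs]] sq_int_integrable[OF complex_sq_int(2)[OF xs]]
  by (simp add: mom_def sqn_def power_mult_distrib)
 finally have m: "(LBINT x. (norm x)^2 * (cmod (u x))^2) = mom (%x. Re (u x)) (%x. Im (u x))" .
 have "quartic u = quart (%x. Re (u x)) (%x. Im (u x))"
  using quartic_eq[of "%x. Re (u x)" "%x. Im (u x)"] by (simp add: quart_def sqn_def)
 thus ?thesis
  unfolding gp_energy_def using x m ang_mom_eq(2)[OF u ab xs] gradient_energy_eq(1)[OF u ab]
  by (simp add: rotation_def)
qed

lemma sq_int_moment_iff: "sq_int f ==> sq_int g ==>
  (%x. norm x *R Complex (f x) (g x)) \<in> L2 \<longleftrightarrow> sq_int (%x. norm x * f x) & sq_int (%x. norm x * g x)"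
 using complex_sq_int[of "%x. norm x *R Complex (f x) (g x)"] sq_int_complex[of "%x. norm x * f x" "%x. norm x * g x"]
 by (auto simp: L2_iff complex_eq_iff scaleR_complex.ctr)

text \<open>The dilation keeps mass and rotation, multiplies gradient and quartic terms by e^2 and
  divides the moment by e^2. Writing the coupling as \<open>a_star\<close> - e^4 splits the
  interaction into its critical part, which enters the defect, and a remainder of the same order as
  the trap.\<close>

lemma blowup:
 assumes e: "e > 0" and f: "wgrad f a" and g: "wgrad g b"
  and xf: "sq_int (%x. norm x * f x)" and xg: "sq_int (%x. norm x * g x)" and m: "sqn f + sqn g = 1"
 defines "F == %x. e * f (e *R x)" and "A == %x. e^2 *R a (e *R x)" and "G == %x. e * g (e *R x)" and "B == %x. e^2 *R b (e *R x)"
 shows "state F A G B"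
  "sqn a + sqn b + mom f g - 2 * \<Omega> * rotation f a g b - (a_star - e^4) / 2 * quart f g = energy \<Omega> e F A G B / e^2" (is ?A)
proof -
 note sf = wgrad_scale[OF f e, of e 0] and sg = wgrad_scale[OF g e, of e 0]
 note [measurable] = wgrad_sq_int[OF f, THEN sq_int_measurable] wgrad_sq_int[OF g, THEN sq_int_measurable]
 have F: "wgrad F A" "sqn F = sqn f" "sqn A = e^2 * sqn a" using sf e by (simp_all add: F_def A_def power2_eq_square)
 have G: "wgrad G B" "sqn G = sqn g" "sqn B = e^2 * sqn b" using sg e by (simp_all add: G_def B_def power2_eq_square)
 have mo: "sq_int (%x. norm x * (e * h (e *R x)))" "sqn (%x. norm x * (e * h (e *R x))) = sqn (%x. norm x * h x) / e^2"
  if "sq_int (%x. norm x * h x)" for h :: "real^2 => real"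
 proof -
  have eq: "(%x. norm x * (e * h (e *R x))) = (%x. (%y. norm y * h y) (0 + e *R x))" using e by auto
  show "sq_int (%x. norm x * (e * h (e *R x)))" "sqn (%x. norm x * (e * h (e *R x))) = sqn (%x. norm x * h x) / e^2"
   unfolding eq using sq_int_affine[OF _ that, of e 0] e by simp_all
 qed
 show "state F A G B" unfolding state_def using F G m mo(1)[OF xf] mo(1)[OF xg] by (simp add: F_def G_def)
 have M: "mom F G = mom f g / e^2" unfolding mom_def F_def G_def mo(2)[OF xf] mo(2)[OF xg] by (simp add: add_divide_distrib)
 have "quart F G = (LBINT x. e^4 * (%y. ((f y)^2 + (g y)^2)^2) (0 + e *R x))"
  unfolding quart_def sqn_def F_def G_def
  by (simp add: power_mult_distrib distrib_left[symmetric] power_mult[symmetric])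
 also have "\<dots> = e^4 * (LBINT x. (%y. ((f y)^2 + (g y)^2)^2) (0 + e *R x))" by simp
 also have "(LBINT x. (%y. ((f y)^2 + (g y)^2)^2) (0 + e *R x)) = 1 / e^2 * quart f g"
  using e by (subst lborel_integral_affine(1)) (auto simp: quart_def sqn_def)
 finally have Q: "quart F G = e^2 * quart f g" using e by (simp add: power4_eq_xxxx power2_eq_square)
 have "rotation F A G B = (LBINT x. e^2 * (%y. rot90 y \<bullet> (f y *R b y - g y *R a y)) (0 + e *R x))"
  unfolding rotation_def F_def G_def A_def B_def
  by (simp add: rot90_linear inner_diff_right power2_eq_square algebra_simps)
 also have "\<dots> = e^2 * (LBINT x. (%y. rot90 y \<bullet> (f y *R b y - g y *R a y)) (0 + e *R x))" by simp
 also have "(LBINT x. (%y. rot90 y \<bullet> (f y *R b y - g y *R a y)) (0 + e *R x)) = 1 / e^2 * rotation f a g b"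
  using e by (subst lborel_integral_affine(1)) (auto simp: rotation_def)
 finally have R: "rotation F A G B = rotation f a g b" using e by simp
 show ?A
  unfolding energy_def defect_def M Q R F G using e by (simp add: power4_eq_xxxx power2_eq_square field_simps)
qed

lemma energy_blowup:
 assumes u: "u \<in> H1" "L2_norm u = 1" and x: "(%x. norm x *R u x) \<in> L2" and e: "e > 0" "a_star - \<alpha> = e^4"
 obtains A B where "state (%x. e * Re (u (e *R x))) A (%x. e * Im (u (e *R x))) B"
  "!!\<Omega>. gp_energy \<Omega> \<alpha> u = ereal (energy \<Omega> e (%x. e * Re (u (e *R x))) A (%x. e * Im (u (e *R x))) B / e^2)"
proof -
 obtain a b where ab: "wgrad (%x. Re (u x)) a" "wgrad (%x. Im (u x)) b" by (rule H1_E[OF u(1)])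
 have m: "sqn (%x. Re (u x)) + sqn (%x. Im (u x)) = 1"
  using u(2) mass_eq[OF wgrad_sq_int(1)[OF ab(1)] wgrad_sq_int(1)[OF ab(2)]] by (simp add: L2_norm_def)
 have xs: "sq_int (%x. norm x *R u x)" using x by (simp add: L2_iff)
 have xx: "sq_int (%x. norm x * Re (u x))" "sq_int (%x. norm x * Im (u x))" using complex_sq_int[OF xs] by simp_all
 have al: "\<alpha> = a_star - e^4" using e(2) by simp
 note B = blowup[OF e(1) ab xx m]
 show thesis
  by (rule that[OF B(1)]) (unfold gp_energy_eq[OF u(1) ab x] al B(2), rule refl)
qed

context gn
begin

lemma defect_nonneg:
 assumes "state f a g b" shows "0 <= defect f a g b"
 using assms gn_pair[of f a g b] by (simp add: state_def defect_def quart_def sqn_def)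

text \<open>The diamagnetic splitting \<open>\<parallel>\<nabla>v\<parallel>\<^sup>2 \<ge> \<parallel>\<nabla>|v|\<parallel>\<^sup>2 + \<parallel>n\<parallel>\<^sup>2\<close>, where \<open>|v| n\<close> is the current.\<close>

lemma phase_part:
 assumes st: "state f a g b"
 obtains n where "sq_int n" "sqn n <= defect f a g b" "!!x. f x *R b x - g x *R a x = sqrt ((f x)^2 + (g x)^2) *R n x"
proof -
 define n where "n x = (1 / sqrt ((f x)^2 + (g x)^2)) *R (f x *R b x - g x *R a x)" for x
 have f: "wgrad f a" and g: "wgrad g b" and m: "sqn f + sqn g = 1" using st by (auto simp: state_def)
 define \<rho> where "\<rho> x = sqrt ((f x)^2 + (g x)^2)" for x
 define r where "r x = (1 / \<rho> x) *R (f x *R a x + g x *R b x)" for x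
 note W = wgrad_modulus_sqn[OF f g, folded \<rho>_def, folded r_def]
 have w: "wgrad \<rho> r" using W(1) by (simp add: \<rho>_def[abs_def] r_def[abs_def])
 note s = wgrad_sq_int[OF f] wgrad_sq_int[OF g] wgrad_sq_int[OF w]
 note [measurable] = s[THEN sq_int_measurable]
 have le: "(norm (r x))^2 + (norm (n x))^2 <= (norm (a x))^2 + (norm (b x))^2" for x
  using modulus_phase_le[of "f x" "g x" "a x" "b x"] by (simp add: r_def n_def \<rho>_def)
 have nm[measurable]: "n \<in> BM" unfolding n_def[abs_def] by measurable
 have iab: "integrable lborel (%x. (norm (a x))^2 + (norm (b x))^2)" using s by (simp add: sq_int_def)
 have "integrable lborel (%x. (norm (n x))^2)"
 proof (rule Bochner_Integration.integrable_bound[OF iab])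
  show "AE x in lborel. norm ((norm (n x))^2) <= norm ((norm (a x))^2 + (norm (b x))^2)"
  proof (rule AE_I2)
   fix x
   have "0 <= (norm (r x))^2" by simp
   hence "(norm (n x))^2 <= (norm (a x))^2 + (norm (b x))^2" using le[of x] by linarith
   thus "norm ((norm (n x))^2) <= norm ((norm (a x))^2 + (norm (b x))^2)" by simp
  qed
 qed measurable
 hence n: "sq_int n" by (simp add: sq_int_def)
 have "sqn r + sqn n = (LBINT x. (norm (r x))^2 + (norm (n x))^2)"
  using s n by (simp add: sqn_def sq_int_def)
 also have "\<dots> <= (LBINT x. (norm (a x))^2 + (norm (b x))^2)"
  by (rule integral_mono[OF _ iab le]) (use s n in \<open>simp add: sq_int_def\<close>)
 also have "\<dots> = sqn a + sqn b" using s by (simp add: sqn_def sq_int_def)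
 finally have 1: "sqn r + sqn n <= sqn a + sqn b" .
 have "sqn \<rho> = 1" using s m by (simp add: sqn_def sq_int_def \<rho>_def)
 hence "a_star / 2 * sqn (sq \<rho>) <= sqn r" using quartic_integrable(2)[OF w] by simp
 hence "sqn n <= defect f a g b" using 1 by (simp add: defect_def quart_def \<rho>_def)
 moreover have "f x *R b x - g x *R a x = sqrt ((f x)^2 + (g x)^2) *R n x" for x
  by (cases "(f x)^2 + (g x)^2 = 0") (auto simp: n_def)
 ultimately show thesis using that n by blast
qed

text \<open>The current is |v| n, so the rotation is at most the norm of |x| |v| times the norm of
  n; the arithmetic-geometric inequality divides it between trap and defect.\<close>

lemma rotation_bound:
 assumes st: "state f a g b"
 shows "2 * e^2 * \<bar>rotation f a g b\<bar> <= defect f a g b + e^4 * mom f g"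
proof -
 obtain n where P: "sq_int n" "sqn n <= defect f a g b" "!!x. f x *R b x - g x *R a x = sqrt ((f x)^2 + (g x)^2) *R n x"
  by (rule phase_part[OF st], rule that, assumption+)
 have xf: "sq_int (%x. norm x * f x)" and xg: "sq_int (%x. norm x * g x)" and fg: "wgrad f a" "wgrad g b" using st by (auto simp: state_def)
 note [measurable] = wgrad_sq_int(1)[OF fg(1), THEN sq_int_measurable] wgrad_sq_int(1)[OF fg(2), THEN sq_int_measurable]
 define w where "w x = sqrt ((f x)^2 + (g x)^2) *R rot90 x" for x
 have wm: "w \<in> BM" unfolding w_def[abs_def] by measurable
 have w2: "(norm (w x))^2 = (norm (norm x * f x))^2 + (norm (norm x * g x))^2" for x
  by (simp add: w_def norm_rot90 power_mult_distrib distrib_right algebra_simps)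
 have w: "sq_int w" using sq_int_integrable[OF xf] sq_int_integrable[OF xg] wm unfolding sq_int_def w2 by simp
 have sw: "sqn w = mom f g" using sq_int_integrable[OF xf] sq_int_integrable[OF xg] unfolding sqn_def w2 mom_def by simp
 have "rotation f a g b = (LBINT x. w x \<bullet> n x)" unfolding rotation_def P(3) w_def by simp
 hence R: "\<bar>rotation f a g b\<bar> <= l2 w * l2 n" using inner_cauchy_schwarz[OF w P(1)] by simp
 have "0 <= (e^2 * l2 w - l2 n)^2" by simp
 hence "2 * e^2 * (l2 w * l2 n) <= e^4 * sqn w + sqn n"
  unfolding l2_power2[symmetric] by (simp add: power2_eq_square power4_eq_xxxx algebra_simps)
 moreover have "2 * e^2 * \<bar>rotation f a g b\<bar> <= 2 * e^2 * (l2 w * l2 n)" using R by (intro mult_left_mono) auto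
 ultimately show ?thesis using P(2) unfolding sw by linarith
qed

text \<open>For \<Omega> < 1 a fixed fraction of defect and trap survives the rotation. For
  quasi-minimizers this gives a defect of order e^4 and bounded moments; it does not yet give the
  sharp constant.\<close>

lemma energy_lower:
 assumes st: "state f a g b" and O: "0 <= \<Omega>" "\<Omega> < 1"
 shows "(1 - \<Omega>) * (defect f a g b + e^4 * mom f g) + e^4 / 2 * quart f g <= energy \<Omega> e f a g b"
proof -
 have "\<Omega> * (2 * e^2 * rotation f a g b) <= \<Omega> * (defect f a g b + e^4 * mom f g)"
 proof (intro mult_left_mono O)
  have "2 * e^2 * rotation f a g b <= 2 * e^2 * \<bar>rotation f a g b\<bar>" by (intro mult_left_mono) auto
  thus "2 * e^2 * rotation f a g b <= defect f a g b + e^4 * mom f g" using rotation_bound[OF st, of e] by linarith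
 qed
 thus ?thesis by (simp add: energy_def algebra_simps)
qed

lemma mom_nonneg: "0 <= mom f g"
 by (simp add: mom_def)

lemma quart_nonneg: "0 <= quart f g"
 by (simp add: quart_def)

lemma energy_nonneg:
 assumes st: "state f a g b" and O: "0 <= \<Omega>" "\<Omega> < 1"
 shows "0 <= energy \<Omega> e f a g b"
 using energy_lower[OF st O, of e] defect_nonneg[OF st] mom_nonneg[of f g] quart_nonneg[of f g] O
 by (smt (verit) mult_nonneg_nonneg zero_le_even_power even_numeral divide_nonneg_nonneg)

end

context gn_Q
begin

text \<open>The profile is real, so its rotation vanishes. Its energy at scale l is
  (\<open>a_star\<close> - \<alpha>) l^2 / \<open>a_star\<close> + M / l^2, which is smallest for
  l^4 = \<open>a_star\<close> M / (\<open>a_star\<close> - \<alpha>); this explains the exponent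
  -1/4 and the factor \<open>lambda_star Q\<close>.\<close>

lemma trial_state:
 fixes \<alpha> :: real assumes al: "\<alpha> < a_star"
 shows "blowup_profile Q \<alpha> \<in> H1" (is ?A) "L2_norm (blowup_profile Q \<alpha>) = 1" (is ?B)
  "gp_energy \<Omega> \<alpha> (blowup_profile Q \<alpha>) = ereal (sqrt (a_star - \<alpha>) * (2 * (lambda_star Q)^2 / a_star))" (is ?C)
proof -
 define l where "l = lambda_star Q * (a_star - \<alpha>) powr (- 1 / 4)"
 have l: "l > 0" using lambda_star_eq(1) al by (simp add: l_def)
 define p where "p x = l * q0 (l *R x)" for x
 have up: "blowup_profile Q \<alpha> = (%x. Complex (p x) 0)"
  using a_pos by (auto simp: blowup_profile_def Let_def l_def p_def q0_def powr_minus powr_half_sqrt complex_eq_iff field_simps)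
 note S = wgrad_scale[OF q0_wgrad(1) l, of l 0]
 have w: "wgrad p (%x. (l * l) *R k0 (l *R x))" using S(1) by (simp add: p_def[abs_def])
 show H: ?A unfolding up by (rule H1_I[OF w wgrad_zero])
 have n1: "sqn p = 1" using S(2) q0_wgrad(2) l by (simp add: p_def[abs_def])
 show ?B
  unfolding up L2_norm_def using mass_eq[OF wgrad_sq_int(1)[OF w] wgrad_sq_int(1)[OF wgrad_zero]] n1 by simp
 have P: "!!x. p x = l * q0 (l *R (x - 0))" by (simp add: p_def)
 note mm = q0_scaled_moment[OF l P]
 have x: "(%x. norm x *R blowup_profile Q \<alpha> x) \<in> L2"
  unfolding up using mm(1) by (subst sq_int_moment_iff) (auto intro: wgrad_sq_int(1)[OF w])
 have g: "sqn (%x. (l * l) *R k0 (l *R x)) = l^2" using S(3) k0(2) by simp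
 have q: "quart p (%x. 0) = l^2 * (2 / a_star)"
 proof -
  have "sqn (sq q0) = 2 / a_star" using q0_wgrad(3) a_pos by (simp add: field_simps)
  thus ?thesis using sqn_square_scale[OF q0_measurable l, of l 0] l
   by (simp add: quart_def p_def[abs_def] power4_eq_xxxx power2_eq_square)
 qed
 have "gp_energy \<Omega> \<alpha> (blowup_profile Q \<alpha>) = ereal (l^2 + M / l^2 - \<alpha> / 2 * (l^2 * (2 / a_star)))"
  using gp_energy_eq[OF H _ _ x, of "%x. (l * l) *R k0 (l *R x)" "%x. 0" \<Omega> \<alpha>] w wgrad_zero mm(2) g q
  by (simp add: up mom_def rotation_def)
 also have "l^2 + M / l^2 - \<alpha> / 2 * (l^2 * (2 / a_star)) = sqrt (a_star - \<alpha>) * (2 * (lambda_star Q)^2 / a_star)"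
 proof -
  define L where "L = (lambda_star Q)^2"
  define d where "d = sqrt (a_star - \<alpha>)"
  have d: "d > 0" "d * d = a_star - \<alpha>" using al by (auto simp: d_def)
  have "((a_star - \<alpha>) powr (- 1 / 4))^2 = (a_star - \<alpha>) powr (- 1 / 2)" using al by (simp add: powr_power)
  also have "\<dots> = 1 / d" using al by (simp add: d_def powr_minus powr_half_sqrt inverse_eq_divide)
  finally have l2: "l^2 = L / d" by (simp add: l_def L_def power_mult_distrib)
  have L: "L > 0" "L * L = a_star * M" using lambda_star_eq(1,2) by (auto simp: L_def power_mult_distrib[symmetric] power2_eq_square power4_eq_xxxx)
  have "l^2 + M / l^2 - \<alpha> / 2 * (l^2 * (2 / a_star)) = (d * d) * L / (d * a_star) + M * d / L"
   unfolding l2 d(2) using a_pos d(1) L(1) by (simp add: field_simps)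
  also have "M * d / L = (a_star * M) * d / (a_star * L)" using a_pos by simp
  also have "\<dots> = L * d / a_star" unfolding L(2)[symmetric] using L(1) by simp
  also have "d * d * L / (d * a_star) + L * d / a_star = d * (2 * L / a_star)" using d(1) by (simp add: add_divide_distrib[symmetric])
  finally show ?thesis by (simp add: L_def d_def)
 qed
 finally show ?C .
qed

end

section \<open>Compactness of almost optimal sequences\<close>

lemma l2_tendsto_scaleR:
 assumes s: "!!n::nat. sq_int (f n)" "sq_int f0" and l: "l2_lim f f0" and c: "c ----> c0"
 shows "l2_lim (%n x. c n *R f n x) (%x. c0 *R f0 x)"
proof (rule null_bound)
 have "(%n. \<bar>c n\<bar> * l2 (%x. f n x - f0 x) + \<bar>c n - c0\<bar> * l2 f0) ----> \<bar>c0\<bar> * 0 + \<bar>c0 - c0\<bar> * l2 f0"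
  by (intro tendsto_intros c l)
 thus "(%n. \<bar>c n\<bar> * l2 (%x. f n x - f0 x) + \<bar>c n - c0\<bar> * l2 f0) ----> 0" by simp
 fix n
 have "l2 (%x. c n *R (f n x - f0 x) + (c n - c0) *R f0 x) <= \<bar>c n\<bar> * l2 (%x. f n x - f0 x) + \<bar>c n - c0\<bar> * l2 f0"
  unfolding l2_scaleR[symmetric] by (intro l2_triangle sq_int_scaleR sq_int_diff s)
 thus "\<bar>l2 (%x. c n *R f n x - c0 *R f0 x)\<bar> <= \<bar>c n\<bar> * l2 (%x. f n x - f0 x) + \<bar>c n - c0\<bar> * l2 f0"
  by (simp add: algebra_simps)
qed

lemma l2_tendsto_combination:
 assumes s: "!!n::nat. sq_int (f n)" "!!n. sq_int (g n)" "sq_int p"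
  and l: "l2_lim f (%x. c1 *R p x)" "l2_lim g (%x. c2 *R p x)"
  and c: "\<alpha> ----> \<alpha>0" "\<beta> ----> \<beta>0"
 shows "(%n. l2 (%x. \<alpha> n *R f n x + \<beta> n *R g n x - (\<alpha>0 * c1 + \<beta>0 * c2) *R p x)) ----> 0"
 using l2_tendsto_add[OF sq_int_scaleR[OF s(1)] sq_int_scaleR[OF sq_int_scaleR[OF s(3)]] sq_int_scaleR[OF s(2)] sq_int_scaleR[OF sq_int_scaleR[OF s(3)]]
  l2_tendsto_scaleR[OF s(1) sq_int_scaleR[OF s(3)] l(1) c(1)] l2_tendsto_scaleR[OF s(2) sq_int_scaleR[OF s(3)] l(2) c(2)]]
 by (simp add: scaleR_left_distrib)

lemma l2_tendsto_0_iff: "(%n::nat. l2 (f n)) ----> 0 \<longleftrightarrow> (%n. sqn (f n)) ----> 0"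
proof
 assume "(%n. l2 (f n)) ----> 0"
 from tendsto_power[OF this, of 2] show "(%n. sqn (f n)) ----> 0" by simp
next
 assume "(%n. sqn (f n)) ----> 0"
 from tendsto_real_sqrt[OF this] show "(%n. l2 (f n)) ----> 0" by (simp add: l2_def)
qed

lemma sqn_rotate:
 fixes c s :: real
 assumes f: "sq_int f" and g: "sq_int g" and cs: "c^2 + s^2 = 1"
 shows "sqn (%x. c *R f x + s *R g x) + sqn (%x. c *R g x - s *R f x) = sqn f + sqn g"
proof -
 have "sqn (%x. c *R f x + s *R g x) + sqn (%x. c *R g x - s *R f x) = (c^2 + s^2) * sqn f + (c^2 + s^2) * sqn g"
  unfolding sqn_add[OF sq_int_scaleR[OF f] sq_int_scaleR[OF g]] sqn_diff[OF sq_int_scaleR[OF g] sq_int_scaleR[OF f]] sqn_scaleR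
  by (simp add: inner_commute algebra_simps)
 thus ?thesis by (simp add: cs)
qed

text \<open>Multiplication of f + i g by the unimodular constant c - i s, under which every term of
  the energy is invariant.\<close>

lemma rotate_state:
 fixes c s :: real
 assumes st: "state f a g b" and cs: "c^2 + s^2 = 1"
 defines "F == %x. c * f x + s * g x" and "A == %x. c *R a x + s *R b x"
  and "G == %x. c * g x - s * f x" and "B == %x. c *R b x - s *R a x"
 shows "state F A G B" "defect F A G B = defect f a g b" (is ?A) "energy \<Omega> e F A G B = energy \<Omega> e f a g b" (is ?B)
proof -
 have f: "wgrad f a" and g: "wgrad g b" and m: "sqn f + sqn g = 1"
  and xf: "sq_int (%x. norm x * f x)" and xg: "sq_int (%x. norm x * g x)" using st by (auto simp: state_def)
 have F: "wgrad F A" "wgrad G B" unfolding F_def A_def G_def B_def by (intro wgrad_add wgrad_diff wgrad_cmult f g)+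
 note s1 = sqn_rotate[OF wgrad_sq_int(1)[OF f] wgrad_sq_int(1)[OF g] cs]
  and s2 = sqn_rotate[OF wgrad_sq_int(2)[OF f] wgrad_sq_int(2)[OF g] cs] and s3 = sqn_rotate[OF xf xg cs]
 have m': "sqn F + sqn G = 1" using s1 m by (simp add: F_def G_def)
 have X: "(%x. norm x * F x) = (%x. c *R (norm x * f x) + s *R (norm x * g x))"
  "(%x. norm x * G x) = (%x. c *R (norm x * g x) - s *R (norm x * f x))" by (auto simp: F_def G_def algebra_simps)
 have "sq_int (%x. norm x * F x)" "sq_int (%x. norm x * G x)" unfolding X by (intro sq_int_add sq_int_diff sq_int_scaleR xf xg)+
 thus "state F A G B" using F m' by (simp add: state_def)
 have M: "mom F G = mom f g" unfolding mom_def X by (rule s3)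
 have "(F x)^2 + (G x)^2 = (c^2 + s^2) * ((f x)^2 + (g x)^2)" for x
  unfolding F_def G_def by (simp add: power2_eq_square algebra_simps)
 hence P: "quart F G = quart f g" by (simp add: quart_def cs)
 show D: ?A unfolding defect_def P using s2 by (simp add: A_def B_def)
 have "F x *R B x - G x *R A x = (c^2 + s^2) *R (f x *R b x - g x *R a x)" for x
  unfolding F_def G_def A_def B_def by (simp add: power2_eq_square algebra_simps)
 hence "rotation F A G B = rotation f a g b" by (simp add: rotation_def cs)
 thus ?B by (simp add: energy_def D M P)
qed

context gn
begin

text \<open>The difference of squares factors into w - u and w + u. Gagliardo-Nirenberg makes the L4
  norm of the first factor small from its L2 norm and the gradient bound, and keeps that of the
  second bounded.\<close>

lemma square_l2_tendsto:
 assumes w: "!!n::nat. wgrad (w n) (v n)" and u: "wgrad u g" and B: "!!n. sqn (w n) <= A" "!!n. sqn (v n) <= A"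
  and l: "l2_lim w u"
 shows "l2_lim (%n x. (w n x)^2) (sq u)"
proof -
 define K where "K = 2 * A + 2 * sqn u + 2 * sqn g"
 have A: "A >= 0" using B(1)[of 0] sqn_nonneg order_trans by blast
 note sw = wgrad_sq_int[OF w] and su = wgrad_sq_int[OF u]
 have d: "wgrad (%x. w n x - u x) (%x. v n x - g x)" "wgrad (%x. w n x + u x) (%x. v n x + g x)" for n
  by (intro wgrad_diff wgrad_add w u)+
 have k: "sqn (%x. v n x - g x) <= K" "sqn (%x. w n x + u x) <= K" "sqn (%x. v n x + g x) <= K" for n
 proof -
  have "sqn (%x. v n x - g x) <= 2 * sqn (v n) + 2 * sqn g" using sqn_add_le[OF sw(2)[of n] sq_int_uminus[OF su(2)]] by simp
  thus "sqn (%x. v n x - g x) <= K" "sqn (%x. w n x + u x) <= K" "sqn (%x. v n x + g x) <= K"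
   using sqn_add_le[OF sw(1)[of n] su(1)] sqn_add_le[OF sw(2)[of n] su(2)] B[of n] sqn_nonneg[of u] sqn_nonneg[of g] A unfolding K_def by linarith+
 qed
 have l': "(%n. sqn (%x. w n x - u x)) ----> 0" using l by (simp only: l2_tendsto_0_iff)
 have q: "(%n. sqn (%x. (w n x - u x)^2)) ----> 0"
 proof (rule null_bound)
  show "(%n. 2 / a_star * (K * sqn (%x. w n x - u x))) ----> 0" by (intro tendsto_mult_right_zero l')
  fix n
  have "a_star / 2 * sqn (%x. (w n x - u x)^2) <= sqn (%x. v n x - g x) * sqn (%x. w n x - u x)" by (rule quartic_integrable(2)[OF d(1)])
  also have "\<dots> <= K * sqn (%x. w n x - u x)" by (intro mult_right_mono k) simp
  finally show "\<bar>sqn (%x. (w n x - u x)^2)\<bar> <= 2 / a_star * (K * sqn (%x. w n x - u x))" using a_pos by (simp add: field_simps)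
 qed
 hence ql: "(%n. l2 (%x. (w n x - u x)^2)) ----> 0" by (simp add: l2_tendsto_0_iff)
 have "(%n. sqn (%x. (w n x)^2 - (u x)^2)) ----> 0"
 proof (rule null_bound)
  show "(%n. l2 (%x. (w n x - u x)^2) * sqrt (2 / a_star * K^2)) ----> 0" by (intro tendsto_mult_left_zero ql)
  fix n
  have "sqn (%x. (w n x)^2 - (u x)^2) = (LBINT x. (w n x - u x)^2 \<bullet> (w n x + u x)^2)"
   unfolding sqn_def by (simp add: power_mult_distrib[symmetric] power2_eq_square algebra_simps)
  also have "\<dots> <= l2 (%x. (w n x - u x)^2) * l2 (%x. (w n x + u x)^2)"
   using inner_cauchy_schwarz[OF quartic_integrable(1)[OF d(1)] quartic_integrable(1)[OF d(2)], of n n] by linarith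
  also have "l2 (%x. (w n x + u x)^2) <= sqrt (2 / a_star * K^2)"
   unfolding l2_def using quartic_bound[OF d(2) k(2,3)] by simp
  finally show "\<bar>sqn (%x. (w n x)^2 - (u x)^2)\<bar> <= l2 (%x. (w n x - u x)^2) * sqrt (2 / a_star * K^2)"
   by (simp add: mult_left_mono)
 qed
 thus ?thesis by (simp add: l2_tendsto_0_iff)
qed

text \<open>The moment prevents escape of mass to infinity and the fourth power prevents
  concentration; \<open>dominated_convergence_almost\<close> tolerates a small multiple of
  both.\<close>

lemma tight_convergence:
 assumes w: "!!n::nat. wgrad (w n) (v n)" and B: "!!n. sqn (w n) <= A" "!!n. sqn (v n) <= A"
  and x: "!!n. sq_int (%x. norm x * w n x)" "!!n. sqn (%x. norm x * w n x) <= A"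
  and lim: "AE x in lborel. (%n. w n x) ----> u x" and u: "sq_int u"
 shows "l2_lim w u"
proof -
 note sw = wgrad_sq_int(1)[OF w] and q = quartic_integrable(1)[OF w]
 note [measurable] = sw[THEN sq_int_measurable] u[THEN sq_int_measurable]
 have "(%n. LBINT x. (w n x - u x)^2) ----> (\<integral>x. 0 \<partial>(lborel :: (real^2) measure))"
 proof (rule dominated_convergence_almost(4)[where a = "%n x. (norm x * w n x)^2 + ((w n x)^2)^2"])
  show "AE x in lborel. (%n. (w n x - u x)^2) ----> 0"
   using lim
  proof eventually_elim
   case (elim x)
   from tendsto_power[OF tendsto_diff[OF elim tendsto_const[of "u x"]], of 2] show ?case by simp
  qed
  show "integrable lborel (%x. (norm x * w n x)^2 + ((w n x)^2)^2)" for n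
   using sq_int_integrable[OF x(1)[of n]] sq_int_integrable[OF q[of n]] by simp
  show "(LBINT x. (norm x * w n x)^2 + ((w n x)^2)^2) <= A + 2 / a_star * A^2" for n
   using sq_int_integrable[OF x(1)[of n]] sq_int_integrable[OF q[of n]] x(2)[of n] quartic_bound[OF w B, of n] by (simp add: sqn_def)
  fix \<delta> :: real assume d: "\<delta> > 0"
  \<comment> \<open>Beyond this radius 2 w^2 is at most \<delta> |x|^2 w^2; inside it is at most
    \<delta> w^4 + 1 / \<delta>.\<close>
  define R where "R = sqrt (2 / \<delta>)"
  have R: "R >= 0" "R^2 = 2 / \<delta>" using d by (auto simp: R_def)
  show "EX G. integrable lborel G & (ALL n. AE x in lborel. norm ((w n x - u x)^2) <= \<delta> * ((norm x * w n x)^2 + ((w n x)^2)^2) + G x)"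
  proof (intro exI conjI allI AE_I2)
   show "integrable lborel (%x. 2 * (u x)^2 + (1 / \<delta>) * indicator (cball 0 R) x)"
    using sq_int_integrable[OF u] integrable_cball[of "1 / \<delta>" R] by simp
   fix n x
   have "0 <= (w n x + u x)^2" by simp
   hence 1: "(w n x - u x)^2 <= 2 * (w n x)^2 + 2 * (u x)^2" by (simp add: power2_eq_square algebra_simps)
   have 2: "2 * (w n x)^2 <= \<delta> * ((norm x * w n x)^2 + ((w n x)^2)^2) + (1 / \<delta>) * indicator (cball 0 R) x"
   proof (cases "norm x <= R")
    case True
    have "0 <= (\<delta> * (w n x)^2 - 1)^2" by simp
    hence "2 * (w n x)^2 * \<delta> <= (\<delta> * ((w n x)^2)^2 + 1 / \<delta>) * \<delta>" using d by (simp add: power2_eq_square algebra_simps)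
    hence "2 * (w n x)^2 <= \<delta> * ((w n x)^2)^2 + 1 / \<delta>" using d by (simp only: mult_le_cancel_right_pos)
    moreover have "0 <= \<delta> * (norm x * w n x)^2" using d by simp
    ultimately show ?thesis using True by (simp add: distrib_left)
   next
    case False
    hence "2 / \<delta> <= (norm x)^2" unfolding R(2)[symmetric] using R(1) by (intro power_mono) auto
    hence "2 <= \<delta> * (norm x)^2" using d by (simp add: field_simps)
    from mult_right_mono[OF this, of "(w n x)^2"] have "2 * (w n x)^2 <= \<delta> * (norm x * w n x)^2" by (simp add: power_mult_distrib mult.assoc)
    moreover have "0 <= \<delta> * ((w n x)^2)^2" using d by simp
    ultimately show ?thesis using False by (simp add: distrib_left)
   qed
   show "norm ((w n x - u x)^2) <= \<delta> * ((norm x * w n x)^2 + ((w n x)^2)^2) + (2 * (u x)^2 + (1 / \<delta>) * indicator (cball 0 R) x)"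
    using 1 2 by (simp only: real_norm_def abs_power2)
  qed
 qed auto
 hence "(%n. sqn (%x. w n x - u x)) ----> 0" by (simp add: sqn_def)
 thus ?thesis by (simp add: l2_tendsto_0_iff)
qed

lemma quart_tendsto:
 assumes w: "!!n::nat. wgrad (f n) (a n)" "!!n. wgrad (g n) (b n)" and u: "wgrad f0 a0" "wgrad g0 b0"
  and B: "!!n. sqn (f n) <= A" "!!n. sqn (a n) <= A" "!!n. sqn (g n) <= A" "!!n. sqn (b n) <= A"
  and l: "l2_lim f f0" "l2_lim g g0"
 shows "(%n. quart (f n) (g n)) ----> quart f0 g0"
proof -
 note s = quartic_integrable(1)[OF w(1)] quartic_integrable(1)[OF u(1)] quartic_integrable(1)[OF w(2)] quartic_integrable(1)[OF u(2)]
 show ?thesis unfolding quart_def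
  by (intro l2_tendsto_imp_sqn_tendsto l2_tendsto_add s sq_int_add square_l2_tendsto[OF w(1) u(1) B(1,2) l(1)] square_l2_tendsto[OF w(2) u(2) B(3,4) l(2)])
qed

text \<open>An almost optimal tight sequence converges strongly: weak limits lose no mass, and the optimal inequality for the limit excludes a loss of gradient norm.\<close>

lemma strong_limit:
 assumes st: "!!n::nat. state (f n) (a n) (g n) (b n)" and D0: "(%n. defect (f n) (a n) (g n) (b n)) ----> 0"
  and K: "!!n. defect (f n) (a n) (g n) (b n) <= K" "!!n. mom (f n) (g n) <= K" "!!n. quart (f n) (g n) <= K"
 obtains r :: "nat => nat" and f0 a0 g0 b0 where "strict_mono r" "wgrad f0 a0" "wgrad g0 b0" "sqn f0 + sqn g0 = 1"
  "sqn a0 + sqn b0 <= a_star / 2 * quart f0 g0"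
  "l2_lim (%n. f (r n)) f0" "l2_lim (%n. a (r n)) a0"
  "l2_lim (%n. g (r n)) g0" "l2_lim (%n. b (r n)) b0"
proof -
 have f: "wgrad (f n) (a n)" and g: "wgrad (g n) (b n)" and m: "sqn (f n) + sqn (g n) = 1"
  and xf: "sq_int (%x. norm x * f n x)" and xg: "sq_int (%x. norm x * g n x)" for n using st by (auto simp: state_def)
 have K0: "K >= 0" using K(3)[of 0] quart_nonneg[of "f 0" "g 0"] by linarith
 define A where "A = 1 + K + a_star / 2 * K"
 have B: "sqn (f n) <= A" "sqn (g n) <= A" "sqn (a n) <= A" "sqn (b n) <= A" "sqn (%x. norm x * f n x) <= A" "sqn (%x. norm x * g n x) <= A" for n
 proof -
  have "a_star / 2 * quart (f n) (g n) <= a_star / 2 * K" using K(3) a_pos by (intro mult_left_mono) auto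
  hence "sqn (a n) + sqn (b n) <= K + a_star / 2 * K" using K(1)[of n] by (simp add: defect_def)
  moreover have "0 <= a_star / 2 * K" using a_pos K0 by simp
  moreover note K(2)[of n] m[of n] sqn_nonneg[of "a n"] sqn_nonneg[of "b n"] sqn_nonneg[of "f n"] sqn_nonneg[of "g n"]
   sqn_nonneg[of "%x. norm x * f n x"] sqn_nonneg[of "%x. norm x * g n x"]
  ultimately show "sqn (f n) <= A" "sqn (g n) <= A" "sqn (a n) <= A" "sqn (b n) <= A" "sqn (%x. norm x * f n x) <= A" "sqn (%x. norm x * g n x) <= A"
   unfolding A_def mom_def using K0 by linarith+
 qed
 have L: "l2 (f n) <= sqrt A" "l2 (g n) <= sqrt A" "l2 (a n) <= sqrt A" "l2 (b n) <= sqrt A" for n using B by (auto simp: l2_def)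
 obtain r1 :: "nat => nat" and f0 where r1: "strict_mono r1" and f0m: "f0 \<in> BM" and f0: "AE x in lborel. (%n. f (r1 n) x) ----> f0 x"
  by (rule rellich_AE[OF f L(1,3)])
 obtain r2 :: "nat => nat" and g0 where r2: "strict_mono r2" and g0m: "g0 \<in> BM" and g0: "AE x in lborel. (%n. g (r1 (r2 n)) x) ----> g0 x"
  by (rule rellich_AE[OF g[of "r1 n" for n] L(2,4)])
 define r where "r n = r1 (r2 n)" for n
 have r: "strict_mono r" using r1 r2 by (simp add: r_def strict_mono_def)
 have F0: "AE x in lborel. (%n. f (r n) x) ----> f0 x"
  using f0 by eventually_elim (use LIMSEQ_subseq_LIMSEQ[OF _ r2] in \<open>auto simp: r_def comp_def\<close>)
 have G0: "AE x in lborel. (%n. g (r n) x) ----> g0 x" using g0 by (simp add: r_def)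
 obtain a0 where a0: "wgrad f0 a0" and "sqn f0 <= A" "sqn a0 <= A" and wa: "!!\<psi>. sq_int \<psi> ==> (%n. LBINT x. \<psi> x \<bullet> a (r n) x) ----> (LBINT x. \<psi> x \<bullet> a0 x)"
  by (rule weak_limit[OF f[of "r n" for n] B(1,3) F0 f0m], rule that, assumption, assumption, assumption, blast)
 obtain b0 where b0: "wgrad g0 b0" and "sqn g0 <= A" "sqn b0 <= A" and wb: "!!\<psi>. sq_int \<psi> ==> (%n. LBINT x. \<psi> x \<bullet> b (r n) x) ----> (LBINT x. \<psi> x \<bullet> b0 x)"
  by (rule weak_limit[OF g[of "r n" for n] B(2,4) G0 g0m], rule that, assumption, assumption, assumption, blast)
 note s = wgrad_sq_int[OF f] wgrad_sq_int[OF g] and s0 = wgrad_sq_int[OF a0] wgrad_sq_int[OF b0]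
 have lf: "l2_lim (%n. f (r n)) f0" by (rule tight_convergence[OF f B(1,3) xf B(5) F0 s0(1)])
 have lg: "l2_lim (%n. g (r n)) g0" by (rule tight_convergence[OF g B(2,4) xg B(6) G0 s0(3)])
 have "(%n. sqn (f (r n)) + sqn (g (r n))) ----> sqn f0 + sqn g0"
  by (intro tendsto_add l2_tendsto_imp_sqn_tendsto s s0 lf lg)
 hence m0: "sqn f0 + sqn g0 = 1" by (simp add: m LIMSEQ_const_iff)
 have q: "(%n. quart (f (r n)) (g (r n))) ----> quart f0 g0" by (rule quart_tendsto[OF f g a0 b0 B(1,3,2,4) lf lg])
 have "(%n. defect (f (r n)) (a (r n)) (g (r n)) (b (r n)) + a_star / 2 * quart (f (r n)) (g (r n))) ----> 0 + a_star / 2 * quart f0 g0"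
  by (intro tendsto_intros q LIMSEQ_subseq_LIMSEQ[OF D0 r, unfolded comp_def])
 hence gr: "(%n. sqn (a (r n)) + sqn (b (r n))) ----> a_star / 2 * quart f0 g0" by (simp add: defect_def)
 have i0: "(LBINT x. h x \<bullet> h x) = sqn h" for h :: "real^2 => real^2" by (simp add: sqn_def power2_norm_eq_inner)
 \<comment> \<open>By weak convergence the squared distance of the gradients tends to the gap
   between the limit of their norms and the norm of their limit. The gap is nonnegative as a limit
   and nonpositive by the optimal inequality.\<close>
 have eq: "sqn (%x. a (r n) x - a0 x) + sqn (%x. b (r n) x - b0 x) = (sqn (a (r n)) + sqn (b (r n))) - 2 * (LBINT x. a0 x \<bullet> a (r n) x) + sqn a0 - 2 * (LBINT x. b0 x \<bullet> b (r n) x) + sqn b0" for n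
  unfolding sqn_diff[OF s(2) s0(2)] sqn_diff[OF s(4) s0(4)] by (simp add: inner_commute)
 have "(%n. sqn (%x. a (r n) x - a0 x) + sqn (%x. b (r n) x - b0 x))
   ----> a_star / 2 * quart f0 g0 - 2 * (LBINT x. a0 x \<bullet> a0 x) + sqn a0 - 2 * (LBINT x. b0 x \<bullet> b0 x) + sqn b0" unfolding eq
  by (intro tendsto_intros gr wa wb s0)
 hence L0: "(%n. sqn (%x. a (r n) x - a0 x) + sqn (%x. b (r n) x - b0 x)) ----> a_star / 2 * quart f0 g0 - (sqn a0 + sqn b0)"
  by (simp add: i0 algebra_simps)
 have nn: "0 <= a_star / 2 * quart f0 g0 - (sqn a0 + sqn b0)"
  by (rule LIMSEQ_le_const[OF L0]) auto
 moreover have "a_star / 2 * quart f0 g0 <= sqn a0 + sqn b0" using gn_pair[OF a0 b0] m0 by (simp add: quart_def sqn_def)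
 ultimately have "a_star / 2 * quart f0 g0 - (sqn a0 + sqn b0) = 0" by linarith
 hence L1: "(%n. sqn (%x. a (r n) x - a0 x) + sqn (%x. b (r n) x - b0 x)) ----> 0" using L0 by (simp only:)
 have "(%n. sqn (%x. a (r n) x - a0 x)) ----> 0" "(%n. sqn (%x. b (r n) x - b0 x)) ----> 0"
  by (rule null_bound[OF L1], simp)+
 hence la: "l2_lim (%n. a (r n)) a0" and lb: "l2_lim (%n. b (r n)) b0"
  by (simp_all add: l2_tendsto_0_iff)
 show thesis by (rule that[OF r a0 b0 m0 _ lf la lg lb]) (use nn in simp)
qed

end

lemma frequently_subseq:
 assumes "!!k. \<exists>\<^sub>F n in sequentially. P k n"
 obtains r :: "nat => nat" where "strict_mono r" "!!k. P k (r k)"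
proof -
 have "EX f. ALL n. P n (f n) & f n < f (Suc n)"
 proof (rule dependent_nat_choice)
  show "EX x. P 0 x" using assms[of 0] by (auto simp: frequently_sequentially)
  show "EX y. P (Suc n) y & x < y" for x n
   using assms[of "Suc n"] unfolding frequently_sequentially by (meson Suc_le_lessD)
 qed
 thus thesis using that by (metis strict_mono_Suc_iff)
qed

lemma l2_cong_AE:
 assumes "AE x in lborel. f x = g x" "f \<in> BM" "g \<in> BM"
 shows "l2 f = l2 g"
proof -
 have "AE x in lborel. norm (f x) = norm (g x)" using assms(1) by eventually_elim simp
 thus ?thesis unfolding l2_def using sqn_cong_AE assms(2,3) by metis
qed

context gn
begin

text \<open>The optimal inequality is spent on f and on g separately, with masses
  \<open>1 - sqn g\<close> and \<open>sqn g\<close>. What remains is, to leading order for small g,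
  the form of the linearized operator at f.\<close>

lemma defect_ge:
 assumes st: "state f a g b"
 shows "sqn g * sqn a + (1 - sqn g) * sqn b - a_star * (LBINT x. (f x)^2 * (g x)^2) <= defect f a g b"
proof -
 have f: "wgrad f a" and g: "wgrad g b" and m: "sqn f = 1 - sqn g" using st by (auto simp: state_def)
 note q = quartic_integrable[OF f] quartic_integrable[OF g]
 have "a_star / 2 * sqn (sq f) <= sqn a * (1 - sqn g)" using q(2) m by simp
 moreover have "quart f g = sqn (sq f) + 2 * (LBINT x. (f x)^2 * (g x)^2) + sqn (sq g)"
  unfolding quart_def using sqn_add[OF q(1,3)] by simp
 ultimately show ?thesis using q(4) by (simp add: defect_def algebra_simps)
qed

end

context gn_Q
begin

text \<open>Otherwise the normalized imaginary parts converge to a null vector of \<open>L\<^sub>-\<close> orthogonal to the ground state \<open>q\<close>.\<close>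

lemma coercive:
 assumes q: "optimizer q k" and qn: "!!x. 0 <= q x" and st: "!!n::nat. state (f n) (a n) (g n) (b n)"
  and o: "!!n. (LBINT x. g n x * q x) = 0"
  and lf: "l2_lim f q" and la: "l2_lim a k"
  and lg: "(%n. l2 (g n)) ----> 0"
 shows "EX \<delta>>0. \<forall>\<^sub>F n in sequentially. \<delta> * (sqn (g n) + sqn (b n)) <= defect (f n) (a n) (g n) (b n)"
proof (rule ccontr)
 assume neg: "\<not> ?thesis"
 define D where "D n = defect (f n) (a n) (g n) (b n)" for n
 define N where "N n = sqn (g n) + sqn (b n)" for n
 have fr: "\<exists>\<^sub>F n in sequentially. D n < 1 / (real j + 1) * N n" for j
 proof -
  have "1 / (real j + 1) > 0" by simp
  hence "\<not> (\<forall>\<^sub>F n in sequentially. 1 / (real j + 1) * N n <= D n)" using neg unfolding D_def N_def by blast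
  thus ?thesis by (simp add: frequently_def not_less)
 qed
 obtain r1 :: "nat => nat" where r1: "strict_mono r1" and DN: "!!j. D (r1 j) < 1 / (real j + 1) * N (r1 j)"
  by (rule frequently_subseq[of "%j n. D n < 1 / (real j + 1) * N n", OF fr], rule that, assumption+)
 note w = optimizerD(1)[OF q]
 have f: "wgrad (f n) (a n)" and g: "wgrad (g n) (b n)" and m: "sqn (f n) = 1 - sqn (g n)" for n using st[of n] by (auto simp: state_def)
 have Np: "N (r1 j) > 0" for j
 proof -
  have "0 < 1 / (real j + 1) * N (r1 j)" using DN[of j] defect_nonneg[OF st[of "r1 j"]] by (simp add: D_def)
  thus ?thesis by (simp add: zero_less_divide_iff)
 qed
 define \<nu> where "\<nu> j = 1 / sqrt (N (r1 j))" for j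
 have nu: "(\<nu> j)^2 = 1 / N (r1 j)" for j using Np[of j] by (simp add: \<nu>_def power_divide)
 define h where "h j x = \<nu> j * g (r1 j) x" for j x
 define c where "c j x = \<nu> j *R b (r1 j) x" for j x
 have h: "wgrad (h j) (c j)" for j unfolding h_def c_def by (rule wgrad_cmult[OF g])
 have hs: "sqn (h j) = sqn (g (r1 j)) / N (r1 j)" "sqn (c j) = sqn (b (r1 j)) / N (r1 j)" for j
  unfolding h_def c_def sqn_cmult sqn_scaleR nu by simp_all
 have hc: "sqn (h j) + sqn (c j) = 1" for j unfolding hs using Np[of j] by (simp add: N_def add_divide_distrib[symmetric])
 have hB: "sqn (h j) <= 1" "sqn (c j) <= 1" for j using hc[of j] sqn_nonneg[of "h j"] sqn_nonneg[of "c j"] by linarith+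
 \<comment> \<open>This is \<open>defect_ge\<close> divided by N: the assumed failure of coercivity
   makes the right-hand side tend to 0.\<close>
 have key: "sqn (h j) * sqn (a (r1 j)) + (1 - sqn (g (r1 j))) * sqn (c j) - a_star * (LBINT x. (f (r1 j) x)^2 * (h j x)^2) <= 1 / (real j + 1)" for j
 proof -
  have "(LBINT x. (f (r1 j) x)^2 * (h j x)^2) = (LBINT x. (1 / N (r1 j)) * ((f (r1 j) x)^2 * (g (r1 j) x)^2))"
   unfolding h_def power_mult_distrib nu by (simp add: ac_simps)
  also have "\<dots> = (LBINT x. (f (r1 j) x)^2 * (g (r1 j) x)^2) / N (r1 j)" by simp
  finally have "sqn (h j) * sqn (a (r1 j)) + (1 - sqn (g (r1 j))) * sqn (c j) - a_star * (LBINT x. (f (r1 j) x)^2 * (h j x)^2)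
    = (sqn (g (r1 j)) * sqn (a (r1 j)) + (1 - sqn (g (r1 j))) * sqn (b (r1 j)) - a_star * (LBINT x. (f (r1 j) x)^2 * (g (r1 j) x)^2)) / N (r1 j)"
   unfolding hs by (simp add: diff_divide_distrib add_divide_distrib)
  also have "\<dots> <= D (r1 j) / N (r1 j)" unfolding D_def using Np[of j] by (intro divide_right_mono defect_ge st) simp
  also have "\<dots> <= 1 / (real j + 1)" using DN[of j] Np[of j] by (simp add: pos_divide_le_eq)
  finally show ?thesis .
 qed
 have L: "l2 (h j) <= 1" "l2 (c j) <= 1" for j using hB[of j] by (simp_all add: l2_def)
 obtain r2 :: "nat => nat" and h0 where r2: "strict_mono r2" and h0m: "h0 \<in> BM" and H0: "AE x in lborel. (%n. h (r2 n) x) ----> h0 x"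
  by (rule rellich_AE[OF h L])
 obtain c0 where h0: "wgrad h0 c0" and wc: "!!\<psi>. sq_int \<psi> ==> (%n. LBINT x. \<psi> x \<bullet> c (r2 n) x) ----> (LBINT x. \<psi> x \<bullet> c0 x)"
  by (rule weak_limit[OF h[of "r2 n" for n] hB H0 h0m], rule that, assumption, blast)
 have r: "strict_mono (%n. r1 (r2 n))" using r1 r2 by (simp add: strict_mono_def)
 note sub = LIMSEQ_subseq_LIMSEQ[OF _ r, unfolded comp_def]
 note qq = quartic_integrable(1)[OF w] and hq = quartic_integrable(1)[OF h] and fq = quartic_integrable(1)[OF f]
 have aL: "(%n. sqn (a (r1 (r2 n)))) ----> sqn k"
  by (rule sub[OF l2_tendsto_imp_sqn_tendsto[OF wgrad_sq_int(2)[OF f] wgrad_sq_int(2)[OF w] la]])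
 have gL: "(%n. sqn (g (r1 (r2 n)))) ----> 0" using sub[OF lg] by (simp add: l2_tendsto_0_iff)
 have f2: "l2_lim (%n x. (f n x)^2) (sq q)"
 proof -
  have "Bseq (%n. sqn (a n))"
   by (rule convergent_imp_Bseq) (use l2_tendsto_imp_sqn_tendsto[OF wgrad_sq_int(2)[OF f] wgrad_sq_int(2)[OF w] la] convergent_def in blast)
  then obtain K where K: "!!n. sqn (a n) <= K" unfolding Bseq_def by auto
  show ?thesis
   by (rule square_l2_tendsto[OF f w _ _ lf, of "max 1 K"])
     (use K m in \<open>auto simp: le_max_iff_disj\<close>)
 qed
 have cross: "(%n. LBINT x. (f (r1 (r2 n)) x)^2 * (h (r2 n) x)^2) ----> (LBINT x. (q x)^2 * (h0 x)^2)"
 proof -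
  have "(%n. LBINT x. ((f (r1 (r2 n)) x)^2 - (q x)^2) * (h (r2 n) x)^2) ----> 0"
  proof (rule null_bound)
   show "(%n. l2 (%x. (f (r1 (r2 n)) x)^2 - (q x)^2) * sqrt (2 / a_star * 1^2)) ----> 0" by (intro tendsto_mult_left_zero sub[OF f2])
   fix n
   have "\<bar>LBINT x. ((f (r1 (r2 n)) x)^2 - (q x)^2) * (h (r2 n) x)^2\<bar> <= l2 (%x. (f (r1 (r2 n)) x)^2 - (q x)^2) * l2 (sq (h (r2 n)))"
    using inner_cauchy_schwarz[OF sq_int_diff[OF fq qq] hq] by simp
   also have "\<dots> <= l2 (%x. (f (r1 (r2 n)) x)^2 - (q x)^2) * sqrt (2 / a_star * 1^2)"
    unfolding l2_def[of "%x. (h (r2 n) x)^2"] using quartic_bound[OF h hB] by (intro mult_left_mono) auto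
   finally show "\<bar>LBINT x. ((f (r1 (r2 n)) x)^2 - (q x)^2) * (h (r2 n) x)^2\<bar> <= l2 (%x. (f (r1 (r2 n)) x)^2 - (q x)^2) * sqrt (2 / a_star * 1^2)" .
  qed
  from tendsto_add[OF this limit_quadratic[OF h hB H0 h0m qq]] show ?thesis
   using integrable_mult_sq_int[OF fq hq] integrable_mult_sq_int[OF qq hq] by (simp add: left_diff_distrib)
 qed
 \<comment> \<open>An upper bound for the positive part of the form at the normalized pair. Its
   limit is the potential term at h0, so the form at h0 is nonpositive by lower
   semicontinuity.\<close>
 define U where "U n = a_star * (LBINT x. (f (r1 (r2 n)) x)^2 * (h (r2 n) x)^2) + 1 / (real (r2 n) + 1) + \<bar>sqn k - sqn (a (r1 (r2 n)))\<bar> + sqn (g (r1 (r2 n)))" for n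
 have "(%n. 1 / (real n + 1)) ----> 0" using LIMSEQ_inverse_real_of_nat by (simp add: inverse_eq_divide add.commute)
 from LIMSEQ_subseq_LIMSEQ[OF this r2] have r0: "(%n. 1 / (real (r2 n) + 1)) ----> 0" by (simp add: comp_def)
 have "U ----> a_star * (LBINT x. (q x)^2 * (h0 x)^2) + 0 + \<bar>sqn k - sqn k\<bar> + 0"
  unfolding U_def by (intro tendsto_intros cross r0 aL gL)
 hence U: "U ----> a_star * (LBINT x. (q x)^2 * (h0 x)^2)" by simp
 have T: "sqn k * sqn (h (r2 n)) + sqn (c (r2 n)) <= U n" for n
 proof -
  have "(sqn k - sqn (a (r1 (r2 n)))) * sqn (h (r2 n)) <= \<bar>sqn k - sqn (a (r1 (r2 n)))\<bar> * 1"
   by (intro mult_mono hB) auto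
  moreover have "sqn (g (r1 (r2 n))) * sqn (c (r2 n)) <= sqn (g (r1 (r2 n))) * 1" by (intro mult_left_mono hB) simp
  ultimately show ?thesis using key[of "r2 n"] by (simp add: U_def algebra_simps)
 qed
 note sh = wgrad_sq_int[OF h] and s0 = wgrad_sq_int[OF h0]
 have lin: "(%n. LBINT x. h0 x * h (r2 n) x) ----> (LBINT x. h0 x * h0 x)" by (rule limit_linear[OF h hB(1) H0 h0m s0(1)])
 have l1: "(%n. U n - 2 * (sqn k * (LBINT x. h0 x * h (r2 n) x) + (LBINT x. c0 x \<bullet> c (r2 n) x)) + (sqn k * sqn h0 + sqn c0))
  ----> a_star * (LBINT x. (q x)^2 * (h0 x)^2) - 2 * (sqn k * (LBINT x. h0 x * h0 x) + (LBINT x. c0 x \<bullet> c0 x)) + (sqn k * sqn h0 + sqn c0)"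
  by (intro tendsto_intros U lin wc s0)
 have p1: "0 <= U n - 2 * (sqn k * (LBINT x. h0 x * h (r2 n) x) + (LBINT x. c0 x \<bullet> c (r2 n) x)) + (sqn k * sqn h0 + sqn c0)" for n
 proof -
  have "0 <= sqn k * sqn (%x. h (r2 n) x - h0 x) + sqn (%x. c (r2 n) x - c0 x)" by simp
  also have "\<dots> = (sqn k * sqn (h (r2 n)) + sqn (c (r2 n))) - 2 * (sqn k * (LBINT x. h0 x * h (r2 n) x) + (LBINT x. c0 x \<bullet> c (r2 n) x)) + (sqn k * sqn h0 + sqn c0)"
   unfolding sqn_diff[OF sh(1) s0(1)] sqn_diff[OF sh(2) s0(2)] by (simp add: inner_commute mult.commute algebra_simps)
  finally show ?thesis using T[of n] by linarith
 qed
 have "0 <= a_star * (LBINT x. (q x)^2 * (h0 x)^2) - 2 * (sqn k * (LBINT x. h0 x * h0 x) + (LBINT x. c0 x \<bullet> c0 x)) + (sqn k * sqn h0 + sqn c0)"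
  by (rule LIMSEQ_le_const[OF l1]) (use p1 in blast)
 moreover have "(LBINT x. h0 x * h0 x) = sqn h0" "(LBINT x. c0 x \<bullet> c0 x) = sqn c0"
  by (simp add: sqn_def power2_eq_square, simp add: sqn_def power2_norm_eq_inner)
 ultimately have "lform q k h0 c0 h0 c0 <= 0" unfolding lform_diag by (simp add: mult.commute algebra_simps)
 hence z: "lform q k h0 c0 h0 c0 = 0" using lform_nonneg[OF q h0] by simp
 have "(%n. LBINT x. q x * h (r2 n) x) ----> (LBINT x. q x * h0 x)" by (rule limit_linear[OF h hB(1) H0 h0m wgrad_sq_int(1)[OF w]])
 moreover have "(LBINT x. q x * h j x) = 0" for j
 proof -
  have "(LBINT x. q x * h j x) = (LBINT x. \<nu> j * (g (r1 j) x * q x))" by (simp add: h_def ac_simps)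
  thus ?thesis using o by simp
 qed
 ultimately have o0: "(LBINT x. h0 x * q x) = 0" by (simp add: LIMSEQ_const_iff mult.commute)
 have qae: "AE x in lborel. 0 <= q x" using qn by simp
 have "AE x in lborel. h0 x = 0" using null_simple[OF q qae h0 z] o0 by simp
 hence "AE x in lborel. (q x)^2 * (h0 x)^2 = 0" by eventually_elim simp
 hence "(LBINT x. (q x)^2 * (h0 x)^2) = 0" by (rule integral_eq_zero_AE)
 hence U0: "U ----> 0" using U by simp
 \<comment> \<open>Since h0 = 0, the potential term and with it U tends to 0, whereas the pair has
   unit H1 norm; this is the contradiction.\<close>
 have "min (sqn k) 1 <= U n" for n
 proof -
  have "min (sqn k) 1 * sqn (h (r2 n)) <= sqn k * sqn (h (r2 n))" "min (sqn k) 1 * sqn (c (r2 n)) <= 1 * sqn (c (r2 n))"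
   by (intro mult_right_mono; simp)+
  moreover have "min (sqn k) 1 * sqn (h (r2 n)) + min (sqn k) 1 * sqn (c (r2 n)) = min (sqn k) 1"
   unfolding distrib_left[symmetric] hc by simp
  ultimately show ?thesis using T[of n] by linarith
 qed
 hence "min (sqn k) 1 <= 0" using U0 by (intro LIMSEQ_le_const) auto
 thus False using optimizer_grad_pos[OF q] by simp
qed

section \<open>Convergence to a profile of unknown scale and centre\<close>

definition profile :: "real => real^2 => real^2 => real" where
 "profile s z x = s * q0 (- (s *R z) + s *R x)"

definition gprofile :: "real => real^2 => real^2 => real^2" where
 "gprofile s z x = (s * s) *R k0 (- (s *R z) + s *R x)"

lemma profile:
 assumes s: "s > 0"
 shows "optimizer (profile s z) (gprofile s z)" (is ?A) "sqn (gprofile s z) = s^2" "0 <= profile s z x"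
  "AE x in lborel. rot90 (x - z) \<bullet> gprofile s z x = 0" (is ?B)
  "sq_int (%x. norm x * profile s z x)" (is ?C) "sqn (%x. norm x * profile s z x) = M / s^2 + (norm z)^2" (is ?D)
proof -
 show ?A "sqn (gprofile s z) = s^2"
  using optimizer_rescale[OF k0(1) s, of "- (s *R z)"] k0(2) by (simp_all add: profile_def[abs_def] gprofile_def[abs_def])
 show "0 <= profile s z x" using s q0_pos by (simp add: profile_def less_imp_le)
 have "profile s z x = s * q0 (s *R (x - z))" for x by (simp add: profile_def algebra_simps)
 from q0_scaled_moment[OF s this] show ?C ?D .
 have "AE x in lborel. rot90 (- (s *R z) + s *R x) \<bullet> k0 (- (s *R z) + s *R x) = 0"
  by (rule AE_lborel_affine[OF _ k0_tangential]) (use s in simp)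
 thus ?B
 proof eventually_elim
  case (elim x)
  have "- (s *R z) + s *R x = s *R (x - z)" by (simp add: algebra_simps)
  thus ?case using elim s by (simp add: gprofile_def rot90_linear)
 qed
qed

text \<open>What the choice of phases achieves. Orthogonality is demanded at every index, as
  \<open>coercive\<close> requires, and not only in the limit; s and z remain undetermined because
  the defect sees neither translations nor, up to a factor, dilations.\<close>

definition tame :: "(nat => real^2 => real) => (nat => real^2 => real^2) => (nat => real^2 => real) => (nat => real^2 => real^2) => real => real^2 => bool" where
 "tame f a g b s z \<longleftrightarrow> s > 0 & (ALL n. state (f n) (a n) (g n) (b n)) & (ALL n. (LBINT x. g n x * profile s z x) = 0) \<and>
  l2_lim f (profile s z) & l2_lim a (gprofile s z) \<and>
  (%n. l2 (g n)) ----> 0 & (%n. l2 (b n)) ----> 0"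

text \<open>By \<open>complex_optimizer\<close> the strong limit has a constant phase (c1, c2). The
  phase at index n is read off from the projections of f and g onto the limit profile; this makes
  the imaginary part exactly orthogonal, and it converges to the limiting phase.\<close>

lemma compactness:
 assumes st: "!!n::nat. state (f n) (a n) (g n) (b n)" and D0: "(%n. defect (f n) (a n) (g n) (b n)) ----> 0"
  and K: "!!n. defect (f n) (a n) (g n) (b n) <= K" "!!n. mom (f n) (g n) <= K" "!!n. quart (f n) (g n) <= K"
 obtains r :: "nat => nat" and c d s z where "strict_mono r" "!!n. (c n)^2 + (d n)^2 = 1"
  "tame (%n x. c n * f (r n) x + d n * g (r n) x) (%n x. c n *R a (r n) x + d n *R b (r n) x)
    (%n x. c n * g (r n) x - d n * f (r n) x) (%n x. c n *R b (r n) x - d n *R a (r n) x) s z"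
proof -
 obtain r :: "nat => nat" and f0 a0 g0 b0 where r: "strict_mono r" and f0: "wgrad f0 a0" and g0: "wgrad g0 b0" and m0: "sqn f0 + sqn g0 = 1"
  and o: "sqn a0 + sqn b0 <= a_star / 2 * quart f0 g0"
  and L: "l2_lim (%n. f (r n)) f0" "l2_lim (%n. a (r n)) a0"
  "l2_lim (%n. g (r n)) g0" "l2_lim (%n. b (r n)) b0"
  by (rule strong_limit[OF st D0 K])
 have o': "sqn a0 + sqn b0 <= a_star / 2 * (LBINT x. ((f0 x)^2 + (g0 x)^2)^2)" using o by (simp add: quart_def sqn_def)
 obtain \<rho> t c1 c2 where R: "optimizer \<rho> t" "!!x. 0 <= \<rho> x" "AE x in lborel. f0 x = c1 * \<rho> x" "AE x in lborel. g0 x = c2 * \<rho> x" "c1^2 + c2^2 = (1::real)"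
  by (rule complex_optimizer[OF f0 g0 m0 o'], rule that, assumption+)
 obtain y where y: "AE x in lborel. \<rho> x = sqrt (sqn t) * q0 (sqrt (sqn t) *R x - y)" by (rule optimizer_shape[OF R(1,2)])
 define s where "s = sqrt (sqn t)"
 have s: "s > 0" using optimizer_grad_pos[OF R(1)] by (simp add: s_def)
 define z where "z = (1 / s) *R y"
 define p where "p = profile s z"
 define k where "k = gprofile s z"
 have p: "optimizer p k" unfolding p_def k_def by (rule profile(1)[OF s])
 have yp: "s * q0 (s *R x - y) = p x" for x using s by (simp add: p_def profile_def z_def)
 have rp: "AE x in lborel. \<rho> x = p x" using y by (simp only: s_def[symmetric] yp)
 have w: "wgrad p k" by (rule optimizerD(1)[OF p])
 note sp = wgrad_sq_int[OF w]
 have F0: "AE x in lborel. f0 x = c1 *R p x" using R(3) rp by eventually_elim simp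
 have G0: "AE x in lborel. g0 x = c2 *R p x" using R(4) rp by eventually_elim simp
 have grd: "AE x in lborel. a' x = e *R k x" if f': "wgrad f' a'" and ae: "AE x in lborel. f' x = e *R p x" for f' a' e
 proof -
  have ce: "wgrad (%x. e * p x) (%x. e *R k x)" by (rule wgrad_cmult[OF w])
  have "wgrad (%x. e * p x) a'"
   by (rule wgrad_cong_AE[OF f']) (use ae sq_int_measurable[OF wgrad_sq_int(1)[OF ce]] sq_int_measurable[OF wgrad_sq_int(2)[OF f']] in auto)
  from wgrad_unique[OF this ce] show ?thesis .
 qed
 have cg: "l2_lim u (%x. e *R v x)"
  if "l2_lim u u0" "AE x in lborel. u0 x = e *R v x" "!!n. sq_int (u n)" "sq_int u0" "sq_int v"
  for u :: "nat => real^2 => 'z::euclidean_space" and u0 v and e :: real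
 proof -
  have "l2 (%x. u n x - u0 x) = l2 (%x. u n x - e *R v x)" for n
  proof (rule l2_cong_AE)
   show "AE x in lborel. u n x - u0 x = u n x - e *R v x" using that(2) by eventually_elim simp
  qed (intro sq_int_measurable sq_int_diff sq_int_scaleR that)+
  thus ?thesis using that(1) by simp
 qed
 have f: "wgrad (f n) (a n)" and g: "wgrad (g n) (b n)" for n using st[of n] by (auto simp: state_def)
 note sf = wgrad_sq_int[OF f] and sg = wgrad_sq_int[OF g]
 have LF: "l2_lim (%n. f (r n)) (%x. c1 *R p x)" by (rule cg[OF L(1) F0 sf(1) wgrad_sq_int(1)[OF f0] sp(1)])
 have LA: "l2_lim (%n. a (r n)) (%x. c1 *R k x)" by (rule cg[OF L(2) grd[OF f0 F0] sf(2) wgrad_sq_int(2)[OF f0] sp(2)])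
 have LG: "l2_lim (%n. g (r n)) (%x. c2 *R p x)" by (rule cg[OF L(3) G0 sg(1) wgrad_sq_int(1)[OF g0] sp(1)])
 have LB: "l2_lim (%n. b (r n)) (%x. c2 *R k x)" by (rule cg[OF L(4) grd[OF g0 G0] sg(2) wgrad_sq_int(2)[OF g0] sp(2)])
 define X where "X n = (LBINT x. f (r n) x * p x)" for n
 define Y where "Y n = (LBINT x. g (r n) x * p x)" for n
 have pp: "(LBINT x. (e *R p x) * p x) = e" for e
  using optimizerD(2)[OF p] by (simp add: sqn_def mult.assoc power2_eq_square[symmetric])
 have cp: "l2_lim (%n. p) p" by simp
 have XL: "X ----> c1" using inner_tendsto[OF sf(1) sq_int_scaleR[OF sp(1)] sp(1) sp(1) LF cp] pp[of c1] by (simp add: X_def[abs_def])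
 have YL: "Y ----> c2" using inner_tendsto[OF sg(1) sq_int_scaleR[OF sp(1)] sp(1) sp(1) LG cp] pp[of c2] by (simp add: Y_def[abs_def])
 define m where "m n = sqrt ((X n)^2 + (Y n)^2)" for n
 have mL: "m ----> 1"
 proof -
  have "m ----> sqrt (c1^2 + c2^2)" unfolding m_def by (intro tendsto_intros XL YL)
  thus ?thesis using R(5) by simp
 qed
 \<comment> \<open>If both projections vanish every phase is orthogonal, and the phase 1 serves as
   default; this happens for finitely many n only.\<close>
 define c where "c n = (if m n = 0 then 1 else X n / m n)" for n
 define d where "d n = (if m n = 0 then 0 else Y n / m n)" for n
 have m0': "\<forall>\<^sub>F n in sequentially. m n ~= 0" using tendsto_imp_eventually_ne[OF mL] by simp
 have cL: "c ----> c1"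
 proof (rule Lim_transform_eventually)
  show "(%n. X n / m n) ----> c1" using tendsto_divide[OF XL mL] by simp
  show "\<forall>\<^sub>F n in sequentially. X n / m n = c n" using m0' by eventually_elim (simp add: c_def)
 qed
 have dL: "d ----> c2"
 proof (rule Lim_transform_eventually)
  show "(%n. Y n / m n) ----> c2" using tendsto_divide[OF YL mL] by simp
  show "\<forall>\<^sub>F n in sequentially. Y n / m n = d n" using m0' by eventually_elim (simp add: d_def)
 qed
 have cd: "(c n)^2 + (d n)^2 = 1" for n
 proof (cases "m n = 0")
  case False
  hence "(c n)^2 + (d n)^2 = ((X n)^2 + (Y n)^2) / (m n)^2" by (simp add: c_def d_def power_divide add_divide_distrib)
  moreover have "(X n)^2 + (Y n)^2 = (m n)^2" by (simp add: m_def)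
  ultimately show ?thesis using False by (simp only:) simp
 qed (simp add: c_def d_def)
 have orth: "(LBINT x. (c n * g (r n) x - d n * f (r n) x) * p x) = 0" for n
 proof -
  have "(LBINT x. (c n * g (r n) x - d n * f (r n) x) * p x) = c n * Y n - d n * X n"
   using integrable_mult_sq_int[OF sg(1) sp(1)] integrable_mult_sq_int[OF sf(1) sp(1)]
   by (simp add: X_def Y_def left_diff_distrib mult.assoc)
  also have "\<dots> = 0" by (auto simp: c_def d_def m_def add_nonneg_eq_0_iff)
  finally show ?thesis .
 qed
 have dL': "(%n. - d n) ----> - c2" by (intro tendsto_intros dL)
 have one: "c1 * c1 + c2 * c2 = 1" using R(5) by (simp add: power2_eq_square)
 have T1: "(%n. l2 (%x. c n * f (r n) x + d n * g (r n) x - p x)) ----> 0"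
  using l2_tendsto_combination[OF sf(1) sg(1) sp(1) LF LG cL dL] one by simp
 have T2: "(%n. l2 (%x. c n *R a (r n) x + d n *R b (r n) x - k x)) ----> 0"
  using l2_tendsto_combination[OF sf(2) sg(2) sp(2) LA LB cL dL] one by simp
 have T3: "(%n. l2 (%x. c n * g (r n) x - d n * f (r n) x)) ----> 0"
  using l2_tendsto_combination[OF sf(1) sg(1) sp(1) LF LG dL' cL] by (simp add: mult.commute)
 have T4: "(%n. l2 (%x. c n *R b (r n) x - d n *R a (r n) x)) ----> 0"
  using l2_tendsto_combination[OF sf(2) sg(2) sp(2) LA LB dL' cL] by (simp add: mult.commute)
 have "tame (%n x. c n * f (r n) x + d n * g (r n) x) (%n x. c n *R a (r n) x + d n *R b (r n) x)
    (%n x. c n * g (r n) x - d n * f (r n) x) (%n x. c n *R b (r n) x - d n *R a (r n) x) s z"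
  unfolding tame_def p_def[symmetric] k_def[symmetric]
  by (intro conjI allI s rotate_state(1)[OF st cd] orth T1 T2 T3 T4)
 from that[OF r cd this] show thesis .
qed

end

section \<open>The rotation term\<close>

definition cutrot :: "(real^2 => real) => real^2 => real^2 => real^2" where
 "cutrot \<phi> z x = \<phi> x *R rot90 (x - z)"

lemma rot90_nth: "rot90 x $ 1 = - x $ 2" "rot90 x $ 2 = x $ 1"
 by (simp_all add: rot90_def)

lemma cutrot_test:
 assumes p: "\<phi> \<in> test_functions"
 shows "(%x. cutrot \<phi> z x $ i) \<in> test_functions"
proof -
 have a: "C_k k (%x. c * (- z + 1 *R x) $ j)" for k c j
  by (rule C_k_affine[of k "%y. c * y $ j" "- z" 1]) (intro C_k_mult C_k_const C_k_coord)
 have "(%x. \<phi> x * (- 1 * (- z + 1 *R x) $ 2)) \<in> test_functions" "(%x. \<phi> x * (1 * (- z + 1 *R x) $ 1)) \<in> test_functions"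
  by (intro test_mult[OF p] a)+
 thus ?thesis using exhaust_2[of i] by (auto simp: cutrot_def rot90_nth algebra_simps)
qed

text \<open>A cutoff that is radial about z has its gradient along x - z, orthogonal to
  \<open>rot90 (x - z)\<close>, and the rotation field itself has no divergence.\<close>

lemma cutrot_divergence:
 assumes p: "\<phi> \<in> test_functions" and r: "EX s. grad \<phi> x = s *R (x - z)"
 shows "partial 1 (%x. cutrot \<phi> z x $ 1) x + partial 2 (%x. cutrot \<phi> z x $ 2) x = 0"
proof -
 have c: "has_grad (%x. s * (x $ j - z $ j)) (%x. s *R axis j 1)" for s j
  using has_grad_mult[OF has_grad_const[of s] has_grad_add[OF has_grad_coord[of j] has_grad_const[of "- z $ j"]]] by simp
 note g = has_grad_mult[OF test_has_grad[OF p] c]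
 have 1: "(%x. cutrot \<phi> z x $ 1) = (%x. \<phi> x * ((- 1) * (x $ 2 - z $ 2)))" "(%x. cutrot \<phi> z x $ 2) = (%x. \<phi> x * (1 * (x $ 1 - z $ 1)))"
  by (auto simp: cutrot_def rot90_nth)
 obtain s where s: "grad \<phi> x = s *R (x - z)" using r by blast
 have pd: "partial 1 \<phi> x = s * (x $ 1 - z $ 1)" "partial 2 \<phi> x = s * (x $ 2 - z $ 2)"
  using arg_cong[OF s, of "%v. v $ 1"] arg_cong[OF s, of "%v. v $ 2"] by simp_all
 show ?thesis unfolding 1 has_grad_partial(1)[OF g] by (simp add: axis_def pd) (simp add: algebra_simps)
qed

text \<open>The rotation field cut off radially about its centre is divergence free.\<close>

lemma cutrot_by_parts:
 assumes p: "\<phi> \<in> test_functions" and r: "!!x. EX s. grad \<phi> x = s *R (x - z)" and f: "wgrad f a" and g: "wgrad g b"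
 shows "integrable lborel (%x. cutrot \<phi> z x \<bullet> (f x *R b x))" (is ?A)
  "(LBINT x. cutrot \<phi> z x \<bullet> (f x *R b x)) = - (LBINT x. cutrot \<phi> z x \<bullet> (g x *R a x))" (is ?B)
proof -
 define \<psi> where "\<psi> i x = cutrot \<phi> z x $ i" for i x
 have t: "\<psi> i \<in> test_functions" for i unfolding \<psi>_def by (rule cutrot_test[OF p])
 have w: "wgrad (%x. \<psi> i x * h x) (%x. \<psi> i x *R d x + h x *R grad (\<psi> i) x)" if "wgrad h d" for i h d
 proof -
  obtain B where "!!x. \<bar>\<psi> i x\<bar> <= B" "!!x. norm (grad (\<psi> i) x) <= B" using test_grad(3)[OF t[of i]] by blast
  thus ?thesis by (rule wgrad_mult_C1[OF that test_has_grad[OF t] test_grad(1)[OF t]])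
 qed
 note sg = wgrad_sq_int[OF g] and swf = wgrad_sq_int[OF w[OF f]] and sa = wgrad_sq_int(2)[OF f] and swg = wgrad_sq_int(1)[OF w[OF g]]
 have I: "integrable lborel (%x. b x $ i * (\<psi> i x * f x))" "integrable lborel (%x. g x * (\<psi> i x *R a x + f x *R grad (\<psi> i) x) $ i)" for i
  by (intro integrable_mult_sq_int sq_int_nth sg swf)+
 have e: "cutrot \<phi> z x \<bullet> (f x *R b x) = b x $ 1 * (\<psi> 1 x * f x) + b x $ 2 * (\<psi> 2 x * f x)" for x
  by (simp add: inner_vec_def sum_2 \<psi>_def ac_simps)
 show ?A unfolding e using I(1) by simp
 have pt: "g x * (\<psi> 1 x *R a x + f x *R grad (\<psi> 1) x) $ 1 + g x * (\<psi> 2 x *R a x + f x *R grad (\<psi> 2) x) $ 2 = cutrot \<phi> z x \<bullet> (g x *R a x)" for x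
 proof -
  have d: "partial 1 (\<psi> 1) x + partial 2 (\<psi> 2) x = 0" unfolding \<psi>_def by (rule cutrot_divergence[OF p r])
  have "g x * (\<psi> 1 x *R a x + f x *R grad (\<psi> 1) x) $ 1 + g x * (\<psi> 2 x *R a x + f x *R grad (\<psi> 2) x) $ 2
   = \<psi> 1 x * (g x * a x $ 1) + \<psi> 2 x * (g x * a x $ 2) + g x * f x * (partial 1 (\<psi> 1) x + partial 2 (\<psi> 2) x)"
   by (simp add: algebra_simps)
  thus ?thesis unfolding d by (simp add: inner_vec_def sum_2 \<psi>_def)
 qed
 have "(LBINT x. cutrot \<phi> z x \<bullet> (f x *R b x)) = (LBINT x. b x $ 1 * (\<psi> 1 x * f x)) + (LBINT x. b x $ 2 * (\<psi> 2 x * f x))"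
  unfolding e using I(1) by simp
 also have "\<dots> = - ((LBINT x. g x * (\<psi> 1 x *R a x + f x *R grad (\<psi> 1) x) $ 1) + (LBINT x. g x * (\<psi> 2 x *R a x + f x *R grad (\<psi> 2) x) $ 2))"
  using wgrad_by_parts[OF g w[OF f], of 1 1] wgrad_by_parts[OF g w[OF f], of 2 2] by simp
 also have "\<dots> = - (LBINT x. g x * (\<psi> 1 x *R a x + f x *R grad (\<psi> 1) x) $ 1 + g x * (\<psi> 2 x *R a x + f x *R grad (\<psi> 2) x) $ 2)"
  by (simp only: Bochner_Integration.integral_add[OF I(2) I(2)])
 also have "\<dots> = - (LBINT x. cutrot \<phi> z x \<bullet> (g x *R a x))" by (simp only: pt)
 finally show ?B .
qed

lemma cutrot_bounded:
 assumes p: "\<phi> \<in> test_functions"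
 obtains B where "B >= 0" "!!x. norm (cutrot \<phi> z x) <= B"
proof -
 obtain B1 where 1: "B1 > 0" "!!x. \<bar>cutrot \<phi> z x $ 1\<bar> <= B1" by (rule test_bounded_const[OF cutrot_test[OF p, of z 1]], rule that, assumption+)
 obtain B2 where 2: "B2 > 0" "!!x. \<bar>cutrot \<phi> z x $ 2\<bar> <= B2" by (rule test_bounded_const[OF cutrot_test[OF p, of z 2]], rule that, assumption+)
 have "norm (cutrot \<phi> z x) <= B1 + B2" for x using norm_le_sum_2[of "cutrot \<phi> z x"] 1(2)[of x] 2(2)[of x] by linarith
 thus thesis using that[of "B1 + B2"] 1(1) 2(1) by simp
qed

text \<open>As the cut field is divergence free, integration by parts turns the pairing with the
  current into -2 times that with g a, linear in the imaginary part. The gradient k of a profile has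
  no angular component about z, so a may be replaced by a - k: the rotation becomes a product of two
  small factors.\<close>

lemma cutrot_current:
 assumes p: "\<phi> \<in> test_functions" and r: "!!x. EX s. grad \<phi> x = s *R (x - z)" and B: "!!x. norm (cutrot \<phi> z x) <= B"
  and f: "wgrad f a" and g: "wgrad g b" and k: "sq_int k" "AE x in lborel. rot90 (x - z) \<bullet> k x = 0"
 shows "integrable lborel (%x. cutrot \<phi> z x \<bullet> (f x *R b x - g x *R a x))" (is ?A)
  "\<bar>LBINT x. cutrot \<phi> z x \<bullet> (f x *R b x - g x *R a x)\<bar> <= 2 * B * (l2 g * l2 (%x. a x - k x))" (is ?B)
proof -
 note 1 = cutrot_by_parts[OF p r f g] and 2 = cutrot_by_parts(1)[OF p r g f]
 note s = wgrad_sq_int[OF f] wgrad_sq_int[OF g]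
 have [measurable]: "\<phi> \<in> BM" "a \<in> BM" "g \<in> BM" "k \<in> BM"
  using test_measurable[OF p] s k(1) by (auto dest: sq_int_measurable)
 have m[measurable]: "cutrot \<phi> z \<in> BM" unfolding cutrot_def[abs_def] by measurable
 show ?A unfolding inner_diff_right using 1(1) 2 by simp
 have "(LBINT x. cutrot \<phi> z x \<bullet> (f x *R b x - g x *R a x)) = - 2 * (LBINT x. cutrot \<phi> z x \<bullet> (g x *R a x))"
  unfolding inner_diff_right using 1 2 by simp
 also have "(LBINT x. cutrot \<phi> z x \<bullet> (g x *R a x)) = (LBINT x. cutrot \<phi> z x \<bullet> (g x *R (a x - k x)))"
 proof (rule integral_cong_AE)
  show "AE x in lborel. cutrot \<phi> z x \<bullet> (g x *R a x) = cutrot \<phi> z x \<bullet> (g x *R (a x - k x))"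
   using k(2) by eventually_elim (simp add: cutrot_def inner_diff_right)
 qed measurable
 finally have eq: "\<bar>LBINT x. cutrot \<phi> z x \<bullet> (f x *R b x - g x *R a x)\<bar> = 2 * \<bar>LBINT x. cutrot \<phi> z x \<bullet> (g x *R (a x - k x))\<bar>"
  by (simp add: abs_mult)
 have d: "sq_int (%x. a x - k x)" by (intro sq_int_diff s k)
 have "\<bar>LBINT x. cutrot \<phi> z x \<bullet> (g x *R (a x - k x))\<bar> <= (LBINT x. B * (norm (g x) * norm (a x - k x)))"
 proof (rule order_trans[OF integral_abs_bound], rule integral_mono')
  show "integrable lborel (%x. B * (norm (g x) * norm (a x - k x)))" using integrable_norm_mult[OF s(3) d] by simp
  fix x
  have "\<bar>cutrot \<phi> z x \<bullet> (g x *R (a x - k x))\<bar> <= norm (cutrot \<phi> z x) * norm (g x *R (a x - k x))" by (rule Cauchy_Schwarz_ineq2)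
  also have "\<dots> <= B * norm (g x *R (a x - k x))" by (intro mult_right_mono B) simp
  finally show "\<bar>cutrot \<phi> z x \<bullet> (g x *R (a x - k x))\<bar> <= B * (norm (g x) * norm (a x - k x))" by simp
  show "0 <= B * (norm (g x) * norm (a x - k x))" using order_trans[OF norm_ge_zero B] by simp
 qed
 also have "\<dots> <= B * (l2 g * l2 (%x. a x - k x))"
  using l2_cauchy_schwarz[OF s(3) d] order_trans[OF norm_ge_zero B] by (simp add: mult_left_mono)
 finally show ?B
  unfolding eq by simp
qed

lemma weighted_square_tendsto:
 fixes p \<eta> :: "real^2 => real"
 assumes f: "!!n::nat. sq_int (f n)" "sq_int p" and l: "l2_lim f p"
  and e: "\<eta> \<in> BM" "!!x. \<bar>\<eta> x\<bar> <= B"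
 shows "(%n. LBINT x. \<eta> x * (f n x)^2) ----> (LBINT x. \<eta> x * (p x)^2)" (is ?A)
  "!!n. integrable lborel (%x. \<eta> x * (f n x)^2)"
proof -
 have B: "B >= 0" using order_trans[OF abs_ge_zero e(2)] .
 have b: "sq_int (%x. \<eta> x * h x)" "l2 (%x. \<eta> x * h x) <= B * l2 h" if "sq_int h" for h :: "real^2 => real"
 proof -
  have m: "(%x. \<eta> x * h x) \<in> BM" using e(1) sq_int_measurable[OF that] by (rule borel_measurable_times)
  have "norm (\<eta> x * h x) <= B * norm (h x)" for x unfolding real_norm_def abs_mult by (intro mult_right_mono e) simp
  from l2_bound[OF that m this B] show "sq_int (%x. \<eta> x * h x)" "l2 (%x. \<eta> x * h x) <= B * l2 h" .
 qed
 have "l2_lim (%n x. \<eta> x * f n x) (%x. \<eta> x * p x)"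
 proof (rule null_bound)
  show "(%n. B * l2 (%x. f n x - p x)) ----> 0" by (intro tendsto_mult_right_zero l)
  show "\<bar>l2 (%x. \<eta> x * f n x - \<eta> x * p x)\<bar> <= B * l2 (%x. f n x - p x)" for n
   using b(2)[OF sq_int_diff[OF f(1)[of n] f(2)]] by (simp add: right_diff_distrib)
 qed
 from inner_tendsto[OF b(1)[OF f(1)] b(1)[OF f(2)] f this l]
 show ?A by (simp add: power2_eq_square mult.assoc)
 show "integrable lborel (%x. \<eta> x * (f n x)^2)" for n
  using integrable_mult_sq_int[OF b(1)[OF f(1)] f(1)] by (simp add: power2_eq_square mult.assoc)
qed

context gn
begin

text \<open>The rotation field splits as \<phi> \<open>rot90 (x - z)\<close> + \<phi>
  \<open>rot90 z\<close> + (1 - \<phi>) \<open>rot90 x\<close>. The first piece is kept. The other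
  two are absorbed by completing the square against the shares \<phi> and 1 - \<phi> of |n|^2, which
  together use up the defect; they cost \<Omega>^2 |z|^2 on the cutoff and at most the trap energy
  off it. Moment that escapes to infinity therefore does no harm.\<close>

lemma energy_cut:
 assumes st: "state f a g b" and O: "0 <= \<Omega>" "\<Omega> < 1" and p: "\<phi> \<in> test_functions" "!!x. 0 <= \<phi> x" "!!x. \<phi> x <= 1"
  and i: "integrable lborel (%x. cutrot \<phi> z x \<bullet> (f x *R b x - g x *R a x))"
 shows "e^4 * (quart f g / 2 + (LBINT x. \<phi> x * (norm x)^2 * ((f x)^2 + (g x)^2)) - \<Omega>^2 * (norm z)^2 * (LBINT x. \<phi> x * ((f x)^2 + (g x)^2)))
   - 2 * \<Omega> * e^2 * (LBINT x. cutrot \<phi> z x \<bullet> (f x *R b x - g x *R a x)) <= energy \<Omega> e f a g b"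
proof -
 have f: "wgrad f a" and g: "wgrad g b" and xf: "sq_int (%x. norm x * f x)" and xg: "sq_int (%x. norm x * g x)"
  using st by (auto simp: state_def)
 note s = wgrad_sq_int[OF f] wgrad_sq_int[OF g]
 have [measurable]: "f \<in> BM" "g \<in> BM" "a \<in> BM" "b \<in> BM" "\<phi> \<in> BM"
  using s test_measurable[OF p(1)] by (auto dest: sq_int_measurable)
 obtain n where n: "sq_int n" "sqn n <= defect f a g b" "!!x. f x *R b x - g x *R a x = sqrt ((f x)^2 + (g x)^2) *R n x"
  by (rule phase_part[OF st], rule that, assumption+)
 define R where "R x = (f x)^2 + (g x)^2" for x
 define j where "j x = f x *R b x - g x *R a x" for x
 have R0: "0 <= R x" for x by (simp add: R_def)
 have jn: "j x = sqrt (R x) *R n x" for x using n(3) by (simp add: j_def R_def)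
 have iR: "integrable lborel R" unfolding R_def[abs_def] using s by (simp add: sq_int_def)
 have xR: "(norm x)^2 * R x = (norm (norm x * f x))^2 + (norm (norm x * g x))^2" for x :: "real^2"
  by (simp add: R_def power_mult_distrib distrib_left)
 have ixR: "integrable lborel (%x. (norm x)^2 * R x)" "(LBINT x. (norm x)^2 * R x) = mom f g"
  unfolding xR mom_def sqn_def using sq_int_integrable[OF xf] sq_int_integrable[OF xg] by simp_all
 have ip: "integrable lborel (%x. \<phi> x * h x)" if h: "integrable lborel h" for h :: "real^2 => real"
 proof (rule Bochner_Integration.integrable_bound[OF h])
  show "(%x. \<phi> x * h x) \<in> borel_measurable lborel" using borel_measurable_integrable[OF h] by simp
  show "AE x in lborel. norm (\<phi> x * h x) <= norm (h x)"
   using p(2,3) by (intro AE_I2) (simp add: abs_mult mult_left_le_one_le)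
 qed
 have ij: "integrable lborel (%x. rot90 x \<bullet> j x)"
 proof (rule Bochner_Integration.integrable_bound)
  show "integrable lborel (%x. (norm x)^2 * R x + (norm (n x))^2)" using ixR(1) sq_int_integrable[OF n(1)] by simp
  show "(%x. rot90 x \<bullet> j x) \<in> borel_measurable lborel" unfolding j_def by measurable
  show "AE x in lborel. norm (rot90 x \<bullet> j x) <= norm ((norm x)^2 * R x + (norm (n x))^2)"
  proof (rule AE_I2)
   fix x
   have "\<bar>rot90 x \<bullet> j x\<bar> <= (norm x * sqrt (R x)) * norm (n x)"
    using Cauchy_Schwarz_ineq2[of "rot90 x" "j x"] R0[of x] by (simp add: jn norm_rot90 mult.assoc)
   also have "\<dots> <= 1 * (norm x * sqrt (R x))^2 + (norm (n x))^2 / 1"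
    using young_tail[of 1 "norm x * sqrt (R x)" "norm (n x)"] by linarith
   finally show "norm (rot90 x \<bullet> j x) <= norm ((norm x)^2 * R x + (norm (n x))^2)"
    using R0[of x] by (simp add: power_mult_distrib)
  qed
 qed
 \<comment> \<open>Completing the square with an arbitrary share t of |n|^2, used for t = \<phi>, y
   = z and for t = 1 - \<phi>, y = x.\<close>
 have Y: "2 * \<Omega> * e^2 * (t * (rot90 y \<bullet> j x)) <= t * ((norm (n x))^2 + \<Omega>^2 * e^4 * ((norm y)^2 * R x))" if t: "0 <= t" for t x y
 proof -
  have "0 <= (norm (n x - (\<Omega> * e^2 * sqrt (R x)) *R rot90 y))^2" by simp
  also have "\<dots> = (norm (n x))^2 - 2 * \<Omega> * e^2 * (rot90 y \<bullet> j x) + \<Omega>^2 * e^4 * ((norm y)^2 * R x)"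
   unfolding norm_diff_sq jn using R0[of x] by (simp add: norm_rot90 power_mult_distrib inner_commute power4_eq_xxxx power2_eq_square[of e])
  finally have "2 * \<Omega> * e^2 * (rot90 y \<bullet> j x) <= (norm (n x))^2 + \<Omega>^2 * e^4 * ((norm y)^2 * R x)" by linarith
  from mult_left_mono[OF this t] show ?thesis by (simp add: ac_simps)
 qed
 have O2: "\<Omega>^2 * e^4 <= e^4"
 proof -
  have "\<Omega>^2 * e^4 <= 1 * e^4" using O by (intro mult_right_mono) (auto simp: power_le_one)
  thus ?thesis by simp
 qed
 have ic: "integrable lborel (%x. cutrot \<phi> z x \<bullet> j x)" using i by (simp add: j_def)
 have iz: "integrable lborel (%x. \<phi> x * R x)" "integrable lborel (%x. \<phi> x * ((norm x)^2 * R x))" by (rule ip[OF iR], rule ip[OF ixR(1)])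
 have "(LBINT x. 2 * \<Omega> * e^2 * (rot90 x \<bullet> j x)) <= (LBINT x. 2 * \<Omega> * e^2 * (cutrot \<phi> z x \<bullet> j x) + (norm (n x))^2
   + \<Omega>^2 * e^4 * (norm z)^2 * (\<phi> x * R x) + e^4 * ((norm x)^2 * R x - \<phi> x * ((norm x)^2 * R x)))"
 proof (rule integral_mono)
  show "integrable lborel (%x. 2 * \<Omega> * e^2 * (rot90 x \<bullet> j x))" using ij by simp
  show "integrable lborel (%x. 2 * \<Omega> * e^2 * (cutrot \<phi> z x \<bullet> j x) + (norm (n x))^2
   + \<Omega>^2 * e^4 * (norm z)^2 * (\<phi> x * R x) + e^4 * ((norm x)^2 * R x - \<phi> x * ((norm x)^2 * R x)))"
   using ic sq_int_integrable[OF n(1)] iz ixR(1) by simp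
  fix x
  have split: "rot90 x \<bullet> j x = cutrot \<phi> z x \<bullet> j x + \<phi> x * (rot90 z \<bullet> j x) + (1 - \<phi> x) * (rot90 x \<bullet> j x)"
   by (simp add: cutrot_def rot90_diff inner_diff_left algebra_simps)
  have "(1 - \<phi> x) * ((norm x)^2 * R x) >= 0" using p(3)[of x] R0[of x] by simp
  from mult_right_mono[OF O2 this]
  have "(1 - \<phi> x) * (\<Omega>^2 * e^4 * ((norm x)^2 * R x)) <= e^4 * ((1 - \<phi> x) * ((norm x)^2 * R x))" by (simp add: ac_simps)
  moreover have "2 * \<Omega> * e^2 * ((1 - \<phi> x) * (rot90 x \<bullet> j x)) <= (1 - \<phi> x) * ((norm (n x))^2 + \<Omega>^2 * e^4 * ((norm x)^2 * R x))"
   by (rule Y) (use p(3)[of x] in simp)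
  moreover note Y[OF p(2)[of x], of z x]
  ultimately have "2 * \<Omega> * e^2 * (cutrot \<phi> z x \<bullet> j x) + 2 * \<Omega> * e^2 * (\<phi> x * (rot90 z \<bullet> j x)) + 2 * \<Omega> * e^2 * ((1 - \<phi> x) * (rot90 x \<bullet> j x))
   <= 2 * \<Omega> * e^2 * (cutrot \<phi> z x \<bullet> j x) + \<phi> x * ((norm (n x))^2 + \<Omega>^2 * e^4 * ((norm z)^2 * R x)) + (1 - \<phi> x) * (norm (n x))^2 + e^4 * ((1 - \<phi> x) * ((norm x)^2 * R x))"
   by (simp only: distrib_left)
  thus "2 * \<Omega> * e^2 * (rot90 x \<bullet> j x) <= 2 * \<Omega> * e^2 * (cutrot \<phi> z x \<bullet> j x) + (norm (n x))^2
   + \<Omega>^2 * e^4 * (norm z)^2 * (\<phi> x * R x) + e^4 * ((norm x)^2 * R x - \<phi> x * ((norm x)^2 * R x))"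
   by (subst split) (simp add: algebra_simps)
 qed
 also have "\<dots> = 2 * \<Omega> * e^2 * (LBINT x. cutrot \<phi> z x \<bullet> j x) + sqn n + \<Omega>^2 * e^4 * (norm z)^2 * (LBINT x. \<phi> x * R x)
   + e^4 * (mom f g - (LBINT x. \<phi> x * ((norm x)^2 * R x)))"
  using ic sq_int_integrable[OF n(1)] iz ixR by (simp add: sqn_def)
 finally have "2 * \<Omega> * e^2 * rotation f a g b <= 2 * \<Omega> * e^2 * (LBINT x. cutrot \<phi> z x \<bullet> j x) + sqn n + \<Omega>^2 * e^4 * (norm z)^2 * (LBINT x. \<phi> x * R x)
   + e^4 * (mom f g - (LBINT x. \<phi> x * ((norm x)^2 * R x)))"
  by (simp add: rotation_def j_def)
 thus ?thesis using n(2) unfolding energy_def j_def R_def by (simp add: algebra_simps)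
qed

end

context gn_Q
begin

section \<open>Expansion of the energy and selection of scale and centre\<close>

lemma convergent_upper_bound:
 assumes "X ----> (L::real)" obtains K where "K >= 0" "!!n::nat. X n <= K"
proof -
 obtain K where "K > 0" "!!n. norm (X n) <= K" using convergent_imp_Bseq[of X] assms unfolding convergent_def Bseq_def by blast
 thus thesis using that[of K] by (simp add: abs_le_iff less_imp_le)
qed

text \<open>In units of e^4 the quartic term and the cut moment converge to their values at the
  profile, and \<open>energy_cut\<close> charges \<Omega>^2 |z|^2 for the displaced centre. The cut
  rotation carries only e^2; the missing e^2 comes from coercivity, which bounds
  \<open>l2 (g n)\<close> by H e^2, and the factor \<open>l2 (%x. a n x - k x)\<close> then makes it
  negligible.\<close>

lemma expansion:
 assumes tm: "tame f a g b s z" and O: "0 <= \<Omega>" "\<Omega> < 1" and e: "!!n. e n > 0"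
  and C: "!!n. energy \<Omega> (e n) (f n) (a n) (g n) (b n) <= C * e n ^ 4" "0 <= C" and \<delta>: "\<delta> > 0"
 shows "\<forall>\<^sub>F n in sequentially. s^2 / a_star + M / s^2 + (1 - \<Omega>^2) * (norm z)^2 - \<delta> <= energy \<Omega> (e n) (f n) (a n) (g n) (b n) / e n ^ 4"
proof -
 define p where "p = profile s z"
 define k where "k = gprofile s z"
 have s: "s > 0" and st: "!!n. state (f n) (a n) (g n) (b n)" and orth: "!!n. (LBINT x. g n x * p x) = 0"
  and lf: "l2_lim f p" and la: "l2_lim a k"
  and lg: "(%n. l2 (g n)) ----> 0" and lb: "(%n. l2 (b n)) ----> 0"
  using tm unfolding tame_def p_def k_def by auto
 note P = profile[OF s, of z, folded p_def k_def]
 note w = optimizerD(1)[OF P(1)]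
 note sp = wgrad_sq_int[OF w]
 have f: "wgrad (f n) (a n)" and g: "wgrad (g n) (b n)" and m: "sqn (f n) + sqn (g n) = 1" for n using st[of n] by (auto simp: state_def)
 note sf = wgrad_sq_int[OF f] and sg = wgrad_sq_int[OF g]
 note [measurable] = sp(1)[THEN sq_int_measurable]
 obtain d0 where d0: "d0 > 0" "\<forall>\<^sub>F n in sequentially. d0 * (sqn (g n) + sqn (b n)) <= defect (f n) (a n) (g n) (b n)"
  using coercive[OF P(1,3) st orth lf la lg] by blast
 \<comment> \<open>Coercivity bounds the mass of g by the defect, and \<open>energy_lower\<close>
   bounds the defect by the energy, hence by C e^4; H collects the constants.\<close>
 define H where "H = sqrt (C / ((1 - \<Omega>) * d0))"
 have gs: "\<forall>\<^sub>F n in sequentially. l2 (g n) <= H * (e n)^2"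
  using d0(2)
 proof eventually_elim
  case (elim n)
  have "(1 - \<Omega>) * (d0 * sqn (g n)) <= (1 - \<Omega>) * (defect (f n) (a n) (g n) (b n) + e n ^ 4 * mom (f n) (g n))"
  proof (rule mult_left_mono)
   have "0 <= e n ^ 4 * mom (f n) (g n)" "0 <= d0 * sqn (b n)" using mom_nonneg d0(1) by simp_all
   thus "d0 * sqn (g n) <= defect (f n) (a n) (g n) (b n) + e n ^ 4 * mom (f n) (g n)" using elim unfolding distrib_left by linarith
  qed (use O in simp)
  also have "\<dots> <= energy \<Omega> (e n) (f n) (a n) (g n) (b n)"
  proof -
   have "0 <= e n ^ 4 / 2 * quart (f n) (g n)" using quart_nonneg by simp
   thus ?thesis using energy_lower[OF st[of n] O, of "e n"] by linarith
  qed
  also have "\<dots> <= C * e n ^ 4" by (rule C(1))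
  finally have "sqn (g n) * ((1 - \<Omega>) * d0) <= C * e n ^ 4" by (simp add: ac_simps)
  hence "sqn (g n) <= (C / ((1 - \<Omega>) * d0)) * e n ^ 4" using O d0(1) by (simp add: pos_le_divide_eq)
  hence "l2 (g n) <= sqrt ((C / ((1 - \<Omega>) * d0)) * e n ^ 4)" unfolding l2_def by simp
  also have "\<dots> = H * (e n)^2" unfolding real_sqrt_mult H_def using real_sqrt_unique[of "(e n)^2" "e n ^ 4"] by simp
  finally show ?case .
 qed
 obtain c :: "nat => real^2 => real" and B0 where c: "B0 > 0" "!!n. c n \<in> test_functions" "!!n x. 0 <= c n x" "!!n x. c n x <= 1"
  "!!x. (%n. c n x) ----> 1" "!!n x i. \<bar>partial i (c n) x\<bar> <= B0 / (real n + 1)" "!!n x. EX s. grad (c n) x = s *R x"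
  by (rule cutoff, rule that, assumption+)
 have ct: "(%x. c n (- z + 1 *R x)) \<in> test_functions" for n by (rule test_affine[OF c(2)]) simp
 have [measurable]: "(%x. c n (- z + 1 *R x)) \<in> BM" for n using ct by (rule test_measurable)
 note mi = sq_int_integrable[OF P(5)]
 have "(%n. LBINT x. c n (- z + 1 *R x) * (norm (norm x * p x))^2) ----> (LBINT x. (norm (norm x * p x))^2)"
 proof (rule integral_dominated_convergence[OF _ _ mi])
  show "AE x in lborel. (%n. c n (- z + 1 *R x) * (norm (norm x * p x))^2) ----> (norm (norm x * p x))^2"
  proof (rule AE_I2)
   fix x
   from tendsto_mult[OF c(5)[of "- z + 1 *R x"] tendsto_const[of "(norm (norm x * p x))^2"]]
   show "(%n. c n (- z + 1 *R x) * (norm (norm x * p x))^2) ----> (norm (norm x * p x))^2" by simp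
  qed
  show "AE x in lborel. norm (c n (- z + 1 *R x) * (norm (norm x * p x))^2) <= (norm (norm x * p x))^2" for n
   using c(3,4) by (intro AE_I2) (simp add: abs_mult mult_left_le_one_le)
 qed measurable
 hence "(%n. LBINT x. c n (- z + 1 *R x) * (norm (norm x * p x))^2) ----> M / s^2 + (norm z)^2" using P(6) by (simp add: sqn_def)
 \<comment> \<open>The cutoff is fixed here, before n tends to infinity: it loses at most \<delta> /
   3 of the moment of the profile and makes the rotation field bounded.\<close>
 from order_tendstoD(1)[OF this, of "M / s^2 + (norm z)^2 - \<delta> / 3"] \<delta>
 obtain N where N: "M / s^2 + (norm z)^2 - \<delta> / 3 < (LBINT x. c N (- z + 1 *R x) * (norm (norm x * p x))^2)"
  by (auto simp: eventually_sequentially)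
 define \<phi> where "\<phi> x = c N (- z + 1 *R x)" for x
 have ph: "\<phi> \<in> test_functions" "!!x. 0 <= \<phi> x" "!!x. \<phi> x <= 1" using ct c(3,4) by (simp_all add: \<phi>_def[abs_def])
 have [measurable]: "\<phi> \<in> BM" using ph(1) by (rule test_measurable)
 have gr: "EX s. grad \<phi> x = s *R (x - z)" for x
 proof -
  obtain t where t: "grad (c N) (- z + 1 *R x) = t *R (- z + 1 *R x)" using c(7) by blast
  have "grad \<phi> x $ i = grad (c N) (- z + 1 *R x) $ i" for i
   using test_partial_affine[OF c(2)[of N], of i "- z" 1 x] by (simp add: \<phi>_def[abs_def])
  hence "grad \<phi> x = t *R (x - z)" unfolding t by (simp add: vec_eq_iff)
  thus ?thesis ..
 qed
 obtain B where B: "B >= 0" "!!x. norm (cutrot \<phi> z x) <= B" by (rule cutrot_bounded[OF ph(1)], rule that, assumption+)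
 obtain B1 R1 where B1: "B1 > 0" "R1 > 0" "!!x. \<bar>\<phi> x\<bar> <= B1 * indicator (cball 0 R1) x" by (rule test_bounded[OF ph(1)], rule that, assumption+)
 have pb: "\<bar>\<phi> x * (norm x)^2\<bar> <= R1^2" for x
 proof (cases "norm x <= R1")
  case True
  hence "\<phi> x * (norm x)^2 <= 1 * R1^2" using ph by (intro mult_mono power_mono) auto
  thus ?thesis using ph(2)[of x] by simp
 next
  case False
  thus ?thesis using B1(3)[of x] by simp
 qed
 have pm: "(%x. \<phi> x * (norm x)^2) \<in> BM" by measurable
 have pb1: "\<bar>\<phi> x\<bar> <= 1" for x using ph by simp
 have lg': "l2_lim g (%x. 0)" using lg by simp
 note W1 = weighted_square_tendsto[OF sf(1) sp(1) lf pm pb] and W2 = weighted_square_tendsto[OF sg(1) sq_int_zero lg' pm pb]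
  and W3 = weighted_square_tendsto[OF sf(1) sp(1) lf test_measurable[OF ph(1)] pb1] and W4 = weighted_square_tendsto[OF sg(1) sq_int_zero lg' test_measurable[OF ph(1)] pb1]
 have V1: "(%n. LBINT x. \<phi> x * (norm x)^2 * ((f n x)^2 + (g n x)^2)) ----> (LBINT x. \<phi> x * (norm x)^2 * (p x)^2)"
  using tendsto_add[OF W1(1) W2(1)] W1(2) W2(2) by (simp add: distrib_left)
 have V2: "(%n. LBINT x. \<phi> x * ((f n x)^2 + (g n x)^2)) ----> (LBINT x. \<phi> x * (p x)^2)"
  using tendsto_add[OF W3(1) W4(1)] W3(2) W4(2) by (simp add: distrib_left)
 have lb': "l2_lim b (%x. 0)" using lb by simp
 obtain K1 where K1: "K1 >= 0" "!!n. sqn (a n) <= K1" by (rule convergent_upper_bound[OF l2_tendsto_imp_sqn_tendsto[OF sf(2) sp(2) la]], rule that, assumption+)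
 obtain K2 where K2: "K2 >= 0" "!!n. sqn (b n) <= K2" by (rule convergent_upper_bound[OF l2_tendsto_imp_sqn_tendsto[OF sg(2) sq_int_zero lb']], rule that, assumption+)
 have bd: "sqn (f n) <= 1 + K1 + K2" "sqn (a n) <= 1 + K1 + K2" "sqn (g n) <= 1 + K1 + K2" "sqn (b n) <= 1 + K1 + K2" for n
  using K1(1) K1(2)[of n] K2(1) K2(2)[of n] m[of n] sqn_nonneg[of "f n"] sqn_nonneg[of "g n"] by linarith+
 have V0: "(%n. quart (f n) (g n)) ----> quart p (%x. 0)"
  by (rule quart_tendsto[OF f g w wgrad_zero bd lf lg'])
 have q0: "quart p (%x. 0) / 2 = s^2 / a_star"
  using optimizerD(4)[OF P(1)] P(2) a_pos by (simp add: quart_def field_simps)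
 define G where "G n = quart (f n) (g n) / 2 + (LBINT x. \<phi> x * (norm x)^2 * ((f n x)^2 + (g n x)^2)) - \<Omega>^2 * (norm z)^2 * (LBINT x. \<phi> x * ((f n x)^2 + (g n x)^2))" for n
 have GL: "G ----> s^2 / a_star + (LBINT x. \<phi> x * (norm x)^2 * (p x)^2) - \<Omega>^2 * (norm z)^2 * (LBINT x. \<phi> x * (p x)^2)"
  unfolding G_def q0[symmetric] by (intro tendsto_intros V0 V1 V2) simp
 have "(LBINT x. \<phi> x * (p x)^2) <= (LBINT x. (norm (p x))^2)"
  by (rule integral_mono'[OF sq_int_integrable[OF sp(1)]]) (use ph in \<open>auto simp: mult_left_le_one_le\<close>)
 hence "(LBINT x. \<phi> x * (p x)^2) <= 1" using optimizerD(2)[OF P(1)] by (simp add: sqn_def)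
 hence "\<Omega>^2 * (norm z)^2 * (LBINT x. \<phi> x * (p x)^2) <= \<Omega>^2 * (norm z)^2 * 1" by (intro mult_left_mono) auto
 moreover have "(LBINT x. \<phi> x * (norm x)^2 * (p x)^2) > M / s^2 + (norm z)^2 - \<delta> / 3"
  using N by (simp add: \<phi>_def power_mult_distrib mult.assoc)
 ultimately have "s^2 / a_star + M / s^2 + (1 - \<Omega>^2) * (norm z)^2 - \<delta> / 3 < s^2 / a_star + (LBINT x. \<phi> x * (norm x)^2 * (p x)^2) - \<Omega>^2 * (norm z)^2 * (LBINT x. \<phi> x * (p x)^2)"
  unfolding left_diff_distrib by simp
 from order_tendstoD(1)[OF GL this]
 have ev1: "\<forall>\<^sub>F n in sequentially. s^2 / a_star + M / s^2 + (1 - \<Omega>^2) * (norm z)^2 - \<delta> / 3 < G n" .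
 have "(%n. 4 * B * H * l2 (%x. a n x - k x)) ----> 0" by (intro tendsto_mult_right_zero la)
 from order_tendstoD(2)[OF this, of "\<delta> / 3"] \<delta>
 have ev2: "\<forall>\<^sub>F n in sequentially. 4 * B * H * l2 (%x. a n x - k x) < \<delta> / 3" by simp
 show ?thesis using ev1 ev2 gs
 proof eventually_elim
  case (elim n)
  note cc = cutrot_current[OF ph(1) gr B(2) f[of n] g[of n] sp(2) P(4)]
  define J where "J = (LBINT x. cutrot \<phi> z x \<bullet> (f n x *R b n x - g n x *R a n x))"
  have "e n ^ 4 * G n - 2 * \<Omega> * (e n)^2 * J <= energy \<Omega> (e n) (f n) (a n) (g n) (b n)"
   unfolding G_def J_def by (rule energy_cut[OF st O ph cc(1)])
  moreover have "2 * \<Omega> * (e n)^2 * J <= e n ^ 4 * (\<delta> / 3)"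
  proof -
   have "2 * \<Omega> * (e n)^2 * J <= 2 * \<Omega> * (e n)^2 * \<bar>J\<bar>" using O by (intro mult_left_mono) auto
   also have "\<dots> <= 2 * 1 * (e n)^2 * (2 * B * (l2 (g n) * l2 (%x. a n x - k x)))"
    using O cc(2) by (intro mult_mono) (auto simp: J_def)
   also have "\<dots> <= 2 * 1 * (e n)^2 * (2 * B * ((H * (e n)^2) * l2 (%x. a n x - k x)))"
    using elim(3) B(1) by (intro mult_left_mono mult_right_mono) auto
   also have "\<dots> = e n ^ 4 * (4 * B * H * l2 (%x. a n x - k x))" by (simp add: power4_eq_xxxx power2_eq_square)
   also have "\<dots> <= e n ^ 4 * (\<delta> / 3)" using elim(2) by (intro mult_left_mono) auto
   finally show ?thesis .
  qed
  moreover have "e n ^ 4 * (s^2 / a_star + M / s^2 + (1 - \<Omega>^2) * (norm z)^2 - \<delta> / 3) <= e n ^ 4 * G n"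
   using elim(1) by (intro mult_left_mono) auto
  ultimately have "e n ^ 4 * (s^2 / a_star + M / s^2 + (1 - \<Omega>^2) * (norm z)^2 - \<delta> / 3) - e n ^ 4 * (\<delta> / 3) <= energy \<Omega> (e n) (f n) (a n) (g n) (b n)" by linarith
  moreover have "e n ^ 4 * (s^2 / a_star + M / s^2 + (1 - \<Omega>^2) * (norm z)^2 - \<delta>) <= e n ^ 4 * (s^2 / a_star + M / s^2 + (1 - \<Omega>^2) * (norm z)^2 - \<delta> / 3) - e n ^ 4 * (\<delta> / 3)"
   unfolding right_diff_distrib[symmetric] using \<delta> by (intro mult_left_mono) auto
  ultimately show ?case using e[of n] by (simp add: pos_le_divide_eq mult.commute)
 qed
qed

text \<open>\<open>expansion\<close> bounds the rescaled energy below by a function of s and z whose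
  minimum equals the upper limit supplied by \<kappa>. Equality determines s and z and forces the
  energy to converge.\<close>

lemma blowup_limit:
 assumes st: "!!n. state (f n) (a n) (g n) (b n)" and O: "0 <= \<Omega>" "\<Omega> < 1" and e: "!!n. e n > 0" "e ----> 0"
  and en: "!!n. energy \<Omega> (e n) (f n) (a n) (g n) (b n) <= \<kappa> n * e n ^ 4"
  and \<kappa>: "\<kappa> ----> E0"
 obtains r :: "nat => nat" and c d where "strict_mono r" "!!n. (c n)^2 + (d n)^2 = (1::real)"
  "(%n. l2 (%x. c n * f (r n) x + d n * g (r n) x - lambda_star Q * q0 (lambda_star Q *R x))) ----> 0"
  "(%n. l2 (%x. c n * g (r n) x - d n * f (r n) x)) ----> 0"
  "(%n. energy \<Omega> (e (r n)) (f (r n)) (a (r n)) (g (r n)) (b (r n)) / e (r n) ^ 4) ----> E0"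
proof -
 define L where "L = (lambda_star Q)^2"
 have L: "L > 0" "L * L = a_star * M" using lambda_star_eq(1,2) by (auto simp: L_def power_mult_distrib[symmetric] power2_eq_square power4_eq_xxxx)
 obtain C where C: "C >= 0" "!!n. \<kappa> n <= C" by (rule convergent_upper_bound[OF \<kappa>], rule that, assumption+)
 have enC: "energy \<Omega> (e n) (f n) (a n) (g n) (b n) <= C * e n ^ 4" for n
 proof -
  have "\<kappa> n * e n ^ 4 <= C * e n ^ 4" by (intro mult_right_mono C) simp
  thus ?thesis using en[of n] by linarith
 qed
 have e4: "(%n. e n ^ 4) ----> 0" using tendsto_power[OF e(2), of 4] by simp
 obtain E where E: "E >= 0" "!!n. e n ^ 4 <= E" by (rule convergent_upper_bound[OF e4], rule that, assumption+)
 have bounds: "defect (f n) (a n) (g n) (b n) <= C / (1 - \<Omega>) * e n ^ 4" "mom (f n) (g n) <= C / (1 - \<Omega>)" "quart (f n) (g n) <= 2 * C" for n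
 proof -
  define D m q where "D = (1 - \<Omega>) * defect (f n) (a n) (g n) (b n)" and "m = (1 - \<Omega>) * mom (f n) (g n)" and "q = quart (f n) (g n) / 2"
  have nn: "0 <= D" "0 <= m" "0 <= q" using O defect_nonneg[OF st[of n]] mom_nonneg quart_nonneg by (simp_all add: D_def m_def q_def)
  have e0: "e n ^ 4 > 0" using e(1)[of n] by simp
  have "(1 - \<Omega>) * (defect (f n) (a n) (g n) (b n) + e n ^ 4 * mom (f n) (g n)) + e n ^ 4 / 2 * quart (f n) (g n) = D + e n ^ 4 * m + e n ^ 4 * q"
   by (simp add: D_def m_def q_def algebra_simps)
  hence le: "D + e n ^ 4 * m + e n ^ 4 * q <= C * e n ^ 4" using energy_lower[OF st[of n] O, of "e n"] enC[of n] by linarith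
  have nn': "0 <= e n ^ 4 * m" "0 <= e n ^ 4 * q" using nn e0 by simp_all
  have "D <= C * e n ^ 4" using le nn' by linarith
  thus "defect (f n) (a n) (g n) (b n) <= C / (1 - \<Omega>) * e n ^ 4" using O by (simp add: D_def pos_le_divide_eq mult.commute)
  have "m * e n ^ 4 <= C * e n ^ 4" "q * e n ^ 4 <= C * e n ^ 4" using le nn' nn(1) by (simp_all add: mult.commute)
  hence "m <= C" "q <= C" using e0 by simp_all
  thus "mom (f n) (g n) <= C / (1 - \<Omega>)" "quart (f n) (g n) <= 2 * C" using O by (simp_all add: m_def q_def pos_le_divide_eq mult.commute)
 qed
 have D0: "(%n. defect (f n) (a n) (g n) (b n)) ----> 0"
 proof (rule null_bound)
  show "(%n. C / (1 - \<Omega>) * e n ^ 4) ----> 0" by (intro tendsto_mult_right_zero e4)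
 qed (use bounds(1) defect_nonneg[OF st] in simp)
 define K where "K = C / (1 - \<Omega>) * E + C / (1 - \<Omega>) + 2 * C"
 have K0: "0 <= C / (1 - \<Omega>)" "0 <= C / (1 - \<Omega>) * E" using O C(1) E(1) by simp_all
 have K: "defect (f n) (a n) (g n) (b n) <= K" "mom (f n) (g n) <= K" "quart (f n) (g n) <= K" for n
 proof -
  have "C / (1 - \<Omega>) * e n ^ 4 <= C / (1 - \<Omega>) * E" by (intro mult_left_mono E K0)
  thus "defect (f n) (a n) (g n) (b n) <= K" "mom (f n) (g n) <= K" "quart (f n) (g n) <= K"
   using bounds[of n] K0 C(1) unfolding K_def by linarith+
 qed
 obtain r :: "nat => nat" and c d s z where r: "strict_mono r" and cd: "!!n. (c n)^2 + (d n)^2 = 1" and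
  tm: "tame (%n x. c n * f (r n) x + d n * g (r n) x) (%n x. c n *R a (r n) x + d n *R b (r n) x)
    (%n x. c n * g (r n) x - d n * f (r n) x) (%n x. c n *R b (r n) x - d n *R a (r n) x) s z"
  by (rule compactness[OF st D0 K], rule that, assumption+)
 have s: "s > 0" using tm by (simp add: tame_def)
 have ee: "energy \<Omega> (e (r n)) (%x. c n * f (r n) x + d n * g (r n) x) (%x. c n *R a (r n) x + d n *R b (r n) x)
    (%x. c n * g (r n) x - d n * f (r n) x) (%x. c n *R b (r n) x - d n *R a (r n) x)
   = energy \<Omega> (e (r n)) (f (r n)) (a (r n)) (g (r n)) (b (r n))" for n
  by (rule rotate_state(3)[OF st cd])
 define V where "V = s^2 / a_star + M / s^2 + (1 - \<Omega>^2) * (norm z)^2"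
 define F where "F n = energy \<Omega> (e (r n)) (f (r n)) (a (r n)) (g (r n)) (b (r n)) / e (r n) ^ 4" for n
 have low: "\<forall>\<^sub>F n in sequentially. V - \<delta> <= F n" if "\<delta> > 0" for \<delta>
  using expansion[OF tm O, of "%n. e (r n)" C \<delta>] e(1) C(1) that enC unfolding ee F_def V_def by simp
 have kr: "(%n. \<kappa> (r n)) ----> 2 * L / a_star" using LIMSEQ_subseq_LIMSEQ[OF \<kappa> r] by (simp add: comp_def L_def)
 have Fk: "F n <= \<kappa> (r n)" for n using en[of "r n"] e(1)[of "r n"] by (simp add: F_def pos_divide_le_eq)
 have "V <= 2 * L / a_star"
 proof (rule field_le_epsilon)
  fix \<delta> :: real assume "\<delta> > 0"
  from low[OF this] have "\<forall>\<^sub>F n in sequentially. V - \<delta> <= \<kappa> (r n)"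
   by eventually_elim (use Fk order_trans in blast)
  hence "V - \<delta> <= 2 * L / a_star" by (rule tendsto_lowerbound[OF kr]) simp
  thus "V <= 2 * L / a_star + \<delta>" by simp
 qed
 \<comment> \<open>Completing the square in s, with M = L^2 / \<open>a_star\<close>.\<close>
 moreover have V: "V = 2 * L / a_star + (s^2 - L)^2 / (a_star * s^2) + (1 - \<Omega>^2) * (norm z)^2"
 proof -
  have "s^2 / a_star + M / s^2 = (s^2 * s^2 + L * L) / (a_star * s^2)" unfolding L(2) using a_pos s by (simp add: field_simps)
  also have "s^2 * s^2 + L * L = 2 * L * s^2 + (s^2 - L)^2" by (simp add: power2_diff power2_eq_square[of L] power2_eq_square[of "s^2"])
  also have "(2 * L * s^2 + (s^2 - L)^2) / (a_star * s^2) = 2 * L / a_star + (s^2 - L)^2 / (a_star * s^2)"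
   using a_pos s by (simp add: add_divide_distrib)
  finally show ?thesis by (simp add: V_def)
 qed
 moreover have nn: "0 <= (s^2 - L)^2 / (a_star * s^2)" "0 <= (1 - \<Omega>^2) * (norm z)^2" "1 - \<Omega>^2 > 0"
  using a_pos O by (auto simp: power_le_one power2_less_1_iff abs_square_less_1)
 ultimately have z0: "(s^2 - L)^2 / (a_star * s^2) = 0" "(1 - \<Omega>^2) * (norm z)^2 = 0" by linarith+
 hence sL: "s^2 = L" "z = 0" using a_pos s nn(3) by auto
 hence sl: "s = lambda_star Q" using s lambda_star_eq(1) by (simp add: L_def power2_eq_iff_nonneg)
 have V': "V = 2 * L / a_star" using V z0 by simp
 have "F ----> 2 * L / a_star"
 proof (rule tendstoI)
  fix \<delta> :: real assume d: "\<delta> > 0"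
  have "\<forall>\<^sub>F n in sequentially. \<kappa> (r n) < 2 * L / a_star + \<delta>" using order_tendstoD(2)[OF kr] d by simp
  moreover have "\<forall>\<^sub>F n in sequentially. V - \<delta> / 2 <= F n" using low[of "\<delta> / 2"] d by simp
  ultimately show "\<forall>\<^sub>F n in sequentially. dist (F n) (2 * L / a_star) < \<delta>"
  proof eventually_elim
   case (elim n)
   thus ?case using Fk[of n] d by (auto simp: dist_real_def V' abs_less_iff)
  qed
 qed
 hence Flim: "(%n. energy \<Omega> (e (r n)) (f (r n)) (a (r n)) (g (r n)) (b (r n)) / e (r n) ^ 4) ----> E0"
  by (simp add: F_def[abs_def] L_def)
 have pr: "profile s z = (%x. lambda_star Q * q0 (lambda_star Q *R x))" by (simp add: profile_def[abs_def] sL sl)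
 have t1: "(%n. l2 (%x. c n * f (r n) x + d n * g (r n) x - lambda_star Q * q0 (lambda_star Q *R x))) ----> 0"
  and t2: "(%n. l2 (%x. c n * g (r n) x - d n * f (r n) x)) ----> 0"
  using tm unfolding tame_def pr by auto
 show thesis by (rule that[OF r cd t1 t2 Flim])
qed

end

section \<open>Energy asymptotics and convergence\<close>

context gn_Q
begin

lemma quarter_power:
 fixes d :: real assumes d: "d > 0"
 shows "(d powr (1/4))^4 = d" "(d powr (1/4))^2 = sqrt d" (is ?A) "d powr (- 1/4) = 1 / d powr (1/4)" (is ?B)
proof -
 show "(d powr (1/4))^4 = d" ?A using d by (simp_all add: powr_power powr_half_sqrt)
 show ?B using powr_minus_divide[of d "1/4"] by simp
qed

lemma blowup_profile_scaled:
 assumes "\<alpha> < a_star" and "e = (a_star - \<alpha>) powr (1/4)"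
 shows "complex_of_real e * blowup_profile Q \<alpha> (e *R y) = complex_of_real (lambda_star Q * q0 (lambda_star Q *R y))"
proof -
 have e: "e > 0" "(a_star - \<alpha>) powr (- 1 / 4) = 1 / e" using assms quarter_power(3)[of "a_star - \<alpha>"] by simp_all
 have "a_star powr (- 1 / 2) = 1 / sqrt a_star" using a_pos by (simp add: powr_minus_divide powr_half_sqrt)
 thus ?thesis unfolding blowup_profile_def Let_def e(2) q0_def using e(1) by (simp add: field_simps)
qed

text \<open>Blow-up by e and multiplication by exp(-i \<theta>) are isometries of L2; F and G are
  the real and imaginary parts of the difference after both.\<close>

lemma profile_distance:
 assumes u: "u \<in> BM" and al: "\<alpha> < a_star" "e = (a_star - \<alpha>) powr (1/4)" and cd: "c = cos \<theta>" "d = sin \<theta>"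
  and s: "sq_int (%x. e * Re (u (e *R x)))" "sq_int (%x. e * Im (u (e *R x)))"
 defines "F == %x. c * (e * Re (u (e *R x))) + d * (e * Im (u (e *R x))) - lambda_star Q * q0 (lambda_star Q *R x)"
  and "G == %x. c * (e * Im (u (e *R x))) - d * (e * Re (u (e *R x)))"
 shows "L2_norm (%x. u x - exp (\<i> * \<theta>) * blowup_profile Q \<alpha> x) = sqrt (sqn F + sqn G)"
proof -
 have e: "e > 0" using al by simp
 have [measurable]: "u \<in> BM" by (rule u)
 have cd1: "c^2 + d^2 = 1" by (simp add: cd)
 have bm[measurable]: "blowup_profile Q \<alpha> \<in> BM"
  unfolding blowup_profile_def[abs_def] Let_def by measurable
 define h where "h x = (cmod (u x - exp (\<i> * \<theta>) * blowup_profile Q \<alpha> x))^2" for x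
 have hm: "h \<in> BM" unfolding h_def[abs_def] by measurable
 have pw: "e^2 * h (0 + e *R x) = (norm (F x))^2 + (norm (G x))^2" for x
 proof -
  define f g P where "f = e * Re (u (e *R x))" and "g = e * Im (u (e *R x))" and "P = lambda_star Q * q0 (lambda_star Q *R x)"
  have "e^2 * h (0 + e *R x) = (cmod (complex_of_real e * (u (e *R x) - exp (\<i> * \<theta>) * blowup_profile Q \<alpha> (e *R x))))^2"
   by (simp add: h_def norm_mult power_mult_distrib)
  also have "complex_of_real e * (u (e *R x) - exp (\<i> * \<theta>) * blowup_profile Q \<alpha> (e *R x))
    = Complex f g - exp (\<i> * \<theta>) * (complex_of_real e * blowup_profile Q \<alpha> (e *R x))"
   by (simp add: f_def g_def algebra_simps complex_eq_iff)
  also have "\<dots> = Complex (f - c * P) (g - d * P)"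
   unfolding blowup_profile_scaled[OF al] by (simp add: P_def cd complex_eq_iff Re_exp Im_exp)
  also have "(cmod (Complex (f - c * P) (g - d * P)))^2 = (f^2 + g^2) - 2 * P * (c * f + d * g) + (c^2 + d^2) * P^2"
   unfolding cmod_power2 by (simp add: power2_eq_square algebra_simps)
  also have "\<dots> = (c^2 + d^2) * (f^2 + g^2) - 2 * P * (c * f + d * g) + P^2" unfolding cd1 by simp
  also have "\<dots> = (c * f + d * g - P)^2 + (c * g - d * f)^2" by (simp add: power2_eq_square algebra_simps)
  finally show ?thesis by (simp add: F_def G_def f_def g_def P_def)
 qed
 have l: "lambda_star Q > 0" by (rule lambda_star_eq(1))
 have sP: "sq_int (%x. lambda_star Q * q0 (lambda_star Q *R x))"
  using wgrad_sq_int(1)[OF wgrad_scale(1)[OF q0_wgrad(1) l, of "lambda_star Q" 0]] by simp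
 have FG: "sq_int F" "sq_int G" unfolding F_def G_def by (intro sq_int_add sq_int_diff sq_int_cmult s sP)+
 have "(LBINT x. h (0 + e *R x)) = (1 / \<bar>e\<bar> ^ DIM(real^2)) *R (LBINT x. h x)"
  by (rule lborel_integral_affine(1)[OF _ hm]) (use e in simp)
 hence "(LBINT x. h x) = (LBINT x. e^2 * h (0 + e *R x))" using e by simp
 also have "\<dots> = sqn F + sqn G" unfolding pw sqn_def using sq_int_integrable[OF FG(1)] sq_int_integrable[OF FG(2)] by simp
 finally show ?thesis by (simp add: L2_norm_def h_def)
qed

text \<open>Only an upper bound on the energies is assumed, with a constant tending to that of the
  trial state. In this form the statement serves both the limit of the ground state energy and the
  convergence of quasi-minimizers.\<close>

lemma minimizing_subsequence:
 assumes O: "0 <= \<Omega>" "\<Omega> < 1" and al: "!!n. \<alpha> n < a_star" "\<alpha> ----> a_star"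
  and u: "!!n::nat. u n \<in> H1" "!!n. L2_norm (u n) = 1"
  and en: "!!n. gp_energy \<Omega> (\<alpha> n) (u n) <= ereal (sqrt (a_star - \<alpha> n) * \<kappa> n)"
  and \<kappa>: "\<kappa> ----> E0"
 obtains r :: "nat => nat" and \<theta> :: "nat => real" where "strict_mono r" "!!n. \<theta> n \<in> {0..<2*pi}"
  "(%n. L2_norm (%x. u (r n) x - exp (\<i> * \<theta> n) * blowup_profile Q (\<alpha> (r n)) x)) ----> 0"
  "(%n. real_of_ereal (gp_energy \<Omega> (\<alpha> (r n)) (u (r n))) / sqrt (a_star - \<alpha> (r n))) ----> E0"
proof -
 define e where "e n = (a_star - \<alpha> n) powr (1/4)" for n
 have e: "e n > 0" "e n ^ 4 = a_star - \<alpha> n" "(e n)^2 = sqrt (a_star - \<alpha> n)" for n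
  using al(1)[of n] quarter_power[of "a_star - \<alpha> n"] by (simp_all add: e_def)
 have "(%n. root 4 (a_star - \<alpha> n)) ----> root 4 (a_star - a_star)" by (intro tendsto_intros al(2))
 moreover have "root 4 (a_star - \<alpha> n) = e n" for n using e(1,2)[of n] real_root_pos_unique[of 4 "e n" "a_star - \<alpha> n"] by simp
 ultimately have e0: "e ----> 0" by simp
 have x: "(%x. norm x *R u n x) \<in> L2" for n using en[of n] by (auto simp: gp_energy_def split: if_splits)
 define f where "f n x = e n * Re (u n (e n *R x))" for n x
 define g where "g n x = e n * Im (u n (e n *R x))" for n x
 define good where "good n A B \<longleftrightarrow> state (f n) A (g n) B & gp_energy \<Omega> (\<alpha> n) (u n) = ereal (energy \<Omega> (e n) (f n) A (g n) B / (e n)^2)" for n A B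
 have "EX A B. good n A B" for n
 proof -
  obtain A B where "state (%x. e n * Re (u n (e n *R x))) A (%x. e n * Im (u n (e n *R x))) B"
   "!!\<Omega>. gp_energy \<Omega> (\<alpha> n) (u n) = ereal (energy \<Omega> (e n) (%x. e n * Re (u n (e n *R x))) A (%x. e n * Im (u n (e n *R x))) B / (e n)^2)"
   by (rule energy_blowup[OF u(1)[of n] u(2)[of n] x[of n] e(1)[of n] e(2)[of n, symmetric]], rule that, assumption+)
  thus ?thesis unfolding good_def f_def[abs_def] g_def[abs_def] by blast
 qed
 then obtain A B where "!!n. good n (A n) (B n)" by metis
 hence st: "state (f n) (A n) (g n) (B n)" and ge: "gp_energy \<Omega> (\<alpha> n) (u n) = ereal (energy \<Omega> (e n) (f n) (A n) (g n) (B n) / (e n)^2)" for n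
  unfolding good_def by blast+
 have e4: "e n ^ 4 = (e n)^2 * (e n)^2" for n by (simp add: power4_eq_xxxx power2_eq_square)
 have en': "energy \<Omega> (e n) (f n) (A n) (g n) (B n) <= \<kappa> n * e n ^ 4" for n
 proof -
  have "energy \<Omega> (e n) (f n) (A n) (g n) (B n) / (e n)^2 <= (e n)^2 * \<kappa> n" using en[of n] unfolding ge e(3)[symmetric] by simp
  thus ?thesis using e(1)[of n] unfolding e4 by (simp add: pos_divide_le_eq ac_simps)
 qed
 obtain r :: "nat => nat" and c d where r: "strict_mono r" and cd: "!!n. (c n)^2 + (d n)^2 = (1::real)" and
  t1: "(%n. l2 (%x. c n * f (r n) x + d n * g (r n) x - lambda_star Q * q0 (lambda_star Q *R x))) ----> 0" and
  t2: "(%n. l2 (%x. c n * g (r n) x - d n * f (r n) x)) ----> 0" and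
  t3: "(%n. energy \<Omega> (e (r n)) (f (r n)) (A (r n)) (g (r n)) (B (r n)) / e (r n) ^ 4) ----> E0"
  by (rule blowup_limit[OF st O e(1) e0 en' \<kappa>], rule that, assumption+)
 have "EX \<theta>. \<theta> \<in> {0..<2*pi} & c n = cos \<theta> & d n = sin \<theta>" for n
  by (rule sincos_total_2pi[OF cd[of n]]) auto
 then obtain \<theta> where th: "!!n. \<theta> n \<in> {0..<2*pi}" "!!n. c n = cos (\<theta> n)" "!!n. d n = sin (\<theta> n)" by metis
 have D: "L2_norm (%x. u (r n) x - exp (\<i> * \<theta> n) * blowup_profile Q (\<alpha> (r n)) x)
   = sqrt (sqn (%x. c n * f (r n) x + d n * g (r n) x - lambda_star Q * q0 (lambda_star Q *R x)) + sqn (%x. c n * g (r n) x - d n * f (r n) x))" for n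
  unfolding f_def g_def
 proof (rule profile_distance[OF _ al(1) e_def th(2,3)])
  have "sq_int (u (r n))" using u(1)[of "r n"] by (simp add: H1_def L2_iff)
  thus "u (r n) \<in> BM" by (rule sq_int_measurable)
  have w: "wgrad (f (r n)) (A (r n))" "wgrad (g (r n)) (B (r n))" using st[of "r n"] by (auto simp: state_def)
  show "sq_int (%x. e (r n) * Re (u (r n) (e (r n) *R x)))" "sq_int (%x. e (r n) * Im (u (r n) (e (r n) *R x)))"
   using wgrad_sq_int(1)[OF w(1)] wgrad_sq_int(1)[OF w(2)] by (simp_all add: f_def[abs_def] g_def[abs_def])
 qed
 have "(%n. sqrt (sqn (%x. c n * f (r n) x + d n * g (r n) x - lambda_star Q * q0 (lambda_star Q *R x)) + sqn (%x. c n * g (r n) x - d n * f (r n) x))) ----> sqrt (0 + 0)"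
  by (intro tendsto_intros t1[unfolded l2_tendsto_0_iff] t2[unfolded l2_tendsto_0_iff])
 hence T: "(%n. L2_norm (%x. u (r n) x - exp (\<i> * \<theta> n) * blowup_profile Q (\<alpha> (r n)) x)) ----> 0" unfolding D by simp
 have "real_of_ereal (gp_energy \<Omega> (\<alpha> (r n)) (u (r n))) / sqrt (a_star - \<alpha> (r n)) = energy \<Omega> (e (r n)) (f (r n)) (A (r n)) (g (r n)) (B (r n)) / e (r n) ^ 4" for n
  unfolding ge e4 e(3)[symmetric] by simp
 hence T3: "(%n. real_of_ereal (gp_energy \<Omega> (\<alpha> (r n)) (u (r n))) / sqrt (a_star - \<alpha> (r n))) ----> E0"
  using t3 by simp
 show thesis by (rule that[OF r th(1) T T3])
qed

text \<open>The trial state bounds the infimum above, and nonnegativity of the blown-up energy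
  bounds it below. It is therefore a real number, and \<open>real_of_ereal\<close> loses
  nothing.\<close>

lemma ground_energy_bounds:
 assumes O: "0 <= \<Omega>" "\<Omega> < 1" and al: "\<alpha> < a_star"
 obtains E where "gp_ground_energy \<Omega> \<alpha> = ereal E" "0 <= E" "E <= sqrt (a_star - \<alpha>) * E0"
proof -
 have "gp_ground_energy \<Omega> \<alpha> <= gp_energy \<Omega> \<alpha> (blowup_profile Q \<alpha>)"
  unfolding gp_ground_energy_def using trial_state(1,2)[OF al] by (intro INF_lower) simp
 hence up: "gp_ground_energy \<Omega> \<alpha> <= ereal (sqrt (a_star - \<alpha>) * E0)"
  unfolding trial_state(3)[OF al] .
 have lo: "0 <= gp_ground_energy \<Omega> \<alpha>"
  unfolding gp_ground_energy_def
 proof (rule INF_greatest)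
  fix u assume "u \<in> {u \<in> H1. L2_norm u = 1}"
  hence u: "u \<in> H1" "L2_norm u = 1" by auto
  show "0 <= gp_energy \<Omega> \<alpha> u"
  proof (cases "(%x. norm x *R u x) \<in> L2")
   case True
   define e where "e = (a_star - \<alpha>) powr (1/4)"
   have e: "e > 0" "a_star - \<alpha> = e ^ 4" using al quarter_power(1)[of "a_star - \<alpha>"] by (simp_all add: e_def)
   obtain A B where AB: "state (%x. e * Re (u (e *R x))) A (%x. e * Im (u (e *R x))) B"
    "!!\<Omega>. gp_energy \<Omega> \<alpha> u = ereal (energy \<Omega> e (%x. e * Re (u (e *R x))) A (%x. e * Im (u (e *R x))) B / e^2)"
    by (rule energy_blowup[OF u True e], rule that, assumption+)
   show ?thesis unfolding AB(2) using energy_nonneg[OF AB(1) O, of e] by simp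
  qed (simp add: gp_energy_def)
 qed
 obtain E where E: "gp_ground_energy \<Omega> \<alpha> = ereal E" using up lo by (cases "gp_ground_energy \<Omega> \<alpha>") auto
 show thesis by (rule that[OF E]) (use up lo E in auto)
qed

text \<open>Near-minimizers take the place of minimizers. If the quotient stayed away from the limit
  along a sequence, then by the upper bound it would stay below; but near-minimizers have quotients
  converging to the limit along a subsequence.\<close>

lemma ground_energy_limit:
 assumes O: "0 <= \<Omega>" "\<Omega> < 1"
 shows "((%\<alpha>. real_of_ereal (gp_ground_energy \<Omega> \<alpha>) / sqrt (a_star - \<alpha>)) \<longlongrightarrow> E0) (at_left a_star)"
proof (rule tendsto_at_left_sequentially[OF a_pos])
 fix S :: "nat => real" assume S: "!!n. S n < a_star" "S ----> a_star"
 define X where "X n = real_of_ereal (gp_ground_energy \<Omega> (S n)) / sqrt (a_star - S n)" for n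
 show "X ----> E0"
 proof (rule ccontr)
  assume nX: "\<not> X ----> E0"
  obtain \<delta> and s :: "nat => nat" where s: "\<delta> > 0" "strict_mono s" "!!n. dist (X (s n)) E0 >= \<delta>"
   by (rule subseq_away[OF nX], rule that, assumption+)
  define q where "q n = sqrt (a_star - S (s n))" for n
  have q: "q n > 0" for n using S(1)[of "s n"] by (simp add: q_def)
  have XE: "gp_ground_energy \<Omega> (S (s n)) = ereal (q n * X (s n))" "X (s n) <= E0" for n
  proof -
   obtain E where "gp_ground_energy \<Omega> (S (s n)) = ereal E" "0 <= E" "E <= sqrt (a_star - S (s n)) * E0"
    by (rule ground_energy_bounds[OF O S(1)[of "s n"]])
   thus "gp_ground_energy \<Omega> (S (s n)) = ereal (q n * X (s n))" "X (s n) <= E0"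
    using q[of n] by (simp_all add: X_def q_def[symmetric] pos_divide_le_eq mult.commute)
  qed
  \<comment> \<open>The error is 1 / (n + 1) in units of \<open>q n\<close>, hence of smaller order
    than sqrt(\<open>a_star\<close> - S (s n)).\<close>
  have "EX u. u \<in> H1 & L2_norm u = 1 & gp_energy \<Omega> (S (s n)) u <= ereal (q n * (X (s n) + 1 / (real n + 1)))" for n
  proof -
   have "gp_ground_energy \<Omega> (S (s n)) < ereal (q n * (X (s n) + 1 / (real n + 1)))" unfolding XE(1) using q[of n] by simp
   thus ?thesis unfolding gp_ground_energy_def INF_less_iff by (auto intro: less_imp_le)
  qed
  then obtain u where u: "!!n. u n \<in> H1" "!!n. L2_norm (u n) = 1" "!!n. gp_energy \<Omega> (S (s n)) (u n) <= ereal (q n * (X (s n) + 1 / (real n + 1)))"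
   by metis
  define \<kappa> where "\<kappa> n = E0 + 1 / (real n + 1)" for n
  have z: "(%n. 1 / (real n + 1)) ----> 0" using LIMSEQ_inverse_real_of_nat by (simp add: inverse_eq_divide add.commute)
  have kL: "\<kappa> ----> E0" unfolding \<kappa>_def using tendsto_add[OF tendsto_const z] by simp
  have en: "gp_energy \<Omega> (S (s n)) (u n) <= ereal (sqrt (a_star - S (s n)) * \<kappa> n)" for n
  proof (rule order_trans[OF u(3)])
   have "q n * (X (s n) + 1 / (real n + 1)) <= q n * \<kappa> n" unfolding \<kappa>_def using q[of n] XE(2)[of n] by (intro mult_left_mono add_right_mono) auto
   thus "ereal (q n * (X (s n) + 1 / (real n + 1))) <= ereal (sqrt (a_star - S (s n)) * \<kappa> n)" by (simp add: q_def)
  qed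
  have Ss: "(%n. S (s n)) ----> a_star" using LIMSEQ_subseq_LIMSEQ[OF S(2) s(2)] by (simp add: comp_def)
  obtain r :: "nat => nat" and \<theta> :: "nat => real" where r: "strict_mono r" "!!n. \<theta> n \<in> {0..<2*pi}"
   "(%n. L2_norm (%x. u (r n) x - exp (\<i> * \<theta> n) * blowup_profile Q (S (s (r n))) x)) ----> 0"
   "(%n. real_of_ereal (gp_energy \<Omega> (S (s (r n))) (u (r n))) / sqrt (a_star - S (s (r n)))) ----> E0"
   by (rule minimizing_subsequence[OF O S(1)[of "s n" for n] Ss u(1,2) en kL], rule that, assumption+)
  define Y where "Y n = real_of_ereal (gp_energy \<Omega> (S (s (r n))) (u (r n))) / q (r n)" for n
  have lb: "Y n - 1 / (real (r n) + 1) <= X (s (r n))" for n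
  proof -
   have "0 <= gp_ground_energy \<Omega> (S (s (r n)))" by (rule ground_energy_bounds[OF O S(1)[of "s (r n)"]]) simp
   moreover have "gp_ground_energy \<Omega> (S (s (r n))) <= gp_energy \<Omega> (S (s (r n))) (u (r n))"
    unfolding gp_ground_energy_def using u(1,2) by (intro INF_lower) simp
   ultimately have "real_of_ereal (gp_energy \<Omega> (S (s (r n))) (u (r n))) <= q (r n) * (X (s (r n)) + 1 / (real (r n) + 1))"
    using u(3)[of "r n"] by (cases "gp_energy \<Omega> (S (s (r n))) (u (r n))") auto
   hence "Y n <= X (s (r n)) + 1 / (real (r n) + 1)" using q[of "r n"] by (simp add: Y_def pos_divide_le_eq mult.commute)
   thus ?thesis by simp
  qed
  have "(%n. Y n - 1 / (real (r n) + 1)) ----> E0 - 0"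
   using r(4) LIMSEQ_subseq_LIMSEQ[OF z r(1)] by (intro tendsto_diff) (simp_all add: Y_def q_def comp_def)
  hence "\<forall>\<^sub>F n in sequentially. E0 - \<delta> < Y n - 1 / (real (r n) + 1)"
   by (rule order_tendstoD(1)) (use s(1) in simp)
  then obtain n where "E0 - \<delta> < Y n - 1 / (real (r n) + 1)" by (auto simp: eventually_sequentially)
  thus False using lb[of n] XE(2)[of "r n"] s(3)[of "r n"] by (simp add: dist_real_def abs_if split: if_splits)
 qed
qed

text \<open>The subsequence principle needs a scalar sequence, so the phases are first eliminated by
  the infimum Y of the distance over all phases. Once Y tends to 0, phases within 1 / (n + 1) of the
  infimum are selected.\<close>

lemma minimizers_converge:
 assumes O: "0 <= \<Omega>" "\<Omega> < 1" and al: "!!n. \<alpha> n < a_star" "\<alpha> ----> a_star"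
  and u: "!!n::nat. u n \<in> H1" "!!n. L2_norm (u n) = 1" and r: "r \<in> o(%n. sqrt (a_star - \<alpha> n))"
  and en: "\<forall>\<^sub>F n in sequentially. gp_energy \<Omega> (\<alpha> n) (u n) = gp_ground_energy \<Omega> (\<alpha> n) + ereal (r n)"
 obtains \<theta> :: "nat => real" where "!!n. \<theta> n \<in> {0..<2*pi}"
  "(%n. L2_norm (%x. u n x - exp (\<i> * \<theta> n) * blowup_profile Q (\<alpha> n) x)) ----> 0"
proof -
 define d where "d n t = L2_norm (%x. u n x - exp (\<i> * complex_of_real t) * blowup_profile Q (\<alpha> n) x)" for n t
 define Y where "Y n = Inf (d n ` {0..<2*pi})" for n
 have d0: "0 <= d n t" for n t by (simp add: d_def L2_norm_def)
 have Yle: "Y n <= d n t" if "t \<in> {0..<2*pi}" for n t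
  unfolding Y_def using that d0 by (intro cInf_lower bdd_belowI[of _ 0]) auto
 have "Y ----> 0"
 proof (rule ccontr)
  assume nX: "\<not> Y ----> 0"
  obtain \<delta> and s0 :: "nat => nat" where s0: "\<delta> > 0" "strict_mono s0" "!!n. dist (Y (s0 n)) 0 >= \<delta>"
   by (rule subseq_away[OF nX], rule that, assumption+)
  obtain N where N: "!!n. n >= N ==> gp_energy \<Omega> (\<alpha> n) (u n) = gp_ground_energy \<Omega> (\<alpha> n) + ereal (r n)"
   using en by (auto simp: eventually_sequentially)
  define s where "s n = s0 (n + N)" for n
  have s: "strict_mono s" using s0(2) by (simp add: s_def strict_mono_def)
  have sN: "s n >= N" for n using seq_suble[OF s0(2), of "n + N"] by (simp add: s_def)
  define \<kappa> where "\<kappa> n = E0 + r n / sqrt (a_star - \<alpha> n)" for n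
  have "(%n. r n / sqrt (a_star - \<alpha> n)) ----> 0" by (rule smalloD_tendsto[OF r])
  hence "\<kappa> ----> E0 + 0" unfolding \<kappa>_def by (intro tendsto_intros)
  from LIMSEQ_subseq_LIMSEQ[OF this s] have kL: "(%n. \<kappa> (s n)) ----> E0" by (simp add: comp_def)
  have aL: "(%n. \<alpha> (s n)) ----> a_star" using LIMSEQ_subseq_LIMSEQ[OF al(2) s] by (simp add: comp_def)
  have le: "gp_energy \<Omega> (\<alpha> (s n)) (u (s n)) <= ereal (sqrt (a_star - \<alpha> (s n)) * \<kappa> (s n))" for n
  proof -
   obtain E where E: "gp_ground_energy \<Omega> (\<alpha> (s n)) = ereal E" "0 <= E" "E <= sqrt (a_star - \<alpha> (s n)) * E0"
    by (rule ground_energy_bounds[OF O al(1)[of "s n"]])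
   have "sqrt (a_star - \<alpha> (s n)) * \<kappa> (s n) = sqrt (a_star - \<alpha> (s n)) * E0 + r (s n)"
    using al(1)[of "s n"] unfolding \<kappa>_def distrib_left by simp
   thus ?thesis unfolding N[OF sN] E(1) using E(3) by simp
  qed
  obtain t :: "nat => nat" and \<theta> :: "nat => real" where t: "strict_mono t" "!!n. \<theta> n \<in> {0..<2*pi}"
   "(%n. L2_norm (%x. u (s (t n)) x - exp (\<i> * \<theta> n) * blowup_profile Q (\<alpha> (s (t n))) x)) ----> 0"
   "(%n. real_of_ereal (gp_energy \<Omega> (\<alpha> (s (t n))) (u (s (t n)))) / sqrt (a_star - \<alpha> (s (t n)))) ----> E0"
   by (rule minimizing_subsequence[OF O al(1)[of "s n" for n] aL u(1)[of "s n" for n] u(2)[of "s n" for n] le kL], rule that, assumption+)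
  have "(%n. d (s (t n)) (\<theta> n)) ----> 0" using t(3) by (simp add: d_def)
  from order_tendstoD(2)[OF this s0(1)] obtain n where n: "d (s (t n)) (\<theta> n) < \<delta>" by (auto simp: eventually_sequentially)
  have "0 <= Y (s (t n))" unfolding Y_def using d0 by (intro cInf_greatest) auto
  thus False using n Yle[OF t(2)[of n], of "s (t n)"] s0(3)[of "t n + N"] by (simp add: s_def)
 qed
 have "EX t. t \<in> {0..<2*pi} & d n t < Y n + 1 / (real n + 1)" for n
 proof -
  have "Inf (d n ` {0..<2*pi}) < Y n + 1 / (real n + 1)" by (simp add: Y_def)
  from cInf_lessD[OF _ this] show ?thesis by auto
 qed
 then obtain \<theta> where th: "!!n. \<theta> n \<in> {0..<2*pi}" "!!n. d n (\<theta> n) < Y n + 1 / (real n + 1)" by metis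
 have z: "(%n. 1 / (real n + 1)) ----> 0" using LIMSEQ_inverse_real_of_nat by (simp add: inverse_eq_divide add.commute)
 have "(%n. d n (\<theta> n)) ----> 0"
 proof (rule null_bound)
  show "(%n. Y n + 1 / (real n + 1)) ----> 0" by (rule tendsto_add_zero[OF \<open>Y ----> 0\<close> z])
 qed (use th(2) d0 in \<open>auto intro: less_imp_le\<close>)
 thus thesis by (intro that[OF th(1)]) (simp add: d_def)
qed

end

theorem theorem2p1:
  fixes \<Omega> :: real and Q :: "real^2 \<Rightarrow> real"
  assumes "0 \<le> \<Omega>" and "\<Omega> < 1"
    and "is_unique_positive_radial_solution Q"
  shows
    "(\<exists>r. r \<in> o[at_left a_star](\<lambda>a. real_of_ereal (gp_ground_energy 0 a)) \<and>
        (\<forall>a\<in>{0<..<a_star}. gp_ground_energy \<Omega> a = gp_ground_energy 0 a + ereal (r a))) \<and>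
     (\<exists>\<epsilon>. (\<epsilon> \<longlongrightarrow> 0) (at_left a_star) \<and>
        (\<forall>a\<in>{0<..<a_star}. gp_ground_energy \<Omega> a =
           ereal (sqrt (a_star - a) * (2 * (lambda_star Q)\<^sup>2 / a_star + \<epsilon> a)))) \<and>
     (\<forall>(a :: nat \<Rightarrow> real) (u :: nat \<Rightarrow> real^2 \<Rightarrow> complex) (r :: nat \<Rightarrow> real).
        a \<longlonglongrightarrow> a_star \<longrightarrow>
        (\<forall>N. 0 < a N \<and> a N < a_star) \<longrightarrow>
        (\<forall>N. u N \<in> H1 \<and> L2_norm (u N) = 1) \<longrightarrow>
        r \<in> o(\<lambda>N. sqrt (a_star - a N)) \<longrightarrow>
        (\<forall>\<^sub>F N in sequentially.
           gp_energy \<Omega> (a N) (u N) = gp_ground_energy \<Omega> (a N) + ereal (r N)) \<longrightarrow>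
        (\<exists>\<theta> :: nat \<Rightarrow> real. (\<forall>N. \<theta> N \<in> {0..<2 * pi}) \<and>
           (\<lambda>N. L2_norm (\<lambda>x. u N x - exp (\<i> * \<theta> N) * blowup_profile Q (a N) x))
             \<longlonglongrightarrow> 0))"
proof (cases "0 < a_star")
 \<comment> \<open>No coupling lies strictly between 0 and \<open>a_star\<close>, so the zero
   functions serve as remainders and the claim on sequences is void.\<close>
 case False
 hence "{0<..<a_star} = {}" "\<not> (0 < x & x < a_star)" for x by auto
 thus ?thesis by (intro conjI exI[of _ "%_. 0"]) auto
next
 case True
 interpret gn_Q Q by unfold_locales (use True assms(3) in auto)
 define G where "G \<omega> a = real_of_ereal (gp_ground_energy \<omega> a) / sqrt (a_star - a)" for \<omega> a
 have GL: "(G \<Omega> \<longlongrightarrow> E0) (at_left a_star)" "(G 0 \<longlongrightarrow> E0) (at_left a_star)"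
  unfolding G_def using ground_energy_limit assms(1,2) by auto
 have fin: "gp_ground_energy \<omega> a = ereal (real_of_ereal (gp_ground_energy \<omega> a))" if "0 <= \<omega>" "\<omega> < 1" "a < a_star" for \<omega> a
  by (rule ground_energy_bounds[OF that]) simp
 have c0: "E0 > 0" using lambda_star_eq(1) a_pos by simp
 have near: "\<forall>\<^sub>F a in at_left a_star. a < a_star" by (auto simp: eventually_at_filter)
 show ?thesis
 proof (intro conjI allI impI)
  define r where "r a = real_of_ereal (gp_ground_energy \<Omega> a) - real_of_ereal (gp_ground_energy 0 a)" for a
  have "r \<in> o[at_left a_star](%a. real_of_ereal (gp_ground_energy 0 a))"
  proof (rule smalloI_tendsto)
   have pos: "\<forall>\<^sub>F a in at_left a_star. G 0 a > 0" using order_tendstoD(1)[OF GL(2) c0] .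
   thus "\<forall>\<^sub>F a in at_left a_star. real_of_ereal (gp_ground_energy 0 a) ~= 0"
    by eventually_elim (auto simp: G_def)
   \<comment> \<open>The factors sqrt(\<open>a_star\<close> - a) cancel in the quotient of the
     energies, and both numerators share the same positive limit.\<close>
   have "((%a. (G \<Omega> a - G 0 a) / G 0 a) \<longlongrightarrow> (E0 - E0) / E0) (at_left a_star)"
    by (intro tendsto_intros GL less_imp_neq[OF c0, symmetric])
   hence lim: "((%a. (G \<Omega> a - G 0 a) / G 0 a) \<longlongrightarrow> 0) (at_left a_star)" by simp
   have "\<forall>\<^sub>F a in at_left a_star. (G \<Omega> a - G 0 a) / G 0 a = r a / real_of_ereal (gp_ground_energy 0 a)"
    using near pos by eventually_elim (simp add: G_def r_def diff_divide_distrib[symmetric])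
   from Lim_transform_eventually[OF lim this] show "((%a. r a / real_of_ereal (gp_ground_energy 0 a)) \<longlongrightarrow> 0) (at_left a_star)" .
  qed
  moreover have "gp_ground_energy \<Omega> a = gp_ground_energy 0 a + ereal (r a)" if "a \<in> {0<..<a_star}" for a
   using fin[of \<Omega> a] fin[of 0 a] that assms(1,2) by (simp add: r_def) (metis add_diff_cancel_left' diff_add_cancel plus_ereal.simps(1) add.commute)
  ultimately show "EX r. r \<in> o[at_left a_star](%a. real_of_ereal (gp_ground_energy 0 a)) & (\<forall>a\<in>{0<..<a_star}. gp_ground_energy \<Omega> a = gp_ground_energy 0 a + ereal (r a))"
   by blast
  have "((%a. G \<Omega> a - E0) \<longlongrightarrow> 0) (at_left a_star)" using tendsto_diff[OF GL(1) tendsto_const[of "E0"]] by simp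
  moreover have "gp_ground_energy \<Omega> a = ereal (sqrt (a_star - a) * (E0 + (G \<Omega> a - E0)))" if "a \<in> {0<..<a_star}" for a
   using fin[of \<Omega> a] that assms(1,2) by (simp add: G_def)
  ultimately show "EX \<epsilon>. (\<epsilon> \<longlongrightarrow> 0) (at_left a_star) & (\<forall>a\<in>{0<..<a_star}. gp_ground_energy \<Omega> a = ereal (sqrt (a_star - a) * (E0 + \<epsilon> a)))"
   by (intro exI[of _ "%a. G \<Omega> a - E0"]) blast
 next
  fix a :: "nat => real" and u :: "nat => real^2 => complex" and r :: "nat => real"
  assume H: "a ----> a_star" "ALL N. 0 < a N & a N < a_star" "ALL N. u N \<in> H1 & L2_norm (u N) = 1"
   "r \<in> o(%N. sqrt (a_star - a N))" "\<forall>\<^sub>F N in sequentially. gp_energy \<Omega> (a N) (u N) = gp_ground_energy \<Omega> (a N) + ereal (r N)"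
  have H': "!!N. a N < a_star" "!!N. u N \<in> H1" "!!N. L2_norm (u N) = 1" using H by auto
  obtain \<theta> :: "nat => real" where "!!n. \<theta> n \<in> {0..<2*pi}"
   "(%n. L2_norm (%x. u n x - exp (\<i> * \<theta> n) * blowup_profile Q (a n) x)) ----> 0"
   by (rule minimizers_converge[OF assms(1,2) H'(1) H(1) H'(2,3) H(4,5)], rule that, assumption+)
  thus "EX \<theta> :: nat => real. (ALL N. \<theta> N \<in> {0..<2 * pi}) & (%N. L2_norm (%x. u N x - exp (\<i> * \<theta> N) * blowup_profile Q (a N) x)) ----> 0"
   by blast
 qed
qed

end
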